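(* Let $\mathbb H$ be a homogeneous group. Suppose that $\varphi^{(\ell)} \in \mathscr S$, $\int \varphi^{(\ell)}\, dx=0$, $1\leq \ell\leq M$, and that there are $\eta^{(\ell)} \in \mathscr S$, $1\le\ell\le M$, and $b\in(0,1)$ for which $$\sum_{j=-\infty}^\infty \sum_{\ell=1}^M \varphi^{(\ell)}_{b^{j}}*\eta^{(\ell)}_{b^{j}}= \lim_{k\to \infty,\; m\to \infty}\ \sum_{j=-k}^m \sum_{\ell=1}^M \varphi^{(\ell)}_{b^{j}}*\eta^{(\ell)}_{b^{j}}=\delta \quad \text{in } \mathscr S'.$$ Let $N>0$, $\gamma/N<p, q<\infty$ and $w \in A_{pN/\gamma}$. Suppose that $(\eta^{(m)}, X_k\varphi^{(\ell)})\in \mathscr C_{N+\epsilon, N}^{(1)}$ for some $\epsilon>0$, for $1\leq k \leq n$ and $1\leq \ell, m \leq M$. Let $\psi\in \mathscr S$ with $\int \psi \, dx=0$. If $(\eta^{(\ell)}, \psi) \in \mathscr C_{N+\epsilon, N}^{(1)}$ for $1\leq \ell\leq M$ with some $\epsilon>0$, then for all $f\in \mathscr S$ $$\left\|\left(\int_0^\infty\left((f*\psi_t)_{N,t^{-1}}^{**}\right)^q \frac{dt}{t}\right)^{1/q}\right\|_{L^p_w} \leq C\sum_{\ell=1}^M \left\|\left(\int_0^\infty|f*\varphi^{(\ell)}_t|^q\,\frac{dt}{t}\right)^{1/q}\right\|_{L^p_w}$$ for some positive constant $C$ independent of $f$.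
   Context: Homogeneous group: $n\ge 2$ and $\mathbb H$ is $\mathbb R^n$ equipped with dilations $A_tx=(t^{a_1}x_1,\dots,t^{a_n}x_n)$, $t>0$, where $1=a_1\le a_2\le\dots\le a_n$ are real numbers, and with a nilpotent Lie group multiplication such that: Lebesgue measure $dx$ is a bi-invariant Haar measure; the identity is $0$ and $x^{-1}=-x$; $(\alpha x)(\beta x)=\alpha x+\beta x$ for $\alpha,\beta\in\mathbb R$; $A_t(xy)=(A_tx)(A_ty)$; and if $z=xy$ then $z_1=x_1+y_1$ and, for $k\ge2$, $z_k=x_k+y_k+R_k(x,y)$ with $R_k$ a polynomial in $x_1,\dots,x_{k-1},y_1,\dots,y_{k-1}$ of the form $\sum_{|I|\ne0,|J|\ne0,\,a(I)+a(J)=a_k}c^{(k)}_{I,J}x^Iy^J$, where for $I\in\mathbb N_0^n$, $|I|=i_1+\dots+i_n$, $a(I)=a_1i_1+\dots+a_ni_n$, $x^I=x_1^{i_1}\cdots x_n^{i_n}$. Put $\gamma=a_1+\dots+a_n$. $\rho$ is a fixed norm function on $\mathbb H$: $\rho$ is continuous on $\mathbb R^n$, smooth off $0$, $\rho(A_tx)=t\rho(x)$, $\rho(x+y)\le\rho(x)+\rho(y)$, $\rho(xy)\le c_0(\rho(x)+\rho(y))$ with a constant $c_0\ge1$, $\rho(x^{-1})=\rho(x)$; $\rho(x)\le1$ iff $|x|\le1$ and $\rho(x)=1$ iff $|x|=1$; and $\rho$ is bounded above and below by constant multiples of positive powers of $|x|$, both on $\{\rho\ge1\}$ and on $\{\rho\le1\}$.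 $\mathscr S$, $\mathscr S'$: usual Schwartz space and tempered distributions on $\mathbb R^n$; $\delta$: Dirac delta at $0$. Convolution: $F*G(x)=\int F(xy^{-1})G(y)\,dy$. $\varphi_t(x)=t^{-\gamma}\varphi(A_t^{-1}x)$. Left-invariant derivatives: $X_jf(x)=\left[\frac{d}{dt}f(x(te_j))\right]_{t=0}$, $e_j$ the standard basis vectors. Peetre maximal function: $F^{**}_{N,R}(x)=\sup_{y\in\mathbb H}\dfrac{|F(xy^{-1})|}{(1+R\rho(y))^N}$. For $\eta,\psi\in\mathscr S$, $t>0$, $L\ge0$: $C(\eta,\psi,t,L)=\int_{\mathbb H}(1+\rho(x))^L|\eta*\psi_t(x)|\,dx$. For $a,L\ge0$: $\mathscr C^{(1)}_{a,L}=\{(\eta,\psi)\in\mathscr S\times\mathscr S:\sup_{t\ge1}t^aC(\eta,\psi,t,L)<\infty\}$. Weights: balls are $B(x,t)=\{y\in\mathbb H:\rho(y^{-1}x)<t\}$. For $1<s<\infty$ a weight $w$ is in the Muckenhoupt class $A_s$ if $\sup_B\left(|B|^{-1}\int_Bw\,dx\right)\left(|B|^{-1}\int_Bw^{-1/(s-1)}dx\right)^{s-1}<\infty$, the supremum being over all balls $B$. $\|f\|_{L^p_w}=\left(\int_{\mathbb H}|f|^pw\,dx\right)^{1/p}$. *)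

theory Defs
  imports "HOL-Analysis.Analysis" "HOL-Algebra.Generated_Groups"
begin

section \<open>Homogeneous groups and norm functions\<close>

fun iterated_deriv ::
  "'a list \<Rightarrow> ('a::real_normed_vector \<Rightarrow> 'b::real_normed_vector) \<Rightarrow> 'a \<Rightarrow> 'b" where
  "iterated_deriv [] f = f"
| "iterated_deriv (v # vs) f = (\<lambda>x. frechet_derivative (iterated_deriv vs f) (at x) v)"

text \<open>For open \<open>S\<close> this is \<open>C\<^sup>\<infinity>\<close>-smoothness: every iterated partial derivative is
  (Frechet) differentiable on \<open>S\<close>.\<close>

definition smooth_on :: "'a set \<Rightarrow> ('a::euclidean_space \<Rightarrow> 'b::real_normed_vector) \<Rightarrow> bool" where
  "smooth_on S f \<longleftrightarrow>
     (\<forall>vs\<in>lists Basis. \<forall>x\<in>S. iterated_deriv vs f differentiable (at x))"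

fun lower_central :: "('a, 'b) monoid_scheme \<Rightarrow> nat \<Rightarrow> 'a set" where
  "lower_central G 0 = carrier G"
| "lower_central G (Suc k) = generate G
     {x \<otimes>\<^bsub>G\<^esub> y \<otimes>\<^bsub>G\<^esub> inv\<^bsub>G\<^esub> x \<otimes>\<^bsub>G\<^esub> inv\<^bsub>G\<^esub> y | x y. x \<in> lower_central G k \<and> y \<in> carrier G}"

definition nilpotent_group :: "('a, 'b) monoid_scheme \<Rightarrow> bool" where
  "nilpotent_group G \<longleftrightarrow> group G \<and> (\<exists>c. lower_central G c = {\<one>\<^bsub>G\<^esub>})"

text \<open>Coordinates are indexed by a finite linearly ordered type \<open>'n\<close>, listed increasingly:
  \<open>Min UNIV\<close> is the first index, and \<open>i < k\<close> is the order of the coordinates.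
  Multi-indices are functions \<open>'n \<Rightarrow> nat\<close>.\<close>

definition dilation :: "('n::finite \<Rightarrow> real) \<Rightarrow> real \<Rightarrow> real^'n \<Rightarrow> real^'n" where
  "dilation a t x = (\<chi> i. t powr a i * x $ i)"

definition hom_dim :: "('n::finite \<Rightarrow> real) \<Rightarrow> real" where
  "hom_dim a = (\<Sum>i\<in>UNIV. a i)"

definition monomial :: "real^'n \<Rightarrow> ('n::finite \<Rightarrow> nat) \<Rightarrow> real" where
  "monomial x I = (\<Prod>i\<in>UNIV. (x $ i) ^ I i)"

text \<open>The pairs \<open>(I, J)\<close> indexing the monomials of \<open>R\<^sub>k\<close>.  As all \<open>a i \<ge> 1\<close> in a homogeneous
  group, this set is finite there.\<close>

definition index_pairs ::
  "('n::{finite,linorder} \<Rightarrow> real) \<Rightarrow> 'n \<Rightarrow> (('n \<Rightarrow> nat) \<times> ('n \<Rightarrow> nat)) set" where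
  "index_pairs a k = {(I, J).
     (\<Sum>i\<in>UNIV. I i) \<noteq> 0 \<and> (\<Sum>i\<in>UNIV. J i) \<noteq> 0 \<and>
     (\<Sum>i\<in>UNIV. a i * real (I i)) + (\<Sum>i\<in>UNIV. a i * real (J i)) = a k \<and>
     (\<forall>i. I i \<noteq> 0 \<or> J i \<noteq> 0 \<longrightarrow> i < k)}"

locale homogeneous_group =
  fixes a :: "'n::{finite,linorder} \<Rightarrow> real"
    and mul :: "real^('n::{finite,linorder}) \<Rightarrow> real^('n::{finite,linorder}) \<Rightarrow> real^('n::{finite,linorder})"
  assumes dim_ge_2: "CARD('n) \<ge> 2"
    and exponent_first: "a (Min UNIV) = 1"
    and exponent_mono: "mono a"
    and nilpotent: "nilpotent_group \<lparr>carrier = UNIV, mult = mul, one = 0\<rparr>"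
    and smooth_mul: "smooth_on UNIV (\<lambda>(x, y). mul x y)"
    and inverse: "mul x (- x) = 0" "mul (- x) x = 0"
    and haar_left: "distr lborel lborel (\<lambda>x. mul y x) = lborel"
    and haar_right: "distr lborel lborel (\<lambda>x. mul x y) = lborel"
    and mul_line: "mul (\<alpha> *\<^sub>R x) (\<beta> *\<^sub>R x) = \<alpha> *\<^sub>R x + \<beta> *\<^sub>R x"
    and dilation_mul: "t > 0 \<Longrightarrow> dilation a t (mul x y) = mul (dilation a t x) (dilation a t y)"
    and mul_first: "mul x y $ Min UNIV = x $ Min UNIV + y $ Min UNIV"
    and mul_other: "k \<noteq> Min UNIV \<Longrightarrow> \<exists>c. \<forall>x y. mul x y $ k = x $ k + y $ k +
          (\<Sum>(I, J)\<in>index_pairs a k. c I J * monomial x I * monomial y J)"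

locale norm_function = homogeneous_group a mul
  for a :: "'n::{finite,linorder} \<Rightarrow> real"
    and mul :: "real^('n::{finite,linorder}) \<Rightarrow> real^('n::{finite,linorder}) \<Rightarrow> real^('n::{finite,linorder})" +
  fixes \<rho> :: "real^('n::{finite,linorder}) \<Rightarrow> real"
  assumes rho_continuous: "continuous_on UNIV \<rho>"
    and rho_smooth: "smooth_on (- {0}) \<rho>"
    and rho_dilation: "t > 0 \<Longrightarrow> \<rho> (dilation a t x) = t * \<rho> x"
    and rho_add: "\<rho> (x + y) \<le> \<rho> x + \<rho> y"
    and rho_mul: "\<exists>c\<^sub>0\<ge>1. \<forall>x y. \<rho> (mul x y) \<le> c\<^sub>0 * (\<rho> x + \<rho> y)"
    and rho_inverse: "\<rho> (- x) = \<rho> x"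
    and rho_le_1: "\<rho> x \<le> 1 \<longleftrightarrow> norm x \<le> 1"
    and rho_eq_1: "\<rho> x = 1 \<longleftrightarrow> norm x = 1"
    and rho_large: "\<exists>C1>0. \<exists>C2>0. \<exists>\<alpha>1>0. \<exists>\<alpha>2>0. \<forall>x. \<rho> x \<ge> 1 \<longrightarrow>
          C1 * norm x powr \<alpha>1 \<le> \<rho> x \<and> \<rho> x \<le> C2 * norm x powr \<alpha>2"
    and rho_small: "\<exists>C1>0. \<exists>C2>0. \<exists>\<alpha>1>0. \<exists>\<alpha>2>0. \<forall>x. \<rho> x \<le> 1 \<longrightarrow>
          C1 * norm x powr \<alpha>1 \<le> \<rho> x \<and> \<rho> x \<le> C2 * norm x powr \<alpha>2"

section \<open>Schwartz functions, tempered distributions, convolution\<close>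

definition schwartz :: "(real^'n::finite \<Rightarrow> complex) set" where
  "schwartz = {f. smooth_on UNIV f \<and>
     (\<forall>vs\<in>lists Basis. \<forall>k::nat. \<exists>C. \<forall>x. (1 + norm x) ^ k * norm (iterated_deriv vs f x) \<le> C)}"

text \<open>Tempered distributions are represented by their action on Schwartz functions, and
  \<open>tempered_lim\<close> is convergence in the weak-* topology.\<close>

definition distr_of :: "(real^'n::finite \<Rightarrow> complex) \<Rightarrow> (real^'n \<Rightarrow> complex) \<Rightarrow> complex" where
  "distr_of F g = (\<integral>x. F x * g x \<partial>lebesgue)"

definition dirac :: "(real^'n::finite \<Rightarrow> complex) \<Rightarrow> complex" where
  "dirac g = g 0"

definition tempered_lim ::
  "('i \<Rightarrow> (real^'n::finite \<Rightarrow> complex) \<Rightarrow> complex) \<Rightarrow> ((real^'n \<Rightarrow> complex) \<Rightarrow> complex) \<Rightarrow>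
    'i filter \<Rightarrow> bool" where
  "tempered_lim T U F \<longleftrightarrow> (\<forall>g\<in>schwartz. ((\<lambda>i. T i g) \<longlongrightarrow> U g) F)"

text \<open>Below, \<open>- y\<close> is the inverse of \<open>y\<close> in the group.\<close>

definition conv :: "(real^'n \<Rightarrow> real^'n \<Rightarrow> real^'n) \<Rightarrow>
    (real^'n::finite \<Rightarrow> complex) \<Rightarrow> (real^'n \<Rightarrow> complex) \<Rightarrow> real^'n \<Rightarrow> complex" where
  "conv mul F G x = (\<integral>y. F (mul x (- y)) * G y \<partial>lebesgue)"

text \<open>For \<open>t > 0\<close> the map \<open>dilation a (1 / t)\<close> is the inverse of \<open>dilation a t\<close>.\<close>

definition rescale :: "('n \<Rightarrow> real) \<Rightarrow> (real^'n::finite \<Rightarrow> complex) \<Rightarrow> real \<Rightarrow> real^'n \<Rightarrow> complex" where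
  "rescale a \<phi> t x = of_real (t powr (- hom_dim a)) * \<phi> (dilation a (1 / t) x)"

definition left_deriv :: "(real^'n \<Rightarrow> real^'n \<Rightarrow> real^'n) \<Rightarrow> 'n \<Rightarrow>
    (real^'n::finite \<Rightarrow> complex) \<Rightarrow> real^'n \<Rightarrow> complex" where
  "left_deriv mul j f x = vector_derivative (\<lambda>t. f (mul x (t *\<^sub>R axis j 1))) (at 0)"

section \<open>Maximal functions, cancellation classes, weights\<close>

text \<open>Real powers in \<open>[0, \<infinity>]\<close>, for exponents \<open>r \<noteq> 0\<close>; note that \<open>0 powr r = 0\<close> on the reals
  even for negative \<open>r\<close>, whereas here \<open>0\<close> to a negative power is \<open>\<infinity>\<close>.\<close>

definition epowr :: "ennreal \<Rightarrow> real \<Rightarrow> ennreal" where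
  "epowr x r =
     (if x = \<infinity> then (if r < 0 then 0 else \<infinity>)
      else if x = 0 \<and> r < 0 then \<infinity>
      else ennreal (enn2real x powr r))"

definition peetre :: "(real^'n \<Rightarrow> real^'n \<Rightarrow> real^'n) \<Rightarrow> (real^'n::finite \<Rightarrow> real) \<Rightarrow>
    real \<Rightarrow> real \<Rightarrow> (real^'n \<Rightarrow> complex) \<Rightarrow> real^'n \<Rightarrow> ennreal" where
  "peetre mul \<rho> N R F x =
     (SUP y. ennreal (norm (F (mul x (- y))) / (1 + R * \<rho> y) powr N))"

definition C_int :: "('n \<Rightarrow> real) \<Rightarrow> (real^'n \<Rightarrow> real^'n \<Rightarrow> real^'n) \<Rightarrow>
    (real^'n::finite \<Rightarrow> real) \<Rightarrow> (real^'n \<Rightarrow> complex) \<Rightarrow> (real^'n \<Rightarrow> complex) \<Rightarrow>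
    real \<Rightarrow> real \<Rightarrow> ennreal" where
  "C_int a mul \<rho> \<eta> \<psi> t L =
     (\<integral>\<^sup>+x. ennreal ((1 + \<rho> x) powr L * norm (conv mul \<eta> (rescale a \<psi> t) x)) \<partial>lebesgue)"

text \<open>The class \<open>\<C>\<^sup>(\<^sup>1\<^sup>)\<close> with parameters \<open>\<alpha>\<close> and \<open>L\<close>.\<close>

definition C1_class :: "('n \<Rightarrow> real) \<Rightarrow> (real^'n \<Rightarrow> real^'n \<Rightarrow> real^'n) \<Rightarrow>
    (real^'n::finite \<Rightarrow> real) \<Rightarrow> real \<Rightarrow> real \<Rightarrow>
    ((real^'n \<Rightarrow> complex) \<times> (real^'n \<Rightarrow> complex)) set" where
  "C1_class a mul \<rho> \<alpha> L =
     {(\<eta>, \<psi>). \<eta> \<in> schwartz \<and> \<psi> \<in> schwartz \<and>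
       (SUP t\<in>{1..}. ennreal (t powr \<alpha>) * C_int a mul \<rho> \<eta> \<psi> t L) < \<infinity>}"

definition gball :: "(real^'n \<Rightarrow> real^'n \<Rightarrow> real^'n) \<Rightarrow> (real^'n::finite \<Rightarrow> real) \<Rightarrow>
    real^'n \<Rightarrow> real \<Rightarrow> (real^'n) set" where
  "gball mul \<rho> x t = {y. \<rho> (mul (- y) x) < t}"

definition average :: "(real^'n::finite) set \<Rightarrow> (real^'n \<Rightarrow> ennreal) \<Rightarrow> ennreal" where
  "average B g = (\<integral>\<^sup>+x\<in>B. g x \<partial>lebesgue) / emeasure lebesgue B"

text \<open>A weight is a nonnegative, locally integrable, Lebesgue measurable function.\<close>

definition weight :: "(real^'n::finite \<Rightarrow> real) \<Rightarrow> bool" where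
  "weight w \<longleftrightarrow> w \<in> borel_measurable lebesgue \<and> (\<forall>x. 0 \<le> w x) \<and>
     (\<forall>K. compact K \<longrightarrow> set_integrable lebesgue K w)"

definition muckenhoupt :: "(real^'n \<Rightarrow> real^'n \<Rightarrow> real^'n) \<Rightarrow> (real^'n::finite \<Rightarrow> real) \<Rightarrow>
    real \<Rightarrow> (real^'n \<Rightarrow> real) set" where
  "muckenhoupt mul \<rho> s = {w. weight w \<and>
     (SUP B\<in>{gball mul \<rho> x t | x t. t > 0}.
        average B (\<lambda>x. ennreal (w x)) *
        epowr (average B (\<lambda>x. epowr (ennreal (w x)) (- 1 / (s - 1)))) (s - 1)) < \<infinity>}"

definition Lp_norm :: "real \<Rightarrow> (real^'n::finite \<Rightarrow> real) \<Rightarrow> (real^'n \<Rightarrow> ennreal) \<Rightarrow> ennreal" where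
  "Lp_norm p w g = epowr (\<integral>\<^sup>+x. epowr (g x) p * ennreal (w x) \<partial>lebesgue) (1 / p)"

text \<open>The norm of \<open>L\<^sup>q((0, \<infinity>), dt/t)\<close>.\<close>

definition Lq_dt_t :: "real \<Rightarrow> (real \<Rightarrow> ennreal) \<Rightarrow> ennreal" where
  "Lq_dt_t q h = epowr (\<integral>\<^sup>+t\<in>{0<..}. epowr (h t) q * ennreal (1 / t) \<partial>lebesgue) (1 / q)"

end

theory Submission imports Defs begin

text \<open>
  The inequality is reduced, pointwise in \<open>x\<close>, to a bound by Hardy-Littlewood maximal functions, and
  then follows from a weighted vector-valued maximal inequality.

  Moved to the scale \<open>t\<close> and convolved with \<open>\<psi>\<^sub>t\<close>, the reproducing formula reads
  \<open>f * \<psi>\<^sub>t = (\<Sum>j. \<Sum>l. (f * \<phi>\<^sup>l\<^sub>s) * (\<eta>\<^sup>l\<^sub>s * \<psi>\<^sub>t))\<close> with \<open>s = b\<^sup>j t\<close>.  The weight in the Peetre maximal function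
  is submultiplicative, so that the summand is at most the Peetre maximal function of \<open>f * \<phi>\<^sup>l\<^sub>s\<close> times a
  weighted \<open>L\<^sup>1\<close> norm of \<open>\<eta>\<^sup>l\<^sub>s * \<psi>\<^sub>t\<close>, which depends on \<open>t / s = b\<^sup>-\<^sup>j\<close> only.  It decays geometrically in
  \<open>\<bar>j\<bar>\<close>: for large \<open>t / s\<close> this is the assumed membership in the cancellation class, for small \<open>t / s\<close> it
  comes from the vanishing integral of \<open>\<psi>\<close> and the smoothness of \<open>\<eta>\<^sup>l\<close> (\<open>C_int_decay\<close>,
  \<open>peetre_domination\<close>).  As \<open>dt / t\<close> is invariant under dilations, the \<open>L\<^sup>q (dt / t)\<close> norm of the Peetre
  maximal function of \<open>f * \<psi>\<^sub>t\<close> is bounded by those of \<open>f * \<phi>\<^sup>l\<^sub>t\<close> (\<open>peetre_square_domination\<close>).  The left-invariant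
  derivatives \<open>X\<^sub>k \<phi>\<^sup>l\<close> have vanishing integral too, so that the same bound holds for them in the place of \<open>\<psi>\<close>.

  By Peetre's inequality the maximal function of \<open>F = f * \<phi>\<^sup>l\<^sub>t\<close> is at most
  \<open>C\<^sub>\<delta> (M (\<bar>F\<bar> powr (\<gamma> / N))) powr (N / \<gamma>)\<close> plus \<open>\<delta>\<close> times the sum of the Peetre maximal functions of the
  \<open>f * (X\<^sub>k \<phi>\<^sup>l)\<^sub>t\<close> (\<open>peetre_inequality\<close>).  In the \<open>L\<^sup>q (dt / t)\<close> norm the second part is, by the previous step, a
  small multiple of the quantity that is being estimated; the latter is finite, because \<open>f\<close> is a Schwartz
  function and the \<open>\<phi>\<^sup>l\<close> have vanishing integral, and the second part is absorbed (\<open>peetre_square_le_maxfn\<close>).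

  There remains the bound of \<open>M\<close> on \<open>L\<^sup>s (w; L\<^sup>u (dt / t))\<close> with \<open>s = p N / \<gamma>\<close>, \<open>u = q N / \<gamma>\<close> and \<open>w\<close> in
  the Muckenhoupt class of exponent \<open>s\<close>.  For \<open>s = u\<close> Fubini's theorem reduces it to the scalar inequality,
  which Lerner's pointwise estimate derives from the unweighted maximal theorem for doubling measures
  (\<open>maxfn_weighted_bound\<close>).  The other exponents are obtained by Rubio de Francia's extrapolation
  (\<open>extrapolation\<close>, \<open>maxfn_vector_valued\<close>).
\<close>

hide_const (open) Order.top

section \<open>Powers and Hoelder's inequality in the extended nonnegative reals\<close>

lemma epowr_ennreal: "0 \<le> x \<Longrightarrow> 0 < r \<Longrightarrow> epowr (ennreal x) r = ennreal (x powr r)"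
  by (auto simp: epowr_def)

lemma epowr_ennreal_pos: "0 < x \<Longrightarrow> epowr (ennreal x) r = ennreal (x powr r)"
  by (auto simp: epowr_def)

lemma epowr_0 [simp]: "0 < r \<Longrightarrow> epowr 0 r = 0"
  by (auto simp: epowr_def)

lemma epowr_top [simp]: "0 < r \<Longrightarrow> epowr top r = top"
  by (auto simp: epowr_def)

lemma epowr_one [simp]: "epowr x 1 = x"
  by (cases x) (auto simp: epowr_def)

lemma epowr_eq_0_iff [simp]: "0 < r \<Longrightarrow> epowr x r = 0 \<longleftrightarrow> x = 0"
  by (cases x) (auto simp: epowr_def)

lemma epowr_eq_top_iff [simp]: "0 < r \<Longrightarrow> epowr x r = top \<longleftrightarrow> x = top"
  by (cases x) (auto simp: epowr_def)

lemma epowr_less_top_iff [simp]: "0 < r \<Longrightarrow> epowr x r < top \<longleftrightarrow> x < top"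
  by (auto simp: less_top[symmetric])

lemma epowr_mono: "x \<le> y \<Longrightarrow> 0 < r \<Longrightarrow> epowr x r \<le> epowr y r"
  by (cases x; cases y) (auto simp: epowr_ennreal top_unique intro!: ennreal_leI powr_mono2)

lemma epowr_mult: "0 < r \<Longrightarrow> epowr (x * y) r = epowr x r * epowr y r"
proof (cases x; cases y)
  fix a b assume "0 < r" "0 \<le> a" "0 \<le> b" "x = ennreal a" "y = ennreal b"
  then show ?thesis
    by (simp add: epowr_ennreal powr_mult flip: ennreal_mult)
qed (auto simp: epowr_ennreal ennreal_top_mult ennreal_mult_top split: if_splits)

lemma epowr_epowr: "0 < r \<Longrightarrow> 0 < s \<Longrightarrow> epowr (epowr x r) s = epowr x (r * s)"
  by (cases x) (auto simp: epowr_ennreal powr_powr)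

lemma epowr_inverse [simp]: "0 < r \<Longrightarrow> epowr (epowr x r) (1 / r) = x"
  "0 < r \<Longrightarrow> epowr (epowr x (1 / r)) r = x"
  by (auto simp: epowr_epowr)

lemma epowr_add: "0 < r \<Longrightarrow> 0 < s \<Longrightarrow> epowr x (r + s) = epowr x r * epowr x s"
  by (cases x) (auto simp: epowr_ennreal powr_add ennreal_mult)

lemma epowr_le_iff: "0 < r \<Longrightarrow> epowr x r \<le> epowr y r \<longleftrightarrow> x \<le> y"
  by (metis epowr_inverse(1) epowr_mono zero_less_divide_1_iff)

lemma epowr_le_swap: "0 < r \<Longrightarrow> epowr x r \<le> z \<longleftrightarrow> x \<le> epowr z (1 / r)"
  by (metis epowr_inverse epowr_le_iff)

lemma epowr_SUP: "0 < r \<Longrightarrow> epowr (SUP i\<in>I. f i) r = (SUP i\<in>I. epowr (f i) r)"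
proof (rule antisym)
  assume "0 < r"
  have "f i \<le> epowr (SUP i\<in>I. epowr (f i) r) (1 / r)" if "i \<in> I" for i
    using \<open>0 < r\<close> that by (subst epowr_le_swap[symmetric]) (auto intro: SUP_upper)
  then show "epowr (SUP i\<in>I. f i) r \<le> (SUP i\<in>I. epowr (f i) r)"
    using \<open>0 < r\<close> by (subst epowr_le_swap) (auto intro: SUP_least)
  show "(SUP i\<in>I. epowr (f i) r) \<le> epowr (SUP i\<in>I. f i) r"
    using \<open>0 < r\<close> by (auto intro!: SUP_least epowr_mono SUP_upper)
qed

lemma borel_measurable_epowr [measurable (raw)]:
  assumes "f \<in> borel_measurable M"
  shows "(\<lambda>x. epowr (f x) r) \<in> borel_measurable M"
proof -
  have meas: "(\<lambda>x. ennreal (enn2real x powr r)) \<in> borel_measurable borel"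
    by measurable
  have top: "{x. x = (top :: ennreal)} = {top}" and zero: "{x. x = (0 :: ennreal)} = {0}"
    by auto
  have inner: "(\<lambda>x. if x = 0 \<and> r < 0 then top else ennreal (enn2real x powr r)) \<in> borel_measurable borel"
  proof -
    have "{x::ennreal. x = 0 \<and> r < 0} \<in> sets borel"
      by (cases "r < 0") (simp_all add: zero)
    then show ?thesis by (intro measurable_If meas) simp_all
  qed
  have "(\<lambda>x. epowr x r) \<in> borel_measurable borel"
    unfolding epowr_def infinity_ennreal_def
    by (intro measurable_If inner measurable_const) (simp_all add: top)
  from measurable_compose[OF assms this] show ?thesis .
qed

lemma epowr_add_le:
  assumes "0 < r" shows "epowr (x + y) r \<le> ennreal (2 powr r) * (epowr x r + epowr y r)"
proof -
  have "x + y \<le> 2 * max x y"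
    by (auto simp: max_def mult_2 intro!: add_mono)
  then have "epowr (x + y) r \<le> epowr (2 * max x y) r"
    using assms by (rule epowr_mono)
  also have "\<dots> = ennreal (2 powr r) * epowr (max x y) r"
    using assms by (simp add: epowr_mult epowr_ennreal flip: ennreal_numeral)
  also have "epowr (max x y) r \<le> epowr x r + epowr y r"
    by (auto simp: max_def)
  finally show ?thesis
    by (simp add: mult_left_mono)
qed

lemma epowr_sum_le:
  assumes "0 < r" "finite A"
  shows "epowr (\<Sum>i\<in>A. f i) r \<le> ennreal (real (card A) powr r) * (\<Sum>i\<in>A. epowr (f i) r)"
proof (cases "A = {}")
  case False
  define m where "m = Max (f ` A)"
  have m: "m \<in> f ` A" "\<And>i. i \<in> A \<Longrightarrow> f i \<le> m"
    unfolding m_def using assms False by auto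
  then obtain k where k: "k \<in> A" "m = f k" by auto
  have "(\<Sum>i\<in>A. f i) \<le> of_nat (card A) * m"
    using m by (intro sum_bounded_above) auto
  then have "epowr (\<Sum>i\<in>A. f i) r \<le> epowr (of_nat (card A) * m) r"
    using assms by (intro epowr_mono)
  also have "\<dots> = ennreal (real (card A) powr r) * epowr (f k) r"
    using assms k by (simp add: epowr_mult epowr_ennreal flip: ennreal_of_nat_eq_real_of_nat)
      (simp add: ennreal_of_nat_eq_real_of_nat epowr_ennreal)
  also have "epowr (f k) r \<le> (\<Sum>i\<in>A. epowr (f i) r)"
    using assms k member_le_sum[of k A "\<lambda>i. epowr (f i) r"] by auto
  finally show ?thesis
    by (simp add: mult_left_mono)
qed (use assms in auto)

lemma epowr_young:
  assumes "0 < \<theta>" "\<theta> < 1"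
  shows "epowr x \<theta> * epowr y (1 - \<theta>) \<le> ennreal \<theta> * x + ennreal (1 - \<theta>) * y"
proof (cases x; cases y)
  fix a b assume ab: "0 \<le> a" "0 \<le> b" "x = ennreal a" "y = ennreal b"
  show ?thesis
  proof (cases "a = 0 \<or> b = 0")
    case False
    then have "a powr \<theta> * b powr (1 - \<theta>) \<le> \<theta> * a + (1 - \<theta>) * b"
      using assms ab by (intro Youngs_inequality_0) auto
    then show ?thesis
      using ab assms by (simp add: epowr_ennreal flip: ennreal_mult ennreal_plus)
  qed (use ab assms in auto)
qed (use assms in \<open>auto simp: ennreal_mult_top\<close>)

text \<open>After normalisation of both integrals this is the weighted inequality of arithmetic and
  geometric means, integrated.\<close>

lemma nn_integral_Hoelder:
  assumes [measurable]: "f \<in> borel_measurable M" "g \<in> borel_measurable M"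
    and \<theta>: "0 < \<theta>" "\<theta> < 1"
  shows "(\<integral>\<^sup>+x. epowr (f x) \<theta> * epowr (g x) (1 - \<theta>) \<partial>M)
    \<le> epowr (\<integral>\<^sup>+x. f x \<partial>M) \<theta> * epowr (\<integral>\<^sup>+x. g x \<partial>M) (1 - \<theta>)"
proof -
  define A where "A = (\<integral>\<^sup>+x. f x \<partial>M)"
  define B where "B = (\<integral>\<^sup>+x. g x \<partial>M)"
  consider "A = 0" | "B = 0" | "A \<noteq> 0" "B \<noteq> 0" "A = top \<or> B = top"
    | "A \<noteq> 0" "B \<noteq> 0" "A < top" "B < top"
    by (auto simp: less_top[symmetric])
  then show ?thesis
  proof cases
    case 1
    then have "AE x in M. f x = 0"
      unfolding A_def by (simp add: nn_integral_0_iff_AE)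
    then have "AE x in M. epowr (f x) \<theta> * epowr (g x) (1 - \<theta>) = 0"
      by eventually_elim (use \<theta> in auto)
    then have "(\<integral>\<^sup>+x. epowr (f x) \<theta> * epowr (g x) (1 - \<theta>) \<partial>M) = 0"
      by (simp add: nn_integral_0_iff_AE)
    then show ?thesis by simp
  next
    case 2
    then have "AE x in M. g x = 0"
      unfolding B_def by (simp add: nn_integral_0_iff_AE)
    then have "AE x in M. epowr (f x) \<theta> * epowr (g x) (1 - \<theta>) = 0"
      by eventually_elim (use \<theta> in auto)
    then have "(\<integral>\<^sup>+x. epowr (f x) \<theta> * epowr (g x) (1 - \<theta>) \<partial>M) = 0"
      by (simp add: nn_integral_0_iff_AE)
    then show ?thesis by simp
  next
    case 3
    then have "epowr A \<theta> * epowr B (1 - \<theta>) = top"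
      using \<theta> by (auto simp: ennreal_mult_eq_top_iff)
    then show ?thesis by (simp add: A_def B_def)
  next
    case 4
    obtain a where a: "A = ennreal a" "0 < a"
      using 4 by (cases A) (auto simp: less_top[symmetric])
    obtain b where b: "B = ennreal b" "0 < b"
      using 4 by (cases B) (auto simp: less_top[symmetric])
    have pt: "epowr (f x) \<theta> * epowr (g x) (1 - \<theta>) \<le>
      epowr A \<theta> * epowr B (1 - \<theta>) * (ennreal (\<theta> / a) * f x + ennreal ((1 - \<theta>) / b) * g x)" for x
    proof -
      have "epowr (f x) \<theta> * epowr (g x) (1 - \<theta>) =
        epowr (A * (ennreal (1 / a) * f x)) \<theta> * epowr (B * (ennreal (1 / b) * g x)) (1 - \<theta>)"
        using a b by (simp add: mult.assoc[symmetric] flip: ennreal_mult)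
      also have "\<dots> = epowr A \<theta> * epowr B (1 - \<theta>) *
          (epowr (ennreal (1 / a) * f x) \<theta> * epowr (ennreal (1 / b) * g x) (1 - \<theta>))"
        using \<theta> by (simp add: epowr_mult mult_ac)
      also have "\<dots> \<le> epowr A \<theta> * epowr B (1 - \<theta>) *
          (ennreal \<theta> * (ennreal (1 / a) * f x) + ennreal (1 - \<theta>) * (ennreal (1 / b) * g x))"
        by (intro mult_left_mono epowr_young \<theta>) auto
      finally show ?thesis
        using \<theta> a b by (simp add: mult.assoc[symmetric] flip: ennreal_mult)
    qed
    have "(\<integral>\<^sup>+x. epowr (f x) \<theta> * epowr (g x) (1 - \<theta>) \<partial>M) \<le>
      (\<integral>\<^sup>+x. epowr A \<theta> * epowr B (1 - \<theta>) * (ennreal (\<theta> / a) * f x + ennreal ((1 - \<theta>) / b) * g x) \<partial>M)"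
      by (intro nn_integral_mono pt)
    also have "\<dots> = epowr A \<theta> * epowr B (1 - \<theta>) * (ennreal (\<theta> / a) * A + ennreal ((1 - \<theta>) / b) * B)"
      by (simp add: nn_integral_cmult nn_integral_add A_def B_def)
    also have "ennreal (\<theta> / a) * A + ennreal ((1 - \<theta>) / b) * B = 1"
      using \<theta> a b by (simp flip: ennreal_mult ennreal_plus)
    finally show ?thesis by (simp add: A_def B_def)
  qed
qed

text \<open>A geometrically weighted series is at most twice the supremum of its terms, and suprema commute
  with powers.\<close>

lemma epowr_suminf_geometric_le:
  assumes "0 < s"
  shows "epowr (\<Sum>k. ennreal ((1/2) ^ k) * f k) s \<le> ennreal (2 powr s) * (\<Sum>k. epowr (f k) s)"
proof -
  have "(\<Sum>k. ennreal ((1/2) ^ k)) = ennreal (\<Sum>k. (1/2) ^ k)"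
    by (intro suminf_ennreal2 summable_geometric) auto
  also have "(\<Sum>k. (1/2::real) ^ k) = 2"
    by (subst suminf_geometric) auto
  finally have geo: "(\<Sum>k. ennreal ((1/2) ^ k)) = 2" by simp
  have "(\<Sum>k. ennreal ((1/2) ^ k) * f k) \<le> (\<Sum>k. ennreal ((1/2) ^ k) * (SUP k. f k))"
    by (intro suminf_le mult_left_mono SUP_upper) auto
  also have "\<dots> = 2 * (SUP k. f k)"
    by (simp only: ennreal_suminf_multc geo)
  finally have "epowr (\<Sum>k. ennreal ((1/2) ^ k) * f k) s \<le> epowr (2 * (SUP k. f k)) s"
    using assms by (intro epowr_mono)
  also have "\<dots> = ennreal (2 powr s) * (SUP k. epowr (f k) s)"
    using assms by (simp add: epowr_mult epowr_SUP epowr_ennreal flip: ennreal_numeral)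
  also have "(SUP k. epowr (f k) s) \<le> (\<Sum>k. epowr (f k) s)"
  proof (rule SUP_least)
    fix k show "epowr (f k) s \<le> (\<Sum>k. epowr (f k) s)"
      using sum_le_suminf[of "\<lambda>k. epowr (f k) s" "{k}"] by simp
  qed
  finally show ?thesis
    by (simp add: mult_left_mono)
qed

lemma divide_le_iff_ennreal:
  fixes a b c :: ennreal
  assumes "0 < b" "b < top"
  shows "a / b \<le> c \<longleftrightarrow> a \<le> c * b"
proof
  assume "a / b \<le> c"
  then have "a / b * b \<le> c * b" by (rule mult_right_mono) simp
  then show "a \<le> c * b" using assms by (simp add: ennreal_divide_times)
next
  assume "a \<le> c * b"
  then show "a / b \<le> c" using assms by (intro divide_le_posI_ennreal) (auto simp: mult.commute)
qed

lemma epowr_layer_cake: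
  assumes "0 < c"
  shows "(\<integral>\<^sup>+\<alpha>. ennreal (c * \<alpha> powr (c - 1)) * indicator {0<..} \<alpha> * indicator {\<alpha>. ennreal \<alpha> < y} \<alpha> \<partial>lborel)
    = epowr y c"
proof -
  have fin: "(\<integral>\<^sup>+\<alpha>. ennreal (c * \<alpha> powr (c - 1)) * indicator {0<..} \<alpha> * indicator {\<alpha>. ennreal \<alpha> < ennreal r} \<alpha> \<partial>lborel)
    = ennreal (r powr c)" if r: "0 \<le> r" for r
  proof -
    have I: "((\<lambda>\<alpha>. c * \<alpha> powr (c - 1)) has_integral (r powr c)) {0..r}"
      using has_integral_mult_right[OF has_integral_powr_from_0[of "c - 1" r], of c] assms r by simp
    have "AE \<alpha> in lborel. \<alpha> \<noteq> r"
      by (rule AE_lborel_singleton)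
    then have "AE \<alpha> in lborel. ennreal (c * \<alpha> powr (c - 1)) * indicator {0<..} \<alpha> * indicator {\<alpha>. ennreal \<alpha> < ennreal r} \<alpha>
      = ennreal (indicator {0..r} \<alpha> * (c * \<alpha> powr (c - 1)))"
      by eventually_elim (use r in \<open>auto simp: indicator_def ennreal_less_iff\<close>)
    then have "(\<integral>\<^sup>+\<alpha>. ennreal (c * \<alpha> powr (c - 1)) * indicator {0<..} \<alpha> * indicator {\<alpha>. ennreal \<alpha> < ennreal r} \<alpha> \<partial>lborel)
      = (\<integral>\<^sup>+\<alpha>. ennreal (indicator {0..r} \<alpha> * (c * \<alpha> powr (c - 1))) \<partial>lborel)"
      by (rule nn_integral_cong_AE)
    also have "\<dots> = ennreal (r powr c)"
      using nn_integral_has_integral_lebesgue[OF _ I] assms by (simp add: nn_integral_completion)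
    finally show ?thesis .
  qed
  show ?thesis
  proof (cases y)
    case (real r)
    then show ?thesis using fin[of r] assms by (simp add: epowr_ennreal)
  next
    case top
    let ?J = "\<lambda>y. \<integral>\<^sup>+\<alpha>. ennreal (c * \<alpha> powr (c - 1)) * indicator {0<..} \<alpha> * indicator {\<alpha>. ennreal \<alpha> < y} \<alpha> \<partial>lborel"
    have le: "ennreal (r powr c) \<le> ?J top" if "0 \<le> r" for r
      unfolding fin[OF that, symmetric]
      by (intro nn_integral_mono mult_left_mono) (auto simp: indicator_def)
    have "?J top = top"
    proof (rule ccontr)
      assume "?J top \<noteq> top"
      then obtain q where q: "?J top = ennreal q" "0 \<le> q"
        by (cases "?J top") auto
      have "ennreal (((q + 1) powr (1 / c)) powr c) \<le> ennreal q"
        using le[of "(q + 1) powr (1 / c)"] q by simp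
      then show False
        using q assms by (simp add: powr_powr)
    qed
    then show ?thesis using top assms by simp
  qed
qed

section \<open>Maximal functions for a countable family of balls\<close>

text \<open>The covering argument behind the maximal theorem rests on an enlargement \<open>E\<close> that swallows every
  intersecting ball of smaller radius and increases the measure by a bounded factor.  A countable
  family of balls makes the maximal function a countable supremum, hence measurable, also jointly
  in a parameter.  The measure is a parameter of the locale, so that the results carry over to
  doubling measures with a density.\<close>

locale ball_system = sigma_finite_measure X for X :: "'a measure" +
  fixes I :: "'i set" and B :: "'i \<Rightarrow> 'a set" and E :: "'i \<Rightarrow> 'i" and rad :: "'i \<Rightarrow> real"
    and D :: real
  assumes countable_I: "countable I"
    and E_closed: "i \<in> I \<Longrightarrow> E i \<in> I"
    and B_sets [measurable]: "\<And>i. i \<in> I \<Longrightarrow> B i \<in> sets X"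
    and B_subset_E: "i \<in> I \<Longrightarrow> B i \<subseteq> B (E i)"
    and engulf: "i \<in> I \<Longrightarrow> j \<in> I \<Longrightarrow> rad i \<le> rad j \<Longrightarrow> B i \<inter> B j \<noteq> {} \<Longrightarrow> B i \<subseteq> B (E j)"
    and B_pos: "i \<in> I \<Longrightarrow> 0 < emeasure X (B i)"
    and B_finite: "i \<in> I \<Longrightarrow> emeasure X (B i) < \<infinity>"
    and D_pos: "0 < D"
    and B_doubling: "i \<in> I \<Longrightarrow> emeasure X (B (E i)) \<le> ennreal D * emeasure X (B i)"
    and B_cover: "space X = (\<Union>i\<in>I. B i)"
begin

definition maxfn :: "('a \<Rightarrow> ennreal) \<Rightarrow> 'a \<Rightarrow> ennreal" where
  "maxfn f x = (SUP i\<in>I. indicator (B i) x * ((\<integral>\<^sup>+y\<in>B i. f y \<partial>X) / emeasure X (B i)))"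

lemma measurable_maxfn_param:
  assumes f: "case_prod f \<in> borel_measurable (N \<Otimes>\<^sub>M X)"
  shows "(\<lambda>(t, x). maxfn (f t) x) \<in> borel_measurable (N \<Otimes>\<^sub>M X)"
proof -
  have [measurable]: "(\<lambda>p. \<integral>\<^sup>+y\<in>B i. f (fst p) y \<partial>X) \<in> borel_measurable (N \<Otimes>\<^sub>M X)" if "i \<in> I" for i
  proof -
    note [measurable] = f B_sets[OF that]
    have "(\<lambda>(t, y). f t y * indicator (B i) y) \<in> borel_measurable (N \<Otimes>\<^sub>M X)"
      by measurable
    from borel_measurable_nn_integral_fst[OF this]
    have "(\<lambda>t. \<integral>\<^sup>+y. f t y * indicator (B i) y \<partial>X) \<in> borel_measurable N"
      by simp
    from measurable_compose[OF measurable_fst this]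
    show ?thesis by simp
  qed
  have "(\<lambda>p. SUP i\<in>I. indicator (B i) (snd p) * ((\<integral>\<^sup>+y\<in>B i. f (fst p) y \<partial>X) / emeasure X (B i)))
      \<in> borel_measurable (N \<Otimes>\<^sub>M X)"
  proof (rule borel_measurable_SUP[OF countable_I])
    fix i assume i: "i \<in> I"
    note [measurable] = B_sets[OF i]
    have "(\<lambda>p. indicator (B i) (snd p) :: ennreal) \<in> borel_measurable (N \<Otimes>\<^sub>M X)"
      by (rule measurable_compose[OF measurable_snd]) measurable
    with i show "(\<lambda>p. indicator (B i) (snd p) * ((\<integral>\<^sup>+y\<in>B i. f (fst p) y \<partial>X) / emeasure X (B i)))
      \<in> borel_measurable (N \<Otimes>\<^sub>M X)"
      by measurable
  qed
  then show ?thesis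
    by (simp add: maxfn_def case_prod_beta)
qed

lemma measurable_maxfn [measurable]: "maxfn f \<in> borel_measurable X"
  unfolding maxfn_def
  by (intro borel_measurable_SUP[OF countable_I] borel_measurable_times borel_measurable_indicator B_sets)
    auto

lemma average_le_maxfn:
  "i \<in> I \<Longrightarrow> x \<in> B i \<Longrightarrow> (\<integral>\<^sup>+y\<in>B i. f y \<partial>X) / emeasure X (B i) \<le> maxfn f x"
  unfolding maxfn_def by (rule SUP_upper2[of i]) auto

lemma maxfn_leI:
  assumes "\<And>i. i \<in> I \<Longrightarrow> x \<in> B i \<Longrightarrow> (\<integral>\<^sup>+y\<in>B i. f y \<partial>X) / emeasure X (B i) \<le> c"
  shows "maxfn f x \<le> c"
  unfolding maxfn_def using assms by (intro SUP_least) (auto simp: indicator_def)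

lemma integral_le_maxfn:
  assumes "i \<in> I" "x \<in> B i"
  shows "(\<integral>\<^sup>+y\<in>B i. f y \<partial>X) \<le> maxfn f x * emeasure X (B i)"
  using average_le_maxfn[OF assms, of f] B_pos[OF assms(1)] B_finite[OF assms(1)]
  by (simp add: divide_le_iff_ennreal)

text \<open>Greedy selection: take a ball of largest radius and discard the balls that it meets.\<close>

lemma vitali_selection:
  assumes "finite F" "F \<subseteq> I"
  shows "\<exists>G\<subseteq>F. disjoint_family_on B G \<and> (\<Union>i\<in>F. B i) \<subseteq> (\<Union>i\<in>G. B (E i))"
  using assms
proof (induction F rule: finite_psubset_induct)
  case (psubset F)
  show ?case
  proof (cases "F = {}")
    case False
    obtain i where i: "i \<in> F" "\<And>j. j \<in> F \<Longrightarrow> rad j \<le> rad i"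
      using Max_in[of "rad ` F"] Max_ge[of "rad ` F"] False psubset.hyps
      by (metis (no_types, lifting) finite_imageI image_iff image_is_empty imageI)
    define F' where "F' = {j\<in>F. B j \<inter> B i = {}}"
    have "i \<notin> F'"
      using B_pos[of i] i psubset.prems by (auto simp: F'_def)
    then have "F' \<subset> F" "F' \<subseteq> I"
      using i psubset.prems by (auto simp: F'_def)
    from psubset.IH[OF this] obtain G where G: "G \<subseteq> F'" "disjoint_family_on B G"
        "(\<Union>i\<in>F'. B i) \<subseteq> (\<Union>i\<in>G. B (E i))"
      by blast
    have "disjoint_family_on B (insert i G)"
      using G(1,2) by (fastforce simp: disjoint_family_on_def F'_def)
    moreover have "B j \<subseteq> (\<Union>i\<in>insert i G. B (E i))" if "j \<in> F" for j
    proof (cases "j \<in> F'")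
      case True
      then show ?thesis using G(3) by blast
    next
      case False
      then have "B j \<subseteq> B (E i)"
        using that i psubset.prems by (intro engulf) (auto simp: F'_def)
      then show ?thesis by blast
    qed
    ultimately show ?thesis
      using G(1) i(1) by (intro exI[of _ "insert i G"]) (auto simp: F'_def)
  qed (auto simp: disjoint_family_on_def)
qed

lemma emeasure_UN_le_finite:
  assumes "S \<subseteq> I" and le: "\<And>F. finite F \<Longrightarrow> F \<subseteq> S \<Longrightarrow> emeasure X (\<Union>i\<in>F. B i) \<le> c"
  shows "emeasure X (\<Union>i\<in>S. B i) \<le> c"
proof (cases "S = {}")
  case False
  define s where "s = from_nat_into S"
  have s: "range s = S"
    unfolding s_def using assms(1) countable_I False by (meson countable_subset range_from_nat_into)
  define A where "A n = (\<Union>k\<le>n. B (s k))" for n :: nat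
  have "(\<Union>i\<in>S. B i) = (\<Union>n. A n)"
    unfolding A_def s[symmetric] by auto
  also have "emeasure X \<dots> = (SUP n. emeasure X (A n))"
  proof (rule SUP_emeasure_incseq[symmetric])
    show "range A \<subseteq> sets X"
      unfolding A_def using s assms(1) by (auto intro!: sets.finite_UN B_sets)
    show "incseq A"
      unfolding A_def by (fastforce simp: incseq_def intro: order_trans)
  qed
  also have "\<dots> \<le> c"
  proof (rule SUP_least)
    fix n
    have "A n = (\<Union>i\<in>s ` {..n}. B i)" by (auto simp: A_def)
    then show "emeasure X (A n) \<le> c"
      using le[of "s ` {..n}"] s by auto
  qed
  finally show ?thesis .
qed simp

lemma maxfn_weak_type:
  assumes [measurable]: "f \<in> borel_measurable X" and \<alpha>: "0 < \<alpha>"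
  shows "emeasure X {x\<in>space X. ennreal \<alpha> < maxfn f x} \<le> ennreal (D / \<alpha>) * (\<integral>\<^sup>+x. f x \<partial>X)"
proof -
  define S where "S = {i\<in>I. ennreal \<alpha> * emeasure X (B i) < (\<integral>\<^sup>+y\<in>B i. f y \<partial>X)}"
  have iff: "ennreal \<alpha> < (\<integral>\<^sup>+y\<in>B i. f y \<partial>X) / emeasure X (B i) \<longleftrightarrow> i \<in> S" if "i \<in> I" for i
    using divide_le_iff_ennreal[of "emeasure X (B i)" "\<integral>\<^sup>+y\<in>B i. f y \<partial>X" "ennreal \<alpha>"]
      B_pos[OF that] B_finite[OF that] that by (simp add: S_def not_le[symmetric])
  have eq: "{x\<in>space X. ennreal \<alpha> < maxfn f x} = (\<Union>i\<in>S. B i)"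
  proof (intro equalityI subsetI)
    fix x assume "x \<in> {x\<in>space X. ennreal \<alpha> < maxfn f x}"
    then obtain i where i: "i \<in> I"
        "ennreal \<alpha> < indicator (B i) x * ((\<integral>\<^sup>+y\<in>B i. f y \<partial>X) / emeasure X (B i))"
      by (auto simp: maxfn_def less_SUP_iff)
    then have "x \<in> B i" by (cases "x \<in> B i") auto
    with i iff[OF i(1)] show "x \<in> (\<Union>i\<in>S. B i)" by auto
  next
    fix x assume "x \<in> (\<Union>i\<in>S. B i)"
    then obtain i where i: "i \<in> S" "x \<in> B i" by auto
    then have "i \<in> I" by (auto simp: S_def)
    with i iff[OF this] average_le_maxfn[OF this i(2), of f] B_cover
    show "x \<in> {x\<in>space X. ennreal \<alpha> < maxfn f x}"
      by (auto intro: less_le_trans)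
  qed
  show ?thesis unfolding eq
  proof (rule emeasure_UN_le_finite)
    show "S \<subseteq> I" by (auto simp: S_def)
    fix F assume "finite F" "F \<subseteq> S"
    then obtain G where G: "G \<subseteq> F" "disjoint_family_on B G" "(\<Union>i\<in>F. B i) \<subseteq> (\<Union>i\<in>G. B (E i))"
      using vitali_selection[of F] by (auto simp: S_def)
    have fin: "finite G" using G \<open>finite F\<close> by (auto intro: finite_subset)
    have GI: "i \<in> I" "i \<in> S" if "i \<in> G" for i
      using that G \<open>F \<subseteq> S\<close> by (auto simp: S_def)
    note [measurable] = B_sets[OF GI(1)] B_sets[OF E_closed[OF GI(1)]]
    have "emeasure X (\<Union>i\<in>F. B i) \<le> emeasure X (\<Union>i\<in>G. B (E i))"
      using G(3) fin GI by (intro emeasure_mono sets.finite_UN) auto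
    also have "\<dots> \<le> (\<Sum>i\<in>G. emeasure X (B (E i)))"
      using fin GI by (intro emeasure_subadditive_finite) (auto intro: B_sets E_closed)
    also have "\<dots> \<le> (\<Sum>i\<in>G. ennreal (D / \<alpha>) * (\<integral>\<^sup>+y\<in>B i. f y \<partial>X))"
    proof (rule sum_mono)
      fix i assume i: "i \<in> G"
      have "emeasure X (B (E i)) \<le> ennreal D * emeasure X (B i)"
        using GI i by (intro B_doubling) auto
      also have "\<dots> = ennreal (D / \<alpha>) * (ennreal \<alpha> * emeasure X (B i))"
        using \<alpha> D_pos by (simp add: mult.assoc[symmetric] flip: ennreal_mult)
      also have "\<dots> \<le> ennreal (D / \<alpha>) * (\<integral>\<^sup>+y\<in>B i. f y \<partial>X)"
        using GI(2)[OF i] by (intro mult_left_mono) (auto simp: S_def)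
      finally show "emeasure X (B (E i)) \<le> ennreal (D / \<alpha>) * (\<integral>\<^sup>+y\<in>B i. f y \<partial>X)" .
    qed
    also have "\<dots> = ennreal (D / \<alpha>) * (\<integral>\<^sup>+y. (\<Sum>i\<in>G. f y * indicator (B i) y) \<partial>X)"
      by (simp add: sum_distrib_left nn_integral_sum)
    also have "(\<integral>\<^sup>+y. (\<Sum>i\<in>G. f y * indicator (B i) y) \<partial>X) \<le> (\<integral>\<^sup>+y. f y \<partial>X)"
    proof (rule nn_integral_mono)
      fix y
      have "(\<Sum>i\<in>G. f y * indicator (B i) y) = f y * indicator (\<Union>i\<in>G. B i) y"
        by (simp only: indicator_UN_disjoint[OF fin G(2), of y] sum_distrib_left)
      then show "(\<Sum>i\<in>G. f y * indicator (B i) y) \<le> f y"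
        by (auto simp: indicator_def)
    qed
    finally show "emeasure X (\<Union>i\<in>F. B i) \<le> ennreal (D / \<alpha>) * (\<integral>\<^sup>+y. f y \<partial>X)"
      by (simp add: mult_left_mono)
  qed
qed

lemma maxfn_le_add_const:
  assumes [measurable]: "g \<in> borel_measurable X" and le: "\<And>x. f x \<le> g x + c"
  shows "maxfn f x \<le> maxfn g x + c"
proof (rule maxfn_leI)
  fix i assume i: "i \<in> I" "x \<in> B i"
  note [measurable] = B_sets[OF i(1)]
  have fin: "0 < emeasure X (B i)" "emeasure X (B i) < top"
    using B_pos B_finite i by auto
  have "(\<integral>\<^sup>+y\<in>B i. f y \<partial>X) \<le> (\<integral>\<^sup>+y. g y * indicator (B i) y + c * indicator (B i) y \<partial>X)"
    using le by (intro nn_integral_mono) (auto simp: indicator_def)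
  also have "\<dots> = (\<integral>\<^sup>+y\<in>B i. g y \<partial>X) + c * emeasure X (B i)"
    by (simp add: nn_integral_add nn_integral_cmult_indicator)
  also have "\<dots> \<le> maxfn g x * emeasure X (B i) + c * emeasure X (B i)"
    by (intro add_right_mono integral_le_maxfn i)
  finally show "(\<integral>\<^sup>+y\<in>B i. f y \<partial>X) / emeasure X (B i) \<le> maxfn g x + c"
    using fin by (simp add: divide_le_iff_ennreal distrib_right)
qed

text \<open>Marcinkiewicz interpolation with the trivial bound in \<open>L\<^sup>\<infinity>\<close>: at height \<open>\<alpha>\<close> only the part of
  \<open>f\<close> above \<open>\<alpha> / 2\<close> matters.\<close>

lemma maxfn_strong_type:
  assumes f [measurable]: "f \<in> borel_measurable X" and p: "1 < p"
  shows "(\<integral>\<^sup>+x. epowr (maxfn f x) p \<partial>X)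
    \<le> ennreal (D * p * 2 powr p / (p - 1)) * (\<integral>\<^sup>+x. epowr (f x) p \<partial>X)"
proof -
  interpret P: pair_sigma_finite lborel X ..
  define h where "h \<alpha> x = f x * indicator {x. ennreal \<alpha> < 2 * f x} x" for \<alpha> x
  have h_meas [measurable]: "(\<lambda>(\<alpha>, x). h \<alpha> x) \<in> borel_measurable (lborel \<Otimes>\<^sub>M X)"
    unfolding h_def indicator_def by measurable
  have h1 [measurable]: "h \<alpha> \<in> borel_measurable X" for \<alpha>
    unfolding h_def indicator_def by measurable
  have lev: "emeasure X {x\<in>space X. ennreal \<alpha> < maxfn f x} \<le> ennreal (2 * D / \<alpha>) * (\<integral>\<^sup>+x. h \<alpha> x \<partial>X)"
    if \<alpha>: "0 < \<alpha>" for \<alpha> :: real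
  proof -
    have "f x \<le> h \<alpha> x + ennreal (\<alpha> / 2)" for x
    proof (cases "ennreal \<alpha> < 2 * f x")
      case False
      then show ?thesis
        using \<alpha> by (cases "f x") (auto simp: h_def not_less ennreal_le_iff simp flip: ennreal_mult ennreal_numeral)
    qed (auto simp: h_def)
    then have le: "maxfn f x \<le> maxfn (h \<alpha>) x + ennreal (\<alpha> / 2)" for x
      by (intro maxfn_le_add_const) auto
    have "ennreal (\<alpha> / 2) < maxfn (h \<alpha>) x" if "ennreal \<alpha> < maxfn f x" for x
    proof (rule ccontr)
      assume "\<not> ?thesis"
      then have "maxfn f x \<le> ennreal (\<alpha> / 2) + ennreal (\<alpha> / 2)"
        using le[of x] by (meson add_right_mono not_less order_trans)
      also have "\<dots> = ennreal \<alpha>" using \<alpha> by (simp flip: ennreal_plus)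
      finally show False using that by simp
    qed
    then have "emeasure X {x\<in>space X. ennreal \<alpha> < maxfn f x}
        \<le> emeasure X {x\<in>space X. ennreal (\<alpha> / 2) < maxfn (h \<alpha>) x}"
      by (intro emeasure_mono) auto
    also have "\<dots> \<le> ennreal (D / (\<alpha> / 2)) * (\<integral>\<^sup>+x. h \<alpha> x \<partial>X)"
      using \<alpha> by (intro maxfn_weak_type) auto
    finally show ?thesis by (simp add: mult.commute)
  qed
  have "(\<integral>\<^sup>+x. epowr (maxfn f x) p \<partial>X) = (\<integral>\<^sup>+x. (\<integral>\<^sup>+\<alpha>. ennreal (p * \<alpha> powr (p - 1)) * indicator {0<..} \<alpha>
      * indicator {\<alpha>. ennreal \<alpha> < maxfn f x} \<alpha> \<partial>lborel) \<partial>X)"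
    using p by (simp add: epowr_layer_cake)
  also have "\<dots> = (\<integral>\<^sup>+\<alpha>. (\<integral>\<^sup>+x. ennreal (p * \<alpha> powr (p - 1)) * indicator {0<..} \<alpha>
      * indicator {\<alpha>. ennreal \<alpha> < maxfn f x} \<alpha> \<partial>X) \<partial>lborel)"
    by (intro P.Fubini') (simp add: indicator_def, measurable)
  also have "\<dots> \<le> (\<integral>\<^sup>+\<alpha>. (\<integral>\<^sup>+x. ennreal (2 * D * p * \<alpha> powr (p - 1 - 1)) * indicator {0<..} \<alpha> * h \<alpha> x \<partial>X) \<partial>lborel)"
  proof (rule nn_integral_mono)
    fix \<alpha> :: real
    have "(\<integral>\<^sup>+x. indicator {\<alpha>. ennreal \<alpha> < maxfn f x} \<alpha> \<partial>X)
        = (\<integral>\<^sup>+x. indicator {x\<in>space X. ennreal \<alpha> < maxfn f x} x \<partial>X)"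
      by (intro nn_integral_cong) (auto simp: indicator_def)
    also have "\<dots> = emeasure X {x\<in>space X. ennreal \<alpha> < maxfn f x}"
      by (rule nn_integral_indicator) measurable
    finally have ind: "(\<integral>\<^sup>+x. indicator {\<alpha>. ennreal \<alpha> < maxfn f x} \<alpha> \<partial>X)
        = emeasure X {x\<in>space X. ennreal \<alpha> < maxfn f x}" .
    have [measurable]: "(\<lambda>x. indicator {\<alpha>. ennreal \<alpha> < maxfn f x} \<alpha> :: ennreal) \<in> borel_measurable X"
      unfolding indicator_def by simp
    have "(\<integral>\<^sup>+x. ennreal (p * \<alpha> powr (p - 1)) * indicator {0<..} \<alpha> * indicator {\<alpha>. ennreal \<alpha> < maxfn f x} \<alpha> \<partial>X)
      = ennreal (p * \<alpha> powr (p - 1)) * indicator {0<..} \<alpha> * emeasure X {x\<in>space X. ennreal \<alpha> < maxfn f x}"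
      by (subst nn_integral_cmult) (auto simp: ind)
    also have "\<dots> \<le> ennreal (2 * D * p * \<alpha> powr (p - 1 - 1)) * indicator {0<..} \<alpha> * (\<integral>\<^sup>+x. h \<alpha> x \<partial>X)"
    proof (cases "0 < \<alpha>")
      case True
      have "ennreal (p * \<alpha> powr (p - 1)) * emeasure X {x\<in>space X. ennreal \<alpha> < maxfn f x} \<le>
          ennreal (p * \<alpha> powr (p - 1)) * (ennreal (2 * D / \<alpha>) * (\<integral>\<^sup>+x. h \<alpha> x \<partial>X))"
        by (intro mult_left_mono lev True) auto
      also have "\<dots> = ennreal (2 * D * p * \<alpha> powr (p - 1 - 1)) * (\<integral>\<^sup>+x. h \<alpha> x \<partial>X)"
      proof -
        have "p * \<alpha> powr (p - 1) * (2 * D / \<alpha>) = 2 * D * p * \<alpha> powr (p - 1 - 1)"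
          using True by (simp add: powr_diff power2_eq_square)
        then have "ennreal (p * \<alpha> powr (p - 1)) * ennreal (2 * D / \<alpha>) = ennreal (2 * D * p * \<alpha> powr (p - 1 - 1))"
          using True D_pos p by (metis ennreal_mult'' less_eq_real_def mult_pos_pos zero_less_divide_iff zero_less_numeral)
        then show ?thesis by (simp only: mult.assoc[symmetric])
      qed
      finally show ?thesis using True by simp
    qed simp
    also have "\<dots> = (\<integral>\<^sup>+x. ennreal (2 * D * p * \<alpha> powr (p - 1 - 1)) * indicator {0<..} \<alpha> * h \<alpha> x \<partial>X)"
      by (simp add: nn_integral_cmult)
    finally show "(\<integral>\<^sup>+x. ennreal (p * \<alpha> powr (p - 1)) * indicator {0<..} \<alpha> * indicator {\<alpha>. ennreal \<alpha> < maxfn f x} \<alpha> \<partial>X)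
      \<le> (\<integral>\<^sup>+x. ennreal (2 * D * p * \<alpha> powr (p - 1 - 1)) * indicator {0<..} \<alpha> * h \<alpha> x \<partial>X)" .
  qed
  also have "\<dots> = (\<integral>\<^sup>+x. (\<integral>\<^sup>+\<alpha>. ennreal (2 * D * p * \<alpha> powr (p - 1 - 1)) * indicator {0<..} \<alpha> * h \<alpha> x \<partial>lborel) \<partial>X)"
    by (intro P.Fubini'[symmetric]) measurable
  also have "\<dots> = (\<integral>\<^sup>+x. ennreal (D * p * 2 powr p / (p - 1)) * epowr (f x) p \<partial>X)"
  proof (rule nn_integral_cong)
    fix x
    have "(\<integral>\<^sup>+\<alpha>. ennreal (2 * D * p * \<alpha> powr (p - 1 - 1)) * indicator {0<..} \<alpha> * h \<alpha> x \<partial>lborel)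
      = (\<integral>\<^sup>+\<alpha>. (ennreal (2 * D * p / (p - 1)) * f x) * (ennreal ((p - 1) * \<alpha> powr (p - 1 - 1)) * indicator {0<..} \<alpha>
          * indicator {\<alpha>. ennreal \<alpha> < 2 * f x} \<alpha>) \<partial>lborel)"
    proof (rule nn_integral_cong)
      fix \<alpha> :: real
      have "ennreal (2 * D * p * \<alpha> powr (p - 1 - 1)) =
          ennreal (2 * D * p / (p - 1)) * ennreal ((p - 1) * \<alpha> powr (p - 1 - 1))"
        using p D_pos by (simp flip: ennreal_mult)
      then show "ennreal (2 * D * p * \<alpha> powr (p - 1 - 1)) * indicator {0<..} \<alpha> * h \<alpha> x =
        (ennreal (2 * D * p / (p - 1)) * f x) * (ennreal ((p - 1) * \<alpha> powr (p - 1 - 1)) * indicator {0<..} \<alpha>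
          * indicator {\<alpha>. ennreal \<alpha> < 2 * f x} \<alpha>)"
        by (auto simp: h_def indicator_def mult_ac)
    qed
    also have "\<dots> = (ennreal (2 * D * p / (p - 1)) * f x) * epowr (2 * f x) (p - 1)"
      using p by (subst nn_integral_cmult, measurable, subst epowr_layer_cake) auto
    also have "\<dots> = ennreal (2 * D * p / (p - 1)) * ennreal (2 powr (p - 1)) * (f x * epowr (f x) (p - 1))"
      using p by (simp add: epowr_mult epowr_ennreal mult_ac flip: ennreal_numeral)
    also have "f x * epowr (f x) (p - 1) = epowr (f x) p"
      using p epowr_add[of 1 "p - 1" "f x"] by simp
    also have "ennreal (2 * D * p / (p - 1)) * ennreal (2 powr (p - 1)) = ennreal (D * p * 2 powr p / (p - 1))"
    proof -
      have "2 * D * p / (p - 1) * 2 powr (p - 1) = D * p * (2 * 2 powr (p - 1)) / (p - 1)"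
        by simp
      also have "2 * 2 powr (p - 1) = 2 powr p"
        by (simp add: powr_diff)
      finally show ?thesis
        using p D_pos by (simp flip: ennreal_mult)
    qed
    finally show "(\<integral>\<^sup>+\<alpha>. ennreal (2 * D * p * \<alpha> powr (p - 1 - 1)) * indicator {0<..} \<alpha> * h \<alpha> x \<partial>lborel)
      = ennreal (D * p * 2 powr p / (p - 1)) * epowr (f x) p" .
  qed
  also have "\<dots> = ennreal (D * p * 2 powr p / (p - 1)) * (\<integral>\<^sup>+x. epowr (f x) p \<partial>X)"
    by (simp add: nn_integral_cmult)
  finally show ?thesis .
qed

end

section \<open>Weighted bounds for the maximal function\<close>

context ball_system
begin

definition muckenhoupt_weight :: "real \<Rightarrow> real \<Rightarrow> ('a \<Rightarrow> real) \<Rightarrow> bool" where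
  "muckenhoupt_weight s K w \<longleftrightarrow> 0 < K \<and> w \<in> borel_measurable X \<and> (\<forall>x. 0 < w x) \<and>
     (\<forall>i\<in>I. (\<integral>\<^sup>+y\<in>B i. ennreal (w y) \<partial>X) *
        epowr (\<integral>\<^sup>+y\<in>B i. ennreal (w y powr (- 1 / (s - 1))) \<partial>X) (s - 1)
        \<le> ennreal K * epowr (emeasure X (B i)) s)"

definition strong_const :: "real \<Rightarrow> real \<Rightarrow> real" where
  "strong_const d p = d * p * 2 powr p / (p - 1)"

definition muckenhoupt_const :: "real \<Rightarrow> real \<Rightarrow> real" where
  "muckenhoupt_const s K = K powr (s / (s - 1)) * strong_const (K * D powr s) (s / (s - 1)) *
     strong_const ((K * D powr s) powr (1 / (s - 1))) s"

lemma strong_const_pos: "0 < d \<Longrightarrow> 1 < p \<Longrightarrow> 0 < strong_const d p"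
  by (simp add: strong_const_def)

lemma muckenhoupt_const_pos: "1 < s \<Longrightarrow> 0 < K \<Longrightarrow> 0 < muckenhoupt_const s K"
  unfolding muckenhoupt_const_def using D_pos
  by (intro mult_pos_pos strong_const_pos) (auto simp: field_simps)

lemma ball_integral_pos:
  assumes [measurable]: "f \<in> borel_measurable X" and pos: "\<And>x. 0 < f x" and i: "i \<in> I"
  shows "0 < (\<integral>\<^sup>+y\<in>B i. f y \<partial>X)"
proof (rule ccontr)
  note [measurable] = B_sets[OF i]
  assume "\<not> ?thesis"
  then have "(\<integral>\<^sup>+y\<in>B i. f y \<partial>X) = 0" by simp
  then have "AE y in X. f y * indicator (B i) y = 0"
    by (subst (asm) nn_integral_0_iff_AE) auto
  then have "AE y in X. y \<notin> B i"
    by eventually_elim (use pos in \<open>auto simp: indicator_def less_le split: if_splits\<close>)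
  then have "emeasure X (B i) = 0"
    by (subst (asm) AE_iff_measurable[OF B_sets[OF i]])
      (use sets.sets_into_space[OF B_sets[OF i]] in auto)
  then show False using B_pos[OF i] by simp
qed

lemma muckenhoupt_weightD:
  assumes "muckenhoupt_weight s K w" "1 < s" "i \<in> I"
  shows "0 < (\<integral>\<^sup>+y\<in>B i. ennreal (w y) \<partial>X)" "(\<integral>\<^sup>+y\<in>B i. ennreal (w y) \<partial>X) < top"
    "0 < (\<integral>\<^sup>+y\<in>B i. ennreal (w y powr (- 1 / (s - 1))) \<partial>X)"
    "(\<integral>\<^sup>+y\<in>B i. ennreal (w y powr (- 1 / (s - 1))) \<partial>X) < top"
proof -
  let ?W = "\<integral>\<^sup>+y\<in>B i. ennreal (w y) \<partial>X"
  let ?S = "\<integral>\<^sup>+y\<in>B i. ennreal (w y powr (- 1 / (s - 1))) \<partial>X"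
  have [measurable]: "w \<in> borel_measurable X" and pos: "\<And>x. 0 < w x"
    using assms by (auto simp: muckenhoupt_weight_def)
  have [simp]: "w x \<noteq> 0" for x using pos[of x] by simp
  show W: "0 < ?W" and S: "0 < ?S"
    using pos assms(3) by (auto intro!: ball_integral_pos)
  have "?W * epowr ?S (s - 1) \<le> ennreal K * epowr (emeasure X (B i)) s"
    using assms by (auto simp: muckenhoupt_weight_def)
  also have "\<dots> < top"
    using assms B_finite[OF assms(3)] by (simp add: ennreal_mult_less_top)
  finally have *: "?W * epowr ?S (s - 1) < top" .
  show "?W < top" "?S < top"
    using * W S assms(2) by (auto simp: ennreal_mult_less_top)
qed

text \<open>Hoelder's inequality is the converse of the Muckenhoupt condition.  Comparing the two on a
  ball and its enlargement gives the doubling property.\<close>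

lemma measure_le_weights:
  assumes [measurable]: "w \<in> borel_measurable X" and pos: "\<And>x. 0 < w x" and s: "1 < s" and i: "i \<in> I"
  shows "epowr (emeasure X (B i)) s \<le> (\<integral>\<^sup>+y\<in>B i. ennreal (w y) \<partial>X) *
        epowr (\<integral>\<^sup>+y\<in>B i. ennreal (w y powr (- 1 / (s - 1))) \<partial>X) (s - 1)"
proof -
  let ?W = "\<integral>\<^sup>+y\<in>B i. ennreal (w y) \<partial>X"
  let ?S = "\<integral>\<^sup>+y\<in>B i. ennreal (w y powr (- 1 / (s - 1))) \<partial>X"
  note [measurable] = B_sets[OF i]
  have "emeasure X (B i) = (\<integral>\<^sup>+y. epowr (ennreal (w y) * indicator (B i) y) (1 / s) *
      epowr (ennreal (w y powr (- 1 / (s - 1))) * indicator (B i) y) (1 - 1 / s) \<partial>X)"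
  proof (subst nn_integral_indicator[OF B_sets[OF i], symmetric], rule nn_integral_cong)
    fix y
    have "w y powr (1 / s) * (w y powr (- 1 / (s - 1))) powr (1 - 1 / s) = w y powr (1 / s + (- 1 / (s - 1)) * (1 - 1 / s))"
      by (simp add: powr_powr flip: powr_add)
    also have "1 / s + (- 1 / (s - 1)) * (1 - 1 / s) = 0"
      using s by (simp add: field_simps)
    finally have "w y powr (1 / s) * (w y powr (- 1 / (s - 1))) powr (1 - 1 / s) = 1"
      using pos[of y] by simp
    then show "indicator (B i) y = epowr (ennreal (w y) * indicator (B i) y) (1 / s) *
      epowr (ennreal (w y powr (- 1 / (s - 1))) * indicator (B i) y) (1 - 1 / s)"
      using s pos[of y] less_imp_le[OF pos[of y]]
      by (cases "y \<in> B i") (auto simp: epowr_ennreal_pos simp flip: ennreal_mult)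
  qed
  also have "\<dots> \<le> epowr ?W (1 / s) * epowr ?S (1 - 1 / s)"
    using s by (intro nn_integral_Hoelder) auto
  finally have "epowr (emeasure X (B i)) s \<le> epowr (epowr ?W (1 / s) * epowr ?S (1 - 1 / s)) s"
    using s by (intro epowr_mono) auto
  also have "\<dots> = ?W * epowr ?S ((1 - 1 / s) * s)"
    using s by (simp add: epowr_mult epowr_epowr)
  also have "(1 - 1 / s) * s = s - 1"
    using s by (simp add: field_simps)
  finally show ?thesis .
qed

lemma muckenhoupt_weight_doubling:
  assumes w: "muckenhoupt_weight s K w" and s: "1 < s" and i: "i \<in> I"
  shows "(\<integral>\<^sup>+y\<in>B (E i). ennreal (w y) \<partial>X) \<le> ennreal (K * D powr s) * (\<integral>\<^sup>+y\<in>B i. ennreal (w y) \<partial>X)"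
    and "(\<integral>\<^sup>+y\<in>B (E i). ennreal (w y powr (- 1 / (s - 1))) \<partial>X)
      \<le> ennreal ((K * D powr s) powr (1 / (s - 1))) * (\<integral>\<^sup>+y\<in>B i. ennreal (w y powr (- 1 / (s - 1))) \<partial>X)"
proof -
  let ?W = "\<lambda>i. \<integral>\<^sup>+y\<in>B i. ennreal (w y) \<partial>X"
  let ?S = "\<lambda>i. \<integral>\<^sup>+y\<in>B i. ennreal (w y powr (- 1 / (s - 1))) \<partial>X"
  have [measurable]: "w \<in> borel_measurable X" and pos: "\<And>x. 0 < w x" and K: "0 < K"
    using w by (auto simp: muckenhoupt_weight_def)
  note fin = muckenhoupt_weightD[OF w s i] muckenhoupt_weightD[OF w s E_closed[OF i]]
  have W: "?W i \<le> ?W (E i)" and S: "?S i \<le> ?S (E i)"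
    using B_subset_E[OF i] by (auto intro!: nn_integral_mono mult_left_mono simp: indicator_def)
  have "?W (E i) * epowr (?S (E i)) (s - 1) \<le> ennreal K * epowr (emeasure X (B (E i))) s"
    using w E_closed[OF i] by (auto simp: muckenhoupt_weight_def)
  also have "\<dots> \<le> ennreal K * epowr (ennreal D * emeasure X (B i)) s"
    using s B_doubling[OF i] by (intro mult_left_mono epowr_mono) auto
  also have "\<dots> = ennreal (K * D powr s) * epowr (emeasure X (B i)) s"
    using s K D_pos by (simp add: epowr_mult epowr_ennreal ennreal_mult mult.assoc)
  also have "\<dots> \<le> ennreal (K * D powr s) * (?W i * epowr (?S i) (s - 1))"
    by (intro mult_left_mono measure_le_weights s i pos) auto
  finally have main: "?W (E i) * epowr (?S (E i)) (s - 1) \<le> ennreal (K * D powr s) * (?W i * epowr (?S i) (s - 1))" .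
  have "epowr (?S i) (s - 1) * ?W (E i) \<le> ?W (E i) * epowr (?S (E i)) (s - 1)"
    using S s by (subst mult.commute) (intro mult_left_mono epowr_mono, auto)
  also note main
  finally have "epowr (?S i) (s - 1) * ?W (E i) \<le> epowr (?S i) (s - 1) * (ennreal (K * D powr s) * ?W i)"
    by (simp add: mult_ac)
  then show "?W (E i) \<le> ennreal (K * D powr s) * ?W i"
    using fin s by (subst (asm) ennreal_mult_le_mult_iff) auto
  have "?W i * epowr (?S (E i)) (s - 1) \<le> ?W (E i) * epowr (?S (E i)) (s - 1)"
    using W by (intro mult_right_mono) auto
  also note main
  finally have "?W i * epowr (?S (E i)) (s - 1) \<le> ?W i * (ennreal (K * D powr s) * epowr (?S i) (s - 1))"
    by (simp add: mult_ac)
  then have "epowr (?S (E i)) (s - 1) \<le> ennreal (K * D powr s) * epowr (?S i) (s - 1)"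
    using fin by (subst (asm) ennreal_mult_le_mult_iff) auto
  then have "?S (E i) \<le> epowr (ennreal (K * D powr s) * epowr (?S i) (s - 1)) (1 / (s - 1))"
    using s by (subst (asm) epowr_le_swap) auto
  also have "\<dots> = ennreal ((K * D powr s) powr (1 / (s - 1))) * ?S i"
    using s K D_pos by (simp add: epowr_mult epowr_ennreal)
  finally show "?S (E i) \<le> ennreal ((K * D powr s) powr (1 / (s - 1))) * ?S i" .
qed

lemma ball_system_density:
  assumes [measurable]: "w \<in> borel_measurable X" and d: "0 < d"
    and "\<And>i. i \<in> I \<Longrightarrow> 0 < (\<integral>\<^sup>+y\<in>B i. ennreal (w y) \<partial>X)"
    and "\<And>i. i \<in> I \<Longrightarrow> (\<integral>\<^sup>+y\<in>B i. ennreal (w y) \<partial>X) < top"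
    and "\<And>i. i \<in> I \<Longrightarrow> (\<integral>\<^sup>+y\<in>B (E i). ennreal (w y) \<partial>X) \<le> ennreal d * (\<integral>\<^sup>+y\<in>B i. ennreal (w y) \<partial>X)"
  shows "ball_system (density X (\<lambda>x. ennreal (w x))) I B E rad d"
proof -
  have em: "emeasure (density X (\<lambda>x. ennreal (w x))) (B i) = (\<integral>\<^sup>+y\<in>B i. ennreal (w y) \<partial>X)" if "i \<in> I" for i
    using that by (simp add: emeasure_density B_sets)
  interpret W: sigma_finite_measure "density X (\<lambda>x. ennreal (w x))"
    by (subst sigma_finite_iff_density_finite') auto
  show ?thesis
    by unfold_locales
      (use assms em B_sets B_cover B_subset_E engulf countable_I E_closed in auto)
qed

text \<open>The pointwise inequality
  \<open>(M f)\<^sup>s\<^sup>-\<^sup>1 \<le> K * M\<^sub>w (M\<^sub>\<sigma> (f / \<sigma>)\<^sup>s\<^sup>-\<^sup>1 / w)\<close> with \<open>\<sigma> = w powr (- 1 / (s - 1))\<close>, due to Lerner,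
  reduces the weighted bound to the unweighted bounds for the doubling measures \<open>w dx\<close> and \<open>\<sigma> dx\<close>.\<close>

theorem maxfn_weighted_bound:
  assumes w: "muckenhoupt_weight s K w" and s: "1 < s" and f [measurable]: "f \<in> borel_measurable X"
  shows "(\<integral>\<^sup>+x. epowr (maxfn f x) s * ennreal (w x) \<partial>X)
    \<le> ennreal (muckenhoupt_const s K) * (\<integral>\<^sup>+x. epowr (f x) s * ennreal (w x) \<partial>X)"
proof -
  define \<sigma> where "\<sigma> x = w x powr (- 1 / (s - 1))" for x
  have w_meas [measurable]: "w \<in> borel_measurable X" and pos: "\<And>x. 0 < w x" and K: "0 < K"
    using w by (auto simp: muckenhoupt_weight_def)
  have \<sigma>_pos: "0 < \<sigma> x" for x using pos[of x] by (simp add: \<sigma>_def)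
  have \<sigma>_meas [measurable]: "\<sigma> \<in> borel_measurable X" unfolding \<sigma>_def by measurable
  define d where "d = K * D powr s"
  have d: "0 < d" "0 < d powr (1 / (s - 1))" using K D_pos by (auto simp: d_def)
  let ?W = "density X (\<lambda>x. ennreal (w x))" and ?V = "density X (\<lambda>x. ennreal (\<sigma> x))"
  interpret W: ball_system ?W I B E rad d
    using muckenhoupt_weightD[OF w s] muckenhoupt_weight_doubling[OF w s] d
    by (intro ball_system_density) (auto simp: d_def)
  interpret V: ball_system ?V I B E rad "d powr (1 / (s - 1))"
    using muckenhoupt_weightD[OF w s] muckenhoupt_weight_doubling[OF w s] d
    by (intro ball_system_density) (auto simp: d_def \<sigma>_def)
  define F where "F = V.maxfn (\<lambda>x. f x * ennreal (1 / \<sigma> x))"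
  have F_meas [measurable]: "F \<in> borel_measurable X"
    using V.measurable_maxfn[of "\<lambda>x. f x * ennreal (1 / \<sigma> x)"] by (simp add: F_def)
  define h where "h x = epowr (F x) (s - 1) * ennreal (1 / w x)" for x
  have h_meas [measurable]: "h \<in> borel_measurable X"
    unfolding h_def by measurable
  have Wh_meas [measurable]: "W.maxfn h \<in> borel_measurable X"
    using W.measurable_maxfn[of h] by simp
  \<comment> \<open>On a ball around \<open>x\<close> the function \<open>F\<close> is bounded below by the integral of \<open>f\<close>, divided by the measure
    of the ball for \<open>\<sigma> dx\<close>.  Integrating the power \<open>s - 1\<close> of this bound over the ball and writing the result
    as an average of \<open>h\<close> for \<open>w dx\<close> brings in exactly the product in the Muckenhoupt condition.\<close>
  have pointwise: "maxfn f x \<le> epowr (ennreal K * W.maxfn h x) (1 / (s - 1))" for x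
  proof (rule maxfn_leI)
    fix i assume i: "i \<in> I" "x \<in> B i"
    note [measurable] = B_sets[OF i(1)]
    define a n \<omega> S where "a = (\<integral>\<^sup>+y\<in>B i. f y \<partial>X)" and "n = emeasure X (B i)"
      and "\<omega> = (\<integral>\<^sup>+y\<in>B i. ennreal (w y) \<partial>X)" and "S = (\<integral>\<^sup>+y\<in>B i. ennreal (\<sigma> y) \<partial>X)"
    have n: "0 < n" "n < top" using B_pos B_finite i by (auto simp: n_def)
    have S: "0 < S" "S < top" using muckenhoupt_weightD[OF w s i(1)] by (auto simp: S_def \<sigma>_def)
    have emW: "emeasure ?W (B i) = \<omega>" and emV: "emeasure ?V (B i) = S"
      using i by (simp_all add: emeasure_density B_sets \<omega>_def S_def)
    have A: "\<omega> * epowr S (s - 1) \<le> ennreal K * epowr n s"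
      using w i by (auto simp: muckenhoupt_weight_def \<omega>_def S_def n_def \<sigma>_def)
    have "(\<integral>\<^sup>+y\<in>B i. f y * ennreal (1 / \<sigma> y) \<partial>?V) = a"
      unfolding a_def
    proof (subst nn_integral_density; (measurable; fail)?)
      show "(\<integral>\<^sup>+y. ennreal (\<sigma> y) * (f y * ennreal (1 / \<sigma> y) * indicator (B i) y) \<partial>X) =
          (\<integral>\<^sup>+y\<in>B i. f y \<partial>X)"
      proof (rule nn_integral_cong)
        fix y
        have "ennreal (\<sigma> y) * ennreal (1 / \<sigma> y) = 1"
          using \<sigma>_pos[of y] by (simp flip: ennreal_mult')
        moreover have "ennreal (\<sigma> y) * (f y * ennreal (1 / \<sigma> y) * indicator (B i) y) =
            (ennreal (\<sigma> y) * ennreal (1 / \<sigma> y)) * (f y * indicator (B i) y)"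
          by (simp add: mult_ac)
        ultimately show "ennreal (\<sigma> y) * (f y * ennreal (1 / \<sigma> y) * indicator (B i) y) = f y * indicator (B i) y"
          by simp
      qed
    qed
    then have "a / S \<le> F y" if "y \<in> B i" for y
      using V.average_le_maxfn[OF i(1) that, of "\<lambda>x. f x * ennreal (1 / \<sigma> x)"]
      by (simp add: F_def emV)
    then have "epowr (a / S) (s - 1) * n \<le> (\<integral>\<^sup>+y\<in>B i. epowr (F y) (s - 1) \<partial>X)"
      using s unfolding n_def
      by (subst nn_integral_cmult_indicator[symmetric])
        (auto intro!: nn_integral_mono epowr_mono simp: indicator_def)
    also have "\<dots> = (\<integral>\<^sup>+y\<in>B i. h y \<partial>?W)"
    proof (subst nn_integral_density; (measurable; fail)?)
      show "(\<integral>\<^sup>+y\<in>B i. epowr (F y) (s - 1) \<partial>X) = (\<integral>\<^sup>+y. ennreal (w y) * (h y * indicator (B i) y) \<partial>X)"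
      proof (rule nn_integral_cong)
        fix y
        have "ennreal (w y) * ennreal (1 / w y) = 1"
          using pos[of y] by (simp flip: ennreal_mult')
        moreover have "ennreal (w y) * (h y * indicator (B i) y) =
            (ennreal (w y) * ennreal (1 / w y)) * (epowr (F y) (s - 1) * indicator (B i) y)"
          by (simp add: h_def mult_ac)
        ultimately show "epowr (F y) (s - 1) * indicator (B i) y = ennreal (w y) * (h y * indicator (B i) y)"
          by simp
      qed
    qed
    also have "\<dots> \<le> W.maxfn h x * \<omega>"
      using W.integral_le_maxfn[OF i, of h] by (simp add: emW)
    finally have "epowr S (s - 1) * (epowr (a / S) (s - 1) * n) \<le> epowr S (s - 1) * (W.maxfn h x * \<omega>)"
      by (rule mult_left_mono) simp
    also have "epowr S (s - 1) * (epowr (a / S) (s - 1) * n) = epowr a (s - 1) * n"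
    proof -
      have "(a / S) * S = a"
        using S by (simp add: ennreal_divide_times)
      then have "a = S * (a / S)" by (simp only: mult.commute)
      then have "epowr a (s - 1) = epowr S (s - 1) * epowr (a / S) (s - 1)"
        using s epowr_mult[of "s - 1" S "a / S"] by simp
      then show ?thesis by (simp add: mult_ac)
    qed
    also have "epowr S (s - 1) * (W.maxfn h x * \<omega>) = W.maxfn h x * (\<omega> * epowr S (s - 1))"
      by (simp add: mult_ac)
    also have "\<dots> \<le> W.maxfn h x * (ennreal K * epowr n s)"
      by (intro mult_left_mono A) simp
    also have "\<dots> = (ennreal K * W.maxfn h x * epowr n (s - 1)) * n"
      using epowr_add[of "s - 1" 1 n] s by (simp add: mult_ac)
    finally have "epowr a (s - 1) \<le> ennreal K * W.maxfn h x * epowr n (s - 1)"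
      using n by (simp add: mult.commute[of _ n] ennreal_mult_le_mult_iff)
    then have "a \<le> epowr (ennreal K * W.maxfn h x * epowr n (s - 1)) (1 / (s - 1))"
      using s by (subst (asm) epowr_le_swap) auto
    also have "\<dots> = epowr (ennreal K * W.maxfn h x) (1 / (s - 1)) * n"
      using s by (simp add: epowr_mult)
    finally show "a / n \<le> epowr (ennreal K * W.maxfn h x) (1 / (s - 1))"
      using n by (simp add: divide_le_iff_ennreal)
  qed
  let ?s' = "s / (s - 1)"
  have s': "1 < ?s'" using s by (simp add: field_simps)
  have "(\<integral>\<^sup>+x. epowr (maxfn f x) s * ennreal (w x) \<partial>X)
      \<le> (\<integral>\<^sup>+x. ennreal (K powr ?s') * (ennreal (w x) * epowr (W.maxfn h x) ?s') \<partial>X)"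
  proof (rule nn_integral_mono)
    fix x
    have "epowr (maxfn f x) s \<le> epowr (epowr (ennreal K * W.maxfn h x) (1 / (s - 1))) s"
      using s by (intro epowr_mono pointwise) auto
    also have "\<dots> = ennreal (K powr ?s') * epowr (W.maxfn h x) ?s'"
      using s K by (simp add: epowr_mult epowr_epowr epowr_ennreal powr_powr)
    finally have "epowr (maxfn f x) s * ennreal (w x) \<le> ennreal (K powr ?s') * epowr (W.maxfn h x) ?s' * ennreal (w x)"
      by (rule mult_right_mono) simp
    then show "epowr (maxfn f x) s * ennreal (w x) \<le> ennreal (K powr ?s') * (ennreal (w x) * epowr (W.maxfn h x) ?s')"
      by (simp add: mult_ac)
  qed
  also have "\<dots> = ennreal (K powr ?s') * (\<integral>\<^sup>+x. epowr (W.maxfn h x) ?s' \<partial>?W)"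
    by (simp add: nn_integral_cmult nn_integral_density)
  also have "\<dots> \<le> ennreal (K powr ?s') * (ennreal (strong_const d ?s') * (\<integral>\<^sup>+x. epowr (h x) ?s' \<partial>?W))"
    unfolding strong_const_def by (intro mult_left_mono W.maxfn_strong_type s') auto
  also have "(\<integral>\<^sup>+x. epowr (h x) ?s' \<partial>?W) = (\<integral>\<^sup>+x. epowr (F x) s \<partial>?V)"
  proof (subst (1 2) nn_integral_density; (measurable; fail)?; intro nn_integral_cong)
    fix x
    have "w x * (1 / w x) powr ?s' = w x powr (1 - ?s')"
      using pos[of x] by (simp add: powr_diff powr_divide)
    also have "1 - ?s' = - 1 / (s - 1)" using s by (simp add: field_simps)
    finally have eq: "ennreal (w x) * ennreal ((1 / w x) powr ?s') = ennreal (\<sigma> x)"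
      using pos[of x] by (simp add: \<sigma>_def flip: ennreal_mult)
    have "(s - 1) * ?s' = s" using s by simp
    then have "epowr (h x) ?s' = epowr (F x) s * ennreal ((1 / w x) powr ?s')"
      using s s' pos[of x] unfolding h_def
      by (simp only: epowr_mult epowr_epowr) (simp add: epowr_ennreal_pos)
    then show "ennreal (w x) * epowr (h x) ?s' = ennreal (\<sigma> x) * epowr (F x) s"
      by (simp add: eq[symmetric] mult_ac)
  qed
  also have "\<dots> \<le> ennreal (strong_const (d powr (1 / (s - 1))) s) * (\<integral>\<^sup>+x. epowr (f x * ennreal (1 / \<sigma> x)) s \<partial>?V)"
    unfolding strong_const_def F_def by (intro V.maxfn_strong_type s) simp
  also have "(\<integral>\<^sup>+x. epowr (f x * ennreal (1 / \<sigma> x)) s \<partial>?V) = (\<integral>\<^sup>+x. epowr (f x) s * ennreal (w x) \<partial>X)"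
  proof (subst nn_integral_density; (measurable; fail)?; intro nn_integral_cong)
    fix x
    have "\<sigma> x * (1 / \<sigma> x) powr s = \<sigma> x powr (1 - s)"
      using \<sigma>_pos[of x] by (simp add: powr_diff powr_divide)
    also have "\<dots> = w x powr ((- 1 / (s - 1)) * (1 - s))"
      by (simp only: \<sigma>_def powr_powr)
    also have "(- 1 / (s - 1)) * (1 - s) = 1"
      using s by (simp add: field_simps)
    also have "w x powr 1 = w x"
      using pos[of x] by simp
    finally have eq: "ennreal (\<sigma> x) * ennreal ((1 / \<sigma> x) powr s) = ennreal (w x)"
      using \<sigma>_pos[of x] by (simp flip: ennreal_mult)
    then show "ennreal (\<sigma> x) * epowr (f x * ennreal (1 / \<sigma> x)) s = epowr (f x) s * ennreal (w x)"
      using s \<sigma>_pos[of x] by (simp add: epowr_mult epowr_ennreal_pos eq[symmetric] mult_ac)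
  qed
  finally have "(\<integral>\<^sup>+x. epowr (maxfn f x) s * ennreal (w x) \<partial>X)
    \<le> ennreal (K powr ?s') * (ennreal (strong_const d ?s') * (ennreal (strong_const (d powr (1 / (s - 1))) s) *
        (\<integral>\<^sup>+x. epowr (f x) s * ennreal (w x) \<partial>X)))"
    by (simp add: mult_left_mono)
  also have "\<dots> = ennreal (muckenhoupt_const s K) * (\<integral>\<^sup>+x. epowr (f x) s * ennreal (w x) \<partial>X)"
    using strong_const_pos[OF d(1) s'] strong_const_pos[OF d(2) s] K
    by (simp add: muckenhoupt_const_def d_def ennreal_mult mult.assoc)
  finally show ?thesis .
qed

end

section \<open>Extrapolation and the vector-valued maximal inequality\<close>

context ball_system
begin

lemma maxfn_cmult_le: "f \<in> borel_measurable X \<Longrightarrow> maxfn (\<lambda>x. c * f x) x \<le> c * maxfn f x"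
proof (rule maxfn_leI)
  fix i assume f [measurable]: "f \<in> borel_measurable X" and i: "i \<in> I" "x \<in> B i"
  note [measurable] = B_sets[OF i(1)]
  have "(\<integral>\<^sup>+y\<in>B i. c * f y \<partial>X) / emeasure X (B i) = c * ((\<integral>\<^sup>+y\<in>B i. f y \<partial>X) / emeasure X (B i))"
    by (simp add: mult.assoc nn_integral_cmult ennreal_times_divide)
  also have "\<dots> \<le> c * maxfn f x"
    by (intro mult_left_mono average_le_maxfn i) simp
  finally show "(\<integral>\<^sup>+y\<in>B i. c * f y \<partial>X) / emeasure X (B i) \<le> c * maxfn f x" .
qed

lemma maxfn_suminf_le:
  assumes [measurable]: "\<And>k. f k \<in> borel_measurable X"
  shows "maxfn (\<lambda>x. \<Sum>k. f k x) x \<le> (\<Sum>k. maxfn (f k) x)"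
proof (rule maxfn_leI)
  fix i assume i: "i \<in> I" "x \<in> B i"
  note [measurable] = B_sets[OF i(1)]
  have "(\<integral>\<^sup>+y\<in>B i. (\<Sum>k. f k y) \<partial>X) = (\<integral>\<^sup>+y. (\<Sum>k. f k y * indicator (B i) y) \<partial>X)"
    by simp
  also have "\<dots> = (\<Sum>k. \<integral>\<^sup>+y\<in>B i. f k y \<partial>X)"
    by (rule nn_integral_suminf) measurable
  finally have "(\<integral>\<^sup>+y\<in>B i. (\<Sum>k. f k y) \<partial>X) / emeasure X (B i) = (\<Sum>k. (\<integral>\<^sup>+y\<in>B i. f k y \<partial>X) / emeasure X (B i))"
    by simp
  also have "\<dots> \<le> (\<Sum>k. maxfn (f k) x)"
    by (intro suminf_le average_le_maxfn i) auto
  finally show "(\<integral>\<^sup>+y\<in>B i. (\<Sum>k. f k y) \<partial>X) / emeasure X (B i) \<le> (\<Sum>k. maxfn (f k) x)" .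
qed

definition A1_const :: "real \<Rightarrow> real \<Rightarrow> real" where
  "A1_const s K = 4 * muckenhoupt_const s K powr (1 / s)"

lemma A1_const_pos: "1 < s \<Longrightarrow> 0 < K \<Longrightarrow> 0 < A1_const s K"
  using muckenhoupt_const_pos[of s K] by (simp add: A1_const_def)

text \<open>The Rubio de Francia algorithm: the series of the normalised iterates of the maximal operator
  is, up to a constant, a majorant of the same size, and the maximal operator shifts it by one index.
  Adding a small strictly positive function first makes the majorant strictly positive.\<close>

lemma rubio_de_francia_majorant:
  assumes w: "muckenhoupt_weight s K w" and s: "1 < s" and h [measurable]: "h \<in> borel_measurable X"
    and c: "0 < c" and le: "(\<integral>\<^sup>+x. epowr (h x) s * ennreal (w x) \<partial>X) \<le> ennreal c"
  obtains V where "V \<in> borel_measurable X" "\<And>x. h x \<le> V x" "\<And>x. 0 < V x"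
    "\<And>x. maxfn V x \<le> ennreal (A1_const s K) * V x"
    "(\<integral>\<^sup>+x. epowr (V x) s * ennreal (w x) \<partial>X) \<le> ennreal (4 powr (s + 1) * c)"
    "AE x in X. V x < top"
proof -
  have w_meas [measurable]: "w \<in> borel_measurable X" and pos: "\<And>x. 0 < w x" and K: "0 < K"
    using w by (auto simp: muckenhoupt_weight_def)
  interpret W: sigma_finite_measure "density X (\<lambda>x. ennreal (w x))"
    by (subst sigma_finite_iff_density_finite') auto
  obtain k0 :: "'a \<Rightarrow> real" where k0: "k0 \<in> borel_measurable (density X (\<lambda>x. ennreal (w x)))"
      "\<And>x. 0 < k0 x" "integrable (density X (\<lambda>x. ennreal (w x))) k0"
    by (rule W.obtain_positive_integrable_function, rule that)
  have [measurable]: "k0 \<in> borel_measurable X" using k0(1) by simp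
  define J where "J = (\<integral>x. k0 x \<partial>density X (\<lambda>x. ennreal (w x)))"
  have "(\<integral>\<^sup>+x. ennreal (w x) * ennreal (k0 x) \<partial>X) = (\<integral>\<^sup>+x. ennreal (k0 x) \<partial>density X (\<lambda>x. ennreal (w x)))"
    by (rule nn_integral_density[symmetric]) measurable
  also have "\<dots> = ennreal J"
    unfolding J_def using k0(2)[THEN less_imp_le] by (intro nn_integral_eq_integral k0(3)) simp
  finally have J: "(\<integral>\<^sup>+x. ennreal (w x) * ennreal (k0 x) \<partial>X) = ennreal J" "0 \<le> J"
    using k0(2)[THEN less_imp_le] by (auto simp: J_def intro!: integral_nonneg)
  \<comment> \<open>a strictly positive function that satisfies the same integral bound as \<open>h\<close>\<close>
  define k where "k x = (c / (J + 1) * k0 x) powr (1 / s)" for x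
  have k_pos: "0 < k x" for x using k0(2)[of x] c J by (simp add: k_def add_nonneg_eq_0_iff)
  have k_meas [measurable]: "k \<in> borel_measurable X" unfolding k_def by measurable
  have "(\<integral>\<^sup>+x. epowr (ennreal (k x)) s * ennreal (w x) \<partial>X)
      = (\<integral>\<^sup>+x. ennreal (c / (J + 1)) * (ennreal (w x) * ennreal (k0 x)) \<partial>X)"
  proof (rule nn_integral_cong)
    fix x
    have "epowr (ennreal (k x)) s = ennreal (c / (J + 1) * k0 x)"
      using k_pos[of x] s c J k0(2)[of x] by (simp add: epowr_ennreal_pos k_def powr_powr)
    also have "\<dots> = ennreal (c / (J + 1)) * ennreal (k0 x)"
      using c J k0(2)[of x] by (intro ennreal_mult) auto
    finally show "epowr (ennreal (k x)) s * ennreal (w x) = ennreal (c / (J + 1)) * (ennreal (w x) * ennreal (k0 x))"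
      by (simp add: mult_ac)
  qed
  also have "\<dots> = ennreal (c / (J + 1)) * ennreal J"
    by (subst nn_integral_cmult) (auto simp: J)
  also have "\<dots> = ennreal (c / (J + 1) * J)"
    using c J by (intro ennreal_mult[symmetric]) auto
  also have "\<dots> \<le> ennreal c"
    using c J by (intro ennreal_leI) (simp add: field_simps)
  finally have k_le: "(\<integral>\<^sup>+x. epowr (ennreal (k x)) s * ennreal (w x) \<partial>X) \<le> ennreal c" .

  define h' where "h' x = h x + ennreal (k x)" for x
  have h'_meas [measurable]: "h' \<in> borel_measurable X" unfolding h'_def by measurable
  have "(\<integral>\<^sup>+x. epowr (h' x) s * ennreal (w x) \<partial>X) \<le>
      (\<integral>\<^sup>+x. ennreal (2 powr s) * (epowr (h x) s * ennreal (w x) + epowr (ennreal (k x)) s * ennreal (w x)) \<partial>X)"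
  proof (rule nn_integral_mono)
    fix x
    have "epowr (h' x) s * ennreal (w x) \<le> ennreal (2 powr s) * (epowr (h x) s + epowr (ennreal (k x)) s) * ennreal (w x)"
      unfolding h'_def using s by (intro mult_right_mono epowr_add_le) auto
    then show "epowr (h' x) s * ennreal (w x) \<le>
        ennreal (2 powr s) * (epowr (h x) s * ennreal (w x) + epowr (ennreal (k x)) s * ennreal (w x))"
      by (simp add: algebra_simps)
  qed
  also have "\<dots> = ennreal (2 powr s) * ((\<integral>\<^sup>+x. epowr (h x) s * ennreal (w x) \<partial>X) +
      (\<integral>\<^sup>+x. epowr (ennreal (k x)) s * ennreal (w x) \<partial>X))"
    by (simp add: nn_integral_cmult nn_integral_add)
  also have "\<dots> \<le> ennreal (2 powr s) * (ennreal c + ennreal c)"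
    by (intro mult_left_mono add_mono le k_le) auto
  also have "\<dots> = ennreal (2 powr s * (2 * c))"
    using c by (simp flip: ennreal_mult ennreal_plus)
  finally have h'_le: "(\<integral>\<^sup>+x. epowr (h' x) s * ennreal (w x) \<partial>X) \<le> ennreal (2 powr s * (2 * c))" .

  define Q where "Q = muckenhoupt_const s K"
  have Q: "0 < Q" using muckenhoupt_const_pos[OF s K] by (simp add: Q_def)
  \<comment> \<open>\<open>L\<close> bounds the norm of the maximal operator on \<open>L\<^sup>s (w)\<close>.  The factors \<open>(2 L)\<^sup>-\<^sup>j\<close> make the norms of the
    iterates decay geometrically; the further factors \<open>2\<^sup>-\<^sup>j\<close> in \<open>V\<close> control the power of the series.\<close>
  define L where "L = Q powr (1 / s)"
  have L: "0 < L" using Q by (simp add: L_def)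
  define m where "m j = (maxfn ^^ j) h'" for j
  have m_meas [measurable]: "m j \<in> borel_measurable X" for j
    by (cases j) (simp_all add: m_def)
  define f where "f j x = ennreal ((1 / (2 * L)) ^ j) * m j x" for j x
  have f_meas [measurable]: "f j \<in> borel_measurable X" for j unfolding f_def by measurable
  have m_int: "(\<integral>\<^sup>+x. epowr (m j x) s * ennreal (w x) \<partial>X) \<le> ennreal (Q ^ j * (2 powr s * (2 * c)))" for j
  proof (induction j)
    case 0
    then show ?case using h'_le by (simp add: m_def)
  next
    case (Suc j)
    have "(\<integral>\<^sup>+x. epowr (m (Suc j) x) s * ennreal (w x) \<partial>X) \<le> ennreal Q * (\<integral>\<^sup>+x. epowr (m j x) s * ennreal (w x) \<partial>X)"
      unfolding Q_def using maxfn_weighted_bound[OF w s m_meas[of j]] by (simp add: m_def)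
    also have "\<dots> \<le> ennreal Q * ennreal (Q ^ j * (2 powr s * (2 * c)))"
      by (intro mult_left_mono Suc) simp
    also have "\<dots> = ennreal (Q ^ Suc j * (2 powr s * (2 * c)))"
      using Q c by (simp flip: ennreal_mult)
    finally show ?case .
  qed
  have f_int: "(\<integral>\<^sup>+x. epowr (f j x) s * ennreal (w x) \<partial>X) \<le> ennreal ((1/2) ^ j * (2 powr s * (2 * c)))" for j
  proof -
    have "epowr (f j x) s * ennreal (w x) = ennreal (((1 / (2 * L)) ^ j) powr s) * (epowr (m j x) s * ennreal (w x))" for x
      using s L by (simp add: f_def epowr_mult epowr_ennreal mult_ac)
    then have "(\<integral>\<^sup>+x. epowr (f j x) s * ennreal (w x) \<partial>X)
        = ennreal (((1 / (2 * L)) ^ j) powr s) * (\<integral>\<^sup>+x. epowr (m j x) s * ennreal (w x) \<partial>X)"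
      by (simp add: nn_integral_cmult)
    also have "\<dots> \<le> ennreal (((1 / (2 * L)) ^ j) powr s) * ennreal (Q ^ j * (2 powr s * (2 * c)))"
      by (intro mult_left_mono m_int) simp
    also have "\<dots> = ennreal (((1 / (2 * L)) ^ j) powr s * (Q ^ j * (2 powr s * (2 * c))))"
      using Q c by (simp flip: ennreal_mult)
    also have "\<dots> \<le> ennreal ((1/2) ^ j * (2 powr s * (2 * c)))"
    proof (intro ennreal_leI)
      have "((1 / (2 * L)) ^ j) powr s * Q ^ j = ((1 / (2 * L)) powr s * Q) ^ j"
        using L by (simp add: power_mult_distrib powr_powr powr_realpow[symmetric] mult.commute)
      also have "(1 / (2 * L)) powr s * Q = (1/2) powr s"
        using L s Q by (simp add: powr_mult powr_divide L_def powr_powr)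
      also have "((1/2) powr s) ^ j \<le> ((1/2) powr 1) ^ j"
        using s by (intro power_mono powr_mono') auto
      finally have "((1 / (2 * L)) ^ j) powr s * Q ^ j \<le> (1/2) ^ j" by simp
      from mult_right_mono[OF this, of "2 powr s * (2 * c)"]
      show "((1 / (2 * L)) ^ j) powr s * (Q ^ j * (2 powr s * (2 * c))) \<le> (1/2) ^ j * (2 powr s * (2 * c))"
        using c by (simp add: mult.assoc)
    qed
    finally show ?thesis .
  qed
  define V where "V x = (\<Sum>j. ennreal ((1/2) ^ j) * f j x)" for x
  have V_meas [measurable]: "V \<in> borel_measurable X" unfolding V_def by measurable
  have "h' x = ennreal ((1/2) ^ 0) * f 0 x" for x by (simp add: f_def m_def)
  also have "ennreal ((1/2) ^ 0) * f 0 x \<le> V x" for x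
    unfolding V_def using sum_le_suminf[of "\<lambda>j. ennreal ((1/2) ^ j) * f j x" "{0}"] by simp
  finally have h'V: "h' x \<le> V x" for x .
  have V_int: "(\<integral>\<^sup>+x. epowr (V x) s * ennreal (w x) \<partial>X) \<le> ennreal (4 powr (s + 1) * c)"
  proof -
    have "(\<integral>\<^sup>+x. epowr (V x) s * ennreal (w x) \<partial>X)
        \<le> (\<integral>\<^sup>+x. ennreal (2 powr s) * (\<Sum>j. epowr (f j x) s * ennreal (w x)) \<partial>X)"
    proof (rule nn_integral_mono)
      fix x
      have "epowr (V x) s * ennreal (w x) \<le> ennreal (2 powr s) * (\<Sum>j. epowr (f j x) s) * ennreal (w x)"
        unfolding V_def using s by (intro mult_right_mono epowr_suminf_geometric_le) auto
      then show "epowr (V x) s * ennreal (w x) \<le> ennreal (2 powr s) * (\<Sum>j. epowr (f j x) s * ennreal (w x))"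
        by (simp add: mult.assoc)
    qed
    also have "\<dots> = ennreal (2 powr s) * (\<Sum>j. \<integral>\<^sup>+x. epowr (f j x) s * ennreal (w x) \<partial>X)"
      by (subst nn_integral_cmult, measurable, subst nn_integral_suminf) auto
    also have "\<dots> \<le> ennreal (2 powr s) * (\<Sum>j. ennreal ((1/2) ^ j * (2 powr s * (2 * c))))"
      by (intro mult_left_mono suminf_le f_int) auto
    also have "(\<Sum>j. ennreal ((1/2) ^ j * (2 powr s * (2 * c)))) = ennreal (\<Sum>j. (1/2) ^ j * (2 powr s * (2 * c)))"
      using c by (intro suminf_ennreal2 summable_mult2 summable_geometric) auto
    also have "(\<Sum>j. (1/2) ^ j * (2 powr s * (2 * c))) = 2 * (2 powr s * (2 * c))"
      by (subst suminf_mult2[symmetric]) (auto simp: suminf_geometric summable_geometric)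
    also have "ennreal (2 powr s) * ennreal (2 * (2 powr s * (2 * c))) = ennreal (2 powr s * (2 * (2 powr s * (2 * c))))"
      using c by (simp flip: ennreal_mult)
    also have "2 powr s * (2 * (2 powr s * (2 * c))) = 4 powr (s + 1) * c"
    proof -
      have "(4::real) powr s = 2 powr s * 2 powr s"
        using powr_mult[of 2 2 s] by simp
      then show ?thesis by (simp add: powr_add)
    qed
    finally show ?thesis .
  qed
  show thesis
  proof (rule that[of V])
    show "V \<in> borel_measurable X" by measurable
    show "h x \<le> V x" for x
      using h'V[of x] unfolding h'_def by (meson le_iff_add order_trans)
    show "0 < V x" for x
    proof -
      have "0 < ennreal (k x)" using k_pos by simp
      also have "\<dots> \<le> h' x" by (simp add: h'_def)
      also note h'V
      finally show ?thesis .
    qed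
    show "(\<integral>\<^sup>+x. epowr (V x) s * ennreal (w x) \<partial>X) \<le> ennreal (4 powr (s + 1) * c)" by fact
    have [simp]: "ennreal (w x) \<noteq> 0" for x using pos[of x] by simp
    have "(\<integral>\<^sup>+x. epowr (V x) s * ennreal (w x) \<partial>X) \<noteq> top"
      using V_int by (auto simp: top_unique)
    then have "AE x in X. epowr (V x) s * ennreal (w x) \<noteq> top"
      by (intro nn_integral_noteq_infinite[unfolded infinity_ennreal_def]) measurable
    then show "AE x in X. V x < top"
      by eventually_elim (use s in \<open>auto simp: ennreal_mult_eq_top_iff less_top[symmetric]\<close>)
    show "maxfn V x \<le> ennreal (A1_const s K) * V x" for x
    proof -
      have "maxfn V x \<le> (\<Sum>j. maxfn (\<lambda>x. ennreal ((1/2) ^ j) * f j x) x)"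
        unfolding V_def by (rule maxfn_suminf_le) measurable
      also have "\<dots> \<le> (\<Sum>j. ennreal (4 * L) * (ennreal ((1/2) ^ Suc j) * f (Suc j) x))"
      proof (intro suminf_le)
        fix j
        have "maxfn (\<lambda>x. ennreal ((1/2) ^ j) * f j x) x
            \<le> ennreal ((1/2) ^ j) * (ennreal ((1 / (2 * L)) ^ j) * maxfn (m j) x)"
          unfolding f_def
          by (rule order_trans[OF maxfn_cmult_le]) (auto intro!: mult_left_mono maxfn_cmult_le)
        also have "maxfn (m j) x = m (Suc j) x" by (simp add: m_def)
        also have "ennreal ((1/2) ^ j) * (ennreal ((1 / (2 * L)) ^ j) * m (Suc j) x) =
            ennreal (4 * L) * (ennreal ((1/2) ^ Suc j) * f (Suc j) x)"
        proof -
          have "(1/2) ^ j * (1 / (2 * L)) ^ j = 4 * L * ((1/2) ^ Suc j * (1 / (2 * L)) ^ Suc j)"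
            using L by simp
          then have "ennreal ((1/2) ^ j * (1 / (2 * L)) ^ j) =
              ennreal (4 * L * ((1/2) ^ Suc j * (1 / (2 * L)) ^ Suc j))"
            by (simp only:)
          also have "\<dots> = ennreal (4 * L) * (ennreal ((1/2) ^ Suc j) * ennreal ((1 / (2 * L)) ^ Suc j))"
            using L by (subst ennreal_mult, simp, simp, subst ennreal_mult) auto
          also have "ennreal ((1/2) ^ j * (1 / (2 * L)) ^ j) = ennreal ((1/2) ^ j) * ennreal ((1 / (2 * L)) ^ j)"
            using L by (intro ennreal_mult) auto
          finally have "ennreal ((1/2) ^ j) * ennreal ((1 / (2 * L)) ^ j) =
              ennreal (4 * L) * (ennreal ((1/2) ^ Suc j) * ennreal ((1 / (2 * L)) ^ Suc j))" .
          then show ?thesis by (simp only: f_def mult.assoc[symmetric])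
        qed
        finally show "maxfn (\<lambda>x. ennreal ((1/2) ^ j) * f j x) x \<le>
            ennreal (4 * L) * (ennreal ((1/2) ^ Suc j) * f (Suc j) x)" .
      qed auto
      also have "\<dots> = ennreal (4 * L) * (\<Sum>j. ennreal ((1/2) ^ Suc j) * f (Suc j) x)"
        by (rule ennreal_suminf_cmult)
      also have "(\<Sum>j. ennreal ((1/2) ^ Suc j) * f (Suc j) x) \<le> V x"
        unfolding V_def
        using suminf_offset[of "\<lambda>j. ennreal ((1/2) ^ j) * f j x" 1] by simp
      finally show ?thesis
        by (simp add: A1_const_def L_def Q_def mult_left_mono)
    qed
  qed
qed

lemma muckenhoupt_weight_dual:
  assumes w: "muckenhoupt_weight s K w" and s: "1 < s"
  shows "muckenhoupt_weight (s / (s - 1)) (K powr (1 / (s - 1))) (\<lambda>x. w x powr (- 1 / (s - 1)))"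
  unfolding muckenhoupt_weight_def
proof (intro conjI allI ballI)
  have [measurable]: "w \<in> borel_measurable X" and pos: "\<And>x. 0 < w x" and K: "0 < K"
    using w by (auto simp: muckenhoupt_weight_def)
  have [simp]: "w x \<noteq> 0" for x using pos[of x] by simp
  have e: "s / (s - 1) - 1 = 1 / (s - 1)" using s by (simp add: field_simps)
  show "0 < K powr (1 / (s - 1))" using K by simp
  show "(\<lambda>x. w x powr (- 1 / (s - 1))) \<in> borel_measurable X" by measurable
  show "0 < w x powr (- 1 / (s - 1))" for x by simp
  fix i assume i: "i \<in> I"
  let ?W = "\<integral>\<^sup>+y\<in>B i. ennreal (w y) \<partial>X"
  let ?S = "\<integral>\<^sup>+y\<in>B i. ennreal (w y powr (- 1 / (s - 1))) \<partial>X"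
  have "- 1 / t * (- 1 / (1 / t)) = 1" if "t \<noteq> 0" for t :: real
    using that by simp
  from this[of "s - 1"] have "- 1 / (s - 1) * (- 1 / (s / (s - 1) - 1)) = 1"
    unfolding e using s by simp
  then have eq: "(w y powr (- 1 / (s - 1))) powr (- 1 / (s / (s - 1) - 1)) = w y" for y
    using pos[of y] by (simp only: powr_powr) simp
  have "?S * epowr ?W (s / (s - 1) - 1) = epowr (?W * epowr ?S (s - 1)) (1 / (s - 1))"
    unfolding e using s by (simp add: epowr_mult mult.commute)
  also have "\<dots> \<le> epowr (ennreal K * epowr (emeasure X (B i)) s) (1 / (s - 1))"
    using w i s by (intro epowr_mono) (auto simp: muckenhoupt_weight_def)
  also have "\<dots> = ennreal (K powr (1 / (s - 1))) * epowr (emeasure X (B i)) (s / (s - 1))"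
    using s K by (simp add: epowr_mult epowr_epowr epowr_ennreal)
  finally show "?S * epowr (\<integral>\<^sup>+y\<in>B i. ennreal ((w y powr (- 1 / (s - 1))) powr (- 1 / (s / (s - 1) - 1))) \<partial>X)
      (s / (s - 1) - 1) \<le> ennreal (K powr (1 / (s - 1))) * epowr (emeasure X (B i)) (s / (s - 1))"
    unfolding eq .
qed

text \<open>The easy half of the factorisation of Muckenhoupt weights: a function that dominates its
  maximal function is on each ball bounded below by a multiple of its average, which is inserted for
  \<open>V1\<close> in the integral of the weight and for \<open>V2\<close> in the integral of its negative power.  The value \<open>1\<close>
  on the null set where \<open>V1\<close> or \<open>V2\<close> is infinite keeps the weight strictly positive everywhere.\<close>

lemma muckenhoupt_weight_factored:
  assumes [measurable]: "V1 \<in> borel_measurable X" "V2 \<in> borel_measurable X"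
    and pos: "\<And>x. 0 < V1 x" "\<And>x. 0 < V2 x"
    and fin: "AE x in X. V1 x < top" "AE x in X. V2 x < top"
    and A1: "\<And>x. maxfn V1 x \<le> ennreal a1 * V1 x" "0 < a1"
    and A2: "\<And>x. maxfn V2 x \<le> ennreal a2 * V2 x" "0 < a2"
    and u: "1 < u"
  shows "muckenhoupt_weight u (a1 powr (u - 1) * a2)
    (\<lambda>x. if V1 x < top \<and> V2 x < top then enn2real (V1 x) powr (1 - u) * enn2real (V2 x) else 1)"
  unfolding muckenhoupt_weight_def
proof (intro conjI allI ballI)
  define v where "v = (\<lambda>x. if V1 x < top \<and> V2 x < top then enn2real (V1 x) powr (1 - u) * enn2real (V2 x) else 1)"
  show "0 < a1 powr (u - 1) * a2" using A1 A2 by simp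
  have v_meas [measurable]: "v \<in> borel_measurable X" unfolding v_def by measurable
  then show "(\<lambda>x. if V1 x < top \<and> V2 x < top then enn2real (V1 x) powr (1 - u) * enn2real (V2 x) else 1) \<in> borel_measurable X"
    by (simp add: v_def)
  show "0 < (if V1 x < top \<and> V2 x < top then enn2real (V1 x) powr (1 - u) * enn2real (V2 x) else 1)" for x
    using pos[of x] by (cases "V1 x"; cases "V2 x") auto
  fix i assume i: "i \<in> I"
  note [measurable] = B_sets[OF i]
  define n where "n = emeasure X (B i)"
  have n: "0 < n" "n < top" using B_pos[OF i] B_finite[OF i] by (auto simp: n_def)
  have avg: "\<exists>m>0. (\<integral>\<^sup>+y\<in>B i. V y \<partial>X) = ennreal m * n \<and> (\<forall>x\<in>B i. ennreal (m / a) \<le> V x)"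
    if [measurable]: "V \<in> borel_measurable X" and "\<And>x. 0 < V x" "AE x in X. V x < top"
      "\<And>x. maxfn V x \<le> ennreal a * V x" "0 < a" for V a
  proof -
    let ?a = "(\<integral>\<^sup>+y\<in>B i. V y \<partial>X) / n"
    have le: "?a \<le> ennreal a * V x" if "x \<in> B i" for x
      using average_le_maxfn[OF i that, of V] \<open>maxfn V x \<le> _\<close> by (auto simp: n_def)
    have "\<exists>x\<in>B i. V x < top"
    proof (rule ccontr)
      assume "\<not> ?thesis"
      with \<open>AE x in X. V x < top\<close> have "AE x in X. x \<notin> B i" by auto
      then have "emeasure X (B i) = 0"
        by (subst (asm) AE_iff_measurable[OF B_sets[OF i]])
          (use sets.sets_into_space[OF B_sets[OF i]] in auto)
      then show False using B_pos[OF i] by simp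
    qed
    then obtain x where "x \<in> B i" "V x < top" by auto
    with le[of x] have "?a < top"
      by (auto simp: ennreal_mult_less_top intro: le_less_trans)
    moreover have "0 < ?a"
      using ball_integral_pos[OF that(1,2) i] n by (simp add: ennreal_zero_less_divide)
    ultimately obtain m where m: "?a = ennreal m" "0 < m"
      by (cases ?a) auto
    have "(\<integral>\<^sup>+y\<in>B i. V y \<partial>X) = ?a * n"
      using n by (simp add: ennreal_divide_times)
    moreover have "ennreal (m / a) \<le> V x" if "x \<in> B i" for x
      using le[OF that] m \<open>0 < a\<close> unfolding m(1)
      by (cases "V x") (auto simp: field_simps ennreal_le_iff simp flip: ennreal_mult)
    ultimately show ?thesis using m by auto
  qed
  obtain m1 where m1: "0 < m1" "(\<integral>\<^sup>+y\<in>B i. V1 y \<partial>X) = ennreal m1 * n" "\<And>x. x \<in> B i \<Longrightarrow> ennreal (m1 / a1) \<le> V1 x"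
    using avg[of V1 a1] pos fin A1 by auto
  obtain m2 where m2: "0 < m2" "(\<integral>\<^sup>+y\<in>B i. V2 y \<partial>X) = ennreal m2 * n" "\<And>x. x \<in> B i \<Longrightarrow> ennreal (m2 / a2) \<le> V2 x"
    using avg[of V2 a2] pos fin A2 by auto
  have "(\<integral>\<^sup>+y\<in>B i. ennreal (v y) \<partial>X) \<le> (\<integral>\<^sup>+y. ennreal ((m1 / a1) powr (1 - u)) * (V2 y * indicator (B i) y) \<partial>X)"
  proof (rule nn_integral_mono_AE)
    show "AE y in X. ennreal (v y) * indicator (B i) y \<le> ennreal ((m1 / a1) powr (1 - u)) * (V2 y * indicator (B i) y)"
      using fin
    proof eventually_elim
      case (elim y)
      then obtain v1 v2 where v: "V1 y = ennreal v1" "V2 y = ennreal v2" "0 < v1" "0 < v2"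
        using pos[of y] by (cases "V1 y"; cases "V2 y") auto
      show ?case
      proof (cases "y \<in> B i")
        case True
        then have "m1 / a1 \<le> v1" using m1(3)[of y] v by (simp add: ennreal_le_iff)
        then have "v1 powr (1 - u) \<le> (m1 / a1) powr (1 - u)"
          using u m1 A1 by (intro powr_mono2') auto
        then have "v y \<le> (m1 / a1) powr (1 - u) * v2"
          using v by (simp add: v_def mult_right_mono)
        then show ?thesis
          using True v by (simp add: ennreal_leI flip: ennreal_mult)
      qed simp
    qed
  qed
  also have "\<dots> = ennreal ((m1 / a1) powr (1 - u)) * (ennreal m2 * n)"
    by (simp add: nn_integral_cmult m2)
  finally have I1: "(\<integral>\<^sup>+y\<in>B i. ennreal (v y) \<partial>X) \<le> ennreal ((m1 / a1) powr (1 - u) * m2) * n"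
    using m2 by (simp add: ennreal_mult mult.assoc)
  let ?e = "- 1 / (u - 1)"
  have "(\<integral>\<^sup>+y\<in>B i. ennreal (v y powr ?e) \<partial>X) \<le> (\<integral>\<^sup>+y. ennreal ((m2 / a2) powr ?e) * (V1 y * indicator (B i) y) \<partial>X)"
  proof (rule nn_integral_mono_AE)
    show "AE y in X. ennreal (v y powr ?e) * indicator (B i) y \<le> ennreal ((m2 / a2) powr ?e) * (V1 y * indicator (B i) y)"
      using fin
    proof eventually_elim
      case (elim y)
      then obtain v1 v2 where v: "V1 y = ennreal v1" "V2 y = ennreal v2" "0 < v1" "0 < v2"
        using pos[of y] by (cases "V1 y"; cases "V2 y") auto
      show ?case
      proof (cases "y \<in> B i")
        case True
        have "m2 / a2 \<le> v2" using True m2(3)[of y] v by (simp add: ennreal_le_iff)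
        then have *: "v2 powr ?e \<le> (m2 / a2) powr ?e"
          using u m2 A2 by (intro powr_mono2') auto
        have "(1 - u) * ?e = 1" using u by (simp add: field_simps)
        then have "v y powr ?e = v2 powr ?e * v1"
          using v by (simp add: v_def powr_mult powr_powr)
        also have "\<dots> \<le> (m2 / a2) powr ?e * v1"
          using * v by (intro mult_right_mono) auto
        finally show ?thesis
          using True v by (simp add: ennreal_leI flip: ennreal_mult)
      qed simp
    qed
  qed
  also have "\<dots> = ennreal ((m2 / a2) powr ?e) * (ennreal m1 * n)"
    by (simp add: nn_integral_cmult m1)
  finally have "(\<integral>\<^sup>+y\<in>B i. ennreal (v y powr ?e) \<partial>X) \<le> ennreal ((m2 / a2) powr ?e * m1) * n"
    using m1 by (simp add: ennreal_mult mult.assoc)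
  then have "epowr (\<integral>\<^sup>+y\<in>B i. ennreal (v y powr ?e) \<partial>X) (u - 1) \<le> epowr (ennreal ((m2 / a2) powr ?e * m1) * n) (u - 1)"
    using u by (intro epowr_mono) auto
  also have "\<dots> = ennreal ((m2 / a2) powr (- 1) * m1 powr (u - 1)) * epowr n (u - 1)"
    using u m1 m2 by (simp add: epowr_mult epowr_ennreal powr_mult powr_powr)
  finally have "(\<integral>\<^sup>+y\<in>B i. ennreal (v y) \<partial>X) * epowr (\<integral>\<^sup>+y\<in>B i. ennreal (v y powr ?e) \<partial>X) (u - 1) \<le>
    (ennreal ((m1 / a1) powr (1 - u) * m2) * n) * (ennreal ((m2 / a2) powr (- 1) * m1 powr (u - 1)) * epowr n (u - 1))"
    by (intro mult_mono I1) auto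
  also have "\<dots> = (ennreal ((m1 / a1) powr (1 - u) * m2) * ennreal ((m2 / a2) powr (- 1) * m1 powr (u - 1))) * (n * epowr n (u - 1))"
    by (simp add: mult_ac)
  also have "n * epowr n (u - 1) = epowr n u"
    using epowr_add[of 1 "u - 1" n] u by simp
  also have "ennreal ((m1 / a1) powr (1 - u) * m2) * ennreal ((m2 / a2) powr (- 1) * m1 powr (u - 1)) = ennreal (a1 powr (u - 1) * a2)"
  proof -
    have "(m1 / a1) powr (1 - u) * m1 powr (u - 1) = a1 powr (u - 1)"
      using m1 A1 by (simp add: powr_divide powr_diff)
    moreover have "m2 * (m2 / a2) powr (- 1) = a2"
      using m2 A2 by (simp add: powr_minus)
    ultimately have "(m1 / a1) powr (1 - u) * m2 * ((m2 / a2) powr (- 1) * m1 powr (u - 1)) = a1 powr (u - 1) * a2"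
      by (metis (no_types, opaque_lifting) mult.assoc mult.commute)
    then show ?thesis using m1 m2 by (simp flip: ennreal_mult)
  qed
  finally show "(\<integral>\<^sup>+y\<in>B i. ennreal (if V1 y < top \<and> V2 y < top then enn2real (V1 y) powr (1 - u) * enn2real (V2 y) else 1) \<partial>X) *
      epowr (\<integral>\<^sup>+y\<in>B i. ennreal ((if V1 y < top \<and> V2 y < top then enn2real (V1 y) powr (1 - u) * enn2real (V2 y) else 1) powr ?e) \<partial>X) (u - 1)
      \<le> ennreal (a1 powr (u - 1) * a2) * epowr (emeasure X (B i)) u"
    by (simp add: v_def n_def)
qed

definition extrapolation_weight_const :: "real \<Rightarrow> real \<Rightarrow> real \<Rightarrow> real" where
  "extrapolation_weight_const u s K =
     A1_const s K powr (u - 1) * A1_const (s / (s - 1)) (K powr (1 / (s - 1)))"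

definition extrapolation_const :: "real \<Rightarrow> real \<Rightarrow> real \<Rightarrow> real" where
  "extrapolation_const u s C = (C powr (1 / u) * (4 powr (s + 1)) powr (1 / s) *
     (4 powr (s / (s - 1) + 1)) powr (1 - 1 / s)) powr s"

text \<open>Rubio de Francia extrapolation.  Let \<open>V1\<close> majorise \<open>G\<close> for the weight \<open>w\<close>, and let \<open>V2\<close> majorise
  \<open>H = A powr (s - 1) * w\<close> for the dual weight.  Then \<open>\<integral>A powr s * w = \<integral>A * H \<le> \<integral>A * V2\<close>, and
  Hoelder's inequality splits \<open>A * V2\<close> into the left-hand side of the \<open>L\<^sup>u\<close> bound with the weight
  \<open>V1 powr (1 - u) * V2\<close> and a power of \<open>V1 * V2\<close>.  The integral of \<open>V1 * V2\<close> is again controlled by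
  Hoelder's inequality; the power of \<open>\<integral>A powr s * w\<close> that it contains is finite and cancels.\<close>

lemma extrapolation_finite:
  assumes w: "muckenhoupt_weight s K w" and s: "1 < s" and u: "1 < u" and C: "0 < C"
    and [measurable]: "A \<in> borel_measurable X" "G \<in> borel_measurable X"
    and bound: "\<And>v. muckenhoupt_weight u (extrapolation_weight_const u s K) v \<Longrightarrow>
      (\<integral>\<^sup>+x. epowr (A x) u * ennreal (v x) \<partial>X) \<le> ennreal C * (\<integral>\<^sup>+x. epowr (G x) u * ennreal (v x) \<partial>X)"
    and A_fin: "(\<integral>\<^sup>+x. epowr (A x) s * ennreal (w x) \<partial>X) < top"
    and c: "0 < c" "(\<integral>\<^sup>+x. epowr (G x) s * ennreal (w x) \<partial>X) \<le> ennreal c"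
  shows "(\<integral>\<^sup>+x. epowr (A x) s * ennreal (w x) \<partial>X) \<le> ennreal (extrapolation_const u s C * c)"
proof (cases "(\<integral>\<^sup>+x. epowr (A x) s * ennreal (w x) \<partial>X) = 0")
  case False
  then obtain IA where IA: "(\<integral>\<^sup>+x. epowr (A x) s * ennreal (w x) \<partial>X) = ennreal IA" "0 < IA"
    using A_fin by (cases "\<integral>\<^sup>+x. epowr (A x) s * ennreal (w x) \<partial>X") auto
  have [measurable]: "w \<in> borel_measurable X" and pos: "\<And>x. 0 < w x" and K: "0 < K"
    using w by (auto simp: muckenhoupt_weight_def)
  let ?s' = "s / (s - 1)" and ?K' = "K powr (1 / (s - 1))"
  have s': "1 < ?s'" using s by (simp add: field_simps)
  define \<sigma> where "\<sigma> x = w x powr (- 1 / (s - 1))" for x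
  have [measurable]: "\<sigma> \<in> borel_measurable X" unfolding \<sigma>_def by measurable
  have \<sigma>_pos: "0 < \<sigma> x" for x using pos[of x] by (simp add: \<sigma>_def)
  have dual: "muckenhoupt_weight ?s' ?K' \<sigma>"
    unfolding \<sigma>_def by (rule muckenhoupt_weight_dual[OF w s])
  obtain V1 where V1 [measurable]: "V1 \<in> borel_measurable X" and V1_ge: "\<And>x. G x \<le> V1 x" and V1_pos: "\<And>x. 0 < V1 x"
    and V1_max: "\<And>x. maxfn V1 x \<le> ennreal (A1_const s K) * V1 x"
    and V1_int: "(\<integral>\<^sup>+x. epowr (V1 x) s * ennreal (w x) \<partial>X) \<le> ennreal (4 powr (s + 1) * c)"
    and V1_fin: "AE x in X. V1 x < top"
    using rubio_de_francia_majorant[where h = G, OF w s _ c] by auto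
  define H where "H x = epowr (A x) (s - 1) * ennreal (w x)" for x
  have [measurable]: "H \<in> borel_measurable X" unfolding H_def by measurable
  have "(\<integral>\<^sup>+x. epowr (H x) ?s' * ennreal (\<sigma> x) \<partial>X) = (\<integral>\<^sup>+x. epowr (A x) s * ennreal (w x) \<partial>X)"
  proof (rule nn_integral_cong)
    fix x
    have "?s' + - 1 / (s - 1) = (s - 1) / (s - 1)" by (simp only: diff_divide_distrib)
    then have "?s' + - 1 / (s - 1) = 1" using s by simp
    then have "w x powr ?s' * \<sigma> x = w x"
      using pos[of x] unfolding \<sigma>_def by (simp only: powr_add[symmetric]) simp
    then have eq: "ennreal (w x powr ?s') * ennreal (\<sigma> x) = ennreal (w x)"
      using pos[of x] by (simp flip: ennreal_mult')
    have "(s - 1) * ?s' = s" using s by simp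
    then have "epowr (H x) ?s' = epowr (A x) s * ennreal (w x powr ?s')"
      using s s' pos[of x] unfolding H_def
      by (simp only: epowr_mult epowr_epowr) (simp add: epowr_ennreal_pos)
    then show "epowr (H x) ?s' * ennreal (\<sigma> x) = epowr (A x) s * ennreal (w x)"
      by (simp only: mult.assoc eq)
  qed
  with IA have H_int: "(\<integral>\<^sup>+x. epowr (H x) ?s' * ennreal (\<sigma> x) \<partial>X) \<le> ennreal IA" by simp
  obtain V2 where V2 [measurable]: "V2 \<in> borel_measurable X" and V2_ge: "\<And>x. H x \<le> V2 x" and V2_pos: "\<And>x. 0 < V2 x"
    and V2_max: "\<And>x. maxfn V2 x \<le> ennreal (A1_const ?s' ?K') * V2 x"
    and V2_int: "(\<integral>\<^sup>+x. epowr (V2 x) ?s' * ennreal (\<sigma> x) \<partial>X) \<le> ennreal (4 powr (?s' + 1) * IA)"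
    and V2_fin: "AE x in X. V2 x < top"
    using rubio_de_francia_majorant[OF dual s' _ IA(2) H_int] by auto
  define v where "v = (\<lambda>x. if V1 x < top \<and> V2 x < top then enn2real (V1 x) powr (1 - u) * enn2real (V2 x) else 1)"
  have [measurable]: "v \<in> borel_measurable X" unfolding v_def by measurable
  have "muckenhoupt_weight u (extrapolation_weight_const u s K) v"
    unfolding v_def extrapolation_weight_const_def using K s s'
    by (intro muckenhoupt_weight_factored V1_pos V2_pos V1_fin V2_fin V1_max V2_max A1_const_pos u) auto
  note v_bound = bound[OF this]
  define J where "J = (4 powr (s + 1) * c) powr (1 / s) * (4 powr (?s' + 1) * IA) powr (1 - 1 / s)"
  have J: "0 \<le> J" by (simp add: J_def)
  have V12: "(\<integral>\<^sup>+x. V1 x * V2 x \<partial>X) \<le> ennreal J"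
  proof -
    have "V1 x * V2 x = epowr (epowr (V1 x) s * ennreal (w x)) (1 / s) * epowr (epowr (V2 x) ?s' * ennreal (\<sigma> x)) (1 - 1 / s)" for x
    proof -
      have e: "?s' * (1 - 1 / s) = 1" "0 < 1 - 1 / s" using s by (auto simp: field_simps)
      have "1 / s + - 1 / (s - 1) * (1 - 1 / s) = 0" using s by (simp add: field_simps)
      then have "w x powr (1 / s) * \<sigma> x powr (1 - 1 / s) = 1"
        using pos[of x] unfolding \<sigma>_def powr_powr by (simp only: powr_add[symmetric]) simp
      then have eq: "ennreal (w x powr (1 / s)) * ennreal (\<sigma> x powr (1 - 1 / s)) = 1"
        by (simp flip: ennreal_mult)
      have "epowr (epowr (V1 x) s * ennreal (w x)) (1 / s) * epowr (epowr (V2 x) ?s' * ennreal (\<sigma> x)) (1 - 1 / s)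
        = V1 x * V2 x * (ennreal (w x powr (1 / s)) * ennreal (\<sigma> x powr (1 - 1 / s)))"
        using s s' e pos[of x] \<sigma>_pos[of x] by (simp add: epowr_mult epowr_epowr epowr_ennreal_pos mult_ac)
      then show ?thesis by (simp add: eq)
    qed
    then have "(\<integral>\<^sup>+x. V1 x * V2 x \<partial>X) = (\<integral>\<^sup>+x. epowr (epowr (V1 x) s * ennreal (w x)) (1 / s) *
        epowr (epowr (V2 x) ?s' * ennreal (\<sigma> x)) (1 - 1 / s) \<partial>X)" by simp
    also have "\<dots> \<le> epowr (\<integral>\<^sup>+x. epowr (V1 x) s * ennreal (w x) \<partial>X) (1 / s) *
        epowr (\<integral>\<^sup>+x. epowr (V2 x) ?s' * ennreal (\<sigma> x) \<partial>X) (1 - 1 / s)"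
      using s by (intro nn_integral_Hoelder) auto
    also have "\<dots> \<le> epowr (ennreal (4 powr (s + 1) * c)) (1 / s) * epowr (ennreal (4 powr (?s' + 1) * IA)) (1 - 1 / s)"
      using s by (intro mult_mono epowr_mono V1_int V2_int) auto
    also have "\<dots> = ennreal J"
    proof -
      have "epowr (ennreal (4 powr (s + 1) * c)) (1 / s) = ennreal ((4 powr (s + 1) * c) powr (1 / s))"
        using s c by (intro epowr_ennreal) auto
      moreover have "epowr (ennreal (4 powr (?s' + 1) * IA)) (1 - 1 / s) = ennreal ((4 powr (?s' + 1) * IA) powr (1 - 1 / s))"
        using s IA by (intro epowr_ennreal) auto
      ultimately show ?thesis
        by (simp only: J_def ennreal_mult'')  (simp only: ennreal_mult' powr_ge_zero)
    qed
    finally show ?thesis .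
  qed
  have Gv: "(\<integral>\<^sup>+x. epowr (G x) u * ennreal (v x) \<partial>X) \<le> ennreal J"
  proof -
    have "(\<integral>\<^sup>+x. epowr (G x) u * ennreal (v x) \<partial>X) \<le> (\<integral>\<^sup>+x. V1 x * V2 x \<partial>X)"
    proof (rule nn_integral_mono_AE)
      show "AE x in X. epowr (G x) u * ennreal (v x) \<le> V1 x * V2 x"
        using V1_fin V2_fin
      proof eventually_elim
        case (elim x)
        then obtain v1 v2 where v: "V1 x = ennreal v1" "V2 x = ennreal v2" "0 < v1" "0 < v2"
          using V1_pos[of x] V2_pos[of x] by (cases "V1 x"; cases "V2 x") auto
        have "epowr (G x) u * ennreal (v x) \<le> epowr (V1 x) u * ennreal (v x)"
          using u by (intro mult_right_mono epowr_mono V1_ge) auto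
        also have "\<dots> = ennreal (v1 powr u * (v1 powr (1 - u) * v2))"
          using v by (simp add: v_def epowr_ennreal_pos flip: ennreal_mult)
        also have "v1 powr u * (v1 powr (1 - u) * v2) = v1 * v2"
          using v by (simp add: powr_diff)
        finally show ?case using v by (simp add: ennreal_mult)
      qed
    qed
    with V12 show ?thesis by simp
  qed
  have "ennreal IA = (\<integral>\<^sup>+x. A x * H x \<partial>X)"
    unfolding IA(1)[symmetric] H_def using epowr_add[of 1 "s - 1"] s
    by (intro nn_integral_cong) (simp add: mult.assoc)
  also have "\<dots> \<le> (\<integral>\<^sup>+x. A x * V2 x \<partial>X)"
    by (intro nn_integral_mono mult_left_mono V2_ge) auto
  also have "\<dots> = (\<integral>\<^sup>+x. epowr (epowr (A x) u * ennreal (v x)) (1 / u) * epowr (V1 x * V2 x) (1 - 1 / u) \<partial>X)"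
  proof (rule nn_integral_cong_AE)
    show "AE x in X. A x * V2 x = epowr (epowr (A x) u * ennreal (v x)) (1 / u) * epowr (V1 x * V2 x) (1 - 1 / u)"
      using V1_fin V2_fin
    proof eventually_elim
      case (elim x)
      then obtain v1 v2 where v: "V1 x = ennreal v1" "V2 x = ennreal v2" "0 < v1" "0 < v2"
        using V1_pos[of x] V2_pos[of x] by (cases "V1 x"; cases "V2 x") auto
      have "epowr (epowr (A x) u * ennreal (v x)) (1 / u) * epowr (V1 x * V2 x) (1 - 1 / u)
        = A x * (ennreal ((v1 powr (1 - u) * v2) powr (1 / u)) * ennreal ((v1 * v2) powr (1 - 1 / u)))"
        using u v by (simp add: epowr_mult v_def epowr_ennreal_pos mult.assoc flip: ennreal_mult)
      also have "ennreal ((v1 powr (1 - u) * v2) powr (1 / u)) * ennreal ((v1 * v2) powr (1 - 1 / u)) = ennreal v2"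
      proof -
        have "(v1 powr (1 - u) * v2) powr (1 / u) * (v1 * v2) powr (1 - 1 / u)
          = (v1 powr ((1 - u) * (1 / u)) * v1 powr (1 - 1 / u)) * (v2 powr (1 / u) * v2 powr (1 - 1 / u))"
          using v by (simp add: powr_mult powr_powr)
        also have "\<dots> = v1 powr ((1 - u) * (1 / u) + (1 - 1 / u)) * v2 powr (1 / u + (1 - 1 / u))"
          by (simp only: powr_add)
        also have "(1 - u) * (1 / u) + (1 - 1 / u) = 0" using u by (simp add: field_simps)
        finally show ?thesis using v by (simp flip: ennreal_mult)
      qed
      finally show ?case using v by simp
    qed
  qed
  also have "\<dots> \<le> epowr (\<integral>\<^sup>+x. epowr (A x) u * ennreal (v x) \<partial>X) (1 / u) * epowr (\<integral>\<^sup>+x. V1 x * V2 x \<partial>X) (1 - 1 / u)"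
    using u by (intro nn_integral_Hoelder) auto
  also have "\<dots> \<le> epowr (ennreal C * ennreal J) (1 / u) * epowr (ennreal J) (1 - 1 / u)"
    using u by (intro mult_mono epowr_mono V12 order_trans[OF v_bound] mult_left_mono Gv) auto
  also have "\<dots> = ennreal (C powr (1 / u) * (J powr (1 / u) * J powr (1 - 1 / u)))"
    using u C J by (simp add: epowr_mult epowr_ennreal mult.assoc powr_mult flip: ennreal_mult)
  also have "J powr (1 / u) * J powr (1 - 1 / u) = J"
    using J by (simp only: powr_add[symmetric]) simp
  finally have "IA \<le> C powr (1 / u) * J"
    using J by (simp add: ennreal_le_iff)
  also have "\<dots> = (C powr (1 / u) * (4 powr (s + 1)) powr (1 / s) * (4 powr (?s' + 1)) powr (1 - 1 / s)) *
      c powr (1 / s) * IA powr (1 - 1 / s)"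
    using c IA by (simp add: J_def powr_mult mult_ac)
  also have "\<dots> = (extrapolation_const u s C * c) powr (1 / s) * IA powr (1 - 1 / s)"
    using s c C by (simp add: extrapolation_const_def powr_mult powr_powr)
  finally have "IA powr (1 / s) * IA powr (1 - 1 / s) \<le> (extrapolation_const u s C * c) powr (1 / s) * IA powr (1 - 1 / s)"
    using IA by (simp only: powr_add[symmetric]) simp
  then have "IA powr (1 / s) \<le> (extrapolation_const u s C * c) powr (1 / s)"
    using IA by (simp add: mult_le_cancel_right)
  then have "(IA powr (1 / s)) powr s \<le> ((extrapolation_const u s C * c) powr (1 / s)) powr s"
    using s by (rule_tac powr_mono2) auto
  then have "IA \<le> extrapolation_const u s C * c"
    using s IA c C by (simp add: powr_powr extrapolation_const_def)
  then show ?thesis unfolding IA(1) by (rule ennreal_leI)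
qed simp

text \<open>The finiteness assumption is removed by truncating \<open>A\<close> in height and to finitely many balls, which
  only decreases the left-hand side of the \<open>L\<^sup>u\<close> bound.\<close>

theorem extrapolation:
  assumes w: "muckenhoupt_weight s K w" and s: "1 < s" and u: "1 < u" and C: "0 < C"
    and A [measurable]: "A \<in> borel_measurable X" and G [measurable]: "G \<in> borel_measurable X"
    and bound: "\<And>v. muckenhoupt_weight u (extrapolation_weight_const u s K) v \<Longrightarrow>
      (\<integral>\<^sup>+x. epowr (A x) u * ennreal (v x) \<partial>X) \<le> ennreal C * (\<integral>\<^sup>+x. epowr (G x) u * ennreal (v x) \<partial>X)"
  shows "(\<integral>\<^sup>+x. epowr (A x) s * ennreal (w x) \<partial>X)
    \<le> ennreal (extrapolation_const u s C) * (\<integral>\<^sup>+x. epowr (G x) s * ennreal (w x) \<partial>X)"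
proof (cases "I = {}")
  case True
  then have "space X = {}" using B_cover by simp
  then have "(\<integral>\<^sup>+x. epowr (A x) s * ennreal (w x) \<partial>X) = 0"
    by (simp add: nn_integral_empty)
  then show ?thesis by simp
next
  case False
  have [measurable]: "w \<in> borel_measurable X" and pos: "\<And>x. 0 < w x"
    using w by (auto simp: muckenhoupt_weight_def)
  define e where "e = from_nat_into I"
  have e: "range e = I"
    unfolding e_def using False countable_I by (rule range_from_nat_into)
  define U where "U n = (\<Union>k\<le>n. B (e k))" for n :: nat
  have U_sets [measurable]: "U n \<in> sets X" for n
    unfolding U_def using e by (intro sets.finite_UN) (auto intro!: B_sets)
  have U_mono: "U m \<subseteq> U n" if "m \<le> n" for m n
    unfolding U_def using that by (intro UN_mono) auto
  have U_fin: "(\<integral>\<^sup>+x\<in>U n. ennreal (w x) \<partial>X) < top" for n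
  proof -
    have "(\<integral>\<^sup>+x\<in>U n. ennreal (w x) \<partial>X) \<le> (\<integral>\<^sup>+x. (\<Sum>k\<le>n. ennreal (w x) * indicator (B (e k)) x) \<partial>X)"
    proof (rule nn_integral_mono)
      fix x
      show "ennreal (w x) * indicator (U n) x \<le> (\<Sum>k\<le>n. ennreal (w x) * indicator (B (e k)) x)"
      proof (cases "x \<in> U n")
        case True
        then obtain k where k: "k \<le> n" "x \<in> B (e k)" by (auto simp: U_def)
        then show ?thesis
          using member_le_sum[of k "{..n}" "\<lambda>k. ennreal (w x) * indicator (B (e k)) x"] True by auto
      qed simp
    qed
    also have "\<dots> = (\<Sum>k\<le>n. \<integral>\<^sup>+x\<in>B (e k). ennreal (w x) \<partial>X)"
      using e by (intro nn_integral_sum) (auto intro!: borel_measurable_times_ennreal borel_measurable_indicator B_sets)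
    also have "\<dots> < top"
      using e muckenhoupt_weightD(2)[OF w s] by auto
    finally show ?thesis .
  qed
  define An where "An n x = min (A x) (of_nat n) * indicator (U n) x" for n x
  have An_meas [measurable]: "An n \<in> borel_measurable X" for n
    unfolding An_def by measurable
  have An_le: "An n x \<le> A x" for n x
    by (auto simp: An_def indicator_def)
  have An_incseq: "incseq (\<lambda>n. An n x)" for x
    unfolding incseq_def An_def
  proof (intro allI impI mult_mono)
    fix m n :: nat assume "m \<le> n"
    then show "min (A x) (of_nat m) \<le> min (A x) (of_nat n :: ennreal)"
      by (intro min.mono) (auto simp: of_nat_mono)
    show "indicator (U m) x \<le> (indicator (U n) x :: ennreal)"
      using U_mono[OF \<open>m \<le> n\<close>] by (auto simp: indicator_def)
  qed auto
  have An_SUP: "(SUP n. An n x) = A x" if x: "x \<in> space X" for x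
  proof (rule antisym)
    show "(SUP n. An n x) \<le> A x" by (intro SUP_least An_le)
    obtain i where "i \<in> I" "x \<in> B i" using B_cover x by auto
    then obtain k where k: "x \<in> B (e k)" using e by (metis image_iff)
    have min_le: "min (A x) (of_nat n) \<le> (SUP n. An n x)" for n
    proof -
      have "x \<in> U (max k n)" using k by (auto simp: U_def)
      then have "An (max k n) x = min (A x) (of_nat (max k n))" by (simp add: An_def)
      moreover have "min (A x) (of_nat n) \<le> min (A x) (of_nat (max k n))"
        by (intro min.mono) (auto intro!: of_nat_mono)
      ultimately show ?thesis
        by (metis SUP_upper2 UNIV_I)
    qed
    show "A x \<le> (SUP n. An n x)"
    proof (cases "A x = top")
      case True
      have "(SUP n. of_nat n :: ennreal) \<le> (SUP n. An n x)"
        using min_le True by (intro SUP_least) (simp add: min_def top_unique)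
      then show ?thesis by (simp only: ennreal_SUP_of_nat_eq_top True)
    next
      case False
      then obtain n where "A x \<le> of_nat n"
        by (meson ennreal_Ex_less_of_nat less_imp_le less_top)
      then have "min (A x) (of_nat n) = A x" by (rule min_absorb1)
      with min_le[of n] show ?thesis by (simp only:)
    qed
  qed
  have main: "(\<integral>\<^sup>+x. epowr (An n x) s * ennreal (w x) \<partial>X) \<le> ennreal (extrapolation_const u s C * c)"
    if c: "0 < c" "(\<integral>\<^sup>+x. epowr (G x) s * ennreal (w x) \<partial>X) \<le> ennreal c" for n c
  proof (rule extrapolation_finite[OF w s u C An_meas G _ _ c])
    fix v assume "muckenhoupt_weight u (extrapolation_weight_const u s K) v"
    note v = bound[OF this]
    have "(\<integral>\<^sup>+x. epowr (An n x) u * ennreal (v x) \<partial>X) \<le> (\<integral>\<^sup>+x. epowr (A x) u * ennreal (v x) \<partial>X)"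
      using u by (intro nn_integral_mono mult_right_mono epowr_mono An_le) auto
    also note v
    finally show "(\<integral>\<^sup>+x. epowr (An n x) u * ennreal (v x) \<partial>X) \<le> ennreal C * (\<integral>\<^sup>+x. epowr (G x) u * ennreal (v x) \<partial>X)" .
  next
    have "(\<integral>\<^sup>+x. epowr (An n x) s * ennreal (w x) \<partial>X)
        \<le> (\<integral>\<^sup>+x. epowr (of_nat n) s * (ennreal (w x) * indicator (U n) x) \<partial>X)"
    proof (rule nn_integral_mono)
      fix x
      have "epowr (An n x) s \<le> epowr (of_nat n * indicator (U n) x) s"
        using s unfolding An_def by (intro epowr_mono mult_right_mono) auto
      also have "\<dots> = epowr (of_nat n) s * indicator (U n) x"
        using s by (auto simp: indicator_def)
      finally have "epowr (An n x) s * ennreal (w x) \<le> epowr (of_nat n) s * indicator (U n) x * ennreal (w x)"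
        by (rule mult_right_mono) simp
      then show "epowr (An n x) s * ennreal (w x) \<le> epowr (of_nat n) s * (ennreal (w x) * indicator (U n) x)"
        by (simp add: mult_ac)
    qed
    also have "\<dots> = epowr (of_nat n) s * (\<integral>\<^sup>+x\<in>U n. ennreal (w x) \<partial>X)"
      by (rule nn_integral_cmult) measurable
    also have "\<dots> < top"
      using U_fin[of n] s by (simp add: ennreal_mult_less_top of_nat_less_top)
    finally show "(\<integral>\<^sup>+x. epowr (An n x) s * ennreal (w x) \<partial>X) < top" .
  qed
  have mono: "(\<integral>\<^sup>+x. epowr (A x) s * ennreal (w x) \<partial>X) = (SUP n. \<integral>\<^sup>+x. epowr (An n x) s * ennreal (w x) \<partial>X)"
  proof -
    have "(\<integral>\<^sup>+x. epowr (A x) s * ennreal (w x) \<partial>X) = (\<integral>\<^sup>+x. (SUP n. epowr (An n x) s * ennreal (w x)) \<partial>X)"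
      using s by (intro nn_integral_cong) (simp add: An_SUP epowr_SUP[symmetric] SUP_mult_right_ennreal[symmetric])
    also have "\<dots> = (SUP n. \<integral>\<^sup>+x. epowr (An n x) s * ennreal (w x) \<partial>X)"
      using s by (intro nn_integral_monotone_convergence_SUP)
        (auto simp: incseq_def le_fun_def intro!: mult_right_mono epowr_mono incseqD[OF An_incseq])
    finally show ?thesis .
  qed
  define E where "E = extrapolation_const u s C"
  have E: "0 < E" using C by (simp add: E_def extrapolation_const_def)
  show ?thesis
  proof (cases "(\<integral>\<^sup>+x. epowr (G x) s * ennreal (w x) \<partial>X)")
    case top
    then show ?thesis using E by (simp add: ennreal_mult_top E_def)
  next
    case (real g)
    have "(\<integral>\<^sup>+x. epowr (A x) s * ennreal (w x) \<partial>X) \<le> ennreal (E * g) + ennreal \<epsilon>" if "0 < \<epsilon>" for \<epsilon>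
    proof -
      have "0 < \<epsilon> / E" using that E by simp
      then have c: "0 < g + \<epsilon> / E" "(\<integral>\<^sup>+x. epowr (G x) s * ennreal (w x) \<partial>X) \<le> ennreal (g + \<epsilon> / E)"
        using real by (auto intro!: ennreal_leI)
      have "(\<integral>\<^sup>+x. epowr (A x) s * ennreal (w x) \<partial>X) \<le> ennreal (E * (g + \<epsilon> / E))"
        unfolding mono E_def by (rule SUP_least, rule main[OF c, unfolded E_def])
      also have "\<dots> = ennreal (E * g) + ennreal \<epsilon>"
        using E real that by (simp add: algebra_simps flip: ennreal_plus)
      finally show ?thesis .
    qed
    then have "(\<integral>\<^sup>+x. epowr (A x) s * ennreal (w x) \<partial>X) \<le> ennreal (E * g)"
      by (rule ennreal_le_epsilon)
    then show ?thesis
      using real E by (simp add: E_def ennreal_mult)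
  qed
qed

text \<open>For \<open>s = u\<close> the vector-valued inequality is the scalar one and Fubini's theorem; extrapolation
  gives all other exponents.\<close>

theorem maxfn_vector_valued:
  assumes w: "muckenhoupt_weight s K w" and s: "1 < s" and u: "1 < u"
    and T: "sigma_finite_measure T"
  shows "\<exists>C>0. \<forall>g. case_prod g \<in> borel_measurable (T \<Otimes>\<^sub>M X) \<longrightarrow>
    (\<integral>\<^sup>+x. epowr (\<integral>\<^sup>+t. epowr (maxfn (g t) x) u \<partial>T) (s / u) * ennreal (w x) \<partial>X)
    \<le> ennreal C * (\<integral>\<^sup>+x. epowr (\<integral>\<^sup>+t. epowr (g t x) u \<partial>T) (s / u) * ennreal (w x) \<partial>X)"
proof -
  interpret T: sigma_finite_measure T by fact
  interpret P: pair_sigma_finite T X ..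
  have [measurable]: "w \<in> borel_measurable X" and pos: "\<And>x. 0 < w x" and K: "0 < K"
    using w by (auto simp: muckenhoupt_weight_def)
  define K' where "K' = extrapolation_weight_const u s K"
  have "1 < s / (s - 1)" using s by (simp add: field_simps)
  then have K': "0 < K'" using K s A1_const_pos[of s K] A1_const_pos[of "s / (s - 1)" "K powr (1 / (s - 1))"]
    by (simp add: K'_def extrapolation_weight_const_def)
  define C0 where "C0 = muckenhoupt_const u K'"
  have C0: "0 < C0" using muckenhoupt_const_pos[OF u K'] by (simp add: C0_def)
  show ?thesis
  proof (intro exI[of _ "extrapolation_const u s C0"] conjI allI impI)
    show "0 < extrapolation_const u s C0" using C0 by (simp add: extrapolation_const_def)
    fix g :: "'b \<Rightarrow> 'a \<Rightarrow> ennreal"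
    assume g [measurable]: "case_prod g \<in> borel_measurable (T \<Otimes>\<^sub>M X)"
    have Mg [measurable]: "(\<lambda>(t, x). maxfn (g t) x) \<in> borel_measurable (T \<Otimes>\<^sub>M X)"
      by (rule measurable_maxfn_param[OF g])
    define A where "A x = epowr (\<integral>\<^sup>+t. epowr (maxfn (g t) x) u \<partial>T) (1 / u)" for x
    define G where "G x = epowr (\<integral>\<^sup>+t. epowr (g t x) u \<partial>T) (1 / u)" for x
    have [measurable]: "A \<in> borel_measurable X" "G \<in> borel_measurable X"
      unfolding A_def G_def by measurable
    have Au: "epowr (A x) u = (\<integral>\<^sup>+t. epowr (maxfn (g t) x) u \<partial>T)"
      and Gu: "epowr (G x) u = (\<integral>\<^sup>+t. epowr (g t x) u \<partial>T)"
      and As: "epowr (A x) s = epowr (\<integral>\<^sup>+t. epowr (maxfn (g t) x) u \<partial>T) (s / u)"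
      and Gs: "epowr (G x) s = epowr (\<integral>\<^sup>+t. epowr (g t x) u \<partial>T) (s / u)" for x
      using u s by (simp_all add: A_def G_def epowr_epowr)
    have "(\<integral>\<^sup>+x. epowr (A x) u * ennreal (v x) \<partial>X) \<le> ennreal C0 * (\<integral>\<^sup>+x. epowr (G x) u * ennreal (v x) \<partial>X)"
      if v: "muckenhoupt_weight u (extrapolation_weight_const u s K) v" for v
    proof -
      have [measurable]: "v \<in> borel_measurable X" using v by (auto simp: muckenhoupt_weight_def)
      have "(\<integral>\<^sup>+x. epowr (A x) u * ennreal (v x) \<partial>X) = (\<integral>\<^sup>+x. (\<integral>\<^sup>+t. epowr (maxfn (g t) x) u * ennreal (v x) \<partial>T) \<partial>X)"
        unfolding Au by (intro nn_integral_cong nn_integral_multc[symmetric]) measurable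
      also have "\<dots> = (\<integral>\<^sup>+t. (\<integral>\<^sup>+x. epowr (maxfn (g t) x) u * ennreal (v x) \<partial>X) \<partial>T)"
        by (intro P.Fubini') measurable
      also have "\<dots> \<le> (\<integral>\<^sup>+t. ennreal C0 * (\<integral>\<^sup>+x. epowr (g t x) u * ennreal (v x) \<partial>X) \<partial>T)"
      proof (rule nn_integral_mono)
        fix t assume t: "t \<in> space T"
        have "g t \<in> borel_measurable X" using measurable_Pair2[OF g t] by simp
        from maxfn_weighted_bound[OF v u this]
        show "(\<integral>\<^sup>+x. epowr (maxfn (g t) x) u * ennreal (v x) \<partial>X) \<le> ennreal C0 * (\<integral>\<^sup>+x. epowr (g t x) u * ennreal (v x) \<partial>X)"
          by (simp add: C0_def K'_def)
      qed
      also have "\<dots> = ennreal C0 * (\<integral>\<^sup>+t. (\<integral>\<^sup>+x. epowr (g t x) u * ennreal (v x) \<partial>X) \<partial>T)"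
        by (rule nn_integral_cmult) measurable
      also have "(\<integral>\<^sup>+t. (\<integral>\<^sup>+x. epowr (g t x) u * ennreal (v x) \<partial>X) \<partial>T) = (\<integral>\<^sup>+x. (\<integral>\<^sup>+t. epowr (g t x) u * ennreal (v x) \<partial>T) \<partial>X)"
        by (intro P.Fubini'[symmetric]) measurable
      also have "\<dots> = (\<integral>\<^sup>+x. epowr (G x) u * ennreal (v x) \<partial>X)"
        unfolding Gu by (intro nn_integral_cong nn_integral_multc) measurable
      finally show ?thesis .
    qed
    from extrapolation[OF w s u C0 _ _ this]
    show "(\<integral>\<^sup>+x. epowr (\<integral>\<^sup>+t. epowr (maxfn (g t) x) u \<partial>T) (s / u) * ennreal (w x) \<partial>X)
      \<le> ennreal (extrapolation_const u s C0) * (\<integral>\<^sup>+x. epowr (\<integral>\<^sup>+t. epowr (g t x) u \<partial>T) (s / u) * ennreal (w x) \<partial>X)"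
      unfolding As Gs by simp
  qed
qed

end

section \<open>Homogeneous groups: invariance and scaling of Lebesgue measure\<close>

lemma smooth_on_continuous: "smooth_on UNIV f \<Longrightarrow> continuous_on UNIV f"
  unfolding smooth_on_def
  by (force intro!: differentiable_imp_continuous_on simp: differentiable_on_def dest: bspec[of _ _ "[]"])

lemma suminf_upper_ennreal: "f k \<le> (\<Sum>k. f k :: ennreal)"
  using sum_le_suminf[of f "{k}"] by simp

lemma nn_integral_lborel_distr:
  assumes "distr lborel lborel T = lborel" "T \<in> borel_measurable borel" "f \<in> borel_measurable borel"
  shows "(\<integral>\<^sup>+x. f (T x) \<partial>lborel) = (\<integral>\<^sup>+x. f x \<partial>lborel)"
  using nn_integral_distr[of T lborel lborel f] assms by simp

lemma integral_lborel_distr: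
  fixes f :: "'a::euclidean_space \<Rightarrow> 'b::{banach, second_countable_topology}"
  assumes "distr lborel lborel T = lborel" "T \<in> borel_measurable borel" "f \<in> borel_measurable borel"
  shows "(\<integral>x. f (T x) \<partial>lborel) = (\<integral>x. f x \<partial>lborel)"
  using integral_distr[of T lborel lborel f] assms by simp

lemma Basis_vec_real: "(Basis :: (real^'n) set) = range (\<lambda>i. axis i 1)"
  by (auto simp: Basis_vec_def)

lemma nn_integral_diagonal:
  fixes c :: "'n::finite \<Rightarrow> real"
  assumes c: "\<And>i. c i \<noteq> 0" and [measurable]: "f \<in> borel_measurable borel"
  shows "(\<integral>\<^sup>+x. f x \<partial>lborel) = ennreal (\<Prod>i\<in>UNIV. \<bar>c i\<bar>) * (\<integral>\<^sup>+x. f (\<chi> i. c i * x $ i) \<partial>lborel)"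
proof -
  define d :: "real^'n \<Rightarrow> real" where "d j = (\<chi> i. c i) \<bullet> j" for j
  have d_axis: "d (axis i 1) = c i" for i by (simp add: d_def inner_axis)
  have T: "0 + (\<Sum>j\<in>Basis. (d j * (x \<bullet> j)) *\<^sub>R j) = (\<chi> i. c i * x $ i)" for x :: "real^'n"
  proof (rule vec_eq_iff[THEN iffD2], rule allI)
    fix k
    have "(\<Sum>j\<in>Basis. (d j * (x \<bullet> j)) *\<^sub>R j) = (\<Sum>i\<in>UNIV. (c i * x $ i) *\<^sub>R axis i 1)"
      unfolding Basis_vec_real
      by (subst sum.reindex) (auto simp: inj_on_def axis_eq_axis d_axis inner_axis)
    also have "\<dots> $ k = (\<Sum>i\<in>UNIV. if k = i then c i * x $ i else 0)"
      unfolding sum_component by (intro sum.cong refl) (simp add: axis_def)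
    finally show "(0 + (\<Sum>j\<in>Basis. (d j * (x \<bullet> j)) *\<^sub>R j)) $ k = (\<chi> i. c i * x $ i) $ k"
      by simp
  qed
  have P: "(\<Prod>j\<in>Basis. \<bar>d j\<bar>) = (\<Prod>i\<in>UNIV. \<bar>c i\<bar>)"
    unfolding Basis_vec_real by (subst prod.reindex) (auto simp: inj_on_def axis_eq_axis d_axis)
  have "d j \<noteq> 0" if "j \<in> Basis" for j using that c unfolding Basis_vec_real by (auto simp: d_axis)
  from lborel_affine_euclidean[of d 0, OF this]
  have L: "(lborel :: (real^'n) measure) = density (distr lborel borel (\<lambda>x. \<chi> i. c i * x $ i)) (\<lambda>_. \<Prod>i\<in>UNIV. \<bar>c i\<bar>)"
    unfolding T P .
  have [measurable]: "(\<lambda>x::real^'n. \<chi> i. c i * x $ i) \<in> borel_measurable borel"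
    by (intro borel_measurable_continuous_onI continuous_intros)
  have "(\<integral>\<^sup>+x. f x \<partial>lborel) = (\<integral>\<^sup>+x. f x \<partial>density (distr lborel borel (\<lambda>x. \<chi> i. c i * x $ i)) (\<lambda>_. ennreal (\<Prod>i\<in>UNIV. \<bar>c i\<bar>)))"
    using L by simp
  also have "\<dots> = ennreal (\<Prod>i\<in>UNIV. \<bar>c i\<bar>) * (\<integral>\<^sup>+x. f (\<chi> i. c i * x $ i) \<partial>lborel)"
    by (subst nn_integral_density; simp add: nn_integral_distr nn_integral_cmult)
  finally show ?thesis .
qed

lemma distr_lborel_uminus: "distr lborel lborel (uminus :: real^'n::finite \<Rightarrow> _) = lborel"
proof (rule measure_eqI)
  fix A :: "(real^'n) set" assume "A \<in> sets (distr lborel lborel uminus)"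
  then have A [measurable]: "A \<in> sets borel" by simp
  have eq: "(\<chi> i. - 1 * x $ i) = - x" for x :: "real^'n" by (simp add: vec_eq_iff)
  have "emeasure (distr lborel lborel uminus) A = (\<integral>\<^sup>+x. indicator A x \<partial>distr lborel lborel uminus)"
    by simp
  also have "\<dots> = (\<integral>\<^sup>+x. indicator A (- x :: real^'n) \<partial>lborel)"
    by (subst nn_integral_distr) auto
  also have "\<dots> = (\<integral>\<^sup>+x. indicator A x \<partial>lborel)"
    using nn_integral_diagonal[of "\<lambda>_. - 1" "indicator A"] unfolding eq by simp
  finally show "emeasure (distr lborel lborel uminus) A = emeasure lborel A" by simp
qed simp

lemma measurable_dilation [measurable]: "dilation a t \<in> borel_measurable borel"
  unfolding dilation_def by (intro borel_measurable_continuous_onI continuous_intros)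

lemma dilation_1 [simp]: "dilation a 1 x = x"
  by (simp add: dilation_def)

lemma dilation_dilation: "0 < s \<Longrightarrow> 0 < t \<Longrightarrow> dilation a s (dilation a t x) = dilation a (s * t) x"
  by (simp add: dilation_def powr_mult mult.assoc)

lemma dilation_inverse [simp]:
  "0 < t \<Longrightarrow> dilation a t (dilation a (1 / t) x) = x"
  "0 < t \<Longrightarrow> dilation a (1 / t) (dilation a t x) = x"
  by (simp_all add: dilation_dilation)

lemma dilation_uminus: "dilation a t (- x) = - dilation a t x"
  by (simp add: dilation_def vec_eq_iff)

lemma dilation_scaleR: "dilation a t (c *\<^sub>R x) = c *\<^sub>R dilation a t x"
  by (simp add: dilation_def vec_eq_iff)

lemma dilation_add: "dilation a t (x + y) = dilation a t x + dilation a t y"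
  by (simp add: dilation_def vec_eq_iff algebra_simps)

lemma dilation_0 [simp]: "dilation a t 0 = 0"
  by (simp add: dilation_def vec_eq_iff)

lemma linear_dilation: "linear (dilation a t)"
  by (intro linearI) (auto simp: dilation_add dilation_scaleR)

lemma nn_integral_dilation:
  assumes t: "0 < t" and f: "f \<in> borel_measurable borel"
  shows "(\<integral>\<^sup>+x. f (dilation a t x) \<partial>lborel) = ennreal (t powr - hom_dim a) * (\<integral>\<^sup>+x. f x \<partial>lborel)"
proof -
  have "(\<Prod>i\<in>UNIV. \<bar>t powr a i\<bar>) = t powr hom_dim a"
    using t by (simp add: hom_dim_def powr_sum)
  then have "(\<integral>\<^sup>+x. f x \<partial>lborel) = ennreal (t powr hom_dim a) * (\<integral>\<^sup>+x. f (dilation a t x) \<partial>lborel)"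
    using nn_integral_diagonal[of "\<lambda>i. t powr a i" f] t f by (simp add: dilation_def[abs_def])
  moreover have "ennreal (t powr - hom_dim a) * ennreal (t powr hom_dim a) = 1"
    using t by (simp add: powr_minus flip: ennreal_mult)
  ultimately show ?thesis
    by (simp add: mult.assoc[symmetric])
qed

lemma distr_dilation:
  assumes t: "0 < t"
  shows "distr lborel lborel (dilation a t) = density lborel (\<lambda>_. ennreal (t powr - hom_dim a))"
proof (rule measure_eqI)
  fix A assume "A \<in> sets (distr lborel lborel (dilation a t))"
  then have A [measurable]: "A \<in> sets borel" by simp
  have "emeasure (distr lborel lborel (dilation a t)) A = (\<integral>\<^sup>+x. indicator A x \<partial>distr lborel lborel (dilation a t))"
    by simp
  also have "\<dots> = (\<integral>\<^sup>+x. indicator A (dilation a t x) \<partial>lborel)"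
    by (subst nn_integral_distr) auto
  also have "\<dots> = ennreal (t powr - hom_dim a) * emeasure lborel A"
    using nn_integral_dilation[OF t, of "indicator A"] by simp
  also have "\<dots> = emeasure (density lborel (\<lambda>_. ennreal (t powr - hom_dim a))) A"
    by (simp add: emeasure_density nn_integral_cmult_indicator)
  finally show "emeasure (distr lborel lborel (dilation a t)) A =
      emeasure (density lborel (\<lambda>_. ennreal (t powr - hom_dim a))) A" .
qed simp

lemma integral_dilation:
  fixes f :: "real^'n::finite \<Rightarrow> 'b::{banach, second_countable_topology}"
  assumes t: "0 < t" and [measurable]: "f \<in> borel_measurable borel"
  shows "(\<integral>x. f (dilation a t x) \<partial>lborel) = (t powr - hom_dim a) *\<^sub>R (\<integral>x. f x \<partial>lborel)"
proof -
  have "(\<integral>x. f (dilation a t x) \<partial>lborel) = (\<integral>x. f x \<partial>distr lborel lborel (dilation a t))"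
    by (rule integral_distr[symmetric]) auto
  also have "\<dots> = (\<integral>x. (t powr - hom_dim a) *\<^sub>R f x \<partial>lborel)"
    unfolding distr_dilation[OF t] by (rule integral_density) auto
  finally show ?thesis by simp
qed

context homogeneous_group
begin

lemma group_mul: "group \<lparr>carrier = UNIV, mult = mul, one = 0\<rparr>"
  using nilpotent by (simp add: nilpotent_group_def)

lemma mul_assoc: "mul (mul x y) z = mul x (mul y z)"
  using monoid.m_assoc[OF group.is_monoid[OF group_mul], of x y z] by simp

lemma mul_zero [simp]: "mul 0 x = x" "mul x 0 = x"
  using monoid.l_one[OF group.is_monoid[OF group_mul], of x]
    monoid.r_one[OF group.is_monoid[OF group_mul], of x] by simp_all

lemma mul_cancel [simp]: "mul (- x) (mul x y) = y" "mul x (mul (- x) y) = y"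
  by (simp_all add: mul_assoc[symmetric] inverse)

lemmas mul_uminus [simp] = inverse

lemma uminus_mul: "- mul x y = mul (- y) (- x)"
proof -
  have "mul (mul x y) (mul (- y) (- x)) = 0"
    by (simp add: mul_assoc)
  then have "mul (- mul x y) (mul (mul x y) (mul (- y) (- x))) = - mul x y"
    by simp
  then show ?thesis by simp
qed

lemma mul_scaleR_same: "mul (mul x (\<alpha> *\<^sub>R u)) (\<beta> *\<^sub>R u) = mul x ((\<alpha> + \<beta>) *\<^sub>R u)"
  by (simp add: mul_assoc mul_line scaleR_add_left)

lemma continuous_mul: "continuous_on UNIV (\<lambda>(x, y). mul x y)"
  by (rule smooth_on_continuous[OF smooth_mul])

lemma continuous_on_mul [continuous_intros]:
  "continuous_on S f \<Longrightarrow> continuous_on S g \<Longrightarrow> continuous_on S (\<lambda>x. mul (f x) (g x))"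
  using continuous_on_compose2[OF continuous_mul, of S "\<lambda>x. (f x, g x)"] by (simp add: continuous_on_Pair)

lemma measurable_mul [measurable (raw)]:
  "f \<in> borel_measurable M \<Longrightarrow> g \<in> borel_measurable M \<Longrightarrow> (\<lambda>x. mul (f x) (g x)) \<in> borel_measurable M"
  by (rule borel_measurable_continuous_Pair[where H = mul])
    (use continuous_mul in \<open>simp_all add: case_prod_beta'\<close>)

lemma nn_integral_mul_left:
  "f \<in> borel_measurable borel \<Longrightarrow> (\<integral>\<^sup>+x. f (mul y x) \<partial>lborel) = (\<integral>\<^sup>+x. f x \<partial>lborel)"
  by (rule nn_integral_lborel_distr[OF haar_left]) simp_all

lemma nn_integral_mul_right:
  "f \<in> borel_measurable borel \<Longrightarrow> (\<integral>\<^sup>+x. f (mul x y) \<partial>lborel) = (\<integral>\<^sup>+x. f x \<partial>lborel)"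
  by (rule nn_integral_lborel_distr[OF haar_right]) simp_all

lemma integral_mul_right:
  fixes f :: "real^('n::{finite,linorder}) \<Rightarrow> complex"
  shows "f \<in> borel_measurable borel \<Longrightarrow> (\<integral>x. f (mul x y) \<partial>lborel) = (\<integral>x. f x \<partial>lborel)"
  by (rule integral_lborel_distr[OF haar_right]) simp_all

lemma exponent_ge_1: "1 \<le> a i"
proof -
  have "Min UNIV \<le> i" by simp
  then have "a (Min UNIV) \<le> a i" using exponent_mono by (rule monoD[rotated])
  then show ?thesis using exponent_first by simp
qed

lemma exponent_le_hom_dim: "a i \<le> hom_dim a"
  unfolding hom_dim_def using exponent_ge_1
  by (intro member_le_sum) (auto intro: order_trans[OF zero_le_one])

lemma hom_dim_ge_1: "1 \<le> hom_dim a"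
  using exponent_ge_1 exponent_le_hom_dim by (rule order_trans)

lemma norm_dilation_ge_1: "1 \<le> r \<Longrightarrow> norm (dilation a r x) \<le> r powr hom_dim a * norm x"
proof -
  assume r: "1 \<le> r"
  have "norm (dilation a r x) \<le> norm ((r powr hom_dim a) *\<^sub>R x)"
    unfolding norm_vec_def using r exponent_le_hom_dim
    by (intro L2_set_mono) (auto simp: dilation_def abs_mult intro!: mult_right_mono powr_mono)
  then show ?thesis by simp
qed

lemma norm_dilation_le_1: "0 < r \<Longrightarrow> r \<le> 1 \<Longrightarrow> norm (dilation a r x) \<le> r * norm x"
proof -
  assume r: "0 < r" "r \<le> 1"
  have "r powr a i \<le> r" for i
    using powr_mono'[OF exponent_ge_1, of r i] r by simp
  then have "norm (dilation a r x) \<le> norm (r *\<^sub>R x)"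
    unfolding norm_vec_def using r
    by (intro L2_set_mono) (auto simp: dilation_def abs_mult intro!: mult_right_mono)
  then show ?thesis using r by simp
qed

end

context norm_function
begin

lemma rho_zero [simp]: "\<rho> 0 = 0"
  using rho_dilation[of 2 0] by simp

lemma rho_nonneg [simp]: "0 \<le> \<rho> x"
  using rho_add[of x "- x"] rho_inverse[of x] by simp

lemma measurable_rho [measurable]: "\<rho> \<in> borel_measurable borel"
  using rho_continuous by (rule borel_measurable_continuous_onI)

lemma rho_normalise: "0 < \<rho> x \<Longrightarrow> norm (dilation a (1 / \<rho> x) x) = 1"
  using rho_dilation[of "1 / \<rho> x" x] rho_eq_1 by simp

text \<open>Every exponent is at least \<open>1\<close>, so that contracting dilations shrink the Euclidean norm at least
  linearly.  Together with the common unit sphere this compares \<open>\<rho>\<close> with the norm.\<close>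

lemma norm_le_rho: "\<rho> x \<le> 1 \<Longrightarrow> norm x \<le> \<rho> x"
proof (cases "\<rho> x = 0")
  case True
  have "norm x \<le> e" if "0 < e" "e \<le> 1" for e
  proof -
    have "norm (dilation a (1 / e) x) \<le> 1"
      using rho_dilation[of "1 / e" x] True that rho_le_1[of "dilation a (1 / e) x"] by simp
    then have "e * norm (dilation a (1 / e) x) \<le> e" using that by simp
    moreover have "norm x \<le> e * norm (dilation a (1 / e) x)"
      using norm_dilation_le_1[of e "dilation a (1 / e) x"] that by simp
    ultimately show ?thesis by linarith
  qed
  then have "norm x \<le> 0 + e" if "0 < e" for e
    using that by (cases "e \<le> 1") (auto intro: order_trans[of _ 1])
  then have "norm x \<le> 0" by (rule field_le_epsilon)
  then show ?thesis using True by simp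
next
  case False
  assume le: "\<rho> x \<le> 1"
  have pos: "0 < \<rho> x" using False rho_nonneg[of x] by linarith
  have "x = dilation a (\<rho> x) (dilation a (1 / \<rho> x) x)" using pos by simp
  then have "norm x = norm (dilation a (\<rho> x) (dilation a (1 / \<rho> x) x))" by simp
  also have "\<dots> \<le> \<rho> x * 1"
    using norm_dilation_le_1[OF pos le] rho_normalise[OF pos] by metis
  finally show ?thesis by simp
qed

lemma rho_eq_0_iff [simp]: "\<rho> x = 0 \<longleftrightarrow> x = 0"
  using norm_le_rho[of x] by auto

lemma rho_pos_iff [simp]: "0 < \<rho> x \<longleftrightarrow> x \<noteq> 0"
  using rho_eq_0_iff[of x] rho_nonneg[of x] by linarith

lemma norm_le_rho_powr: "norm x \<le> (1 + \<rho> x) powr hom_dim a"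
proof (cases "\<rho> x \<le> 1")
  case True
  then have "norm x \<le> 1" using rho_le_1 by simp
  also have "\<dots> \<le> (1 + \<rho> x) powr hom_dim a"
    using hom_dim_ge_1 by (intro ge_one_powr_ge_zero) auto
  finally show ?thesis .
next
  case False
  then have pos: "0 < \<rho> x" by linarith
  have "norm x = norm (dilation a (\<rho> x) (dilation a (1 / \<rho> x) x))" using pos by simp
  also have "\<dots> \<le> \<rho> x powr hom_dim a * 1"
    using norm_dilation_ge_1[of "\<rho> x" "dilation a (1 / \<rho> x) x"] rho_normalise[OF pos] False by simp
  also have "\<dots> \<le> (1 + \<rho> x) powr hom_dim a"
    using hom_dim_ge_1 by (simp add: powr_mono2)
  finally show ?thesis .
qed

lemma rho_le_norm: "\<rho> x \<le> 1 + norm x"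
proof (cases "norm x \<le> 1")
  case True
  then show ?thesis using rho_le_1[of x] norm_ge_zero[of x] by linarith
next
  case False
  then have pos: "0 < norm x" "1 / norm x \<le> 1" by (auto simp: divide_le_eq_1)
  have "norm (dilation a (1 / norm x) x) \<le> 1"
    using norm_dilation_le_1[of "1 / norm x" x] pos by simp
  then have "\<rho> (dilation a (1 / norm x) x) \<le> 1" using rho_le_1 by simp
  then have "norm x * \<rho> (dilation a (1 / norm x) x) \<le> norm x * 1"
    by (intro mult_left_mono) auto
  then have "\<rho> x \<le> norm x"
    using rho_dilation[of "1 / norm x" x] pos by simp
  then show ?thesis by simp
qed

definition c\<^sub>0 :: real where
  "c\<^sub>0 = (SOME c. 1 \<le> c \<and> (\<forall>x y. \<rho> (mul x y) \<le> c * (\<rho> x + \<rho> y)))"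

lemma c\<^sub>0: "1 \<le> c\<^sub>0" "\<rho> (mul x y) \<le> c\<^sub>0 * (\<rho> x + \<rho> y)"
  unfolding c\<^sub>0_def using someI_ex[of "\<lambda>c. 1 \<le> c \<and> (\<forall>x y. \<rho> (mul x y) \<le> c * (\<rho> x + \<rho> y))"] rho_mul
  by auto

lemma one_plus_rho_mul:
  assumes R: "0 \<le> R"
  shows "1 + R * \<rho> (mul x y) \<le> c\<^sub>0 * ((1 + R * \<rho> x) * (1 + R * \<rho> y))"
proof -
  have "R * \<rho> (mul x y) \<le> R * (c\<^sub>0 * (\<rho> x + \<rho> y))"
    by (intro mult_left_mono c\<^sub>0 R)
  then have "1 + R * \<rho> (mul x y) \<le> c\<^sub>0 * 1 + c\<^sub>0 * (R * \<rho> x + R * \<rho> y)"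
    using c\<^sub>0(1) by (simp add: algebra_simps)
  also have "\<dots> \<le> c\<^sub>0 * 1 + c\<^sub>0 * (R * \<rho> x + R * \<rho> y) + c\<^sub>0 * ((R * \<rho> x) * (R * \<rho> y))"
    using R c\<^sub>0(1) by simp
  finally show ?thesis by (simp add: algebra_simps)
qed

definition unit_volume :: real where
  "unit_volume = measure lborel {x. \<rho> x < 1}"

lemma emeasure_unit_ball: "emeasure lborel {x. \<rho> x < 1} = ennreal unit_volume"
  and unit_volume_pos: "0 < unit_volume"
proof -
  have op: "open {x. \<rho> x < 1}"
    using rho_continuous by (intro open_Collect_less continuous_on_const) auto
  have "{x. \<rho> x < 1} \<subseteq> cball 0 1"
  proof
    fix x assume "x \<in> {x. \<rho> x < 1}"
    then have "\<rho> x \<le> 1" by simp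
    then have "norm x \<le> 1" using rho_le_1 by blast
    then show "x \<in> cball 0 1" by simp
  qed
  then have "emeasure lborel {x. \<rho> x < 1} \<le> emeasure lborel (cball 0 1 :: (real^('n::{finite,linorder})) set)"
    by (intro emeasure_mono) auto
  also have "\<dots> < \<infinity>"
    using emeasure_bounded_finite[of "cball 0 1 :: (real^('n::{finite,linorder})) set"] by simp
  finally have fin: "emeasure lborel {x. \<rho> x < 1} < \<infinity>" .
  then show eq: "emeasure lborel {x. \<rho> x < 1} = ennreal unit_volume"
    unfolding unit_volume_def by (intro emeasure_eq_ennreal_measure) auto
  have "0 \<in> {x. \<rho> x < 1}" by simp
  then obtain e where e: "0 < e" "ball 0 e \<subseteq> {x. \<rho> x < 1}"
    using op by (meson open_contains_ball)
  have "0 < emeasure lborel (ball (0 :: real^('n::{finite,linorder})) e)"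
    using e(1) by (simp add: emeasure_ball)
  also have "\<dots> \<le> emeasure lborel {x. \<rho> x < 1}"
    using e(2) by (intro emeasure_mono) auto
  finally show "0 < unit_volume" unfolding eq by simp
qed

lemma emeasure_rho_ball:
  assumes "0 < r" shows "emeasure lborel {x. \<rho> x < r} = ennreal (r powr hom_dim a * unit_volume)"
proof -
  have "emeasure lborel {x. \<rho> x < r} = (\<integral>\<^sup>+x. indicator {x. \<rho> x < r} x \<partial>lborel)"
    by (subst nn_integral_indicator) auto
  also have "\<dots> = (\<integral>\<^sup>+x. indicator {x. \<rho> x < 1} (dilation a (1 / r) x) \<partial>lborel)"
    using assms by (intro nn_integral_cong) (auto simp: indicator_def rho_dilation field_simps)
  also have "\<dots> = ennreal ((1 / r) powr - hom_dim a) * emeasure lborel {x. \<rho> x < 1}"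
    using assms by (subst nn_integral_dilation) auto
  also have "(1 / r) powr - hom_dim a = r powr hom_dim a"
    using assms by (simp add: powr_divide powr_minus)
  finally show ?thesis
    using unit_volume_pos by (simp add: emeasure_unit_ball ennreal_mult)
qed

lemma rho_minus_swap: "\<rho> (mul (- x) y) = \<rho> (mul (- y) x)"
  using rho_inverse[of "mul (- x) y"] by (simp add: uminus_mul)

lemma sets_gball [measurable]: "gball mul \<rho> x t \<in> sets borel"
  unfolding gball_def by measurable

lemma emeasure_gball:
  assumes "0 < t" shows "emeasure lborel (gball mul \<rho> x t) = ennreal (t powr hom_dim a * unit_volume)"
proof -
  have "emeasure lborel (gball mul \<rho> x t) = (\<integral>\<^sup>+y. indicator {z. \<rho> z < t} (mul (- x) y) \<partial>lborel)"
  proof -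
    have "emeasure lborel (gball mul \<rho> x t) = (\<integral>\<^sup>+y. indicator (gball mul \<rho> x t) y \<partial>lborel)"
      by simp
    also have "\<dots> = (\<integral>\<^sup>+y. indicator {z. \<rho> z < t} (mul (- x) y) \<partial>lborel)"
      by (intro nn_integral_cong) (auto simp: gball_def indicator_def rho_minus_swap)
    finally show ?thesis .
  qed
  also have "\<dots> = (\<integral>\<^sup>+y. indicator {z. \<rho> z < t} y \<partial>lborel)"
    by (rule nn_integral_mul_left) auto
  finally show ?thesis using emeasure_rho_ball[OF assms] by simp
qed

text \<open>Summing over dyadic shells.\<close>

lemma nn_integral_rho_decay:
  assumes L: "hom_dim a < L"
  shows "(\<integral>\<^sup>+x. ennreal ((1 + \<rho> x) powr - L) \<partial>lborel) < top"
proof -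
  let ?g = "hom_dim a"
  define q where "q = (2::real) powr (?g - L)"
  have q: "0 < q" "q < 1" using L by (auto simp: q_def powr_less_one)
  define A where "A k = {x. \<rho> x < 2 ^ Suc k}" for k :: nat
  have [measurable]: "A k \<in> sets borel" for k unfolding A_def by measurable
  have "(\<integral>\<^sup>+x. ennreal ((1 + \<rho> x) powr - L) \<partial>lborel)
      \<le> (\<integral>\<^sup>+x. (\<Sum>k. ennreal ((2 ^ k) powr - L) * indicator (A k) x) \<partial>lborel)"
  proof (rule nn_integral_mono)
    fix x
    define k where "k = nat \<lfloor>log 2 (1 + \<rho> x)\<rfloor>"
    have "0 \<le> log 2 (1 + \<rho> x)" by (simp add: zero_le_log_cancel_iff add_pos_nonneg)
    then have k: "real k \<le> log 2 (1 + \<rho> x)" "log 2 (1 + \<rho> x) < real (Suc k)"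
      unfolding k_def by linarith+
    have *: "2 powr (log 2 (1 + \<rho> x)) = 1 + \<rho> x"
      by (rule powr_log_cancel) (auto simp: add_pos_nonneg)
    have lo: "2 ^ k \<le> 1 + \<rho> x"
      using powr_mono[OF k(1), of 2] * by (simp add: powr_realpow)
    have hi: "1 + \<rho> x < 2 ^ Suc k"
      using powr_less_mono[OF k(2), of 2] * by (simp add: powr_realpow powr_add)
    have "(1 + \<rho> x) powr - L \<le> (2 ^ k) powr - L"
      using lo L hom_dim_ge_1 by (intro powr_mono2') auto
    then have "ennreal ((1 + \<rho> x) powr - L) \<le> ennreal ((2 ^ k) powr - L) * indicator (A k) x"
      using hi by (simp add: A_def ennreal_leI)
    also have "\<dots> \<le> (\<Sum>k. ennreal ((2 ^ k) powr - L) * indicator (A k) x)"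
      by (rule suminf_upper_ennreal)
    finally show "ennreal ((1 + \<rho> x) powr - L) \<le> (\<Sum>k. ennreal ((2 ^ k) powr - L) * indicator (A k) x)" .
  qed
  also have "\<dots> = (\<Sum>k. ennreal ((2 ^ k) powr - L) * emeasure lborel (A k))"
    by (subst nn_integral_suminf) (auto simp: nn_integral_cmult_indicator)
  also have "\<dots> = (\<Sum>k. ennreal (q ^ k * (2 powr ?g * unit_volume)))"
  proof (intro suminf_cong)
    fix k
    have "emeasure lborel (A k) = ennreal ((2 ^ Suc k) powr ?g * unit_volume)"
      unfolding A_def by (rule emeasure_rho_ball) simp
    moreover have "(2 ^ k) powr - L * ((2 ^ Suc k) powr ?g * unit_volume) = q ^ k * (2 powr ?g * unit_volume)"
    proof -
      have "(2 ^ k) powr - L * (2 ^ Suc k) powr ?g = ((2 ^ k) powr - L * (2 ^ k) powr ?g) * 2 powr ?g"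
        by (simp add: powr_mult)
      also have "(2 ^ k) powr - L * (2 ^ k) powr ?g = (2 ^ k :: real) powr (?g - L)"
        by (simp add: powr_add[symmetric])
      also have "\<dots> = q ^ k"
        by (simp add: q_def powr_powr mult.commute flip: powr_realpow)
      finally show ?thesis by (simp add: mult.assoc)
    qed
    ultimately show "ennreal ((2 ^ k) powr - L) * emeasure lborel (A k) = ennreal (q ^ k * (2 powr ?g * unit_volume))"
      using unit_volume_pos by (simp add: mult.assoc[symmetric] flip: ennreal_mult)
  qed
  also have "\<dots> = ennreal (\<Sum>k. q ^ k * (2 powr ?g * unit_volume))"
    using q unit_volume_pos by (intro suminf_ennreal2 summable_mult2 summable_geometric) auto
  also have "\<dots> < top" by simp
  finally show ?thesis .
qed

end

section \<open>The maximal function on a homogeneous group\<close>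

context norm_function
begin

lemma quasi_triangle: "\<rho> (mul (- x) z) \<le> c\<^sub>0 * (\<rho> (mul (- x) y) + \<rho> (mul (- y) z))"
  using c\<^sub>0(2)[of "mul (- x) y" "mul (- y) z"] by (simp add: mul_assoc)

text \<open>Two applications of the quasi-triangle inequality give the factor \<open>3 c\<^sub>0\<^sup>2\<close>.  Rounding it up to an
  integer keeps the family of balls with rational radii invariant.\<close>

definition enlargement :: real where
  "enlargement = real (nat \<lceil>3 * c\<^sub>0 * c\<^sub>0\<rceil>)"

lemma enlargement: "3 * c\<^sub>0 * c\<^sub>0 \<le> enlargement" "1 \<le> enlargement" "enlargement \<in> \<rat>"
proof -
  show le: "3 * c\<^sub>0 * c\<^sub>0 \<le> enlargement"
    unfolding enlargement_def by linarith
  have "1 * 1 \<le> c\<^sub>0 * c\<^sub>0" using c\<^sub>0(1) by (intro mult_mono) auto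
  with le show "1 \<le> enlargement" by linarith
  show "enlargement \<in> \<rat>" by (simp add: enlargement_def)
qed

definition dense_points :: "(real^('n::{finite,linorder})) set" where
  "dense_points = (SOME D. countable D \<and> (\<forall>X. open X \<longrightarrow> X \<noteq> {} \<longrightarrow> (\<exists>d\<in>D. d \<in> X)))"

lemma dense_points: "countable dense_points" "open X \<Longrightarrow> x \<in> X \<Longrightarrow> \<exists>d\<in>dense_points. d \<in> X"
proof -
  have ex: "\<exists>D::(real^('n::{finite,linorder})) set. countable D \<and> (\<forall>X. open X \<longrightarrow> X \<noteq> {} \<longrightarrow> (\<exists>d\<in>D. d \<in> X))"
    using countable_dense_exists by blast
  from someI_ex[OF this]
  show "countable dense_points" "open X \<Longrightarrow> x \<in> X \<Longrightarrow> \<exists>d\<in>dense_points. d \<in> X"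
    unfolding dense_points_def[symmetric] by blast+
qed

definition ball_index :: "((real^('n::{finite,linorder})) \<times> real) set" where
  "ball_index = dense_points \<times> {r\<in>\<rat>. 0 < r}"

sublocale balls: ball_system lborel ball_index "\<lambda>i. gball mul \<rho> (fst i) (snd i)"
  "\<lambda>i. (fst i, enlargement * snd i)" snd "enlargement powr hom_dim a"
proof
  show "countable ball_index"
    unfolding ball_index_def
    by (intro countable_SIGMA dense_points countable_subset[OF _ countable_rat]) auto
  fix i assume i: "i \<in> ball_index"
  then have r: "0 < snd i" by (auto simp: ball_index_def)
  then have r': "0 < enlargement * snd i" using enlargement by simp
  show "(fst i, enlargement * snd i) \<in> ball_index"
    using i enlargement r' by (auto simp: ball_index_def)
  show "gball mul \<rho> (fst i) (snd i) \<in> sets lborel" by simp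
  show "gball mul \<rho> (fst i) (snd i) \<subseteq> gball mul \<rho> (fst (fst i, enlargement * snd i)) (snd (fst i, enlargement * snd i))"
    using enlargement(2) r by (auto simp: gball_def intro: less_le_trans)
  show "0 < emeasure lborel (gball mul \<rho> (fst i) (snd i))"
    using unit_volume_pos r by (simp add: emeasure_gball)
  show "emeasure lborel (gball mul \<rho> (fst i) (snd i)) < \<infinity>"
    using r by (simp add: emeasure_gball)
  show "emeasure lborel (gball mul \<rho> (fst (fst i, enlargement * snd i)) (snd (fst i, enlargement * snd i)))
    \<le> ennreal (enlargement powr hom_dim a) * emeasure lborel (gball mul \<rho> (fst i) (snd i))"
    using r r' enlargement unit_volume_pos
    by (simp add: emeasure_gball powr_mult mult.assoc flip: ennreal_mult)
next
  fix i j assume ij: "i \<in> ball_index" "j \<in> ball_index" "snd i \<le> snd j"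
    and "gball mul \<rho> (fst i) (snd i) \<inter> gball mul \<rho> (fst j) (snd j) \<noteq> {}"
  then obtain p where p: "\<rho> (mul (- p) (fst i)) < snd i" "\<rho> (mul (- p) (fst j)) < snd j"
    by (auto simp: gball_def)
  have s: "0 < snd j" using ij by (auto simp: ball_index_def)
  have "\<rho> (mul (- z) (fst j)) < enlargement * snd j" if z: "\<rho> (mul (- z) (fst i)) < snd i" for z
  proof -
    have "\<rho> (mul (- fst i) (fst j)) \<le> c\<^sub>0 * (\<rho> (mul (- fst i) p) + \<rho> (mul (- p) (fst j)))"
      by (rule quasi_triangle)
    also have "\<dots> \<le> c\<^sub>0 * (snd j + snd j)"
      using p c\<^sub>0(1) ij by (intro mult_left_mono add_mono) (auto simp: rho_minus_swap)
    finally have 1: "\<rho> (mul (- fst i) (fst j)) \<le> 2 * c\<^sub>0 * snd j" by simp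
    have "\<rho> (mul (- z) (fst j)) \<le> c\<^sub>0 * (\<rho> (mul (- z) (fst i)) + \<rho> (mul (- fst i) (fst j)))"
      by (rule quasi_triangle)
    also have "\<dots> < c\<^sub>0 * (snd j + 2 * c\<^sub>0 * snd j)"
      using z ij 1 c\<^sub>0(1) by (intro mult_strict_left_mono add_less_le_mono) auto
    also have "\<dots> \<le> c\<^sub>0 * (c\<^sub>0 * snd j + 2 * c\<^sub>0 * snd j)"
      using c\<^sub>0(1) s by (intro mult_left_mono add_right_mono) auto
    also have "\<dots> = (3 * c\<^sub>0 * c\<^sub>0) * snd j" by (simp add: algebra_simps)
    also have "\<dots> \<le> enlargement * snd j"
      using enlargement(1) s by (intro mult_right_mono) auto
    finally show ?thesis .
  qed
  then show "gball mul \<rho> (fst i) (snd i) \<subseteq> gball mul \<rho> (fst (fst j, enlargement * snd j)) (snd (fst j, enlargement * snd j))"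
    by (auto simp: gball_def)
next
  show "0 < enlargement powr hom_dim a" using enlargement by simp
  have "\<exists>i\<in>ball_index. x \<in> gball mul \<rho> (fst i) (snd i)" for x
  proof -
    have op: "open {c. \<rho> (mul (- x) c) < 1}"
      by (intro open_Collect_less continuous_on_const continuous_on_compose2[OF rho_continuous] continuous_intros) auto
    have "x \<in> {c. \<rho> (mul (- x) c) < 1}" by simp
    from dense_points(2)[OF op this] obtain c where "c \<in> dense_points" "\<rho> (mul (- x) c) < 1" by auto
    then show ?thesis by (intro bexI[of _ "(c, 1)"]) (auto simp: gball_def ball_index_def)
  qed
  then show "space lborel = (\<Union>i\<in>ball_index. gball mul \<rho> (fst i) (snd i))" by auto
qed

text \<open>Every ball lies in a ball of the countable family of comparable radius.\<close>

lemma integral_gball_le_maxfn: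
  assumes R: "0 < R"
  shows "(\<integral>\<^sup>+y\<in>gball mul \<rho> x R. f y \<partial>lborel)
    \<le> ennreal ((3 * c\<^sub>0) powr hom_dim a) * balls.maxfn f x * ennreal (R powr hom_dim a * unit_volume)"
proof -
  have op: "open {c. \<rho> (mul (- x) c) < R}"
    by (intro open_Collect_less continuous_on_const continuous_on_compose2[OF rho_continuous] continuous_intros) auto
  have "x \<in> {c. \<rho> (mul (- x) c) < R}" using R by simp
  from dense_points(2)[OF op this] obtain c where c: "c \<in> dense_points" "\<rho> (mul (- x) c) < R" by auto
  have "2 * c\<^sub>0 * R < 3 * c\<^sub>0 * R" using c\<^sub>0(1) R by simp
  then obtain r where r: "r \<in> \<rat>" "2 * c\<^sub>0 * R < r" "r < 3 * c\<^sub>0 * R"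
    using Rats_dense_in_real by blast
  have "R \<le> 2 * c\<^sub>0 * R" "0 \<le> 2 * c\<^sub>0 * R" using c\<^sub>0(1) R by (auto simp: mult_le_cancel_right)
  then have r0: "0 < r" "R \<le> r" using r by linarith+
  have i: "(c, r) \<in> ball_index" using c r r0 by (simp add: ball_index_def)
  have sub: "gball mul \<rho> x R \<subseteq> gball mul \<rho> c r"
  proof
    fix y assume "y \<in> gball mul \<rho> x R"
    then have y: "\<rho> (mul (- y) x) < R" by (simp add: gball_def)
    have "\<rho> (mul (- y) c) \<le> c\<^sub>0 * (\<rho> (mul (- y) x) + \<rho> (mul (- x) c))"
      by (rule quasi_triangle)
    also have "\<dots> \<le> c\<^sub>0 * (R + R)" using y c c\<^sub>0(1) by (intro mult_left_mono add_mono) auto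
    also have "\<dots> < r" using r by (simp add: algebra_simps)
    finally show "y \<in> gball mul \<rho> c r" by (simp add: gball_def)
  qed
  have "x \<in> gball mul \<rho> x R" using R by (simp add: gball_def)
  with sub have x: "x \<in> gball mul \<rho> c r" by blast
  have pos: "0 < R powr hom_dim a * unit_volume" using R unit_volume_pos by simp
  have "(\<integral>\<^sup>+y\<in>gball mul \<rho> x R. f y \<partial>lborel) \<le> (\<integral>\<^sup>+y\<in>gball mul \<rho> c r. f y \<partial>lborel)"
    using sub by (intro nn_integral_mono mult_left_mono) (auto simp: indicator_def)
  also have "\<dots> \<le> balls.maxfn f x * emeasure lborel (gball mul \<rho> c r)"
    using balls.integral_le_maxfn[OF i, of x f] x by simp
  also have "\<dots> \<le> balls.maxfn f x * ennreal ((3 * c\<^sub>0) powr hom_dim a * (R powr hom_dim a * unit_volume))"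
  proof (intro mult_left_mono)
    have "r powr hom_dim a \<le> (3 * c\<^sub>0 * R) powr hom_dim a"
      using r r0 hom_dim_ge_1 by (intro powr_mono2) auto
    also have "\<dots> = (3 * c\<^sub>0) powr hom_dim a * R powr hom_dim a"
      using c\<^sub>0(1) R by (simp add: powr_mult)
    finally show "emeasure lborel (gball mul \<rho> c r) \<le> ennreal ((3 * c\<^sub>0) powr hom_dim a * (R powr hom_dim a * unit_volume))"
      unfolding emeasure_gball[OF r0(1)] mult.assoc[symmetric] using unit_volume_pos
      by (intro ennreal_leI mult_right_mono) auto
  qed simp
  also have "\<dots> = ennreal ((3 * c\<^sub>0) powr hom_dim a) * balls.maxfn f x * ennreal (R powr hom_dim a * unit_volume)"
    using pos by (subst ennreal_mult) (auto simp: mult_ac)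
  finally show ?thesis .
qed

lemma average_lborel: "average (gball mul \<rho> x t) g = (\<integral>\<^sup>+y\<in>gball mul \<rho> x t. g y \<partial>lborel) / emeasure lborel (gball mul \<rho> x t)"
  by (simp add: average_def nn_integral_completion)

text \<open>With the convention \<open>0 * \<infinity> = 0\<close> the zero function belongs to every Muckenhoupt class.  Apart
  from this degenerate case a weight is positive almost everywhere: a large ball that meets both
  the zero set and its complement in positive measure would violate the condition.\<close>

lemma muckenhoupt_zero_or_positive:
  assumes w: "w \<in> muckenhoupt mul \<rho> s" and s: "1 < s"
    and w'[measurable]: "w' \<in> borel_measurable borel" and eq: "AE x in lborel. w x = w' x"
  shows "(AE x in lborel. w' x = 0) \<or> (AE x in lborel. 0 < w' x)"
proof (rule ccontr)
  assume neg: "\<not> ?thesis"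
  have w_nonneg: "0 \<le> w x" for x using w by (auto simp: muckenhoupt_def weight_def)
  define U where "U n = gball mul \<rho> 0 (real (Suc n))" for n
  have U_cover: "\<exists>n. x \<in> U n" for x
  proof -
    obtain n where "\<rho> (- x) < real n" using reals_Archimedean2 by blast
    then show ?thesis by (intro exI[of _ n]) (simp add: U_def gball_def)
  qed
  have U_mono: "U m \<subseteq> U n" if "m \<le> n" for m n
    using that by (auto simp: U_def gball_def intro: less_le_trans)
  have ex: "\<exists>n. \<not> (AE x in lborel. x \<in> U n \<longrightarrow> P x)" if "\<not> (AE x in lborel. P x)" for P
  proof (rule ccontr)
    assume "\<not> ?thesis"
    then have "AE x in lborel. \<forall>n. x \<in> U n \<longrightarrow> P x"
      by (subst AE_all_countable) auto
    then have "AE x in lborel. P x"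
      by eventually_elim (use U_cover in blast)
    with that show False by contradiction
  qed
  obtain m where m: "\<not> (AE x in lborel. x \<in> U m \<longrightarrow> w' x = 0)"
    using ex[of "\<lambda>x. w' x = 0"] neg by auto
  obtain n where n: "\<not> (AE x in lborel. x \<in> U n \<longrightarrow> 0 < w' x)"
    using ex[of "\<lambda>x. 0 < w' x"] neg by auto
  define k where "k = max m n"
  have mk: "\<not> (AE x in lborel. x \<in> U k \<longrightarrow> w' x = 0)"
  proof
    assume "AE x in lborel. x \<in> U k \<longrightarrow> w' x = 0"
    then have "AE x in lborel. x \<in> U m \<longrightarrow> w' x = 0"
      by eventually_elim (use U_mono[of m k] in \<open>auto simp: k_def\<close>)
    with m show False by contradiction
  qed
  have nk: "\<not> (AE x in lborel. x \<in> U k \<longrightarrow> 0 < w' x)"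
  proof
    assume "AE x in lborel. x \<in> U k \<longrightarrow> 0 < w' x"
    then have "AE x in lborel. x \<in> U n \<longrightarrow> 0 < w' x"
      by eventually_elim (use U_mono[of n k] in \<open>auto simp: k_def\<close>)
    with n show False by contradiction
  qed
  have [measurable]: "U k \<in> sets borel" by (simp add: U_def)
  let ?e = "- 1 / (s - 1)"
  have e: "?e < 0" using s by simp
  have U_fin: "0 < emeasure lborel (U k)" "emeasure lborel (U k) < top"
    using unit_volume_pos by (auto simp: U_def emeasure_gball)
  have 1: "(\<integral>\<^sup>+x\<in>U k. ennreal (w x) \<partial>lborel) \<noteq> 0"
  proof
    assume "(\<integral>\<^sup>+x\<in>U k. ennreal (w x) \<partial>lborel) = 0"
    moreover have "(\<integral>\<^sup>+x\<in>U k. ennreal (w x) \<partial>lborel) = (\<integral>\<^sup>+x\<in>U k. ennreal (w' x) \<partial>lborel)"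
      using eq by (intro nn_integral_cong_AE) auto
    ultimately have "(\<integral>\<^sup>+x\<in>U k. ennreal (w' x) \<partial>lborel) = 0" by simp
    then have "AE x in lborel. ennreal (w' x) * indicator (U k) x = 0"
      by (subst (asm) nn_integral_0_iff_AE) auto
    with eq have "AE x in lborel. x \<in> U k \<longrightarrow> w' x = 0"
    proof eventually_elim
      case (elim x)
      then show ?case using w_nonneg[of x] by (auto simp: ennreal_eq_0_iff)
    qed
    with mk show False by contradiction
  qed
  have 2: "(\<integral>\<^sup>+x\<in>U k. epowr (ennreal (w x)) ?e \<partial>lborel) = top"
  proof (rule ccontr)
    assume fin: "\<not> ?thesis"
    have "(\<integral>\<^sup>+x\<in>U k. epowr (ennreal (w x)) ?e \<partial>lborel) = (\<integral>\<^sup>+x\<in>U k. epowr (ennreal (w' x)) ?e \<partial>lborel)"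
      using eq by (intro nn_integral_cong_AE) auto
    with fin have "AE x in lborel. epowr (ennreal (w' x)) ?e * indicator (U k) x \<noteq> \<infinity>"
      by (intro nn_integral_noteq_infinite) auto
    with eq have "AE x in lborel. x \<in> U k \<longrightarrow> 0 < w' x"
    proof eventually_elim
      case (elim x)
      then show ?case using w_nonneg[of x] e by (auto simp: epowr_def ennreal_eq_0_iff split: if_splits)
    qed
    with nk show False by contradiction
  qed
  have "average (U k) (\<lambda>x. ennreal (w x)) \<noteq> 0"
    using 1 U_fin unfolding U_def average_lborel by simp
  moreover have "average (U k) (\<lambda>x. epowr (ennreal (w x)) ?e) = top"
    using 2 U_fin unfolding U_def average_lborel by (simp add: ennreal_top_divide)
  ultimately have "top \<le> average (U k) (\<lambda>x. ennreal (w x)) * epowr (average (U k) (\<lambda>x. epowr (ennreal (w x)) ?e)) (s - 1)"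
    using s by (simp add: ennreal_mult_top)
  also have "\<dots> \<le> (SUP B\<in>{gball mul \<rho> x t | x t. t > 0}.
        average B (\<lambda>x. ennreal (w x)) * epowr (average B (\<lambda>x. epowr (ennreal (w x)) ?e)) (s - 1))"
    by (rule SUP_upper) (auto simp: U_def intro!: exI[of _ "0 :: real^('n::{finite,linorder})"] exI[of _ "real (Suc k)"])
  also have "\<dots> < \<infinity>"
    using w by (simp only: muckenhoupt_def mem_Collect_eq)
  finally show False by simp
qed

text \<open>Weights are Lebesgue measurable, whereas the maximal theorem is stated for Borel functions; a
  modification on a null set changes none of the averages.\<close>

lemma muckenhoupt_weight_borel:
  assumes w: "w \<in> muckenhoupt mul \<rho> s" and s: "1 < s" and pos: "\<And>x. 0 < w' x"
    and [measurable]: "w' \<in> borel_measurable borel" and eq: "AE x in lborel. w x = w' x"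
  shows "\<exists>K. balls.muckenhoupt_weight s K w'"
proof -
  let ?e = "- 1 / (s - 1)"
  define Q where "Q B = average B (\<lambda>x. ennreal (w x)) * epowr (average B (\<lambda>x. epowr (ennreal (w x)) ?e)) (s - 1)" for B
  have "(SUP B\<in>{gball mul \<rho> x t | x t. t > 0}. Q B) < top"
    using w by (simp add: muckenhoupt_def Q_def)
  then obtain K0 where K0: "(SUP B\<in>{gball mul \<rho> x t | x t. t > 0}. Q B) = ennreal K0" "0 \<le> K0"
    by (cases "SUP B\<in>{gball mul \<rho> x t | x t. t > 0}. Q B") auto
  have Q: "Q (gball mul \<rho> x t) \<le> ennreal (K0 + 1)" if "0 < t" for x t
  proof -
    have "Q (gball mul \<rho> x t) \<le> ennreal K0"
      unfolding K0(1)[symmetric] using that by (intro SUP_upper) auto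
    also have "\<dots> \<le> ennreal (K0 + 1)" by (intro ennreal_leI) simp
    finally show ?thesis .
  qed
  have "balls.muckenhoupt_weight s (K0 + 1) w'"
    unfolding balls.muckenhoupt_weight_def
  proof (intro conjI allI ballI pos)
    show "0 < K0 + 1" using K0 by simp
    show "w' \<in> borel_measurable lborel" by simp
    fix i assume i: "i \<in> ball_index"
    then have t: "0 < snd i" by (auto simp: ball_index_def)
    define V where "V = gball mul \<rho> (fst i) (snd i)"
    define n where "n = emeasure lborel V"
    have n: "0 < n" "n < top"
      using t unit_volume_pos by (auto simp: n_def V_def emeasure_gball)
    define W S where "W = (\<integral>\<^sup>+y\<in>V. ennreal (w' y) \<partial>lborel)" and "S = (\<integral>\<^sup>+y\<in>V. ennreal (w' y powr ?e) \<partial>lborel)"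
    have W: "W / n = average V (\<lambda>x. ennreal (w x))"
      unfolding W_def V_def average_lborel n_def using eq
      by (intro arg_cong2[where f = "(/)"] nn_integral_cong_AE refl) auto
    have S: "S / n = average V (\<lambda>x. epowr (ennreal (w x)) ?e)"
    proof -
      have "S = (\<integral>\<^sup>+y\<in>V. epowr (ennreal (w y)) ?e \<partial>lborel)"
        unfolding S_def
      proof (rule nn_integral_cong_AE)
        show "AE y in lborel. ennreal (w' y powr ?e) * indicator V y = epowr (ennreal (w y)) ?e * indicator V y"
          using eq by eventually_elim (use pos in \<open>simp add: epowr_ennreal_pos\<close>)
      qed
      then show ?thesis unfolding V_def average_lborel n_def by simp
    qed
    have "W / n * epowr (S / n) (s - 1) \<le> ennreal (K0 + 1)"
      unfolding W S using Q[OF t, of "fst i"] by (simp add: Q_def V_def)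
    then have "(W / n * epowr (S / n) (s - 1)) * epowr n s \<le> ennreal (K0 + 1) * epowr n s"
      by (rule mult_right_mono) simp
    also have "(W / n * epowr (S / n) (s - 1)) * epowr n s = (W / n * n) * epowr (S / n * n) (s - 1)"
      using s epowr_add[of "1" "s - 1" n] by (simp add: epowr_mult mult_ac)
    also have "W / n * n = W" using n by (simp add: ennreal_divide_times)
    also have "S / n * n = S" using n by (simp add: ennreal_divide_times)
    finally show "(\<integral>\<^sup>+y\<in>gball mul \<rho> (fst i) (snd i). ennreal (w' y) \<partial>lborel) *
       epowr (\<integral>\<^sup>+y\<in>gball mul \<rho> (fst i) (snd i). ennreal (w' y powr (- 1 / (s - 1))) \<partial>lborel) (s - 1)
       \<le> ennreal (K0 + 1) * epowr (emeasure lborel (gball mul \<rho> (fst i) (snd i))) s"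
      by (simp add: W_def S_def V_def n_def)
  qed
  then show ?thesis by blast
qed

theorem maxfn_vector_valued_muckenhoupt:
  assumes w: "w \<in> muckenhoupt mul \<rho> s" and s: "1 < s" and u: "1 < u" and T: "sigma_finite_measure T"
  shows "\<exists>C>0. \<forall>g. case_prod g \<in> borel_measurable (T \<Otimes>\<^sub>M lborel) \<longrightarrow>
    (\<integral>\<^sup>+x. epowr (\<integral>\<^sup>+t. epowr (balls.maxfn (g t) x) u \<partial>T) (s / u) * ennreal (w x) \<partial>lebesgue)
    \<le> ennreal C * (\<integral>\<^sup>+x. epowr (\<integral>\<^sup>+t. epowr (g t x) u \<partial>T) (s / u) * ennreal (w x) \<partial>lebesgue)"
proof -
  have "w \<in> borel_measurable lebesgue" using w by (simp add: muckenhoupt_def weight_def)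
  from completion_ex_borel_measurable_real[OF this]
  obtain w0 where w0: "w0 \<in> borel_measurable lborel" "AE x in lborel. w x = w0 x" by blast
  then have [measurable]: "w0 \<in> borel_measurable borel" by simp
  consider "AE x in lborel. w0 x = 0" | "AE x in lborel. 0 < w0 x"
    using muckenhoupt_zero_or_positive[OF w s _ w0(2)] by auto
  then show ?thesis
  proof cases
    case 1
    with w0(2) have z: "AE x in lborel. w x = 0" by eventually_elim simp
    have "(\<integral>\<^sup>+x. h x * ennreal (w x) \<partial>lebesgue) = 0" for h
    proof -
      have "(\<integral>\<^sup>+x. h x * ennreal (w x) \<partial>lborel) = (\<integral>\<^sup>+x. 0 * ennreal (w x) \<partial>lborel)"
      proof (rule nn_integral_cong_AE)
        show "AE x in lborel. h x * ennreal (w x) = 0 * ennreal (w x)" using z by eventually_elim simp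
      qed
      then show ?thesis by (simp add: nn_integral_completion)
    qed
    then show ?thesis by (intro exI[of _ 1]) simp
  next
    case 2
    define w' where "w' x = (if 0 < w0 x then w0 x else 1)" for x
    have w'_pos: "0 < w' x" for x by (simp add: w'_def)
    have w'_meas [measurable]: "w' \<in> borel_measurable borel" unfolding w'_def by measurable
    have eq: "AE x in lborel. w x = w' x"
      using 2 w0(2) by eventually_elim (simp add: w'_def)
    have swap: "(\<integral>\<^sup>+x. h x * ennreal (w x) \<partial>lebesgue) = (\<integral>\<^sup>+x. h x * ennreal (w' x) \<partial>lborel)" for h
      unfolding nn_integral_completion
    proof (rule nn_integral_cong_AE)
      show "AE x in lborel. h x * ennreal (w x) = h x * ennreal (w' x)" using eq by eventually_elim simp
    qed
    obtain K where "balls.muckenhoupt_weight s K w'"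
      using muckenhoupt_weight_borel[OF w s w'_pos w'_meas eq] by auto
    from balls.maxfn_vector_valued[OF this s u T] show ?thesis unfolding swap .
  qed
qed

end

section \<open>Schwartz functions and convolution\<close>

lemma schwartz_continuous: "f \<in> schwartz \<Longrightarrow> continuous_on UNIV f"
  by (auto simp: schwartz_def intro: smooth_on_continuous)

lemma schwartz_measurable: "f \<in> schwartz \<Longrightarrow> f \<in> borel_measurable borel"
  by (rule borel_measurable_continuous_onI[OF schwartz_continuous])

lemma schwartz_differentiable: "f \<in> schwartz \<Longrightarrow> f differentiable (at x)"
  unfolding schwartz_def smooth_on_def by (force dest: bspec[of _ _ "[]"])

lemma linear_le_sum_Basis:
  fixes D :: "'a::euclidean_space \<Rightarrow> 'b::real_normed_vector"
  assumes "linear D"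
  shows "norm (D h) \<le> (\<Sum>b\<in>Basis. norm (D b)) * norm h"
proof -
  have "D h = D (\<Sum>b\<in>Basis. (h \<bullet> b) *\<^sub>R b)" by (simp add: euclidean_representation)
  also have "\<dots> = (\<Sum>b\<in>Basis. (h \<bullet> b) *\<^sub>R D b)"
    using assms by (simp add: linear_sum linear_cmul)
  also have "norm \<dots> \<le> (\<Sum>b\<in>Basis. norm (D b) * norm h)"
  proof (intro order_trans[OF norm_sum] sum_mono)
    fix b :: 'a assume "b \<in> Basis"
    then have "norm (D b) * \<bar>h \<bullet> b\<bar> \<le> norm (D b) * norm h"
      by (intro mult_left_mono Basis_le_norm) auto
    then show "norm ((h \<bullet> b) *\<^sub>R D b) \<le> norm (D b) * norm h"
      by (simp add: mult.commute)
  qed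
  finally show ?thesis by (simp add: sum_distrib_right)
qed

lemma schwartz_lipschitz:
  assumes f: "f \<in> schwartz"
  shows "\<exists>C\<ge>0. \<forall>x y. norm (f x - f y) \<le> C * norm (x - y)"
proof -
  have "\<exists>C. \<forall>x. norm (frechet_derivative f (at x) b) \<le> C" if b: "b \<in> Basis" for b
  proof -
    have "[b] \<in> lists Basis" using b by simp
    then obtain C where "\<And>x. (1 + norm x) ^ 0 * norm (iterated_deriv [b] f x) \<le> C"
      using f unfolding schwartz_def by blast
    then show ?thesis by auto
  qed
  then obtain C where C: "\<And>b x. b \<in> Basis \<Longrightarrow> norm (frechet_derivative f (at x) b) \<le> C b"
    by metis
  have deriv: "(f has_derivative frechet_derivative f (at x)) (at x)" for x
    using schwartz_differentiable[OF f] by (simp add: frechet_derivative_works)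
  have on: "onorm (frechet_derivative f (at x)) \<le> (\<Sum>b\<in>Basis. C b)" for x
  proof (rule onorm_le)
    fix h
    have "norm (frechet_derivative f (at x) h) \<le> (\<Sum>b\<in>Basis. norm (frechet_derivative f (at x) b)) * norm h"
      using deriv by (intro linear_le_sum_Basis has_derivative_linear)
    also have "\<dots> \<le> (\<Sum>b\<in>Basis. C b) * norm h"
      by (intro mult_right_mono sum_mono C) auto
    finally show "norm (frechet_derivative f (at x) h) \<le> (\<Sum>b\<in>Basis. C b) * norm h" .
  qed
  have "norm (f x - f y) \<le> (\<Sum>b\<in>Basis. C b) * norm (x - y)" for x y
    using deriv on by (intro differentiable_bound[of UNIV]) auto
  moreover have "0 \<le> (\<Sum>b\<in>Basis. C b)"
    by (intro sum_nonneg order_trans[OF norm_ge_zero C]) auto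
  ultimately show ?thesis by blast
qed

lemma ennreal_mult3: "0 \<le> x \<Longrightarrow> 0 \<le> y \<Longrightarrow> 0 \<le> z \<Longrightarrow> ennreal (x * (y * z)) = ennreal x * (ennreal y * ennreal z)"
  by (simp add: ennreal_mult)

lemma norm_integral_le_nn_integral: "ennreal (norm (\<integral>x. f x \<partial>M)) \<le> (\<integral>\<^sup>+x. ennreal (norm (f x)) \<partial>M)"
  by (cases "integrable M f") (auto simp: integral_norm_bound_ennreal not_integrable_integral_eq)

context homogeneous_group
begin

lemma conv_lborel:
  assumes [measurable]: "F \<in> borel_measurable borel" "G \<in> borel_measurable borel"
  shows "conv mul F G x = (\<integral>y. F (mul x (- y)) * G y \<partial>lborel)"
  unfolding conv_def by (rule integral_completion) measurable

lemma conv_inverted: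
  assumes [measurable]: "F \<in> borel_measurable borel" "G \<in> borel_measurable borel"
  shows "conv mul F G x = (\<integral>z. F (- z) * G (mul z x) \<partial>lborel)"
proof -
  have "(\<integral>z. F (mul x (- mul z x)) * G (mul z x) \<partial>lborel) = (\<integral>y. F (mul x (- y)) * G y \<partial>lborel)"
    by (rule integral_mul_right[where f = "\<lambda>y. F (mul x (- y)) * G y"]) measurable
  then show ?thesis by (simp add: conv_lborel uminus_mul)
qed

lemma measurable_conv [measurable (raw)]:
  assumes [measurable]: "F \<in> borel_measurable borel" "G \<in> borel_measurable borel"
  shows "conv mul F G \<in> borel_measurable borel"
proof -
  have "(\<lambda>x. \<integral>y. F (mul x (- y)) * G y \<partial>lborel) \<in> borel_measurable borel" by measurable
  moreover have "conv mul F G = (\<lambda>x. \<integral>y. F (mul x (- y)) * G y \<partial>lborel)"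
    by (rule ext, rule conv_lborel) measurable
  ultimately show ?thesis by simp
qed

lemma norm_conv_le:
  assumes [measurable]: "F \<in> borel_measurable borel" "G \<in> borel_measurable borel"
  shows "ennreal (norm (conv mul F G x)) \<le> (\<integral>\<^sup>+y. ennreal (norm (F (mul x (- y)))) * ennreal (norm (G y)) \<partial>lborel)"
  using norm_integral_le_nn_integral[where f = "\<lambda>y. F (mul x (- y)) * G y" and M = lborel]
  by (simp add: conv_lborel norm_mult ennreal_mult)

lemma nn_integral_conv_le:
  assumes [measurable]: "F \<in> borel_measurable borel" "G \<in> borel_measurable borel"
  shows "(\<integral>\<^sup>+x. ennreal (norm (conv mul F G x)) \<partial>lborel)
    \<le> (\<integral>\<^sup>+x. ennreal (norm (F x)) \<partial>lborel) * (\<integral>\<^sup>+x. ennreal (norm (G x)) \<partial>lborel)"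
proof -
  have "(\<integral>\<^sup>+x. ennreal (norm (conv mul F G x)) \<partial>lborel)
      \<le> (\<integral>\<^sup>+x. (\<integral>\<^sup>+y. ennreal (norm (F (mul x (- y)))) * ennreal (norm (G y)) \<partial>lborel) \<partial>lborel)"
    by (intro nn_integral_mono norm_conv_le) measurable
  also have "\<dots> = (\<integral>\<^sup>+y. (\<integral>\<^sup>+x. ennreal (norm (F (mul x (- y)))) * ennreal (norm (G y)) \<partial>lborel) \<partial>lborel)"
    by (rule lborel_pair.Fubini') measurable
  also have "\<dots> = (\<integral>\<^sup>+y. (\<integral>\<^sup>+x. ennreal (norm (F x)) \<partial>lborel) * ennreal (norm (G y)) \<partial>lborel)"
  proof (intro nn_integral_cong)
    fix y
    show "(\<integral>\<^sup>+x. ennreal (norm (F (mul x (- y)))) * ennreal (norm (G y)) \<partial>lborel) =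
        (\<integral>\<^sup>+x. ennreal (norm (F x)) \<partial>lborel) * ennreal (norm (G y))"
      by (subst nn_integral_multc)
        (simp_all add: nn_integral_mul_right[where f = "\<lambda>x. ennreal (norm (F x))"])
  qed
  also have "\<dots> = (\<integral>\<^sup>+x. ennreal (norm (F x)) \<partial>lborel) * (\<integral>\<^sup>+x. ennreal (norm (G x)) \<partial>lborel)"
    by (rule nn_integral_cmult) measurable
  finally show ?thesis .
qed

lemma integrable_conv:
  assumes F: "integrable lborel F" and G: "integrable lborel G"
  shows "integrable lborel (conv mul F G)"
proof (rule integrableI_bounded)
  have [measurable]: "F \<in> borel_measurable borel" "G \<in> borel_measurable borel"
    using F G by (auto dest: borel_measurable_integrable)
  show "conv mul F G \<in> borel_measurable lborel" by measurable
  show "(\<integral>\<^sup>+x. ennreal (norm (conv mul F G x)) \<partial>lborel) < \<infinity>"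
    using F G by (intro le_less_trans[OF nn_integral_conv_le])
      (auto simp: integrable_iff_bounded ennreal_mult_less_top)
qed

lemma conv_assoc:
  assumes F [measurable]: "F \<in> borel_measurable borel" and bdd: "\<And>x. norm (F x) \<le> b"
    and G: "integrable lborel G" and H: "integrable lborel H"
  shows "conv mul (conv mul F G) H x = conv mul F (conv mul G H) x"
proof -
  have [measurable]: "G \<in> borel_measurable borel" "H \<in> borel_measurable borel"
    using G H by (auto dest: borel_measurable_integrable)
  have "0 \<le> b" using bdd[of 0] norm_ge_zero order_trans by blast
  define k where "k v z = F (mul x (- v)) * G (mul v (- z)) * H z" for v z
  have [measurable]: "case_prod k \<in> borel_measurable (lborel \<Otimes>\<^sub>M lborel)"
    unfolding k_def by measurable
  have "integrable (lborel \<Otimes>\<^sub>M lborel) (case_prod k)"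
  proof (rule integrableI_bounded)
    have "(\<integral>\<^sup>+p. ennreal (norm (case_prod k p)) \<partial>(lborel \<Otimes>\<^sub>M lborel)) = (\<integral>\<^sup>+z. (\<integral>\<^sup>+v. ennreal (norm (k v z)) \<partial>lborel) \<partial>lborel)"
      by (subst lborel_pair.nn_integral_snd[symmetric]) (auto simp: case_prod_beta)
    also have "\<dots> \<le> (\<integral>\<^sup>+z. (\<integral>\<^sup>+v. ennreal b * ennreal (norm (H z)) * ennreal (norm (G (mul v (- z)))) \<partial>lborel) \<partial>lborel)"
    proof (intro nn_integral_mono)
      fix z v
      have "norm (k v z) \<le> b * norm (H z) * norm (G (mul v (- z)))"
        using mult_right_mono[OF bdd[of "mul x (- v)"], of "norm (H z) * norm (G (mul v (- z)))"]
        by (simp add: k_def norm_mult mult_ac)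
      then show "ennreal (norm (k v z)) \<le> ennreal b * ennreal (norm (H z)) * ennreal (norm (G (mul v (- z))))"
        using \<open>0 \<le> b\<close> by (simp add: ennreal_leI flip: ennreal_mult)
    qed
    also have "\<dots> = (\<integral>\<^sup>+z. ennreal b * ennreal (norm (H z)) * (\<integral>\<^sup>+v. ennreal (norm (G v)) \<partial>lborel) \<partial>lborel)"
    proof (rule nn_integral_cong)
      fix z
      show "(\<integral>\<^sup>+v. ennreal b * ennreal (norm (H z)) * ennreal (norm (G (mul v (- z)))) \<partial>lborel) =
          ennreal b * ennreal (norm (H z)) * (\<integral>\<^sup>+v. ennreal (norm (G v)) \<partial>lborel)"
        by (subst nn_integral_cmult) (simp_all add: nn_integral_mul_right[where f = "\<lambda>x. ennreal (norm (G x))"])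
    qed
    also have "\<dots> = ennreal b * (\<integral>\<^sup>+z. ennreal (norm (H z)) \<partial>lborel) * (\<integral>\<^sup>+v. ennreal (norm (G v)) \<partial>lborel)"
      by (simp add: nn_integral_cmult nn_integral_multc)
    also have "\<dots> < \<infinity>"
      using G H by (auto simp: integrable_iff_bounded ennreal_mult_less_top)
    finally show "(\<integral>\<^sup>+p. ennreal (norm (case_prod k p)) \<partial>(lborel \<Otimes>\<^sub>M lborel)) < \<infinity>" .
  qed measurable
  from lborel_pair.Fubini_integral[OF this]
  have swap: "(\<integral>z. (\<integral>v. k v z \<partial>lborel) \<partial>lborel) = (\<integral>v. (\<integral>z. k v z \<partial>lborel) \<partial>lborel)" .
  have "conv mul (conv mul F G) H x = (\<integral>z. conv mul F G (mul x (- z)) * H z \<partial>lborel)"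
    by (rule conv_lborel) measurable
  also have "\<dots> = (\<integral>z. (\<integral>v. k v z \<partial>lborel) \<partial>lborel)"
  proof (rule Bochner_Integration.integral_cong[OF refl])
    fix z
    have "(\<integral>v. F (mul x (- v)) * G (mul v (- z)) \<partial>lborel)
        = (\<integral>y. F (mul x (- mul y z)) * G (mul (mul y z) (- z)) \<partial>lborel)"
      by (rule integral_mul_right[where f = "\<lambda>v. F (mul x (- v)) * G (mul v (- z))", symmetric]) measurable
    also have "\<dots> = conv mul F G (mul x (- z))"
      by (simp add: conv_lborel mul_assoc uminus_mul)
    finally show "conv mul F G (mul x (- z)) * H z = (\<integral>v. k v z \<partial>lborel)"
      by (simp add: k_def)
  qed
  also note swap
  also have "(\<integral>v. (\<integral>z. k v z \<partial>lborel) \<partial>lborel) = (\<integral>v. F (mul x (- v)) * conv mul G H v \<partial>lborel)"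
    by (simp add: k_def conv_lborel mult.assoc)
  also have "\<dots> = conv mul F (conv mul G H) x"
    by (rule conv_lborel[symmetric]) measurable
  finally show ?thesis .
qed

lemma measurable_rescale [measurable (raw)]:
  assumes "\<phi> \<in> borel_measurable borel"
  shows "rescale a \<phi> t \<in> borel_measurable borel"
proof -
  have "(\<lambda>x. \<phi> (dilation a (1 / t) x)) \<in> borel_measurable borel"
    by (rule measurable_compose[OF measurable_dilation assms])
  then show ?thesis unfolding rescale_def[abs_def] by simp
qed

lemma measurable_rescale_compose [measurable (raw)]:
  "\<phi> \<in> borel_measurable borel \<Longrightarrow> g \<in> borel_measurable M \<Longrightarrow> (\<lambda>x. rescale a \<phi> t (g x)) \<in> borel_measurable M"
  by (rule measurable_compose[OF _ measurable_rescale])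

lemma nn_integral_rescale:
  assumes t: "0 < t" and [measurable]: "\<phi> \<in> borel_measurable borel" "h \<in> borel_measurable borel"
  shows "(\<integral>\<^sup>+x. h x * ennreal (norm (rescale a \<phi> t x)) \<partial>lborel) = (\<integral>\<^sup>+x. h (dilation a t x) * ennreal (norm (\<phi> x)) \<partial>lborel)"
proof -
  define k where "k z = ennreal (t powr - hom_dim a) * (h (dilation a t z) * ennreal (norm (\<phi> z)))" for z
  have [measurable]: "k \<in> borel_measurable borel" unfolding k_def by measurable
  have "h x * ennreal (norm (rescale a \<phi> t x)) = k (dilation a (1 / t) x)" for x
  proof -
    have "ennreal (norm (rescale a \<phi> t x)) = ennreal (t powr - hom_dim a) * ennreal (norm (\<phi> (dilation a (1 / t) x)))"
      by (simp add: rescale_def norm_mult ennreal_mult')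
    then show ?thesis using t by (simp only: k_def dilation_inverse mult.left_commute)
  qed
  then have "(\<integral>\<^sup>+x. h x * ennreal (norm (rescale a \<phi> t x)) \<partial>lborel) = (\<integral>\<^sup>+x. k (dilation a (1 / t) x) \<partial>lborel)"
    by simp
  also have "\<dots> = ennreal ((1 / t) powr - hom_dim a) * (\<integral>\<^sup>+x. k x \<partial>lborel)"
    using t by (intro nn_integral_dilation) auto
  also have "(\<integral>\<^sup>+x. k x \<partial>lborel) = ennreal (t powr - hom_dim a) * (\<integral>\<^sup>+x. h (dilation a t x) * ennreal (norm (\<phi> x)) \<partial>lborel)"
    unfolding k_def by (rule nn_integral_cmult) measurable
  also have "ennreal ((1 / t) powr - hom_dim a) * (ennreal (t powr - hom_dim a) * (\<integral>\<^sup>+x. h (dilation a t x) * ennreal (norm (\<phi> x)) \<partial>lborel))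
    = ennreal ((1 / t) powr - hom_dim a * t powr - hom_dim a) * (\<integral>\<^sup>+x. h (dilation a t x) * ennreal (norm (\<phi> x)) \<partial>lborel)"
    by (simp add: ennreal_mult mult.assoc)
  also have "(1 / t) powr - hom_dim a * t powr - hom_dim a = 1"
    using t by (simp add: powr_mult[symmetric])
  finally show ?thesis by simp
qed

lemma integral_rescale:
  assumes t: "0 < t" and [measurable]: "\<phi> \<in> borel_measurable borel" "h \<in> borel_measurable borel"
  shows "(\<integral>x. h x * rescale a \<phi> t x \<partial>lborel) = (\<integral>x. h (dilation a t x) * \<phi> x \<partial>lborel)"
proof -
  define k where "k z = of_real (t powr - hom_dim a) * (h (dilation a t z) * \<phi> z)" for z
  have [measurable]: "k \<in> borel_measurable borel" unfolding k_def by measurable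
  have "h x * rescale a \<phi> t x = k (dilation a (1 / t) x)" for x
    using t by (simp add: k_def rescale_def mult_ac)
  then have "(\<integral>x. h x * rescale a \<phi> t x \<partial>lborel) = (\<integral>x. k (dilation a (1 / t) x) \<partial>lborel)"
    by simp
  also have "\<dots> = ((1 / t) powr - hom_dim a) *\<^sub>R (\<integral>x. k x \<partial>lborel)"
    using t by (intro integral_dilation) auto
  also have "(\<integral>x. k x \<partial>lborel) = (t powr - hom_dim a) *\<^sub>R (\<integral>x. h (dilation a t x) * \<phi> x \<partial>lborel)"
    unfolding k_def by (simp add: scaleR_conv_of_real)
  also have "((1 / t) powr - hom_dim a) *\<^sub>R (t powr - hom_dim a) *\<^sub>R (\<integral>x. h (dilation a t x) * \<phi> x \<partial>lborel) =
      ((1 / t) powr - hom_dim a * t powr - hom_dim a) *\<^sub>R (\<integral>x. h (dilation a t x) * \<phi> x \<partial>lborel)"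
    by simp
  also have "(1 / t) powr - hom_dim a * t powr - hom_dim a = 1"
    using t by (simp add: powr_mult[symmetric])
  finally show ?thesis by simp
qed

lemma integrable_rescale:
  assumes t: "0 < t" and \<phi>: "integrable lborel \<phi>"
  shows "integrable lborel (rescale a \<phi> t)"
proof -
  have [measurable]: "\<phi> \<in> borel_measurable borel" using \<phi> by (auto dest: borel_measurable_integrable)
  show ?thesis
    using \<phi> nn_integral_rescale[OF t, of \<phi> "\<lambda>_. 1"] by (auto simp: integrable_iff_bounded)
qed

lemma rescale_rescale: "0 < s \<Longrightarrow> 0 < t \<Longrightarrow> rescale a (rescale a \<phi> s) t = rescale a \<phi> (s * t)"
  by (rule ext) (simp add: rescale_def dilation_dilation powr_mult mult_ac)

lemma conv_rescale:
  assumes s: "0 < s" and [measurable]: "F \<in> borel_measurable borel" "G \<in> borel_measurable borel"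
  shows "conv mul (rescale a F s) (rescale a G s) = rescale a (conv mul F G) s"
proof
  fix x
  have "conv mul (rescale a F s) (rescale a G s) x = (\<integral>y. rescale a F s (mul x (- y)) * rescale a G s y \<partial>lborel)"
    by (rule conv_lborel) measurable
  also have "\<dots> = (\<integral>y. rescale a F s (mul x (- dilation a s y)) * G y \<partial>lborel)"
    by (rule integral_rescale[OF s, where h = "\<lambda>y. rescale a F s (mul x (- y))"]) measurable
  also have "\<dots> = (\<integral>y. of_real (s powr - hom_dim a) * (F (mul (dilation a (1 / s) x) (- y)) * G y) \<partial>lborel)"
  proof (rule Bochner_Integration.integral_cong[OF refl])
    fix y
    have "dilation a (1 / s) (mul x (- dilation a s y)) = mul (dilation a (1 / s) x) (- y)"
      using s by (simp add: dilation_mul dilation_uminus)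
    then show "rescale a F s (mul x (- dilation a s y)) * G y =
        of_real (s powr - hom_dim a) * (F (mul (dilation a (1 / s) x) (- y)) * G y)"
      by (simp add: rescale_def mult.assoc)
  qed
  also have "\<dots> = rescale a (conv mul F G) s x"
    by (simp add: rescale_def conv_lborel)
  finally show "conv mul (rescale a F s) (rescale a G s) x = rescale a (conv mul F G) s x" .
qed

lemma continuous_conv:
  assumes F: "continuous_on UNIV F" and bdd: "\<And>x. norm (F x) \<le> b" and G: "integrable lborel G"
  shows "continuous_on UNIV (conv mul F G)"
proof -
  have [measurable]: "F \<in> borel_measurable borel" "G \<in> borel_measurable borel"
    using G F by (auto dest: borel_measurable_integrable intro: borel_measurable_continuous_onI)
  have "continuous_on UNIV (\<lambda>x. \<integral>y. F (mul x (- y)) * G y \<partial>lborel)"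
    unfolding continuous_on_sequentially
  proof (intro ballI allI impI, unfold o_def)
    fix x and u :: "nat \<Rightarrow> real^('n::{finite,linorder})"
    assume u: "(\<forall>n. u n \<in> UNIV) \<and> u \<longlonglongrightarrow> x"
    show "(\<lambda>n. \<integral>y. F (mul (u n) (- y)) * G y \<partial>lborel) \<longlonglongrightarrow> (\<integral>y. F (mul x (- y)) * G y \<partial>lborel)"
    proof (rule integral_dominated_convergence)
      show "integrable lborel (\<lambda>y. b * norm (G y))" using G by auto
      show "AE y in lborel. (\<lambda>n. F (mul (u n) (- y)) * G y) \<longlonglongrightarrow> F (mul x (- y)) * G y"
      proof (intro AE_I2 tendsto_mult tendsto_const)
        fix y
        have "continuous_on UNIV (\<lambda>x. F (mul x (- y)))"
          by (intro continuous_on_compose2[OF F] continuous_intros) auto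
        then show "(\<lambda>n. F (mul (u n) (- y))) \<longlonglongrightarrow> F (mul x (- y))"
          using u by (auto simp: continuous_on_sequentially o_def)
      qed
      show "AE y in lborel. norm (F (mul (u n) (- y)) * G y) \<le> b * norm (G y)" for n
        using bdd by (intro AE_I2) (auto simp: norm_mult intro!: mult_right_mono)
    qed measurable
  qed
  then show ?thesis by (simp add: conv_lborel cong: continuous_on_cong)
qed

text \<open>On the unit ball the multiplication is Lipschitz by compactness; dilations carry this to
  the whole group at the cost of polynomial factors.\<close>

lemma mul_lipschitz_unit_ball:
  "\<exists>C\<ge>0. \<forall>x y. norm x \<le> 1 \<longrightarrow> norm y \<le> 1 \<longrightarrow> norm (mul x y - x) \<le> C * norm y"
proof -
  let ?m = "\<lambda>p. mul (fst p) (snd p)"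
  let ?D = "\<lambda>p. frechet_derivative ?m (at p)"
  let ?K = "cball (0::real^('n::{finite,linorder})) 1 \<times> cball (0::real^('n::{finite,linorder})) 1"
  have sm: "smooth_on UNIV ?m" using smooth_mul by (simp add: case_prod_beta')
  have deriv: "(?m has_derivative ?D p) (at p)" for p
  proof -
    have "[] \<in> lists (Basis :: ((real^('n::{finite,linorder})) \<times> (real^('n::{finite,linorder}))) set)" by simp
    with sm have "iterated_deriv [] ?m differentiable (at p)"
      unfolding smooth_on_def by blast
    then show ?thesis by (simp add: frechet_derivative_works)
  qed
  have "\<forall>b\<in>Basis. \<exists>C. \<forall>p\<in>?K. norm (?D p b) \<le> C"
  proof
    fix b :: "(real^('n::{finite,linorder})) \<times> (real^('n::{finite,linorder}))" assume b: "b \<in> Basis"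
    have "[b] \<in> lists Basis" using b by simp
    with sm have "\<forall>p. iterated_deriv [b] ?m differentiable (at p)"
      unfolding smooth_on_def by blast
    then have "\<forall>p. (\<lambda>p. ?D p b) differentiable (at p)" by simp
    then have "continuous_on ?K (\<lambda>p. ?D p b)"
      by (intro differentiable_imp_continuous_on) (auto simp: differentiable_on_def differentiable_at_withinI)
    then have "compact ((\<lambda>p. ?D p b) ` ?K)"
      by (intro compact_continuous_image compact_Times compact_cball)
    then have "bounded ((\<lambda>p. ?D p b) ` ?K)" by (rule compact_imp_bounded)
    then obtain c where c: "\<forall>y\<in>(\<lambda>p. ?D p b) ` ?K. norm y \<le> c" unfolding bounded_iff ..
    then have "norm (?D p b) \<le> c" if "p \<in> ?K" for p
      by (rule bspec) (rule imageI[OF that])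
    then show "\<exists>C. \<forall>p\<in>?K. norm (?D p b) \<le> C" by (intro exI ballI)
  qed
  from bchoice[OF this] obtain C where all: "\<forall>b\<in>Basis. \<forall>p\<in>?K. norm (?D p b) \<le> C b" ..
  have C: "norm (?D p b) \<le> C b" if "b \<in> Basis" "p \<in> ?K" for b p
  proof -
    from all that(1) have "\<forall>p\<in>?K. norm (?D p b) \<le> C b" by (rule bspec)
    then show ?thesis using that(2) by (rule bspec)
  qed
  define S where "S = (\<Sum>b\<in>Basis. \<bar>C b\<bar>)"
  have "norm (mul x y - x) \<le> S * norm y" if x: "norm x \<le> 1" and y: "norm y \<le> 1" for x y
  proof -
    have d: "((\<lambda>y. mul x y) has_derivative (\<lambda>h. ?D (x, z) (0, h))) (at z within cball 0 1)" for z
    proof -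
      have "((\<lambda>y. (x, y)) has_derivative (\<lambda>h. (0, h))) (at z within cball 0 1)"
        by (auto intro!: derivative_eq_intros)
      from has_derivative_compose[OF this deriv] show ?thesis by simp
    qed
    have "norm (mul x y - mul x 0) \<le> S * norm (y - 0)"
    proof (rule differentiable_bound[OF convex_cball d])
      fix z :: "real^('n::{finite,linorder})" assume z: "z \<in> cball 0 1"
      show "onorm (\<lambda>h. ?D (x, z) (0, h)) \<le> S"
      proof (rule onorm_le)
        fix h :: "real^('n::{finite,linorder})"
        have "norm (?D (x, z) (0, h)) \<le> (\<Sum>b\<in>Basis. norm (?D (x, z) b)) * norm (0 :: real^('n::{finite,linorder}), h)"
          using deriv by (intro linear_le_sum_Basis has_derivative_linear)
        also have "\<dots> \<le> S * norm h"
          unfolding S_def using x z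
          by (intro mult_mono sum_mono order_trans[OF C abs_ge_self]) (auto simp: sum_nonneg norm_Pair)
        finally show "norm (?D (x, z) (0, h)) \<le> S * norm h" .
      qed
    qed (use y in auto)
    then show ?thesis by simp
  qed
  moreover have "0 \<le> S" by (simp add: S_def sum_nonneg)
  ultimately show ?thesis by blast
qed

end

context norm_function
begin

lemma norm_mul_minus_le:
  "\<exists>C\<ge>0. \<forall>x y. norm (mul x (- y) - x) \<le> C * ((1 + \<rho> x) powr hom_dim a * (1 + \<rho> y) powr hom_dim a * \<rho> y)"
proof -
  obtain C where C: "0 \<le> C" "\<And>x y. norm x \<le> 1 \<Longrightarrow> norm y \<le> 1 \<Longrightarrow> norm (mul x y - x) \<le> C * norm y"
    using mul_lipschitz_unit_ball by blast
  have "norm (mul x (- y) - x) \<le> C * ((1 + \<rho> x) powr hom_dim a * (1 + \<rho> y) powr hom_dim a * \<rho> y)" for x y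
  proof -
    define R where "R = (1 + \<rho> x) * (1 + \<rho> y)"
    have Rx: "1 + \<rho> x \<le> R" and Ry: "1 + \<rho> y \<le> R"
      using mult_left_mono[of 1 "1 + \<rho> y" "1 + \<rho> x"] mult_right_mono[of 1 "1 + \<rho> x" "1 + \<rho> y"]
      by (auto simp: R_def)
    have R: "1 \<le> R" using Rx rho_nonneg[of x] by linarith
    then have R0: "0 < R" by simp
    define x' y' where "x' = dilation a (1 / R) x" and "y' = dilation a (1 / R) y"
    have x: "x = dilation a R x'" and y: "y = dilation a R y'" using R0 by (simp_all add: x'_def y'_def)
    have "\<rho> x' \<le> 1" "\<rho> y' \<le> 1"
      using rho_dilation[of "1 / R"] R0 Rx Ry by (auto simp: x'_def y'_def)
    then have nx: "norm x' \<le> 1" and ny: "norm y' \<le> 1" using rho_le_1 by auto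
    have "mul x (- y) - x = dilation a R (mul x' (- y') - x')"
      using R0 unfolding x y
      by (simp add: dilation_mul dilation_uminus linear_diff[OF linear_dilation])
    then have "norm (mul x (- y) - x) \<le> R powr hom_dim a * norm (mul x' (- y') - x')"
      using norm_dilation_ge_1[OF R] by simp
    also have "\<dots> \<le> R powr hom_dim a * (C * norm (- y'))"
      using nx ny by (intro mult_left_mono C(2)) auto
    also have "\<dots> \<le> R powr hom_dim a * (C * \<rho> y)"
    proof (intro mult_left_mono)
      have "norm y' \<le> \<rho> y'" using \<open>\<rho> y' \<le> 1\<close> by (rule norm_le_rho)
      also have "\<dots> = \<rho> y / R" using rho_dilation[of "1 / R" y] R0 by (simp add: y'_def)
      also have "\<dots> \<le> \<rho> y / 1" using R by (intro divide_left_mono) auto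
      finally show "norm (- y') \<le> \<rho> y" by simp
    qed (use C in auto)
    also have "R powr hom_dim a = (1 + \<rho> x) powr hom_dim a * (1 + \<rho> y) powr hom_dim a"
      by (simp add: R_def powr_mult)
    finally show ?thesis by (simp add: mult_ac)
  qed
  with C(1) show ?thesis by blast
qed

text \<open>Decay is measured in terms of \<open>\<rho>\<close>, which is adapted to convolution and dilations.\<close>

definition rapid :: "(real^('n::{finite,linorder}) \<Rightarrow> complex) \<Rightarrow> bool" where
  "rapid f \<longleftrightarrow> f \<in> borel_measurable borel \<and>
     (\<forall>L\<ge>0. \<exists>C\<ge>0. \<forall>x. norm (f x) \<le> C * (1 + \<rho> x) powr - L)"

lemma one_plus_rho_pos [simp]: "0 < 1 + \<rho> x" "1 + \<rho> x \<noteq> 0"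
  using rho_nonneg[of x] by linarith+

lemma one_plus_rho_le_norm: "1 + \<rho> x \<le> 2 * (1 + norm x)"
proof -
  have "1 + \<rho> x \<le> 1 + (1 + norm x)" using rho_le_norm by (rule add_left_mono)
  also have "\<dots> \<le> 2 * (1 + norm x)" using norm_ge_zero[of x] by (simp add: algebra_simps)
  finally show ?thesis .
qed

lemma schwartz_rapid:
  assumes f: "f \<in> schwartz" shows "rapid f"
  unfolding rapid_def
proof (intro conjI allI impI)
  show "f \<in> borel_measurable borel" using f by (rule schwartz_measurable)
  fix L :: real assume L: "0 \<le> L"
  obtain k :: nat where k: "L \<le> real k" using real_arch_simple by blast
  have "[] \<in> lists Basis" by simp
  then obtain C where C: "\<And>x. (1 + norm x) ^ k * norm (iterated_deriv [] f x) \<le> C"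
    using f unfolding schwartz_def by blast
  have "norm (f x) \<le> (C * 2 ^ k) * (1 + \<rho> x) powr - L" for x
  proof -
    note le = one_plus_rho_le_norm[of x]
    have "(1 + \<rho> x) powr L \<le> (1 + \<rho> x) powr real k"
      using k by (intro powr_mono) auto
    also have "\<dots> = (1 + \<rho> x) ^ k" by (rule powr_realpow) (simp add: add_pos_nonneg)
    also have "\<dots> \<le> (2 * (1 + norm x)) ^ k"
      using le by (intro power_mono) auto
    finally have "(1 + \<rho> x) powr L * norm (f x) \<le> (2 * (1 + norm x)) ^ k * norm (f x)"
      by (rule mult_right_mono) simp
    also have "\<dots> = 2 ^ k * ((1 + norm x) ^ k * norm (f x))" by (simp only: power_mult_distrib mult.assoc)
    also have "\<dots> \<le> 2 ^ k * C" using C[of x] by (intro mult_left_mono) auto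
    finally show ?thesis
      by (simp add: powr_minus_divide pos_le_divide_eq mult.commute)
  qed
  moreover have "0 \<le> C * 2 ^ k"
    using order_trans[OF _ C[of 0]] by simp
  ultimately show "\<exists>C\<ge>0. \<forall>x. norm (f x) \<le> C * (1 + \<rho> x) powr - L" by blast
qed

lemma rapid_measurable: "rapid f \<Longrightarrow> f \<in> borel_measurable borel"
  by (simp add: rapid_def)

lemma rapidD: "rapid f \<Longrightarrow> 0 \<le> L \<Longrightarrow> \<exists>C\<ge>0. \<forall>x. norm (f x) \<le> C * (1 + \<rho> x) powr - L"
  by (simp add: rapid_def)

lemma rapid_bounded: "rapid f \<Longrightarrow> \<exists>b\<ge>0. \<forall>x. norm (f x) \<le> b"
  using rapidD[of f 0] by (auto simp: add_nonneg_eq_0_iff)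

lemma rapid_moment:
  assumes f: "rapid f" and A: "0 \<le> A"
  shows "(\<integral>\<^sup>+x. ennreal ((1 + \<rho> x) powr A) * ennreal (norm (f x)) \<partial>lborel) < top"
proof -
  define L where "L = A + hom_dim a + 1"
  have "0 \<le> L" using A hom_dim_ge_1 by (simp add: L_def)
  from rapidD[OF f this] obtain C where C: "0 \<le> C" "\<And>x. norm (f x) \<le> C * (1 + \<rho> x) powr - L" by blast
  have "(\<integral>\<^sup>+x. ennreal ((1 + \<rho> x) powr A) * ennreal (norm (f x)) \<partial>lborel)
      \<le> (\<integral>\<^sup>+x. ennreal C * ennreal ((1 + \<rho> x) powr - (hom_dim a + 1)) \<partial>lborel)"
  proof (rule nn_integral_mono)
    fix x
    have "(1 + \<rho> x) powr A * norm (f x) \<le> (1 + \<rho> x) powr A * (C * (1 + \<rho> x) powr - L)"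
      by (intro mult_left_mono C) simp
    also have "\<dots> = C * (1 + \<rho> x) powr (A + - L)"
      by (simp add: powr_add del: add_uminus_conv_diff)
    also have "A + - L = - (hom_dim a + 1)" by (simp add: L_def)
    finally show "ennreal ((1 + \<rho> x) powr A) * ennreal (norm (f x)) \<le> ennreal C * ennreal ((1 + \<rho> x) powr - (hom_dim a + 1))"
      using C(1) by (simp add: ennreal_leI flip: ennreal_mult)
  qed
  also have "\<dots> = ennreal C * (\<integral>\<^sup>+x. ennreal ((1 + \<rho> x) powr - (hom_dim a + 1)) \<partial>lborel)"
    by (rule nn_integral_cmult) measurable
  also have "\<dots> < top"
    using nn_integral_rho_decay[of "hom_dim a + 1"] by (simp add: ennreal_mult_less_top)
  finally show ?thesis .
qed

lemma rapid_integrable: "rapid f \<Longrightarrow> integrable lborel f"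
  using rapid_moment[of f 0] rapid_measurable[of f]
  by (auto simp: integrable_iff_bounded add_nonneg_eq_0_iff)

text \<open>The increments under right translations are controlled by the geometric mean of a
  Lipschitz bound, which is small in \<open>y\<close>, and of the rapid decay.\<close>

lemma schwartz_increment:
  assumes \<eta>: "\<eta> \<in> schwartz" and L: "0 \<le> L"
  shows "\<exists>C\<ge>0. \<forall>x y. norm (\<eta> (mul x (- y)) - \<eta> x)
    \<le> C * (\<rho> y powr (1/2) * (1 + \<rho> y) powr (hom_dim a + L) * (1 + \<rho> x) powr - L)"
proof -
  let ?g = "hom_dim a"
  define L' where "L' = 2 * L + ?g"
  have L': "0 \<le> L'" using L hom_dim_ge_1 by (simp add: L'_def)
  obtain C1 where C1: "0 \<le> C1" "\<And>x y. norm (\<eta> x - \<eta> y) \<le> C1 * norm (x - y)"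
    using schwartz_lipschitz[OF \<eta>] by blast
  obtain C2 where C2: "0 \<le> C2" "\<And>x y. norm (mul x (- y) - x) \<le> C2 * ((1 + \<rho> x) powr ?g * (1 + \<rho> y) powr ?g * \<rho> y)"
    using norm_mul_minus_le by blast
  obtain C3 where C3: "0 \<le> C3" "\<And>x. norm (\<eta> x) \<le> C3 * (1 + \<rho> x) powr - L'"
    using rapidD[OF schwartz_rapid[OF \<eta>] L'] by blast
  define C4 where "C4 = C3 * (c\<^sub>0 powr L' + 1)"
  have C4: "0 \<le> C4" using C3 by (simp add: C4_def)
  have main: "norm (\<eta> (mul x (- y)) - \<eta> x) \<le> sqrt (C1 * C2 * C4) * (\<rho> y powr (1/2) * (1 + \<rho> y) powr (?g + L) * (1 + \<rho> x) powr - L)" for x y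
  proof -
    define d where "d = norm (\<eta> (mul x (- y)) - \<eta> x)"
    define X Y where "X = 1 + \<rho> x" and "Y = 1 + \<rho> y"
    have XY: "1 \<le> X" "1 \<le> Y" by (auto simp: X_def Y_def)
    have "d \<le> C1 * norm (mul x (- y) - x)" unfolding d_def by (rule C1)
    also have "\<dots> \<le> C1 * (C2 * (X powr ?g * Y powr ?g * \<rho> y))"
      unfolding X_def Y_def by (intro mult_left_mono C2 C1)
    finally have d1: "d \<le> C1 * C2 * (X powr ?g * Y powr ?g * \<rho> y)" by (simp add: mult.assoc)
    have "d \<le> norm (\<eta> (mul x (- y))) + norm (\<eta> x)" unfolding d_def by (rule norm_triangle_ineq4)
    also have "norm (\<eta> (mul x (- y))) \<le> C3 * (c\<^sub>0 powr L' * Y powr L' * X powr - L')"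
    proof -
      define Z where "Z = 1 + \<rho> (mul x (- y))"
      have Z: "0 < Z" by (simp add: Z_def add_pos_nonneg)
      have "X \<le> c\<^sub>0 * (Z * Y)"
        using one_plus_rho_mul[of 1 "mul x (- y)" y] by (simp add: X_def Y_def Z_def mul_assoc)
      then have "X powr L' \<le> (c\<^sub>0 * (Z * Y)) powr L'"
        using XY L' by (intro powr_mono2) auto
      also have "\<dots> = c\<^sub>0 powr L' * (Z powr L' * Y powr L')"
        using c\<^sub>0(1) XY Z by (simp add: powr_mult)
      finally have "Z powr - L' \<le> c\<^sub>0 powr L' * Y powr L' * X powr - L'"
        using XY Z by (simp add: powr_minus field_simps)
      then have "C3 * Z powr - L' \<le> C3 * (c\<^sub>0 powr L' * Y powr L' * X powr - L')"
        using C3(1) by (intro mult_left_mono)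
      with C3(2)[of "mul x (- y)"] show ?thesis by (simp add: Z_def)
    qed
    also have "norm (\<eta> x) \<le> C3 * (1 * Y powr L' * X powr - L')"
    proof -
      have "1 \<le> Y powr L'" using XY L' by (auto intro: ge_one_powr_ge_zero)
      then have "C3 * (1 * X powr - L') \<le> C3 * (Y powr L' * X powr - L')"
        using C3(1) XY by (intro mult_left_mono mult_right_mono) auto
      with C3(2)[of x] show ?thesis by (simp add: X_def)
    qed
    finally have d2: "d \<le> C4 * (Y powr L' * X powr - L')"
      by (simp add: C4_def algebra_simps)
    have "d * d \<le> (C1 * C2 * (X powr ?g * Y powr ?g * \<rho> y)) * (C4 * (Y powr L' * X powr - L'))"
      using d1 d2 C1 C2 C4 XY by (intro mult_mono) (auto simp: d_def)
    also have "\<dots> = (C1 * C2 * C4) * (\<rho> y * (Y powr ?g * Y powr L') * (X powr ?g * X powr - L'))"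
      by (simp add: mult_ac)
    also have "Y powr ?g * Y powr L' = (Y powr (?g + L))\<^sup>2"
      using XY by (simp add: L'_def power2_eq_square powr_add[symmetric])
    also have "X powr ?g * X powr - L' = (X powr - L)\<^sup>2"
      using XY by (simp add: L'_def power2_eq_square powr_add[symmetric])
    finally have "d\<^sup>2 \<le> (C1 * C2 * C4) * (\<rho> y * (Y powr (?g + L))\<^sup>2 * (X powr - L)\<^sup>2)"
      by (simp add: power2_eq_square)
    then have "sqrt (d\<^sup>2) \<le> sqrt ((C1 * C2 * C4) * (\<rho> y * (Y powr (?g + L))\<^sup>2 * (X powr - L)\<^sup>2))"
      by (rule real_sqrt_le_mono)
    then show ?thesis
      by (simp add: d_def[symmetric] X_def[symmetric] Y_def[symmetric] real_sqrt_mult powr_half_sqrt)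
  qed
  show ?thesis
    by (rule exI[of _ "sqrt (C1 * C2 * C4)"]) (use main C1 C2 C4 in auto)
qed

text \<open>As the integral of \<open>\<psi>\<close> vanishes, \<open>\<eta> (x y\<^sup>-\<^sup>1)\<close> may be replaced by its increment
  \<open>\<eta> (x y\<^sup>-\<^sup>1) - \<eta> x\<close>, which is small at the distances \<open>\<rho> y \<approx> t\<close> where \<open>\<psi>\<^sub>t\<close> lives.\<close>

lemma conv_rescale_small:
  assumes \<eta>: "\<eta> \<in> schwartz" and \<psi>: "rapid \<psi>" and mean: "(\<integral>x. \<psi> x \<partial>lborel) = 0" and L: "0 \<le> L"
  shows "\<exists>C\<ge>0. \<forall>t x. 0 < t \<longrightarrow> t \<le> 1 \<longrightarrow>
    norm (conv mul \<eta> (rescale a \<psi> t) x) \<le> C * (t powr (1/2) * (1 + \<rho> x) powr - L)"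
proof -
  have [measurable]: "\<eta> \<in> borel_measurable borel" "\<psi> \<in> borel_measurable borel"
    using \<eta> \<psi> by (auto intro: schwartz_measurable rapid_measurable)
  define A where "A = hom_dim a + L"
  have A: "0 \<le> A" using L hom_dim_ge_1 by (simp add: A_def)
  obtain C1 where C1: "0 \<le> C1" "\<And>x y. norm (\<eta> (mul x (- y)) - \<eta> x) \<le> C1 * (\<rho> y powr (1/2) * (1 + \<rho> y) powr A * (1 + \<rho> x) powr - L)"
    using schwartz_increment[OF \<eta> L] unfolding A_def by blast
  obtain b where b: "\<And>x. norm (\<eta> x) \<le> b" using rapid_bounded[OF schwartz_rapid[OF \<eta>]] by blast
  obtain J where J: "(\<integral>\<^sup>+x. ennreal ((1 + \<rho> x) powr (A + 1/2)) * ennreal (norm (\<psi> x)) \<partial>lborel) = ennreal J" "0 \<le> J"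
    using rapid_moment[OF \<psi>, of "A + 1/2"] A
    by (cases "\<integral>\<^sup>+x. ennreal ((1 + \<rho> x) powr (A + 1/2)) * ennreal (norm (\<psi> x)) \<partial>lborel") auto
  have "norm (conv mul \<eta> (rescale a \<psi> t) x) \<le> (C1 * J) * (t powr (1/2) * (1 + \<rho> x) powr - L)"
    if t: "0 < t" "t \<le> 1" for t x
  proof -
    have \<psi>t: "integrable lborel (rescale a \<psi> t)"
      using t rapid_integrable[OF \<psi>] by (intro integrable_rescale)
    have zero: "(\<integral>y. rescale a \<psi> t y \<partial>lborel) = 0"
      using integral_rescale[OF t(1), of \<psi> "\<lambda>_. 1"] mean by simp
    have i1: "integrable lborel (\<lambda>y. \<eta> (mul x (- y)) * rescale a \<psi> t y)"
      by (rule Bochner_Integration.integrable_bound[OF integrable_mult_right[OF integrable_norm[OF \<psi>t], of b]])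
        (use b in \<open>auto simp: norm_mult abs_mult intro!: AE_I2 mult_right_mono order_trans[OF _ abs_ge_self]\<close>)
    have "conv mul \<eta> (rescale a \<psi> t) x = (\<integral>y. \<eta> (mul x (- y)) * rescale a \<psi> t y \<partial>lborel) - (\<integral>y. \<eta> x * rescale a \<psi> t y \<partial>lborel)"
      using zero by (simp add: conv_lborel)
    also have "\<dots> = (\<integral>y. (\<eta> (mul x (- y)) - \<eta> x) * rescale a \<psi> t y \<partial>lborel)"
      using i1 \<psi>t by (simp add: left_diff_distrib)
    finally have eq: "conv mul \<eta> (rescale a \<psi> t) x = (\<integral>y. (\<eta> (mul x (- y)) - \<eta> x) * rescale a \<psi> t y \<partial>lborel)" .
    have "ennreal (norm (conv mul \<eta> (rescale a \<psi> t) x))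
        \<le> (\<integral>\<^sup>+y. ennreal (norm ((\<eta> (mul x (- y)) - \<eta> x) * rescale a \<psi> t y)) \<partial>lborel)"
      unfolding eq by (rule norm_integral_le_nn_integral)
    also have "\<dots> \<le> (\<integral>\<^sup>+y. ennreal (C1 * (1 + \<rho> x) powr - L) * (ennreal (\<rho> y powr (1/2) * (1 + \<rho> y) powr A) * ennreal (norm (rescale a \<psi> t y))) \<partial>lborel)"
    proof (rule nn_integral_mono)
      fix y
      have "norm ((\<eta> (mul x (- y)) - \<eta> x) * rescale a \<psi> t y) \<le>
          C1 * (\<rho> y powr (1/2) * (1 + \<rho> y) powr A * (1 + \<rho> x) powr - L) * norm (rescale a \<psi> t y)"
        unfolding norm_mult by (intro mult_right_mono C1) simp
      also have "\<dots> = (C1 * (1 + \<rho> x) powr - L) * ((\<rho> y powr (1/2) * (1 + \<rho> y) powr A) * norm (rescale a \<psi> t y))"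
        by (simp add: mult_ac)
      finally have "ennreal (norm ((\<eta> (mul x (- y)) - \<eta> x) * rescale a \<psi> t y)) \<le>
          ennreal ((C1 * (1 + \<rho> x) powr - L) * ((\<rho> y powr (1/2) * (1 + \<rho> y) powr A) * norm (rescale a \<psi> t y)))"
        by (rule ennreal_leI)
      also have "\<dots> = ennreal (C1 * (1 + \<rho> x) powr - L) * (ennreal (\<rho> y powr (1/2) * (1 + \<rho> y) powr A) * ennreal (norm (rescale a \<psi> t y)))"
        using C1(1) by (intro ennreal_mult3) auto
      finally show "ennreal (norm ((\<eta> (mul x (- y)) - \<eta> x) * rescale a \<psi> t y)) \<le>
        ennreal (C1 * (1 + \<rho> x) powr - L) * (ennreal (\<rho> y powr (1/2) * (1 + \<rho> y) powr A) * ennreal (norm (rescale a \<psi> t y)))" .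
    qed
    also have "\<dots> = ennreal (C1 * (1 + \<rho> x) powr - L) * (\<integral>\<^sup>+y. ennreal (\<rho> y powr (1/2) * (1 + \<rho> y) powr A) * ennreal (norm (rescale a \<psi> t y)) \<partial>lborel)"
      by (rule nn_integral_cmult) measurable
    also have "(\<integral>\<^sup>+y. ennreal (\<rho> y powr (1/2) * (1 + \<rho> y) powr A) * ennreal (norm (rescale a \<psi> t y)) \<partial>lborel)
      = (\<integral>\<^sup>+y. ennreal (\<rho> (dilation a t y) powr (1/2) * (1 + \<rho> (dilation a t y)) powr A) * ennreal (norm (\<psi> y)) \<partial>lborel)"
      by (rule nn_integral_rescale[OF t(1)]) measurable
    also have "\<dots> \<le> (\<integral>\<^sup>+y. ennreal (t powr (1/2)) * (ennreal ((1 + \<rho> y) powr (A + 1/2)) * ennreal (norm (\<psi> y))) \<partial>lborel)"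
    proof (rule nn_integral_mono)
      fix y
      have "\<rho> (dilation a t y) powr (1/2) * (1 + \<rho> (dilation a t y)) powr A =
          t powr (1/2) * (\<rho> y powr (1/2) * (1 + t * \<rho> y) powr A)"
        using t by (simp add: rho_dilation powr_mult)
      also have "\<dots> \<le> t powr (1/2) * ((1 + \<rho> y) powr (1/2) * (1 + \<rho> y) powr A)"
        using t A by (intro mult_left_mono mult_mono powr_mono2) (auto simp: mult_left_le_one_le)
      also have "\<dots> = t powr (1/2) * (1 + \<rho> y) powr (A + 1/2)"
        by (simp add: powr_add[symmetric] add.commute)
      finally have "ennreal (\<rho> (dilation a t y) powr (1/2) * (1 + \<rho> (dilation a t y)) powr A) \<le>
          ennreal (t powr (1/2)) * ennreal ((1 + \<rho> y) powr (A + 1/2))"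
        by (simp add: ennreal_leI flip: ennreal_mult)
      then show "ennreal (\<rho> (dilation a t y) powr (1/2) * (1 + \<rho> (dilation a t y)) powr A) * ennreal (norm (\<psi> y)) \<le>
          ennreal (t powr (1/2)) * (ennreal ((1 + \<rho> y) powr (A + 1/2)) * ennreal (norm (\<psi> y)))"
        unfolding mult.assoc[symmetric] by (rule mult_right_mono) simp
    qed
    also have "\<dots> = ennreal (t powr (1/2)) * ennreal J"
      unfolding J(1)[symmetric] by (rule nn_integral_cmult) measurable
    finally have "ennreal (norm (conv mul \<eta> (rescale a \<psi> t) x)) \<le> ennreal (C1 * (1 + \<rho> x) powr - L * (t powr (1/2) * J))"
      using C1(1) J(2) by (simp add: mult_left_mono ennreal_mult''[symmetric] ennreal_mult'[symmetric])
    then show ?thesis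
      using C1 J by (subst (asm) ennreal_le_iff) (auto simp: mult_ac)
  qed
  with C1 J show ?thesis by (intro exI[of _ "C1 * J"]) auto
qed

lemma conv_rescale_large:
  assumes f: "rapid f" and \<phi>: "rapid \<phi>"
  shows "\<exists>C\<ge>0. \<forall>t x. 0 < t \<longrightarrow> norm (conv mul f (rescale a \<phi> t) x) \<le> C * t powr - hom_dim a"
proof -
  have [measurable]: "f \<in> borel_measurable borel" "\<phi> \<in> borel_measurable borel"
    using f \<phi> by (auto intro: rapid_measurable)
  obtain b where b: "0 \<le> b" "\<And>x. norm (\<phi> x) \<le> b" using rapid_bounded[OF \<phi>] by blast
  define J where "J = (\<integral>x. norm (f (- x)) \<partial>lborel)"
  have i: "integrable lborel (\<lambda>x. f (- x))"
    using rapid_integrable[OF f] distr_lborel_uminus[where ?'n = 'n]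
      integrable_distr[of uminus lborel lborel f] by simp
  have "norm (conv mul f (rescale a \<phi> t) x) \<le> (b * J) * t powr - hom_dim a" if t: "0 < t" for t x
  proof -
    have bd: "norm (f (- z) * rescale a \<phi> t (mul z x)) \<le> (t powr - hom_dim a * b) * norm (f (- z))" for z
    proof -
      have "norm (rescale a \<phi> t (mul z x)) \<le> t powr - hom_dim a * b"
        unfolding rescale_def norm_mult by (intro mult_mono b) auto
      then show ?thesis
        unfolding norm_mult by (subst mult.commute) (intro mult_right_mono, auto)
    qed
    have i1: "integrable lborel (\<lambda>z. (t powr - hom_dim a * b) * norm (f (- z)))" using i by auto
    then have i2: "integrable lborel (\<lambda>z. f (- z) * rescale a \<phi> t (mul z x))"
      by (rule Bochner_Integration.integrable_bound) (auto intro!: AE_I2 order_trans[OF bd abs_ge_self])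
    have "norm (\<integral>z. f (- z) * rescale a \<phi> t (mul z x) \<partial>lborel) \<le> (\<integral>z. norm (f (- z) * rescale a \<phi> t (mul z x)) \<partial>lborel)"
      by (rule integral_norm_bound)
    also have "\<dots> \<le> (\<integral>z. (t powr - hom_dim a * b) * norm (f (- z)) \<partial>lborel)"
      by (intro integral_mono integrable_norm i1 i2 bd)
    finally have "norm (\<integral>z. f (- z) * rescale a \<phi> t (mul z x) \<partial>lborel) \<le> (\<integral>z. (t powr - hom_dim a * b) * norm (f (- z)) \<partial>lborel)" .
    then show ?thesis by (simp add: conv_inverted J_def mult_ac)
  qed
  moreover have "0 \<le> b * J" using b by (simp add: J_def)
  ultimately show ?thesis by blast
qed

end

section \<open>Polynomial substitutions in Schwartz functions\<close>

lemma real_polynomial_function_has_derivative: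
  "real_polynomial_function p \<Longrightarrow>
    \<exists>p'. (\<forall>y. (p has_derivative (\<lambda>h. p' h y)) (at y)) \<and> (\<forall>h. real_polynomial_function (p' h))"
proof (induction rule: real_polynomial_function.induct)
  case (linear f)
  then show ?case
    by (intro exI[of _ "\<lambda>h y. f h"]) (auto intro: bounded_linear_imp_has_derivative real_polynomial_function.intros(2))
next
  case (const c)
  then show ?case by (intro exI[of _ "\<lambda>h y. 0"]) (auto intro: real_polynomial_function.intros(2))
next
  case (add f g)
  then obtain f' g' where
    "\<And>y. (f has_derivative (\<lambda>h. f' h y)) (at y)" "\<And>h. real_polynomial_function (f' h)"
    "\<And>y. (g has_derivative (\<lambda>h. g' h y)) (at y)" "\<And>h. real_polynomial_function (g' h)" by blast
  then show ?case
    by (intro exI[of _ "\<lambda>h y. f' h y + g' h y"]) (auto intro!: has_derivative_add real_polynomial_function.intros(3))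
next
  case (mult f g)
  then obtain f' g' where
    "\<And>y. (f has_derivative (\<lambda>h. f' h y)) (at y)" "\<And>h. real_polynomial_function (f' h)"
    "\<And>y. (g has_derivative (\<lambda>h. g' h y)) (at y)" "\<And>h. real_polynomial_function (g' h)" by blast
  with mult.hyps show ?case
    by (intro exI[of _ "\<lambda>h y. f y * g' h y + f' h y * g y"])
      (auto intro!: has_derivative_mult real_polynomial_function.intros(3) real_polynomial_function.intros(4))
qed

lemma real_polynomial_function_bound:
  "real_polynomial_function p \<Longrightarrow> \<exists>C\<ge>0. \<exists>k. \<forall>y. \<bar>p y\<bar> \<le> C * (1 + norm y) ^ k"
proof (induction rule: real_polynomial_function.induct)
  case (linear f)
  then obtain K where K: "0 \<le> K" "\<And>y. norm (f y) \<le> norm y * K"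
    using bounded_linear.nonneg_bounded by blast
  have "\<bar>f y\<bar> \<le> K * (1 + norm y) ^ 1" for y
    using K(2)[of y] K(1) by (simp add: algebra_simps)
  with K(1) show ?case by blast
next
  case (const c)
  have "\<bar>c\<bar> \<le> \<bar>c\<bar> * (1 + norm y) ^ 0" for y :: 'a by simp
  then show ?case using abs_ge_zero by blast
next
  case (add f g)
  then obtain C1 k1 C2 k2 where C: "0 \<le> C1" "\<And>y. \<bar>f y\<bar> \<le> C1 * (1 + norm y) ^ k1"
    "0 \<le> C2" "\<And>y. \<bar>g y\<bar> \<le> C2 * (1 + norm y) ^ k2" by blast
  have "\<bar>f y + g y\<bar> \<le> (C1 + C2) * (1 + norm y) ^ (k1 + k2)" for y
  proof -
    have "(1 + norm y) ^ k1 \<le> (1 + norm y) ^ (k1 + k2)" "(1 + norm y) ^ k2 \<le> (1 + norm y) ^ (k1 + k2)"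
      by (auto intro!: power_increasing)
    then have "C1 * (1 + norm y) ^ k1 + C2 * (1 + norm y) ^ k2 \<le> C1 * (1 + norm y) ^ (k1 + k2) + C2 * (1 + norm y) ^ (k1 + k2)"
      using C(1,3) by (intro add_mono mult_left_mono)
    with C(2)[of y] C(4)[of y] show ?thesis by (simp add: algebra_simps)
  qed
  with C(1,3) show ?case by (meson add_nonneg_nonneg)
next
  case (mult f g)
  then obtain C1 k1 C2 k2 where C: "0 \<le> C1" "\<And>y. \<bar>f y\<bar> \<le> C1 * (1 + norm y) ^ k1"
    "0 \<le> C2" "\<And>y. \<bar>g y\<bar> \<le> C2 * (1 + norm y) ^ k2" by blast
  have "\<bar>f y * g y\<bar> \<le> (C1 * C2) * (1 + norm y) ^ (k1 + k2)" for y
  proof -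
    have "\<bar>f y\<bar> * \<bar>g y\<bar> \<le> (C1 * (1 + norm y) ^ k1) * (C2 * (1 + norm y) ^ k2)"
      using C by (intro mult_mono) auto
    then show ?thesis by (simp add: abs_mult power_add mult_ac)
  qed
  with C(1,3) show ?case by (meson mult_nonneg_nonneg)
qed

text \<open>The span of the functions \<open>p (D\<^sup>v\<^sup>s f \<circ> P)\<close> with polynomials \<open>p\<close> contains \<open>f \<circ> P\<close> and is closed
  under partial derivatives, which reduces iterated derivatives of the composition to the first
  order chain rule.\<close>

inductive chain_span :: "(real^'n::finite \<Rightarrow> complex) \<Rightarrow> (real^'n \<Rightarrow> real^'n) \<Rightarrow> (real^'n \<Rightarrow> complex) \<Rightarrow> bool"
  for f P where
  base: "real_polynomial_function p \<Longrightarrow> vs \<in> lists Basis \<Longrightarrow>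
    chain_span f P (\<lambda>y. p y *\<^sub>R iterated_deriv vs f (P y))"
| add: "chain_span f P g \<Longrightarrow> chain_span f P h \<Longrightarrow> chain_span f P (\<lambda>y. g y + h y)"

lemma chain_span_sum:
  assumes "finite A" "\<And>i. i \<in> A \<Longrightarrow> chain_span f P (g i)"
  shows "chain_span f P (\<lambda>y. \<Sum>i\<in>A. g i y)"
  using assms
proof (induction A)
  case empty
  have "chain_span f P (\<lambda>y. 0 *\<^sub>R iterated_deriv [] f (P y))"
    by (rule chain_span.base) (auto intro: real_polynomial_function.intros(2))
  then show ?case by simp
next
  case (insert i A)
  then show ?case using chain_span.add[of f P "g i" "\<lambda>y. \<Sum>i\<in>A. g i y"] by simp
qed

lemma chain_span_deriv:
  assumes f: "f \<in> schwartz" and P: "\<And>e. e \<in> Basis \<Longrightarrow> real_polynomial_function (\<lambda>y. P y \<bullet> e)"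
    and g: "chain_span f P g"
  shows "(\<forall>y. g differentiable (at y)) \<and> (\<forall>b. chain_span f P (\<lambda>y. frechet_derivative g (at y) b))"
  using g
proof (induction rule: chain_span.induct)
  case (base p vs)
  let ?F = "iterated_deriv vs f"
  have "?F differentiable (at z)" for z
    using f base(2) by (auto simp: schwartz_def smooth_on_def)
  then have F: "(?F has_derivative frechet_derivative ?F (at z)) (at z)" for z
    by (simp add: frechet_derivative_works)
  obtain p' where p': "\<And>y. (p has_derivative (\<lambda>h. p' h y)) (at y)" "\<And>h. real_polynomial_function (p' h)"
    using real_polynomial_function_has_derivative[OF base(1)] by blast
  have "\<forall>e\<in>Basis. \<exists>q. (\<forall>y. ((\<lambda>y. P y \<bullet> e) has_derivative (\<lambda>h. q h y)) (at y)) \<and> (\<forall>h. real_polynomial_function (q h))"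
    using real_polynomial_function_has_derivative[OF P] by blast
  from bchoice[OF this] obtain q where q: "\<And>e y. e \<in> Basis \<Longrightarrow> ((\<lambda>y. P y \<bullet> e) has_derivative (\<lambda>h. q e h y)) (at y)"
    "\<And>e h. e \<in> Basis \<Longrightarrow> real_polynomial_function (q e h)" by blast
  have P': "(P has_derivative (\<lambda>h. \<Sum>e\<in>Basis. q e h y *\<^sub>R e)) (at y)" for y
  proof -
    have "((\<lambda>y. \<Sum>e\<in>Basis. (P y \<bullet> e) *\<^sub>R e) has_derivative (\<lambda>h. \<Sum>e\<in>Basis. q e h y *\<^sub>R e)) (at y)"
      by (intro has_derivative_sum has_derivative_scaleR_left q)
    then show ?thesis by (simp add: euclidean_representation)
  qed
  have D: "((\<lambda>y. p y *\<^sub>R ?F (P y)) has_derivative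
      (\<lambda>h. p y *\<^sub>R frechet_derivative ?F (at (P y)) (\<Sum>e\<in>Basis. q e h y *\<^sub>R e) + p' h y *\<^sub>R ?F (P y))) (at y)" for y
    by (intro has_derivative_scaleR p' has_derivative_compose[OF P' F])
  have eq: "frechet_derivative (\<lambda>y. p y *\<^sub>R ?F (P y)) (at y) b =
      p' b y *\<^sub>R ?F (P y) + (\<Sum>e\<in>Basis. (p y * q e b y) *\<^sub>R iterated_deriv (e # vs) f (P y))" for y b
  proof -
    have lin: "linear (frechet_derivative ?F (at (P y)))" using F by (rule has_derivative_linear)
    have "frechet_derivative (\<lambda>y. p y *\<^sub>R ?F (P y)) (at y) b =
        p y *\<^sub>R frechet_derivative ?F (at (P y)) (\<Sum>e\<in>Basis. q e b y *\<^sub>R e) + p' b y *\<^sub>R ?F (P y)"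
      by (rule fun_cong[OF frechet_derivative_at[OF D], symmetric])
    also have "frechet_derivative ?F (at (P y)) (\<Sum>e\<in>Basis. q e b y *\<^sub>R e) =
        (\<Sum>e\<in>Basis. q e b y *\<^sub>R frechet_derivative ?F (at (P y)) e)"
      using lin by (simp add: linear_sum linear_cmul)
    finally show ?thesis by (simp add: scaleR_sum_right)
  qed
  have "chain_span f P (\<lambda>y. p' b y *\<^sub>R ?F (P y) + (\<Sum>e\<in>Basis. (p y * q e b y) *\<^sub>R iterated_deriv (e # vs) f (P y)))" for b
    using base p' q
    by (intro chain_span.add chain_span_sum chain_span.base finite_Basis real_polynomial_function.intros(4)) auto
  then have "chain_span f P (\<lambda>y. frechet_derivative (\<lambda>y. p y *\<^sub>R ?F (P y)) (at y) b)" for b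
    by (simp only: eq)
  moreover have "(\<lambda>y. p y *\<^sub>R ?F (P y)) differentiable (at y)" for y
    using D by (rule differentiableI)
  ultimately show ?case by blast
next
  case (add g h)
  then have d: "(g has_derivative frechet_derivative g (at y)) (at y)" "(h has_derivative frechet_derivative h (at y)) (at y)" for y
    by (simp_all add: frechet_derivative_works)
  have D: "((\<lambda>y. g y + h y) has_derivative (\<lambda>b. frechet_derivative g (at y) b + frechet_derivative h (at y) b)) (at y)" for y
    by (intro has_derivative_add d)
  have "frechet_derivative (\<lambda>y. g y + h y) (at y) b = frechet_derivative g (at y) b + frechet_derivative h (at y) b" for y b
    by (rule fun_cong[OF frechet_derivative_at[OF D], symmetric])
  then show ?case
    using add.IH differentiableI[OF D] by (auto intro: chain_span.add)
qed

lemma chain_span_decay: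
  assumes f: "f \<in> schwartz"
    and growth: "0 \<le> C" "\<And>y. 1 + norm y \<le> C * (1 + norm (P y)) ^ m"
    and g: "chain_span f P g"
  shows "\<exists>K. \<forall>y. (1 + norm y) ^ k * norm (g y) \<le> K"
  using g
proof (induction rule: chain_span.induct)
  case (base p vs)
  let ?F = "iterated_deriv vs f"
  obtain c d where c: "0 \<le> c" "\<And>y. \<bar>p y\<bar> \<le> c * (1 + norm y) ^ d"
    using real_polynomial_function_bound[OF base(1)] by blast
  obtain K where K: "\<And>z. (1 + norm z) ^ (m * (k + d)) * norm (?F z) \<le> K"
    using f base(2) unfolding schwartz_def by blast
  have "(1 + norm y) ^ k * norm (p y *\<^sub>R ?F (P y)) \<le> c * C ^ (k + d) * K" for y
  proof -
    have "(1 + norm y) ^ k * norm (p y *\<^sub>R ?F (P y)) \<le> (1 + norm y) ^ k * (c * (1 + norm y) ^ d * norm (?F (P y)))"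
      using c by (auto intro!: mult_left_mono mult_right_mono)
    also have "\<dots> = c * ((1 + norm y) ^ (k + d) * norm (?F (P y)))"
      by (simp add: power_add mult_ac)
    also have "\<dots> \<le> c * ((C * (1 + norm (P y)) ^ m) ^ (k + d) * norm (?F (P y)))"
      using c growth by (intro mult_left_mono mult_right_mono power_mono) auto
    also have "\<dots> = c * C ^ (k + d) * ((1 + norm (P y)) ^ (m * (k + d)) * norm (?F (P y)))"
      by (simp add: power_mult_distrib power_mult mult_ac)
    also have "\<dots> \<le> c * C ^ (k + d) * K"
      using c growth(1) by (intro mult_left_mono K) auto
    finally show ?thesis .
  qed
  then show ?case by blast
next
  case (add g h)
  then obtain K1 K2 where K: "\<And>y. (1 + norm y) ^ k * norm (g y) \<le> K1" "\<And>y. (1 + norm y) ^ k * norm (h y) \<le> K2"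
    by blast
  have "(1 + norm y) ^ k * norm (g y + h y) \<le> K1 + K2" for y
  proof -
    have "(1 + norm y) ^ k * norm (g y + h y) \<le> (1 + norm y) ^ k * (norm (g y) + norm (h y))"
      by (intro mult_left_mono norm_triangle_ineq) auto
    with K[of y] show ?thesis by (simp add: distrib_left)
  qed
  then show ?case by blast
qed

theorem schwartz_compose_polynomial:
  fixes P :: "real^'n::finite \<Rightarrow> real^'n"
  assumes f: "f \<in> schwartz" and P: "\<And>e. e \<in> Basis \<Longrightarrow> real_polynomial_function (\<lambda>y. P y \<bullet> e)"
    and growth: "0 \<le> C" "\<And>y. 1 + norm y \<le> C * (1 + norm (P y)) ^ m"
  shows "(\<lambda>y. f (P y)) \<in> schwartz"
proof -
  have "chain_span f P (\<lambda>y. 1 *\<^sub>R iterated_deriv [] f (P y))"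
    by (rule chain_span.base) (auto intro: real_polynomial_function.intros(2))
  then have span: "chain_span f P (\<lambda>y. f (P y))" by simp
  have iter: "chain_span f P (iterated_deriv vs (\<lambda>y. f (P y)))" for vs
  proof (induction vs)
    case (Cons v vs)
    then show ?case using chain_span_deriv[OF f P] by simp
  qed (use span in simp)
  then show ?thesis
    using chain_span_deriv[OF f P iter] chain_span_decay[OF f growth iter]
    unfolding schwartz_def smooth_on_def by blast
qed

context norm_function
begin

lemma real_polynomial_function_nth: "real_polynomial_function (\<lambda>y::real^('n::{finite,linorder}). y $ i)"
  by (intro real_polynomial_function.intros(1) bounded_linear_vec_nth)

lemma real_polynomial_function_mul:
  "real_polynomial_function (\<lambda>y. mul x (- dilation a t y) $ k)"
proof -
  have lin: "real_polynomial_function (\<lambda>y::real^('n::{finite,linorder}). (- dilation a t y) $ i)" for i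
  proof -
    have "real_polynomial_function (\<lambda>y::real^('n::{finite,linorder}). (- (t powr a i)) * y $ i)"
      by (intro real_polynomial_function.intros(4) real_polynomial_function.intros(2) real_polynomial_function_nth)
    then show ?thesis by (simp add: dilation_def)
  qed
  show ?thesis
  proof (cases "k = Min UNIV")
    case True
    then show ?thesis
      by (simp only: mul_first) (intro real_polynomial_function.intros(3) real_polynomial_function.intros(2) lin)
  next
    case False
    from mul_other[OF this] obtain c where c: "\<And>x y. mul x y $ k = x $ k + y $ k +
        (\<Sum>(I, J)\<in>index_pairs a k. c I J * monomial x I * monomial y J)" by blast
    have mono: "real_polynomial_function (\<lambda>y::real^('n::{finite,linorder}). monomial (- dilation a t y) J)" for J
      unfolding monomial_def by (intro real_polynomial_function_prod real_polynomial_function_power lin) simp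
    have "real_polynomial_function (\<lambda>y::real^('n::{finite,linorder}).
        \<Sum>(I, J)\<in>index_pairs a k. c I J * monomial x I * monomial (- dilation a t y) J)"
    proof (cases "finite (index_pairs a k)")
      case True
      then show ?thesis
        unfolding case_prod_beta
        by (intro real_polynomial_function_sum real_polynomial_function.intros(4) real_polynomial_function.intros(2) mono)
    qed (auto intro: real_polynomial_function.intros(2))
    then show ?thesis
      unfolding c by (intro real_polynomial_function.intros(3) real_polynomial_function.intros(2) lin)
  qed
qed

text \<open>The inverse of the polynomial map \<open>y \<mapsto> x (A\<^sub>t y)\<^sup>-\<^sup>1\<close> grows at most polynomially, so that the decay
  of \<open>f\<close> survives the substitution.\<close>

lemma schwartz_translate:
  assumes f: "f \<in> schwartz" and t: "0 < t"
  shows "(\<lambda>y. f (mul x (- dilation a t y))) \<in> schwartz"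
proof -
  obtain m :: nat where m: "hom_dim a \<le> real m" using real_arch_simple by blast
  define K where "K = 1 + c\<^sub>0 / t * (\<rho> x + 1)"
  have K1: "1 \<le> K" using c\<^sub>0(1) t by (simp add: K_def)
  have growth: "1 + norm y \<le> (2 * K ^ m) * (1 + norm (mul x (- dilation a t y))) ^ m" for y
  proof -
    define z where "z = mul x (- dilation a t y)"
    have "t * \<rho> y = \<rho> (- dilation a t y)" using t by (simp add: rho_dilation rho_inverse)
    also have "- dilation a t y = mul (- x) z" by (simp add: z_def)
    also have "\<rho> (mul (- x) z) \<le> c\<^sub>0 * (\<rho> x + \<rho> z)" using c\<^sub>0(2)[of "- x" z] by (simp add: rho_inverse)
    also have "\<dots> \<le> c\<^sub>0 * ((\<rho> x + 1) * (1 + norm z))"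
    proof -
      have "\<rho> x + \<rho> z \<le> \<rho> x + (1 + norm z)" using rho_le_norm[of z] by simp
      also have "\<dots> \<le> (\<rho> x + 1) * (1 + norm z)" by (simp add: algebra_simps)
      finally show ?thesis using c\<^sub>0(1) by (intro mult_left_mono) auto
    qed
    finally have "\<rho> y \<le> c\<^sub>0 * ((\<rho> x + 1) * (1 + norm z)) / t"
      using t by (simp add: pos_le_divide_eq mult.commute)
    then have "\<rho> y \<le> c\<^sub>0 / t * (\<rho> x + 1) * (1 + norm z)" by (simp add: mult_ac)
    then have "1 + \<rho> y \<le> 1 * (1 + norm z) + c\<^sub>0 / t * (\<rho> x + 1) * (1 + norm z)"
      by (intro add_mono) auto
    also have "\<dots> = K * (1 + norm z)" by (simp add: K_def algebra_simps)
    finally have 1: "1 + \<rho> y \<le> K * (1 + norm z)" .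
    have "1 \<le> 1 + \<rho> y" by simp
    with 1 have 2: "1 \<le> K * (1 + norm z)" by (rule order_trans[rotated])
    have "norm y \<le> (1 + \<rho> y) powr hom_dim a" by (rule norm_le_rho_powr)
    also have "\<dots> \<le> (1 + \<rho> y) powr real m" using m by (intro powr_mono) auto
    also have "\<dots> = (1 + \<rho> y) ^ m" by (simp add: powr_realpow)
    also have "\<dots> \<le> (K * (1 + norm z)) ^ m" using 1 by (intro power_mono) auto
    finally have "1 + norm y \<le> (K * (1 + norm z)) ^ m + (K * (1 + norm z)) ^ m"
      using one_le_power[OF 2, of m] by (intro add_mono)
    then show ?thesis by (simp add: power_mult_distrib z_def)
  qed
  show ?thesis
  proof (rule schwartz_compose_polynomial[OF f _ _ growth])
    show "0 \<le> 2 * K ^ m" using K1 by simp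
    fix e :: "real^('n::{finite,linorder})" assume "e \<in> Basis"
    then obtain i where "e = axis i 1" by (auto simp: Basis_vec_real)
    then show "real_polynomial_function (\<lambda>y. mul x (- dilation a t y) \<bullet> e)"
      using real_polynomial_function_mul by (simp add: inner_axis)
  qed
qed

end

section \<open>The reproducing formula\<close>

lemma sum_geometric_int_le:
  fixes q :: real
  assumes q: "0 < q" "q < 1"
  shows "(\<Sum>j\<in>{- int n..int n}. q ^ nat \<bar>j\<bar>) \<le> 2 / (1 - q)"
proof -
  have geo: "(\<Sum>i\<le>n. q ^ i) \<le> 1 / (1 - q)"
  proof -
    have "(\<Sum>i\<le>n. q ^ i) \<le> (\<Sum>i. q ^ i)"
      using q by (intro sum_le_suminf summable_geometric) auto
    then show ?thesis using q by (simp add: suminf_geometric)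
  qed
  have "{- int n..int n} = int ` {..n} \<union> (\<lambda>i. - int i) ` {..n}"
  proof (intro equalityI subsetI)
    fix j assume j: "j \<in> {- int n..int n}"
    show "j \<in> int ` {..n} \<union> (\<lambda>i. - int i) ` {..n}"
      using j by (cases "0 \<le> j") (auto intro: image_eqI[of _ _ "nat j"] image_eqI[of _ _ "nat (- j)"])
  qed auto
  then have "(\<Sum>j\<in>{- int n..int n}. q ^ nat \<bar>j\<bar>) \<le>
      (\<Sum>j\<in>int ` {..n}. q ^ nat \<bar>j\<bar>) + (\<Sum>j\<in>(\<lambda>i. - int i) ` {..n}. q ^ nat \<bar>j\<bar>)"
    using q sum.union_inter[of "int ` {..n}" "(\<lambda>i. - int i) ` {..n}" "\<lambda>j. q ^ nat \<bar>j\<bar>"]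
      sum_nonneg[of "int ` {..n} \<inter> (\<lambda>i. - int i) ` {..n}" "\<lambda>j. q ^ nat \<bar>j\<bar>"] by simp
  also have "\<dots> = (\<Sum>i\<le>n. q ^ i) + (\<Sum>i\<le>n. q ^ i)"
    by (simp add: sum.reindex inj_on_def)
  also have "\<dots> \<le> 1 / (1 - q) + 1 / (1 - q)" by (intro add_mono geo)
  finally show ?thesis by simp
qed

lemma ennreal_norm_sum_le: "ennreal (norm (sum f A)) \<le> (\<Sum>i\<in>A. ennreal (norm (f i)))"
  by (subst sum_ennreal) (auto intro!: ennreal_leI norm_sum)

lemma min_powr_powi:
  fixes b d :: real and j :: int
  assumes b: "0 < b" "b < 1" and d: "0 < d"
  shows "min ((b powi j) powr d) ((b powi j) powr - d) = (b powr d) ^ nat \<bar>j\<bar>"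
proof -
  have 1: "(b powi j) powr e = b powr (real_of_int j * e)" for e :: real
    using b by (simp add: powr_real_of_int'[symmetric] powr_powr)
  have 2: "(b powr d) ^ nat \<bar>j\<bar> = b powr (d * real_of_int \<bar>j\<bar>)"
    using b by (simp add: powr_realpow[symmetric] powr_powr)
  have mono: "b powr x \<le> b powr y \<longleftrightarrow> y \<le> x" for x y :: real
    using b powr_mono'[of x y b] powr_mono'[of y x b] powr_inj[of b x y] by (metis less_eq_real_def linear not_less)
  show ?thesis
    unfolding 1 2 using d by (cases "0 \<le> j") (auto simp: min_def mono mult_ac mult_le_cancel_left zero_le_mult_iff mult_le_0_iff intro: antisym)
qed

context norm_function
begin

lemma conv_rescale_bound:
  assumes f: "f \<in> schwartz" and \<phi>: "rapid \<phi>" and mean: "(\<integral>x. \<phi> x \<partial>lborel) = 0"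
  shows "\<exists>C\<ge>0. \<forall>t x. 0 < t \<longrightarrow> norm (conv mul f (rescale a \<phi> t) x) \<le> C * min (t powr (1/2)) (t powr (- 1/2))"
proof -
  obtain C1 where C1: "0 \<le> C1" "\<And>t x. 0 < t \<Longrightarrow> t \<le> 1 \<Longrightarrow> norm (conv mul f (rescale a \<phi> t) x) \<le> C1 * (t powr (1/2) * (1 + \<rho> x) powr - 0)"
    using conv_rescale_small[OF f \<phi> mean, of 0] by auto
  obtain C2 where C2: "0 \<le> C2" "\<And>t x. 0 < t \<Longrightarrow> norm (conv mul f (rescale a \<phi> t) x) \<le> C2 * t powr - hom_dim a"
    using conv_rescale_large[OF schwartz_rapid[OF f] \<phi>] by blast
  have "norm (conv mul f (rescale a \<phi> t) x) \<le> (C1 + C2) * min (t powr (1/2)) (t powr (- 1/2))" if t: "0 < t" for t x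
  proof (cases "t \<le> 1")
    case True
    have "t powr (1/2) \<le> t powr (- 1/2)" using t True by (intro powr_mono') auto
    then have m: "min (t powr (1/2)) (t powr (- 1/2)) = t powr (1/2)" by simp
    have "norm (conv mul f (rescale a \<phi> t) x) \<le> C1 * t powr (1/2)" using C1(2)[OF t True, of x] by simp
    also have "\<dots> \<le> (C1 + C2) * t powr (1/2)" using C2(1) by (intro mult_right_mono) auto
    finally show ?thesis unfolding m .
  next
    case False
    have "t powr (- 1/2) \<le> t powr (1/2)" using False by (intro powr_mono) auto
    then have m: "min (t powr (1/2)) (t powr (- 1/2)) = t powr (- 1/2)" by simp
    have "t powr - hom_dim a \<le> t powr (- 1/2)" using False hom_dim_ge_1 by (intro powr_mono) auto
    then have "C2 * t powr - hom_dim a \<le> (C1 + C2) * t powr (- 1/2)"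
      using C1(1) C2(1) by (intro mult_mono) auto
    then show ?thesis unfolding m using C2(2)[OF t, of x] by linarith
  qed
  with C1 C2 show ?thesis by (intro exI[of _ "C1 + C2"]) auto
qed

lemma norm_le_peetre:
  assumes "0 \<le> R"
  shows "ennreal (norm (F (mul x (- y)))) \<le> peetre mul \<rho> N R F x * ennreal ((1 + R * \<rho> y) powr N)"
proof -
  have pos: "0 < 1 + R * \<rho> y" using assms by (simp add: add_pos_nonneg)
  have "ennreal (norm (F (mul x (- y)))) = ennreal (norm (F (mul x (- y))) / (1 + R * \<rho> y) powr N) * ennreal ((1 + R * \<rho> y) powr N)"
    using pos by (simp flip: ennreal_mult)
  also have "\<dots> \<le> peetre mul \<rho> N R F x * ennreal ((1 + R * \<rho> y) powr N)"
    unfolding peetre_def by (intro mult_right_mono SUP_upper) auto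
  finally show ?thesis .
qed

text \<open>In \<open>F * (\<eta>\<^sub>s * \<psi>\<^sub>t)\<close>, evaluated at \<open>x z\<^sup>-\<^sup>1\<close>, the function \<open>F\<close> is taken at \<open>x (v z)\<^sup>-\<^sup>1\<close>.  The Peetre weight of
  \<open>v z\<close> is at most the product of those of \<open>v\<close> and of \<open>z\<close>; the former goes into the integral over \<open>v\<close>,
  which becomes \<open>C (\<eta>, \<psi>, t / s, N)\<close> after rescaling, and the latter is transferred from the scale \<open>s\<close> to the
  scale \<open>t\<close>.\<close>

lemma conv_le_peetre:
  assumes F [measurable]: "F \<in> borel_measurable borel" and \<eta> [measurable]: "\<eta> \<in> borel_measurable borel"
    and \<psi> [measurable]: "\<psi> \<in> borel_measurable borel" and s: "0 < s" and t: "0 < t" and N: "0 < N"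
  shows "ennreal (norm (conv mul F (conv mul (rescale a \<eta> s) (rescale a \<psi> t)) (mul x (- z))))
    \<le> peetre mul \<rho> N (1 / s) F x * (ennreal (c\<^sub>0 powr N * (1 + \<rho> z / t) powr N) *
        (ennreal (max 1 (t / s) powr N) * C_int a mul \<rho> \<eta> \<psi> (t / s) N))"
proof -
  define H where "H = conv mul (rescale a \<eta> s) (rescale a \<psi> t)"
  have [measurable]: "H \<in> borel_measurable borel" unfolding H_def by measurable
  define P where "P = peetre mul \<rho> N (1 / s) F x"
  define D where "D = c\<^sub>0 powr N * (1 + \<rho> z / s) powr N"
  have D: "0 \<le> D" by (simp add: D_def)
  have \<psi>t: "rescale a (rescale a \<psi> (t / s)) s = rescale a \<psi> t"
    using s t by (simp add: rescale_rescale)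
  have "(\<integral>\<^sup>+v. ennreal ((1 + \<rho> v / s) powr N) * ennreal (norm (H v)) \<partial>lborel) =
      (\<integral>\<^sup>+v. ennreal ((1 + \<rho> v / s) powr N) * ennreal (norm (rescale a (conv mul \<eta> (rescale a \<psi> (t / s))) s v)) \<partial>lborel)"
    unfolding H_def \<psi>t[symmetric] using s by (subst conv_rescale) auto
  also have "\<dots> = (\<integral>\<^sup>+v. ennreal ((1 + \<rho> (dilation a s v) / s) powr N) * ennreal (norm (conv mul \<eta> (rescale a \<psi> (t / s)) v)) \<partial>lborel)"
    by (rule nn_integral_rescale[OF s, where h = "\<lambda>v. ennreal ((1 + \<rho> v / s) powr N)"]) measurable
  also have "\<dots> = C_int a mul \<rho> \<eta> \<psi> (t / s) N"
    using s by (simp add: C_int_def nn_integral_completion rho_dilation ennreal_mult)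
  finally have CI: "(\<integral>\<^sup>+v. ennreal ((1 + \<rho> v / s) powr N) * ennreal (norm (H v)) \<partial>lborel) = C_int a mul \<rho> \<eta> \<psi> (t / s) N" .
  have "ennreal (norm (conv mul F H (mul x (- z)))) \<le>
      (\<integral>\<^sup>+v. ennreal (norm (F (mul (mul x (- z)) (- v)))) * ennreal (norm (H v)) \<partial>lborel)"
    by (rule norm_conv_le) measurable
  also have "\<dots> \<le> (\<integral>\<^sup>+v. P * ennreal D * (ennreal ((1 + \<rho> v / s) powr N) * ennreal (norm (H v))) \<partial>lborel)"
  proof (rule nn_integral_mono)
    fix v
    have "mul (mul x (- z)) (- v) = mul x (- mul v z)"
      by (simp add: mul_assoc uminus_mul)
    then have "ennreal (norm (F (mul (mul x (- z)) (- v)))) \<le> P * ennreal ((1 + 1 / s * \<rho> (mul v z)) powr N)"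
      unfolding P_def using norm_le_peetre[of "1 / s" F x "mul v z" N] s by simp
    also have "\<dots> \<le> P * ennreal (D * (1 + \<rho> v / s) powr N)"
    proof (intro mult_left_mono ennreal_leI)
      have "(1 + 1 / s * \<rho> (mul v z)) powr N \<le> (c\<^sub>0 * ((1 + 1 / s * \<rho> v) * (1 + 1 / s * \<rho> z))) powr N"
        using s N by (intro powr_mono2 one_plus_rho_mul) auto
      also have "\<dots> = D * (1 + \<rho> v / s) powr N"
        using s c\<^sub>0(1) by (simp add: D_def powr_mult mult_ac)
      finally show "(1 + 1 / s * \<rho> (mul v z)) powr N \<le> D * (1 + \<rho> v / s) powr N" .
    qed simp
    finally have "ennreal (norm (F (mul (mul x (- z)) (- v)))) \<le> P * ennreal D * ennreal ((1 + \<rho> v / s) powr N)"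
      using D by (simp add: ennreal_mult mult.assoc)
    then show "ennreal (norm (F (mul (mul x (- z)) (- v)))) * ennreal (norm (H v)) \<le>
        P * ennreal D * (ennreal ((1 + \<rho> v / s) powr N) * ennreal (norm (H v)))"
      unfolding mult.assoc[symmetric] by (rule mult_right_mono) simp
  qed
  also have "\<dots> = P * ennreal D * C_int a mul \<rho> \<eta> \<psi> (t / s) N"
    unfolding CI[symmetric] by (rule nn_integral_cmult) measurable
  also have "\<dots> \<le> P * ennreal ((c\<^sub>0 powr N * (1 + \<rho> z / t) powr N) * max 1 (t / s) powr N) * C_int a mul \<rho> \<eta> \<psi> (t / s) N"
  proof (intro mult_left_mono mult_right_mono ennreal_leI)
    have "\<rho> z / s = (t / s) * (\<rho> z / t)" using t by simp
    also have "\<dots> \<le> max 1 (t / s) * (\<rho> z / t)" using t by (intro mult_right_mono) auto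
    finally have "1 + \<rho> z / s \<le> max 1 (t / s) * (1 + \<rho> z / t)"
      by (simp add: distrib_left add_mono)
    then have "(1 + \<rho> z / s) powr N \<le> (max 1 (t / s) * (1 + \<rho> z / t)) powr N"
      using s N by (intro powr_mono2) auto
    also have "\<dots> = (1 + \<rho> z / t) powr N * max 1 (t / s) powr N"
      using t by (simp add: powr_mult mult.commute)
    finally show "D \<le> (c\<^sub>0 powr N * (1 + \<rho> z / t) powr N) * max 1 (t / s) powr N"
      unfolding D_def mult.assoc by (rule mult_left_mono) simp
  qed simp_all
  also have "ennreal ((c\<^sub>0 powr N * (1 + \<rho> z / t) powr N) * max 1 (t / s) powr N) =
      ennreal (c\<^sub>0 powr N * (1 + \<rho> z / t) powr N) * ennreal (max 1 (t / s) powr N)"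
    by (rule ennreal_mult) auto
  finally show ?thesis by (simp only: H_def P_def mult.assoc)
qed

text \<open>The cancellation class controls large \<open>\<tau>\<close>, with \<open>\<tau>\<^sup>-\<^sup>\<epsilon>\<close> left over from the factor \<open>\<tau>\<^sup>N\<close>; the vanishing
  integral of \<open>\<psi>\<close> controls small \<open>\<tau>\<close>, with a factor \<open>\<tau>\<^sup>1\<^sup>/\<^sup>2\<close>.\<close>

lemma C_int_decay:
  assumes cl: "(\<eta>, \<psi>) \<in> C1_class a mul \<rho> (N + \<epsilon>) N" and mean: "(\<integral>x. \<psi> x \<partial>lborel) = 0"
    and \<epsilon>: "0 < \<epsilon>" and N: "0 < N"
  shows "\<exists>K>0. \<forall>\<tau>>0. ennreal (max 1 \<tau> powr N) * C_int a mul \<rho> \<eta> \<psi> \<tau> N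
    \<le> ennreal (K * min (\<tau> powr min \<epsilon> (1/2)) (\<tau> powr - min \<epsilon> (1/2)))"
proof -
  let ?d = "min \<epsilon> (1/2)"
  have \<eta>: "\<eta> \<in> schwartz" and \<psi>: "\<psi> \<in> schwartz" using cl by (auto simp: C1_class_def)
  have [measurable]: "\<eta> \<in> borel_measurable borel" "\<psi> \<in> borel_measurable borel"
    using \<eta> \<psi> by (auto intro: schwartz_measurable)
  have "(SUP t\<in>{1..}. ennreal (t powr (N + \<epsilon>)) * C_int a mul \<rho> \<eta> \<psi> t N) < top"
    using cl by (simp add: C1_class_def)
  then obtain K1 where K1: "(SUP t\<in>{1..}. ennreal (t powr (N + \<epsilon>)) * C_int a mul \<rho> \<eta> \<psi> t N) = ennreal K1" "0 \<le> K1"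
    by (cases "SUP t\<in>{1..}. ennreal (t powr (N + \<epsilon>)) * C_int a mul \<rho> \<eta> \<psi> t N") auto
  define L where "L = N + (hom_dim a + 1)"
  have L: "0 \<le> L" using N hom_dim_ge_1 by (simp add: L_def)
  obtain C where C: "0 \<le> C" "\<And>t x. 0 < t \<Longrightarrow> t \<le> 1 \<Longrightarrow> norm (conv mul \<eta> (rescale a \<psi> t) x) \<le> C * (t powr (1/2) * (1 + \<rho> x) powr - L)"
    using conv_rescale_small[OF \<eta> schwartz_rapid[OF \<psi>] mean L] by blast
  obtain J where J: "(\<integral>\<^sup>+x. ennreal ((1 + \<rho> x) powr - (hom_dim a + 1)) \<partial>lborel) = ennreal J" "0 \<le> J"
    using nn_integral_rho_decay[of "hom_dim a + 1"]
    by (cases "\<integral>\<^sup>+x. ennreal ((1 + \<rho> x) powr - (hom_dim a + 1)) \<partial>lborel") auto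
  define K where "K = K1 + C * J + 1"
  have K: "0 < K" "K1 \<le> K" "C * J \<le> K"
    using K1(2) C(1) J(2) by (auto simp: K_def add_nonneg_pos mult_nonneg_nonneg)
  have "ennreal (max 1 \<tau> powr N) * C_int a mul \<rho> \<eta> \<psi> \<tau> N \<le> ennreal (K * min (\<tau> powr ?d) (\<tau> powr - ?d))"
    if \<tau>: "0 < \<tau>" for \<tau>
  proof (cases "1 \<le> \<tau>")
    case True
    have "\<tau> powr - ?d \<le> \<tau> powr ?d" using True \<epsilon> by (intro powr_mono) auto
    then have m: "min (\<tau> powr ?d) (\<tau> powr - ?d) = \<tau> powr - ?d" by simp
    have "ennreal (\<tau> powr N) * C_int a mul \<rho> \<eta> \<psi> \<tau> N = ennreal (\<tau> powr - \<epsilon> * \<tau> powr (N + \<epsilon>)) * C_int a mul \<rho> \<eta> \<psi> \<tau> N"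
      by (simp add: powr_add[symmetric])
    also have "\<dots> = ennreal (\<tau> powr - \<epsilon>) * (ennreal (\<tau> powr (N + \<epsilon>)) * C_int a mul \<rho> \<eta> \<psi> \<tau> N)"
      by (simp add: ennreal_mult mult.assoc)
    also have "\<dots> \<le> ennreal (\<tau> powr - \<epsilon>) * ennreal K1"
      unfolding K1(1)[symmetric] using True by (intro mult_left_mono SUP_upper) auto
    also have "\<dots> = ennreal (\<tau> powr - \<epsilon> * K1)" using K1(2) by (simp add: ennreal_mult)
    also have "\<dots> \<le> ennreal (\<tau> powr - ?d * K)"
      using True K K1 by (intro ennreal_leI mult_mono powr_mono) auto
    finally show ?thesis unfolding m using True by (simp add: max_def mult.commute)
  next
    case False
    have "\<tau> powr ?d \<le> \<tau> powr - ?d" using False \<tau> \<epsilon> by (intro powr_mono') auto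
    then have m: "min (\<tau> powr ?d) (\<tau> powr - ?d) = \<tau> powr ?d" by simp
    have "C_int a mul \<rho> \<eta> \<psi> \<tau> N \<le> (\<integral>\<^sup>+x. ennreal (C * \<tau> powr (1/2)) * ennreal ((1 + \<rho> x) powr - (hom_dim a + 1)) \<partial>lborel)"
      unfolding C_int_def nn_integral_completion
    proof (rule nn_integral_mono)
      fix x
      have "(1 + \<rho> x) powr N * norm (conv mul \<eta> (rescale a \<psi> \<tau>) x) \<le> (1 + \<rho> x) powr N * (C * (\<tau> powr (1/2) * (1 + \<rho> x) powr - L))"
        using \<tau> False by (intro mult_left_mono C) auto
      also have "\<dots> = (C * \<tau> powr (1/2)) * ((1 + \<rho> x) powr N * (1 + \<rho> x) powr - L)"
        by (simp add: mult_ac)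
      also have "(1 + \<rho> x) powr N * (1 + \<rho> x) powr - L = (1 + \<rho> x) powr (N + - L)"
        by (rule powr_add[symmetric])
      also have "N + - L = - (hom_dim a + 1)" by (simp add: L_def)
      finally show "ennreal ((1 + \<rho> x) powr N * norm (conv mul \<eta> (rescale a \<psi> \<tau>) x)) \<le>
          ennreal (C * \<tau> powr (1/2)) * ennreal ((1 + \<rho> x) powr - (hom_dim a + 1))"
        using C(1) by (simp add: ennreal_leI flip: ennreal_mult)
    qed
    also have "\<dots> = ennreal (C * \<tau> powr (1/2)) * ennreal J"
      unfolding J(1)[symmetric] by (rule nn_integral_cmult) measurable
    also have "\<dots> = ennreal ((C * J) * \<tau> powr (1/2))"
      using C(1) J(2) by (simp add: mult_ac flip: ennreal_mult)
    also have "\<dots> \<le> ennreal (K * \<tau> powr ?d)"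
      using False \<tau> K C(1) J(2) by (intro ennreal_leI mult_mono powr_mono') auto
    finally show ?thesis unfolding m using False by (simp add: max_def)
  qed
  with K show ?thesis by blast
qed

end

locale calderon_system = norm_function a mul \<rho>
  for a :: "'n::{finite,linorder} \<Rightarrow> real"
    and mul :: "real^('n::{finite,linorder}) \<Rightarrow> real^('n::{finite,linorder}) \<Rightarrow> real^('n::{finite,linorder})"
    and \<rho> :: "real^('n::{finite,linorder}) \<Rightarrow> real" +
  fixes M :: nat and \<phi> \<eta> :: "nat \<Rightarrow> real^('n::{finite,linorder}) \<Rightarrow> complex" and b :: real
  assumes \<phi>_schwartz: "l \<in> {1..M} \<Longrightarrow> \<phi> l \<in> schwartz"
    and \<phi>_mean: "l \<in> {1..M} \<Longrightarrow> (\<integral>x. \<phi> l x \<partial>lborel) = 0"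
    and \<eta>_schwartz: "l \<in> {1..M} \<Longrightarrow> \<eta> l \<in> schwartz"
    and b_pos: "0 < b" and b_less_1: "b < 1"
    and reproducing: "tempered_lim
      (\<lambda>(k::nat, m::nat). distr_of (\<lambda>x. \<Sum>j\<in>{- int k..int m}. \<Sum>l\<in>{1..M}.
          conv mul (rescale a (\<phi> l) (b powi j)) (rescale a (\<eta> l) (b powi j)) x))
      dirac (sequentially \<times>\<^sub>F sequentially)"
begin

lemma scale_pos: "0 < b powi j" "0 < t \<Longrightarrow> 0 < b powi j * t"
  using b_pos by (simp_all add: zero_less_power_int)

lemma \<phi>_integrable: "l \<in> {1..M} \<Longrightarrow> 0 < s \<Longrightarrow> integrable lborel (rescale a (\<phi> l) s)"
  and \<eta>_integrable: "l \<in> {1..M} \<Longrightarrow> 0 < s \<Longrightarrow> integrable lborel (rescale a (\<eta> l) s)"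
  by (blast intro: integrable_rescale rapid_integrable schwartz_rapid \<phi>_schwartz \<eta>_schwartz)+

lemma \<phi>_measurable: "l \<in> {1..M} \<Longrightarrow> \<phi> l \<in> borel_measurable borel"
  and \<eta>_measurable: "l \<in> {1..M} \<Longrightarrow> \<eta> l \<in> borel_measurable borel"
  by (blast intro: schwartz_measurable \<phi>_schwartz \<eta>_schwartz)+

lemma conv_\<phi>_bounded:
  assumes f: "f \<in> schwartz" and l: "l \<in> {1..M}" and s: "0 < s"
  shows "\<exists>B. \<forall>x. norm (conv mul f (rescale a (\<phi> l) s) x) \<le> B"
  using conv_rescale_bound[OF f schwartz_rapid[OF \<phi>_schwartz[OF l]] \<phi>_mean[OF l]] s by blast

text \<open>Testing the hypothesis with \<open>y \<mapsto> f (x (A\<^sub>t y)\<^sup>-\<^sup>1)\<close> moves it to the scales \<open>b\<^sup>j t\<close>.\<close>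

lemma reproducing_pointwise:
  assumes f: "f \<in> schwartz" and t: "0 < t"
  shows "(\<lambda>n. \<Sum>j\<in>{- int n..int n}. \<Sum>l\<in>{1..M}.
    conv mul (conv mul f (rescale a (\<phi> l) (b powi j * t))) (rescale a (\<eta> l) (b powi j * t)) x) \<longlonglongrightarrow> f x"
proof -
  have [measurable]: "f \<in> borel_measurable borel" using f by (rule schwartz_measurable)
  obtain B where B: "\<And>x. norm (f x) \<le> B" using rapid_bounded[OF schwartz_rapid[OF f]] by blast
  define g where "g y = f (mul x (- dilation a t y))" for y
  have g: "g \<in> schwartz" unfolding g_def by (rule schwartz_translate[OF f t])
  have [measurable]: "g \<in> borel_measurable borel" using g by (rule schwartz_measurable)
  have diag: "filterlim (\<lambda>n::nat. (n, n)) (sequentially \<times>\<^sub>F sequentially) sequentially"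
    by (intro filterlim_Pair filterlim_ident)
  define K where "K n y = (\<Sum>j\<in>{- int n..int n}. \<Sum>l\<in>{1..M}.
          conv mul (rescale a (\<phi> l) (b powi j)) (rescale a (\<eta> l) (b powi j)) y)" for n y
  have "(\<lambda>n. distr_of (K n) g) \<longlonglongrightarrow> dirac g"
    using filterlim_compose[OF _ diag] reproducing g
    unfolding tempered_lim_def K_def[abs_def] by (fastforce simp: case_prod_beta)
  moreover have "dirac g = f x" by (simp add: dirac_def g_def)
  moreover have "distr_of (K n) g = (\<Sum>j\<in>{- int n..int n}. \<Sum>l\<in>{1..M}.
    conv mul (conv mul f (rescale a (\<phi> l) (b powi j * t))) (rescale a (\<eta> l) (b powi j * t)) x)" for n
  proof -
    define h where "h j l = conv mul (rescale a (\<phi> l) (b powi j)) (rescale a (\<eta> l) (b powi j))" for j l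
    have h_int: "integrable lborel (h j l)" if "l \<in> {1..M}" for j l
      unfolding h_def using that scale_pos by (intro integrable_conv \<phi>_integrable \<eta>_integrable)
    have h_meas: "h j l \<in> borel_measurable borel" if "l \<in> {1..M}" for j l
      using h_int[OF that] by (auto dest: borel_measurable_integrable)
    have hg_int: "integrable lborel (\<lambda>y. h j l y * g y)" if l: "l \<in> {1..M}" for j l
    proof (rule Bochner_Integration.integrable_bound)
      show "integrable lborel (\<lambda>y. B * norm (h j l y))" using h_int[OF l] by auto
      note [measurable] = h_meas[OF l]
      show "(\<lambda>y. h j l y * g y) \<in> borel_measurable lborel" by measurable
      show "AE y in lborel. norm (h j l y * g y) \<le> norm (B * norm (h j l y))"
      proof (intro AE_I2)
        fix y
        have "norm (h j l y) * norm (g y) \<le> norm (h j l y) * B"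
          unfolding g_def by (intro mult_left_mono B) simp
        also have "\<dots> \<le> \<bar>B * norm (h j l y)\<bar>" by (simp add: mult.commute abs_ge_self)
        finally show "norm (h j l y * g y) \<le> norm (B * norm (h j l y))" by (simp add: norm_mult)
      qed
    qed
    have term_eq: "(\<integral>y. h j l y * g y \<partial>lborel) =
        conv mul (conv mul f (rescale a (\<phi> l) (b powi j * t))) (rescale a (\<eta> l) (b powi j * t)) x" if l: "l \<in> {1..M}" for j l
    proof -
      note [measurable] = h_meas[OF l] \<phi>_measurable[OF l] \<eta>_measurable[OF l]
      have "(\<integral>y. h j l y * g y \<partial>lborel) = (\<integral>y. f (mul x (- dilation a t y)) * h j l y \<partial>lborel)"
        by (simp add: g_def mult.commute)
      also have "\<dots> = (\<integral>y. f (mul x (- y)) * rescale a (h j l) t y \<partial>lborel)"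
        by (rule integral_rescale[OF t, where h = "\<lambda>y. f (mul x (- y))", symmetric]) measurable
      also have "\<dots> = conv mul f (rescale a (h j l) t) x"
        by (rule conv_lborel[symmetric]) measurable
      also have "rescale a (h j l) t = conv mul (rescale a (\<phi> l) (b powi j * t)) (rescale a (\<eta> l) (b powi j * t))"
        unfolding h_def using t scale_pos
        by (subst conv_rescale[symmetric]) (auto simp: rescale_rescale)
      also have "conv mul f \<dots> x = conv mul (conv mul f (rescale a (\<phi> l) (b powi j * t))) (rescale a (\<eta> l) (b powi j * t)) x"
        using l t scale_pos by (intro conv_assoc[symmetric, OF _ B] \<phi>_integrable \<eta>_integrable) auto
      finally show ?thesis .
    qed
    have K_eq: "K n y = (\<Sum>j\<in>{- int n..int n}. \<Sum>l\<in>{1..M}. h j l y)" for y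
      by (simp add: K_def h_def)
    have K_meas: "(\<lambda>y. K n y * g y) \<in> borel_measurable lborel"
      unfolding K_eq
      by (intro borel_measurable_times borel_measurable_sum) (use h_meas in auto)
    have "distr_of (K n) g = (\<integral>y. K n y * g y \<partial>lborel)"
      unfolding distr_of_def using K_meas by (rule integral_completion)
    also have "\<dots> = (\<integral>y. (\<Sum>j\<in>{- int n..int n}. \<Sum>l\<in>{1..M}. h j l y * g y) \<partial>lborel)"
      by (simp add: K_eq sum_distrib_right)
    also have "\<dots> = (\<Sum>j\<in>{- int n..int n}. \<Sum>l\<in>{1..M}. (\<integral>y. h j l y * g y \<partial>lborel))"
      using hg_int by (subst Bochner_Integration.integral_sum) (auto intro!: sum.cong Bochner_Integration.integral_sum Bochner_Integration.integrable_sum)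
    also have "\<dots> = (\<Sum>j\<in>{- int n..int n}. \<Sum>l\<in>{1..M}.
        conv mul (conv mul f (rescale a (\<phi> l) (b powi j * t))) (rescale a (\<eta> l) (b powi j * t)) x)"
      by (intro sum.cong refl term_eq)
    finally show ?thesis .
  qed
  ultimately show ?thesis by simp
qed

text \<open>The decay of \<open>f * \<phi>\<^sub>s\<close> for small and for large \<open>s\<close> bounds the partial sums uniformly, so that the
  formula may be convolved with an integrable function.\<close>

lemma partial_sums_bounded:
  assumes f: "f \<in> schwartz" and t: "0 < t"
  shows "\<exists>C. \<forall>n x. norm (\<Sum>j\<in>{- int n..int n}. \<Sum>l\<in>{1..M}.
    conv mul (conv mul f (rescale a (\<phi> l) (b powi j * t))) (rescale a (\<eta> l) (b powi j * t)) x) \<le> C"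
proof -
  have [measurable]: "f \<in> borel_measurable borel" using f by (rule schwartz_measurable)
  define q where "q = b powr (1/2)"
  have q: "0 < q" "q < 1" using b_pos b_less_1 by (auto simp: q_def powr01_less_one)
  define T where "T = max (t powr (1/2)) (t powr (- 1/2))"
  have T: "0 \<le> T" by (simp add: T_def le_max_iff_disj)
  have "\<forall>l\<in>{1..M}. \<exists>C\<ge>0. \<forall>s x. 0 < s \<longrightarrow> norm (conv mul f (rescale a (\<phi> l) s) x) \<le> C * min (s powr (1/2)) (s powr (- 1/2))"
    using conv_rescale_bound[OF f schwartz_rapid[OF \<phi>_schwartz] \<phi>_mean] by blast
  from bchoice[OF this] obtain C where C: "\<And>l. l \<in> {1..M} \<Longrightarrow> 0 \<le> C l"
    "\<And>l s x. l \<in> {1..M} \<Longrightarrow> 0 < s \<Longrightarrow> norm (conv mul f (rescale a (\<phi> l) s) x) \<le> C l * min (s powr (1/2)) (s powr (- 1/2))"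
    by blast
  define J where "J l = (\<integral>x. norm (\<eta> l x) \<partial>lborel)" for l
  have J: "0 \<le> J l" for l by (simp add: J_def)
  have min_le: "min ((b powi j * t) powr (1/2)) ((b powi j * t) powr (- 1/2)) \<le> T * q ^ nat \<bar>j\<bar>" for j
  proof -
    have "min ((b powi j * t) powr (1/2)) ((b powi j * t) powr (- 1/2)) =
        min ((b powi j) powr (1/2) * t powr (1/2)) ((b powi j) powr - (1/2) * t powr (- 1/2))"
      using t scale_pos(1)[of j] by (simp add: powr_mult)
    also have "\<dots> \<le> min ((b powi j) powr (1/2) * T) ((b powi j) powr - (1/2) * T)"
      by (intro min.mono mult_left_mono) (auto simp: T_def)
    also have "\<dots> = min ((b powi j) powr (1/2)) ((b powi j) powr - (1/2)) * T"
      using T by (simp add: min_mult_distrib_right)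
    also have "\<dots> = T * q ^ nat \<bar>j\<bar>"
      using min_powr_powi[OF b_pos b_less_1, of "1/2" j] by (simp add: q_def)
    finally show ?thesis .
  qed
  have summand: "norm (conv mul (conv mul f (rescale a (\<phi> l) (b powi j * t))) (rescale a (\<eta> l) (b powi j * t)) x) \<le> C l * T * J l * q ^ nat \<bar>j\<bar>"
    if l: "l \<in> {1..M}" for l j x
  proof -
    note [measurable] = \<phi>_measurable[OF l] \<eta>_measurable[OF l]
    let ?s = "b powi j * t"
    have s: "0 < ?s" using t by (rule scale_pos)
    have Fb: "norm (conv mul f (rescale a (\<phi> l) ?s) y) \<le> C l * (T * q ^ nat \<bar>j\<bar>)" for y
      using C(2)[OF l s, of y] mult_left_mono[OF min_le C(1)[OF l]] by (rule order_trans)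
    have "ennreal (norm (conv mul (conv mul f (rescale a (\<phi> l) ?s)) (rescale a (\<eta> l) ?s) x)) \<le>
      (\<integral>\<^sup>+y. ennreal (norm (conv mul f (rescale a (\<phi> l) ?s) (mul x (- y)))) * ennreal (norm (rescale a (\<eta> l) ?s y)) \<partial>lborel)"
      by (rule norm_conv_le) measurable
    also have "\<dots> \<le> (\<integral>\<^sup>+y. ennreal (C l * (T * q ^ nat \<bar>j\<bar>)) * ennreal (norm (rescale a (\<eta> l) ?s y)) \<partial>lborel)"
      by (intro nn_integral_mono mult_right_mono ennreal_leI Fb) auto
    also have "\<dots> = (\<integral>\<^sup>+y. ennreal (C l * (T * q ^ nat \<bar>j\<bar>)) * ennreal (norm (\<eta> l y)) \<partial>lborel)"
      by (rule nn_integral_rescale[OF s, where h = "\<lambda>_. ennreal (C l * (T * q ^ nat \<bar>j\<bar>))"]) measurable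
    also have "\<dots> = ennreal (C l * (T * q ^ nat \<bar>j\<bar>)) * ennreal (J l)"
      unfolding J_def using rapid_integrable[OF schwartz_rapid[OF \<eta>_schwartz[OF l]]]
      by (subst nn_integral_cmult) (auto simp: nn_integral_eq_integral)
    also have "\<dots> = ennreal (C l * T * J l * q ^ nat \<bar>j\<bar>)"
      using C(1)[OF l] J q T by (subst ennreal_mult[symmetric]) (auto simp: mult_ac)
    finally show ?thesis
      using C(1)[OF l] J q T by (subst (asm) ennreal_le_iff) auto
  qed
  have "norm (\<Sum>j\<in>{- int n..int n}. \<Sum>l\<in>{1..M}.
      conv mul (conv mul f (rescale a (\<phi> l) (b powi j * t))) (rescale a (\<eta> l) (b powi j * t)) x) \<le>
      (\<Sum>l\<in>{1..M}. C l * T * J l) * (2 / (1 - q))" for n x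
  proof -
    have "norm (\<Sum>j\<in>{- int n..int n}. \<Sum>l\<in>{1..M}.
      conv mul (conv mul f (rescale a (\<phi> l) (b powi j * t))) (rescale a (\<eta> l) (b powi j * t)) x) \<le>
      (\<Sum>j\<in>{- int n..int n}. \<Sum>l\<in>{1..M}. C l * T * J l * q ^ nat \<bar>j\<bar>)"
      by (intro sum_norm_le order_trans[OF norm_sum] sum_mono summand)
    also have "\<dots> = (\<Sum>l\<in>{1..M}. C l * T * J l) * (\<Sum>j\<in>{- int n..int n}. q ^ nat \<bar>j\<bar>)"
      by (simp add: sum_distrib_left sum_distrib_right)
    also have "\<dots> \<le> (\<Sum>l\<in>{1..M}. C l * T * J l) * (2 / (1 - q))"
      using C(1) J q T by (intro mult_left_mono sum_geometric_int_le sum_nonneg) auto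
    finally show ?thesis .
  qed
  then show ?thesis by blast
qed

lemma reproducing_convolved:
  assumes f: "f \<in> schwartz" and t: "0 < t" and \<psi>: "integrable lborel \<psi>"
  shows "(\<lambda>n. \<Sum>j\<in>{- int n..int n}. \<Sum>l\<in>{1..M}.
    conv mul (conv mul f (rescale a (\<phi> l) (b powi j * t))) (conv mul (rescale a (\<eta> l) (b powi j * t)) \<psi>) x)
    \<longlonglongrightarrow> conv mul f \<psi> x"
proof -
  have [measurable]: "f \<in> borel_measurable borel" using f by (rule schwartz_measurable)
  have [measurable]: "\<psi> \<in> borel_measurable borel" using \<psi> by (auto dest: borel_measurable_integrable)
  define u where "u j l = conv mul (conv mul f (rescale a (\<phi> l) (b powi j * t))) (rescale a (\<eta> l) (b powi j * t))" for j l
  have u_meas: "u j l \<in> borel_measurable borel" if "l \<in> {1..M}" for j l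
    unfolding u_def using that \<phi>_measurable \<eta>_measurable by measurable
  define S where "S n y = (\<Sum>j\<in>{- int n..int n}. \<Sum>l\<in>{1..M}. u j l y)" for n y
  have S_meas [measurable]: "S n \<in> borel_measurable borel" for n
    unfolding S_def by (intro borel_measurable_sum u_meas)
  obtain C where C: "\<And>n y. norm (S n y) \<le> C"
    using partial_sums_bounded[OF f t] unfolding S_def u_def by blast
  have lim: "(\<lambda>n. S n y) \<longlonglongrightarrow> f y" for y
    unfolding S_def u_def by (rule reproducing_pointwise[OF f t])
  have "(\<lambda>n. \<integral>y. S n (mul x (- y)) * \<psi> y \<partial>lborel) \<longlonglongrightarrow> (\<integral>y. f (mul x (- y)) * \<psi> y \<partial>lborel)"
  proof (rule integral_dominated_convergence)
    show "integrable lborel (\<lambda>y. C * norm (\<psi> y))" using \<psi> by auto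
    show "AE y in lborel. (\<lambda>n. S n (mul x (- y)) * \<psi> y) \<longlonglongrightarrow> f (mul x (- y)) * \<psi> y"
      by (intro AE_I2 tendsto_mult lim tendsto_const)
    show "AE y in lborel. norm (S n (mul x (- y)) * \<psi> y) \<le> C * norm (\<psi> y)" for n
      using C by (intro AE_I2) (auto simp: norm_mult intro!: mult_right_mono)
  qed measurable
  moreover have "(\<integral>y. S n (mul x (- y)) * \<psi> y \<partial>lborel) = (\<Sum>j\<in>{- int n..int n}. \<Sum>l\<in>{1..M}.
    conv mul (conv mul f (rescale a (\<phi> l) (b powi j * t))) (conv mul (rescale a (\<eta> l) (b powi j * t)) \<psi>) x)" for n
  proof -
    have i: "integrable lborel (\<lambda>y. u j l (mul x (- y)) * \<psi> y)"
      and e: "(\<integral>y. u j l (mul x (- y)) * \<psi> y \<partial>lborel) = conv mul (conv mul f (rescale a (\<phi> l) (b powi j * t))) (conv mul (rescale a (\<eta> l) (b powi j * t)) \<psi>) x"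
      if l: "l \<in> {1..M}" for j l
    proof -
      note [measurable] = u_meas[OF l] \<phi>_measurable[OF l] \<eta>_measurable[OF l]
      have s: "0 < b powi j * t" using t by (rule scale_pos)
      obtain B where B: "\<And>x. norm (conv mul f (rescale a (\<phi> l) (b powi j * t)) x) \<le> B"
        using conv_\<phi>_bounded[OF f l s] by blast
      have B0: "0 \<le> B" using order_trans[OF norm_ge_zero B] .
      define J where "J = (\<integral>x. norm (rescale a (\<eta> l) (b powi j * t) x) \<partial>lborel)"
      have ub: "norm (u j l y) \<le> B * J" for y
      proof -
        have "ennreal (norm (u j l y)) \<le> (\<integral>\<^sup>+z. ennreal (norm (conv mul f (rescale a (\<phi> l) (b powi j * t)) (mul y (- z)))) *
            ennreal (norm (rescale a (\<eta> l) (b powi j * t) z)) \<partial>lborel)"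
          unfolding u_def by (rule norm_conv_le) measurable
        also have "\<dots> \<le> (\<integral>\<^sup>+z. ennreal B * ennreal (norm (rescale a (\<eta> l) (b powi j * t) z)) \<partial>lborel)"
          by (intro nn_integral_mono mult_right_mono ennreal_leI B) auto
        also have "\<dots> = ennreal (B * J)"
          using \<eta>_integrable[OF l s] B0 unfolding J_def
          by (subst nn_integral_cmult) (auto simp: nn_integral_eq_integral ennreal_mult)
        finally show ?thesis
          using B0 by (subst (asm) ennreal_le_iff) (auto simp: J_def)
      qed
      show "integrable lborel (\<lambda>y. u j l (mul x (- y)) * \<psi> y)"
      proof (rule Bochner_Integration.integrable_bound)
        show "integrable lborel (\<lambda>y. (B * J) * norm (\<psi> y))" using \<psi> by auto
        show "(\<lambda>y. u j l (mul x (- y)) * \<psi> y) \<in> borel_measurable lborel" by measurable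
        show "AE y in lborel. norm (u j l (mul x (- y)) * \<psi> y) \<le> norm ((B * J) * norm (\<psi> y))"
        proof (intro AE_I2)
          fix y
          have "norm (u j l (mul x (- y))) * norm (\<psi> y) \<le> (B * J) * norm (\<psi> y)"
            by (intro mult_right_mono ub) simp
          also have "\<dots> \<le> \<bar>(B * J) * norm (\<psi> y)\<bar>" by (rule abs_ge_self)
          finally show "norm (u j l (mul x (- y)) * \<psi> y) \<le> norm ((B * J) * norm (\<psi> y))" by (simp add: norm_mult)
        qed
      qed
      have "(\<integral>y. u j l (mul x (- y)) * \<psi> y \<partial>lborel) = conv mul (u j l) \<psi> x"
        by (rule conv_lborel[symmetric]) measurable
      also have "\<dots> = conv mul (conv mul f (rescale a (\<phi> l) (b powi j * t))) (conv mul (rescale a (\<eta> l) (b powi j * t)) \<psi>) x"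
        unfolding u_def using l s \<psi> by (intro conv_assoc[OF _ B] \<eta>_integrable) auto
      finally show "(\<integral>y. u j l (mul x (- y)) * \<psi> y \<partial>lborel) = conv mul (conv mul f (rescale a (\<phi> l) (b powi j * t))) (conv mul (rescale a (\<eta> l) (b powi j * t)) \<psi>) x" .
    qed
    have "(\<integral>y. S n (mul x (- y)) * \<psi> y \<partial>lborel) = (\<integral>y. (\<Sum>j\<in>{- int n..int n}. \<Sum>l\<in>{1..M}. u j l (mul x (- y)) * \<psi> y) \<partial>lborel)"
      by (simp add: S_def sum_distrib_right)
    also have "\<dots> = (\<Sum>j\<in>{- int n..int n}. \<Sum>l\<in>{1..M}. (\<integral>y. u j l (mul x (- y)) * \<psi> y \<partial>lborel))"
      using i by (subst Bochner_Integration.integral_sum) (auto intro!: sum.cong Bochner_Integration.integral_sum Bochner_Integration.integrable_sum)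
    finally show ?thesis by (simp add: e)
  qed
  ultimately show ?thesis by (simp add: conv_lborel)
qed

text \<open>As the scales \<open>b\<^sup>j t\<close> move with \<open>t\<close>, the bound can be integrated in \<open>t\<close>.  Half of the geometric decay
  in \<open>\<bar>j\<bar>\<close> is spent on summing the series and the other half remains in the supremum, which commutes
  with the power \<open>q\<close> for every \<open>q > 0\<close>.\<close>

theorem peetre_domination:
  assumes \<psi>: "\<psi> \<in> schwartz" and mean: "(\<integral>x. \<psi> x \<partial>lborel) = 0" and N: "0 < N" and \<epsilon>: "0 < \<epsilon>"
    and cl: "\<And>l. l \<in> {1..M} \<Longrightarrow> (\<eta> l, \<psi>) \<in> C1_class a mul \<rho> (N + \<epsilon>) N"
  shows "\<exists>C>0. \<exists>r. 0 < r \<and> r < 1 \<and> (\<forall>f\<in>schwartz. \<forall>t>0. \<forall>x.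
    peetre mul \<rho> N (1 / t) (conv mul f (rescale a \<psi> t)) x \<le> ennreal C *
      (SUP j. ennreal (r ^ nat \<bar>j\<bar>) * (\<Sum>l\<in>{1..M}.
        peetre mul \<rho> N (1 / (b powi j * t)) (conv mul f (rescale a (\<phi> l) (b powi j * t))) x)))"
proof -
  define d where "d = min \<epsilon> (1/2)"
  have d: "0 < d" using \<epsilon> by (simp add: d_def)
  define r where "r = b powr (d / 2)"
  have r: "0 < r" "r < 1" using b_pos b_less_1 d by (auto simp: r_def powr01_less_one)
  have "\<forall>l\<in>{1..M}. \<exists>K>0. \<forall>\<tau>>0. ennreal (max 1 \<tau> powr N) * C_int a mul \<rho> (\<eta> l) \<psi> \<tau> N
      \<le> ennreal (K * min (\<tau> powr d) (\<tau> powr - d))"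
    using C_int_decay[OF cl mean \<epsilon> N] unfolding d_def by blast
  from bchoice[OF this] obtain K where K: "\<And>l. l \<in> {1..M} \<Longrightarrow> 0 < K l"
    "\<And>l \<tau>. l \<in> {1..M} \<Longrightarrow> 0 < \<tau> \<Longrightarrow> ennreal (max 1 \<tau> powr N) * C_int a mul \<rho> (\<eta> l) \<psi> \<tau> N \<le> ennreal (K l * min (\<tau> powr d) (\<tau> powr - d))"
    by blast
  define K0 where "K0 = 1 + (\<Sum>l\<in>{1..M}. K l)"
  have K0: "0 < K0" unfolding K0_def by (intro add_pos_nonneg zero_less_one sum_nonneg less_imp_le[OF K(1)])
  have K_le: "K l \<le> K0" if "l \<in> {1..M}" for l
    using member_le_sum[of l "{1..M}" K] K(1) that by (simp add: K0_def less_imp_le)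
  have coeff: "ennreal (max 1 (t / (b powi j * t)) powr N) * C_int a mul \<rho> (\<eta> l) \<psi> (t / (b powi j * t)) N
      \<le> ennreal (K0 * (r ^ nat \<bar>j\<bar> * r ^ nat \<bar>j\<bar>))" if l: "l \<in> {1..M}" and t: "0 < t" for l j t
  proof -
    have \<tau>: "t / (b powi j * t) = b powi (- j)" using t by (simp add: power_int_minus field_simps)
    have "min ((b powi (- j)) powr d) ((b powi (- j)) powr - d) = (b powr d) ^ nat \<bar>- j\<bar>"
      by (rule min_powr_powi[OF b_pos b_less_1 d])
    also have "b powr d = r * r" using b_pos by (simp add: r_def powr_add[symmetric])
    finally have m: "min ((b powi (- j)) powr d) ((b powi (- j)) powr - d) = r ^ nat \<bar>j\<bar> * r ^ nat \<bar>j\<bar>"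
      by (simp add: power_mult_distrib)
    have "ennreal (max 1 (b powi (- j)) powr N) * C_int a mul \<rho> (\<eta> l) \<psi> (b powi (- j)) N \<le> ennreal (K l * (r ^ nat \<bar>j\<bar> * r ^ nat \<bar>j\<bar>))"
      using K(2)[OF l scale_pos(1)[of "- j"]] unfolding m .
    also have "\<dots> \<le> ennreal (K0 * (r ^ nat \<bar>j\<bar> * r ^ nat \<bar>j\<bar>))"
      using r by (intro ennreal_leI mult_right_mono K_le l) auto
    finally show ?thesis unfolding \<tau> .
  qed
  define C where "C = c\<^sub>0 powr N * K0 * (2 / (1 - r))"
  have C: "0 < C" using c\<^sub>0(1) K0 r by (simp add: C_def)
  have main: "peetre mul \<rho> N (1 / t) (conv mul f (rescale a \<psi> t)) x \<le> ennreal C *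
      (SUP j. ennreal (r ^ nat \<bar>j\<bar>) * (\<Sum>l\<in>{1..M}.
        peetre mul \<rho> N (1 / (b powi j * t)) (conv mul f (rescale a (\<phi> l) (b powi j * t))) x))"
    if f: "f \<in> schwartz" and t: "0 < t" for f t x
  proof -
    have [measurable]: "f \<in> borel_measurable borel" "\<psi> \<in> borel_measurable borel"
      using f \<psi> by (auto intro: schwartz_measurable)
    define P where "P j l = peetre mul \<rho> N (1 / (b powi j * t)) (conv mul f (rescale a (\<phi> l) (b powi j * t))) x" for j l
    define Q where "Q = (SUP j. ennreal (r ^ nat \<bar>j\<bar>) * (\<Sum>l\<in>{1..M}. P j l))"
    have "ennreal (norm (conv mul f (rescale a \<psi> t) (mul x (- z))) / (1 + 1 / t * \<rho> z) powr N) \<le> ennreal C * Q" for z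
    proof -
      define D where "D = (1 + \<rho> z / t) powr N"
      have "0 < 1 + \<rho> z / t" using t by (simp add: add_pos_nonneg)
      then have D: "0 < D" unfolding D_def by auto
      define S where "S n = (\<Sum>j\<in>{- int n..int n}. \<Sum>l\<in>{1..M}.
        conv mul (conv mul f (rescale a (\<phi> l) (b powi j * t))) (conv mul (rescale a (\<eta> l) (b powi j * t)) (rescale a \<psi> t)) (mul x (- z)))" for n
      have lim: "S \<longlonglongrightarrow> conv mul f (rescale a \<psi> t) (mul x (- z))"
        unfolding S_def by (intro reproducing_convolved f t integrable_rescale rapid_integrable schwartz_rapid \<psi>)
      have bound: "ennreal (norm (S n)) \<le> ennreal (C * D) * Q" for n
      proof -
        have "ennreal (norm (S n)) \<le> (\<Sum>j\<in>{- int n..int n}. \<Sum>l\<in>{1..M}. ennreal (norm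
            (conv mul (conv mul f (rescale a (\<phi> l) (b powi j * t))) (conv mul (rescale a (\<eta> l) (b powi j * t)) (rescale a \<psi> t)) (mul x (- z)))))"
          unfolding S_def by (intro order_trans[OF ennreal_norm_sum_le] sum_mono ennreal_norm_sum_le)
        also have "\<dots> \<le> (\<Sum>j\<in>{- int n..int n}. \<Sum>l\<in>{1..M}. P j l * (ennreal (c\<^sub>0 powr N * D) * ennreal (K0 * (r ^ nat \<bar>j\<bar> * r ^ nat \<bar>j\<bar>))))"
        proof (intro sum_mono)
          fix j l assume l: "l \<in> {1..M}"
          note [measurable] = \<phi>_measurable[OF l] \<eta>_measurable[OF l]
          let ?s = "b powi j * t"
          have s: "0 < ?s" using t by (rule scale_pos)
          have "ennreal (norm (conv mul (conv mul f (rescale a (\<phi> l) ?s)) (conv mul (rescale a (\<eta> l) ?s) (rescale a \<psi> t)) (mul x (- z))))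
            \<le> P j l * (ennreal (c\<^sub>0 powr N * D) * (ennreal (max 1 (t / ?s) powr N) * C_int a mul \<rho> (\<eta> l) \<psi> (t / ?s) N))"
            unfolding P_def D_def by (rule conv_le_peetre[OF _ _ _ s t N]) measurable
          also have "\<dots> \<le> P j l * (ennreal (c\<^sub>0 powr N * D) * ennreal (K0 * (r ^ nat \<bar>j\<bar> * r ^ nat \<bar>j\<bar>)))"
            by (intro mult_left_mono coeff l t) auto
          finally show "ennreal (norm (conv mul (conv mul f (rescale a (\<phi> l) ?s)) (conv mul (rescale a (\<eta> l) ?s) (rescale a \<psi> t)) (mul x (- z))))
            \<le> P j l * (ennreal (c\<^sub>0 powr N * D) * ennreal (K0 * (r ^ nat \<bar>j\<bar> * r ^ nat \<bar>j\<bar>)))" .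
        qed
        also have "\<dots> = (\<Sum>j\<in>{- int n..int n}. ennreal (c\<^sub>0 powr N * D * K0) * ennreal (r ^ nat \<bar>j\<bar>) * (ennreal (r ^ nat \<bar>j\<bar>) * (\<Sum>l\<in>{1..M}. P j l)))"
        proof (intro sum.cong refl)
          fix j
          have "ennreal (c\<^sub>0 powr N * D) * ennreal (K0 * (r ^ nat \<bar>j\<bar> * r ^ nat \<bar>j\<bar>)) =
              ennreal (c\<^sub>0 powr N * D * K0) * ennreal (r ^ nat \<bar>j\<bar>) * ennreal (r ^ nat \<bar>j\<bar>)"
            using D K0 r by (simp add: mult_ac flip: ennreal_mult)
          then show "(\<Sum>l\<in>{1..M}. P j l * (ennreal (c\<^sub>0 powr N * D) * ennreal (K0 * (r ^ nat \<bar>j\<bar> * r ^ nat \<bar>j\<bar>)))) =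
              ennreal (c\<^sub>0 powr N * D * K0) * ennreal (r ^ nat \<bar>j\<bar>) * (ennreal (r ^ nat \<bar>j\<bar>) * (\<Sum>l\<in>{1..M}. P j l))"
            by (simp only: sum_distrib_right[symmetric] mult_ac)
        qed
        also have "\<dots> \<le> (\<Sum>j\<in>{- int n..int n}. ennreal (c\<^sub>0 powr N * D * K0) * ennreal (r ^ nat \<bar>j\<bar>) * Q)"
          unfolding Q_def by (intro sum_mono mult_left_mono SUP_upper) auto
        also have "\<dots> = ennreal (c\<^sub>0 powr N * D * K0) * ennreal (\<Sum>j\<in>{- int n..int n}. r ^ nat \<bar>j\<bar>) * Q"
          using r by (simp add: sum_distrib_left[symmetric] sum_distrib_right[symmetric] sum_ennreal)
        also have "\<dots> \<le> ennreal (c\<^sub>0 powr N * D * K0) * ennreal (2 / (1 - r)) * Q"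
          by (intro mult_right_mono mult_left_mono ennreal_leI sum_geometric_int_le r) auto
        also have "ennreal (c\<^sub>0 powr N * D * K0) * ennreal (2 / (1 - r)) = ennreal (C * D)"
          using D K0 r by (simp add: C_def mult_ac flip: ennreal_mult)
        finally show ?thesis .
      qed
      have "(\<lambda>n. ennreal (norm (S n))) \<longlonglongrightarrow> ennreal (norm (conv mul f (rescale a \<psi> t) (mul x (- z))))"
        by (intro tendsto_ennrealI tendsto_norm lim)
      then have "ennreal (norm (conv mul f (rescale a \<psi> t) (mul x (- z)))) \<le> ennreal (C * D) * Q"
        by (rule LIMSEQ_le_const2) (use bound in auto)
      then have "ennreal (1 / D) * ennreal (norm (conv mul f (rescale a \<psi> t) (mul x (- z)))) \<le> ennreal (1 / D) * (ennreal (C * D) * Q)"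
        by (rule mult_left_mono) simp
      also have "\<dots> = ennreal C * Q"
        using D C by (simp add: mult.assoc[symmetric] flip: ennreal_mult)
      finally show ?thesis
        using D by (simp add: D_def[symmetric] flip: ennreal_mult)
    qed
    then show ?thesis unfolding peetre_def Q_def P_def by (rule SUP_least)
  qed
  then show ?thesis using C r by blast
qed

end

section \<open>The mean value inequality and Peetre's inequality\<close>

lemma vec_eq_sum_axis: "(v :: real^'n::finite) = (\<Sum>k\<in>UNIV. v $ k *\<^sub>R axis k 1)"
  by (simp add: vec_eq_iff sum_component axis_def if_distrib cong: if_cong)

context homogeneous_group
begin

lemma has_derivative_mul_right: "\<exists>m. (mul z has_derivative m) (at v)"
proof -
  let ?m = "\<lambda>p. mul (fst p) (snd p)"
  have sm: "smooth_on UNIV ?m" using smooth_mul by (simp add: case_prod_beta')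
  have "[] \<in> lists (Basis :: ((real^('n::{finite,linorder})) \<times> (real^('n::{finite,linorder}))) set)" by simp
  with sm have "iterated_deriv [] ?m differentiable (at (z, v))" unfolding smooth_on_def by blast
  then have "(?m has_derivative frechet_derivative ?m (at (z, v))) (at (z, v))"
    by (simp add: frechet_derivative_works)
  moreover have "((\<lambda>y. (z, y)) has_derivative (\<lambda>h. (0, h))) (at v)"
    by (auto intro!: derivative_eq_intros)
  ultimately have "((\<lambda>y. ?m (z, y)) has_derivative (\<lambda>h. frechet_derivative ?m (at (z, v)) (0, h))) (at v)"
    by (rule has_derivative_compose[rotated])
  then show ?thesis by auto
qed

end

context norm_function
begin

lemma left_deriv_linear:
  assumes \<phi>: "\<phi> \<in> schwartz"
  shows "\<exists>G. ((\<lambda>v. \<phi> (mul z v)) has_derivative G) (at 0) \<and> (\<forall>k. left_deriv mul k \<phi> z = G (axis k 1))"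
proof -
  obtain m where m: "(mul z has_derivative m) (at 0)"
    using has_derivative_mul_right by blast
  have "\<phi> differentiable (at (mul z 0))" using \<phi> by (rule schwartz_differentiable)
  then have "(\<phi> has_derivative frechet_derivative \<phi> (at (mul z 0))) (at (mul z 0))"
    by (simp only: frechet_derivative_works)
  from has_derivative_compose[OF m this]
  have G: "((\<lambda>v. \<phi> (mul z v)) has_derivative (\<lambda>h. frechet_derivative \<phi> (at (mul z 0)) (m h))) (at 0)" .
  define G where "G h = frechet_derivative \<phi> (at (mul z 0)) (m h)" for h
  have G': "((\<lambda>v. \<phi> (mul z v)) has_derivative G) (at 0)" using G by (simp add: G_def[abs_def])
  have lin: "linear G" using G' by (rule has_derivative_linear)
  have "left_deriv mul k \<phi> z = G (axis k 1)" for k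
  proof -
    have l: "((\<lambda>t. t *\<^sub>R axis k (1::real)) has_derivative (\<lambda>t. t *\<^sub>R axis k (1::real))) (at (0::real))"
      by (auto intro!: derivative_eq_intros)
    have "((\<lambda>t. \<phi> (mul z (t *\<^sub>R axis k 1))) has_derivative (\<lambda>t. G (t *\<^sub>R axis k 1))) (at 0)"
      by (rule has_derivative_compose[OF l]) (use G' in simp)
    then have "((\<lambda>t. \<phi> (mul z (t *\<^sub>R axis k 1))) has_vector_derivative G (axis k 1)) (at 0)"
      by (simp add: has_vector_derivative_def linear_cmul[OF lin])
    then show ?thesis unfolding left_deriv_def by (rule vector_derivative_at)
  qed
  with G' show ?thesis by blast
qed

text \<open>Since \<open>s \<mapsto> s u\<close> is a one-parameter subgroup, the derivative of \<open>\<phi> (y (s u))\<close> is at every \<open>s\<close> a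
  combination of left-invariant derivatives with constant coefficients.\<close>

lemma left_increment:
  assumes \<phi>: "\<phi> \<in> schwartz" and X: "\<And>k. left_deriv mul k \<phi> \<in> schwartz"
  shows "\<phi> (mul y u) - \<phi> y = (\<integral>s. indicator {0..1} s *\<^sub>R (\<Sum>k\<in>UNIV. of_real (u $ k) * left_deriv mul k \<phi> (mul y (s *\<^sub>R u))) \<partial>lborel)"
proof -
  define F where "F s = \<phi> (mul y (s *\<^sub>R u))" for s :: real
  define d where "d s = (\<Sum>k\<in>UNIV. of_real (u $ k) * left_deriv mul k \<phi> (mul y (s *\<^sub>R u)))" for s :: real
  have deriv: "(F has_vector_derivative d s) (at s within {0..1})" for s
  proof -
    define z where "z = mul y (s *\<^sub>R u)"
    obtain G where G: "((\<lambda>v. \<phi> (mul z v)) has_derivative G) (at 0)" "\<And>k. left_deriv mul k \<phi> z = G (axis k 1)"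
      using left_deriv_linear[OF \<phi>, of z] by blast
    have lin: "linear G" using G(1) by (rule has_derivative_linear)
    have "G u = G (\<Sum>k\<in>UNIV. u $ k *\<^sub>R axis k 1)" by (simp only: vec_eq_sum_axis[symmetric])
    also have "\<dots> = (\<Sum>k\<in>UNIV. u $ k *\<^sub>R G (axis k 1))"
      by (simp add: linear_sum[OF lin] linear_cmul[OF lin])
    also have "\<dots> = d s"
      by (simp only: d_def G(2)[symmetric] z_def scaleR_conv_of_real[where 'a = complex])
    finally have Gu: "G u = d s" .
    have F: "F s' = \<phi> (mul z ((s' - s) *\<^sub>R u))" for s'
      by (simp add: F_def z_def mul_scaleR_same)
    have l: "((\<lambda>s'. (s' - s) *\<^sub>R u) has_derivative (\<lambda>h. h *\<^sub>R u)) (at s within {0..1})"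
      by (auto intro!: derivative_eq_intros)
    have "((\<lambda>s'. \<phi> (mul z ((s' - s) *\<^sub>R u))) has_derivative (\<lambda>h. G (h *\<^sub>R u))) (at s within {0..1})"
      by (rule has_derivative_compose[OF l]) (use G(1) in simp)
    then show ?thesis
      by (simp add: has_vector_derivative_def F[abs_def] linear_cmul[OF lin] Gu)
  qed
  have cont: "continuous_on {0..1} d"
    unfolding d_def
    by (intro continuous_on_sum continuous_on_mult continuous_on_const
        continuous_on_compose2[OF schwartz_continuous[OF X]] continuous_intros) auto
  have "(\<integral>s. indicator {0..1} s *\<^sub>R d s \<partial>lborel) = F 1 - F 0"
    by (rule integral_FTC_Icc[OF _ deriv cont]) auto
  then show ?thesis by (simp add: F_def d_def)
qed

text \<open>The integral over \<open>x\<close> of \<open>\<phi> (x e\<^sub>k) - \<phi> x\<close> vanishes by right invariance.  On the other hand the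
  increment is an average of right translates of \<open>X\<^sub>k \<phi>\<close>, all of which have the same integral.\<close>

lemma left_deriv_mean_zero:
  assumes \<phi>: "\<phi> \<in> schwartz" and X: "\<And>k. left_deriv mul k \<phi> \<in> schwartz"
  shows "(\<integral>x. left_deriv mul k \<phi> x \<partial>lborel) = 0"
proof -
  let ?X = "left_deriv mul k \<phi>" and ?e = "axis k (1::real) :: real^('n::{finite,linorder})"
  have [measurable]: "\<phi> \<in> borel_measurable borel" "?X \<in> borel_measurable borel"
    using \<phi> X by (auto intro: schwartz_measurable)
  have i: "integrable lborel \<phi>" "integrable lborel ?X"
    using \<phi> X by (auto intro: rapid_integrable schwartz_rapid)
  have i1: "integrable lborel (\<lambda>x. \<phi> (mul x ?e))"
    using i(1) by (simp add: integrable_iff_bounded nn_integral_mul_right[where f = "\<lambda>x. ennreal (norm (\<phi> x))"])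
  have inc: "\<phi> (mul x ?e) - \<phi> x = (\<integral>s. indicator {0..1} s *\<^sub>R ?X (mul x (s *\<^sub>R ?e)) \<partial>lborel)" for x
  proof -
    have "(\<Sum>i\<in>UNIV. of_real (?e $ i) * left_deriv mul i \<phi> z) = ?X z" for z
    proof -
      have "(\<Sum>i\<in>UNIV. of_real (?e $ i) * left_deriv mul i \<phi> z) = (\<Sum>i\<in>UNIV. if i = k then left_deriv mul i \<phi> z else 0)"
        by (intro sum.cong refl) (simp add: axis_def)
      then show ?thesis by simp
    qed
    then show ?thesis using left_increment[OF \<phi> X, of x ?e] by simp
  qed
  have "integrable (lborel \<Otimes>\<^sub>M lborel) (\<lambda>(x, s). indicator {0..1::real} s *\<^sub>R ?X (mul x (s *\<^sub>R ?e)))"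
  proof (rule integrableI_bounded)
    have "(\<integral>\<^sup>+p. ennreal (norm (case p of (x, s) \<Rightarrow> indicator {0..1::real} s *\<^sub>R ?X (mul x (s *\<^sub>R ?e)))) \<partial>(lborel \<Otimes>\<^sub>M lborel))
      = (\<integral>\<^sup>+s. (\<integral>\<^sup>+x. ennreal (norm (indicator {0..1::real} s *\<^sub>R ?X (mul x (s *\<^sub>R ?e)))) \<partial>lborel) \<partial>lborel)"
      by (subst lborel_pair.nn_integral_snd[symmetric]) (auto simp: case_prod_beta)
    also have "\<dots> = (\<integral>\<^sup>+s. indicator {0..1::real} s * (\<integral>\<^sup>+x. ennreal (norm (?X x)) \<partial>lborel) \<partial>lborel)"
    proof (rule nn_integral_cong)
      fix s :: real
      show "(\<integral>\<^sup>+x. ennreal (norm (indicator {0..1::real} s *\<^sub>R ?X (mul x (s *\<^sub>R ?e)))) \<partial>lborel) =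
          indicator {0..1::real} s * (\<integral>\<^sup>+x. ennreal (norm (?X x)) \<partial>lborel)"
        using nn_integral_mul_right[where f = "\<lambda>x. ennreal (norm (?X x))" and y = "s *\<^sub>R ?e"]
        by (cases "s \<in> {0..1}") auto
    qed
    also have "\<dots> = (\<integral>\<^sup>+x. ennreal (norm (?X x)) \<partial>lborel)"
      by (subst nn_integral_multc) auto
    also have "\<dots> < \<infinity>" using i(2) by (simp add: integrable_iff_bounded)
    finally show "(\<integral>\<^sup>+p. ennreal (norm (case p of (x, s) \<Rightarrow> indicator {0..1::real} s *\<^sub>R ?X (mul x (s *\<^sub>R ?e)))) \<partial>(lborel \<Otimes>\<^sub>M lborel)) < \<infinity>" .
  qed measurable
  from lborel_pair.Fubini_integral[OF this]
  have swap: "(\<integral>s. (\<integral>x. indicator {0..1::real} s *\<^sub>R ?X (mul x (s *\<^sub>R ?e)) \<partial>lborel) \<partial>lborel) =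
      (\<integral>x. (\<integral>s. indicator {0..1} s *\<^sub>R ?X (mul x (s *\<^sub>R ?e)) \<partial>lborel) \<partial>lborel)" .
  have "0 = (\<integral>x. \<phi> (mul x ?e) \<partial>lborel) - (\<integral>x. \<phi> x \<partial>lborel)"
    by (simp add: integral_mul_right)
  also have "\<dots> = (\<integral>x. \<phi> (mul x ?e) - \<phi> x \<partial>lborel)"
    using i i1 by simp
  also have "\<dots> = (\<integral>s. (\<integral>x. indicator {0..1::real} s *\<^sub>R ?X (mul x (s *\<^sub>R ?e)) \<partial>lborel) \<partial>lborel)"
    unfolding inc swap ..
  also have "\<dots> = (\<integral>s. indicator {0..1::real} s *\<^sub>R (\<integral>x. ?X x \<partial>lborel) \<partial>lborel)"
    by (simp add: integral_mul_right)
  also have "\<dots> = (\<integral>x. ?X x \<partial>lborel)"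
    by simp
  finally show ?thesis by simp
qed

text \<open>Left-invariant derivatives of a convolution fall on its right factor.  The increment formula is
  applied to \<open>\<phi>\<close> at scale \<open>1\<close>, where the displacement is \<open>A\<^sub>t\<^sup>-\<^sup>1 u\<close>.\<close>

lemma conv_increment:
  assumes f: "f \<in> schwartz" and \<phi>: "\<phi> \<in> schwartz" and X: "\<And>k. left_deriv mul k \<phi> \<in> schwartz" and t: "0 < t"
  shows "conv mul f (rescale a \<phi> t) (mul x u) - conv mul f (rescale a \<phi> t) x =
    (\<integral>s. indicator {0..1} s *\<^sub>R (\<Sum>k\<in>UNIV. of_real (dilation a (1 / t) u $ k) *
      conv mul f (rescale a (left_deriv mul k \<phi>) t) (mul x (s *\<^sub>R u))) \<partial>lborel)"
proof -
  let ?X = "\<lambda>k. rescale a (left_deriv mul k \<phi>) t" and ?u = "dilation a (1 / t) u"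
  have [measurable]: "f \<in> borel_measurable borel" "\<phi> \<in> borel_measurable borel"
    using f \<phi> by (auto intro: schwartz_measurable)
  have [measurable]: "left_deriv mul k \<phi> \<in> borel_measurable borel" for k
    using X by (rule schwartz_measurable)
  have resc_bdd: "\<exists>B\<ge>0. \<forall>x. norm (rescale a g t x) \<le> B" if g: "g \<in> schwartz" for g
  proof -
    obtain B where B: "0 \<le> B" "\<And>x. norm (g x) \<le> B" using rapid_bounded[OF schwartz_rapid[OF g]] by blast
    have "norm (rescale a g t x) \<le> t powr - hom_dim a * B" for x
      unfolding rescale_def norm_mult by (intro mult_mono B) auto
    then show ?thesis using B(1) by (intro exI[of _ "t powr - hom_dim a * B"]) auto
  qed
  have f_int: "integrable lborel (\<lambda>z. f (- z))"
    using rapid_integrable[OF schwartz_rapid[OF f]] distr_lborel_uminus[where ?'n = 'n]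
      integrable_distr[of uminus lborel lborel f] by simp
  have f_mult: "integrable lborel (\<lambda>z. f (- z) * g z)"
    if [measurable]: "g \<in> borel_measurable borel" and B: "\<And>z. norm (g z) \<le> B" for g :: "real^('n::{finite,linorder}) \<Rightarrow> complex" and B
  proof (rule Bochner_Integration.integrable_bound)
    show "integrable lborel (\<lambda>z. B * norm (f (- z)))" using f_int by auto
    show "(\<lambda>z. f (- z) * g z) \<in> borel_measurable lborel" by measurable
    show "AE z in lborel. norm (f (- z) * g z) \<le> norm (B * norm (f (- z)))"
    proof (intro AE_I2)
      fix z
      have "norm (f (- z)) * norm (g z) \<le> norm (f (- z)) * B" by (intro mult_left_mono B) simp
      also have "\<dots> \<le> \<bar>B * norm (f (- z))\<bar>" by (simp add: mult.commute abs_ge_self)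
      finally show "norm (f (- z) * g z) \<le> norm (B * norm (f (- z)))" by (simp add: norm_mult)
    qed
  qed
  have f_resc: "integrable lborel (\<lambda>z. f (- z) * rescale a g t (mul z w))" if g: "g \<in> schwartz" for g w
  proof -
    have [measurable]: "g \<in> borel_measurable borel" using g by (rule schwartz_measurable)
    obtain B where "\<And>x. norm (rescale a g t x) \<le> B" using resc_bdd[OF g] by blast
    then show ?thesis by (intro f_mult) auto
  qed
  have inc: "rescale a \<phi> t (mul z (mul x u)) - rescale a \<phi> t (mul z x) =
      (\<integral>s. indicator {0..1} s *\<^sub>R (\<Sum>k\<in>UNIV. of_real (?u $ k) * ?X k (mul z (mul x (s *\<^sub>R u)))) \<partial>lborel)" for z
  proof -
    let ?y = "dilation a (1 / t) (mul z x)"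
    have dil: "dilation a (1 / t) (mul z (mul x (s *\<^sub>R u))) = mul ?y (s *\<^sub>R ?u)" for s
      using t by (simp add: dilation_mul[symmetric] mul_assoc dilation_scaleR[symmetric])
    have "rescale a \<phi> t (mul z (mul x u)) - rescale a \<phi> t (mul z x) =
        of_real (t powr - hom_dim a) * (\<phi> (mul ?y ?u) - \<phi> ?y)"
      using dil[of 1] by (simp add: rescale_def right_diff_distrib)
    also have "\<dots> = of_real (t powr - hom_dim a) *
        (\<integral>s. indicator {0..1} s *\<^sub>R (\<Sum>k\<in>UNIV. of_real (?u $ k) * left_deriv mul k \<phi> (mul ?y (s *\<^sub>R ?u))) \<partial>lborel)"
      by (simp only: left_increment[OF \<phi> X, of ?y ?u])
    also have "\<dots> = (\<integral>s. of_real (t powr - hom_dim a) *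
        (indicator {0..1} s *\<^sub>R (\<Sum>k\<in>UNIV. of_real (?u $ k) * left_deriv mul k \<phi> (mul ?y (s *\<^sub>R ?u)))) \<partial>lborel)"
      by (rule integral_mult_right_zero[symmetric])
    also have "\<dots> = (\<integral>s. indicator {0..1} s *\<^sub>R (\<Sum>k\<in>UNIV. of_real (?u $ k) * ?X k (mul z (mul x (s *\<^sub>R u)))) \<partial>lborel)"
      by (intro Bochner_Integration.integral_cong refl) (simp add: rescale_def dil sum_distrib_left mult_ac)
    finally show ?thesis .
  qed
  define k where "k z s = f (- z) * (indicator {0..1::real} s *\<^sub>R (\<Sum>k\<in>UNIV. of_real (?u $ k) * ?X k (mul z (mul x (s *\<^sub>R u)))))" for z s
  have [measurable]: "case_prod k \<in> borel_measurable (lborel \<Otimes>\<^sub>M lborel)"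
    unfolding k_def by measurable
  obtain B where B: "\<And>k. 0 \<le> B k" "\<And>k x. norm (?X k x) \<le> B k" using resc_bdd[OF X] by metis
  define B0 where "B0 = (\<Sum>k\<in>UNIV. \<bar>?u $ k\<bar> * B k)"
  have B0: "0 \<le> B0" unfolding B0_def using B(1) by (intro sum_nonneg) auto
  have sum_le: "norm (\<Sum>k\<in>UNIV. of_real (?u $ k) * ?X k y) \<le> B0" for y
    unfolding B0_def by (intro sum_norm_le) (auto simp: norm_mult intro!: mult_left_mono B)
  have "integrable (lborel \<Otimes>\<^sub>M lborel) (case_prod k)"
  proof (rule integrableI_bounded)
    have "(\<integral>\<^sup>+p. ennreal (norm (case_prod k p)) \<partial>(lborel \<Otimes>\<^sub>M lborel)) = (\<integral>\<^sup>+s. (\<integral>\<^sup>+z. ennreal (norm (k z s)) \<partial>lborel) \<partial>lborel)"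
      by (subst lborel_pair.nn_integral_snd[symmetric]) (auto simp: case_prod_beta)
    also have "\<dots> \<le> (\<integral>\<^sup>+s. (\<integral>\<^sup>+z. (ennreal B0 * indicator {0..1::real} s) * ennreal (norm (f (- z))) \<partial>lborel) \<partial>lborel)"
    proof (intro nn_integral_mono)
      fix s z
      have "norm (f (- z)) * norm (\<Sum>k\<in>UNIV. of_real (?u $ k) * ?X k (mul z (mul x (s *\<^sub>R u)))) \<le> norm (f (- z)) * B0"
        by (intro mult_left_mono sum_le) simp
      then show "ennreal (norm (k z s)) \<le> (ennreal B0 * indicator {0..1::real} s) * ennreal (norm (f (- z)))"
        using B0 by (cases "s \<in> {0..1}") (auto simp: k_def norm_mult mult_ac intro!: ennreal_leI simp flip: ennreal_mult)
    qed
    also have "\<dots> = (\<integral>\<^sup>+s. (ennreal B0 * indicator {0..1::real} s) * (\<integral>\<^sup>+z. ennreal (norm (f (- z))) \<partial>lborel) \<partial>lborel)"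
      by (simp add: nn_integral_cmult)
    also have "\<dots> = ennreal B0 * (\<integral>\<^sup>+z. ennreal (norm (f (- z))) \<partial>lborel)"
      by (subst nn_integral_multc) (auto simp: nn_integral_cmult_indicator)
    also have "\<dots> < \<infinity>" using f_int by (auto simp: integrable_iff_bounded ennreal_mult_less_top)
    finally show "(\<integral>\<^sup>+p. ennreal (norm (case_prod k p)) \<partial>(lborel \<Otimes>\<^sub>M lborel)) < \<infinity>" .
  qed measurable
  from lborel_pair.Fubini_integral[OF this]
  have swap: "(\<integral>s. (\<integral>z. k z s \<partial>lborel) \<partial>lborel) = (\<integral>z. (\<integral>s. k z s \<partial>lborel) \<partial>lborel)" .
  have "conv mul f (rescale a \<phi> t) (mul x u) - conv mul f (rescale a \<phi> t) x =
      (\<integral>z. f (- z) * rescale a \<phi> t (mul z (mul x u)) \<partial>lborel) - (\<integral>z. f (- z) * rescale a \<phi> t (mul z x) \<partial>lborel)"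
    by (simp add: conv_inverted)
  also have "\<dots> = (\<integral>z. f (- z) * (rescale a \<phi> t (mul z (mul x u)) - rescale a \<phi> t (mul z x)) \<partial>lborel)"
    using f_resc[OF \<phi>] by (simp add: right_diff_distrib)
  also have "\<dots> = (\<integral>z. (\<integral>s. k z s \<partial>lborel) \<partial>lborel)"
    unfolding inc k_def by (simp only: integral_mult_right_zero)
  also have "\<dots> = (\<integral>s. (\<integral>z. k z s \<partial>lborel) \<partial>lborel)" by (rule swap[symmetric])
  also have "\<dots> = (\<integral>s. indicator {0..1} s *\<^sub>R (\<Sum>k\<in>UNIV. of_real (?u $ k) * conv mul f (?X k) (mul x (s *\<^sub>R u))) \<partial>lborel)"
  proof (rule Bochner_Integration.integral_cong[OF refl])
    fix s :: real
    have "(\<integral>z. k z s \<partial>lborel) = (\<integral>z. indicator {0..1} s *\<^sub>R (\<Sum>k\<in>UNIV. of_real (?u $ k) * (f (- z) * ?X k (mul z (mul x (s *\<^sub>R u))))) \<partial>lborel)"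
      by (intro Bochner_Integration.integral_cong refl) (simp add: k_def sum_distrib_left mult_ac)
    also have "\<dots> = indicator {0..1} s *\<^sub>R (\<integral>z. (\<Sum>k\<in>UNIV. of_real (?u $ k) * (f (- z) * ?X k (mul z (mul x (s *\<^sub>R u))))) \<partial>lborel)"
      by (rule integral_scaleR_right)
    also have "(\<integral>z. (\<Sum>k\<in>UNIV. of_real (?u $ k) * (f (- z) * ?X k (mul z (mul x (s *\<^sub>R u))))) \<partial>lborel) =
        (\<Sum>k\<in>UNIV. (\<integral>z. of_real (?u $ k) * (f (- z) * ?X k (mul z (mul x (s *\<^sub>R u)))) \<partial>lborel))"
      by (intro Bochner_Integration.integral_sum integrable_mult_right f_resc X)
    also have "\<dots> = (\<Sum>k\<in>UNIV. of_real (?u $ k) * conv mul f (?X k) (mul x (s *\<^sub>R u)))"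
      by (simp add: conv_inverted)
    finally show "(\<integral>z. k z s \<partial>lborel) = indicator {0..1} s *\<^sub>R (\<Sum>k\<in>UNIV. of_real (?u $ k) * conv mul f (?X k) (mul x (s *\<^sub>R u)))" .
  qed
  finally show ?thesis .
qed

lemma norm_conv_increment_le:
  assumes f: "f \<in> schwartz" and \<phi>: "\<phi> \<in> schwartz" and X: "\<And>k. left_deriv mul k \<phi> \<in> schwartz" and t: "0 < t"
    and b: "\<And>k s. 0 \<le> s \<Longrightarrow> s \<le> 1 \<Longrightarrow> norm (conv mul f (rescale a (left_deriv mul k \<phi>) t) (mul x (s *\<^sub>R u))) \<le> b k"
  shows "norm (conv mul f (rescale a \<phi> t) (mul x u) - conv mul f (rescale a \<phi> t) x)
    \<le> (\<Sum>k\<in>UNIV. \<bar>dilation a (1 / t) u $ k\<bar> * b k)"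
proof -
  define S where "S = (\<Sum>k\<in>UNIV. \<bar>dilation a (1 / t) u $ k\<bar> * b k)"
  have b0: "0 \<le> b k" for k using order_trans[OF norm_ge_zero b[of 0 k]] by simp
  have S: "0 \<le> S" unfolding S_def using b0 by (intro sum_nonneg) auto
  have "ennreal (norm (conv mul f (rescale a \<phi> t) (mul x u) - conv mul f (rescale a \<phi> t) x)) \<le>
    (\<integral>\<^sup>+s. ennreal (norm (indicator {0..1} s *\<^sub>R (\<Sum>k\<in>UNIV. of_real (dilation a (1 / t) u $ k) *
      conv mul f (rescale a (left_deriv mul k \<phi>) t) (mul x (s *\<^sub>R u))))) \<partial>lborel)"
    unfolding conv_increment[OF f \<phi> X t] by (rule norm_integral_le_nn_integral)
  also have "\<dots> \<le> (\<integral>\<^sup>+s. ennreal S * indicator {0..1::real} s \<partial>lborel)"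
  proof (rule nn_integral_mono)
    fix s :: real
    show "ennreal (norm (indicator {0..1} s *\<^sub>R (\<Sum>k\<in>UNIV. of_real (dilation a (1 / t) u $ k) *
      conv mul f (rescale a (left_deriv mul k \<phi>) t) (mul x (s *\<^sub>R u))))) \<le> ennreal S * indicator {0..1::real} s"
    proof (cases "s \<in> {0..1}")
      case True
      have "norm (\<Sum>k\<in>UNIV. of_real (dilation a (1 / t) u $ k) *
          conv mul f (rescale a (left_deriv mul k \<phi>) t) (mul x (s *\<^sub>R u))) \<le> S"
        unfolding S_def using True by (intro sum_norm_le) (auto simp: norm_mult intro!: mult_left_mono b)
      then show ?thesis using True by (simp add: ennreal_leI)
    qed simp
  qed
  also have "\<dots> = ennreal S" by (simp add: nn_integral_cmult_indicator)
  finally show ?thesis using S by (simp add: S_def)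
qed

text \<open>The unit ball of \<open>\<rho>\<close> is the Euclidean one, hence star-shaped.\<close>

lemma rho_scaleR_le:
  assumes "0 \<le> s" "s \<le> 1" shows "\<rho> (s *\<^sub>R u) \<le> \<rho> u"
proof (cases "u = 0")
  case False
  define r where "r = \<rho> u"
  have r: "0 < r" using False by (simp add: r_def)
  define u' where "u' = dilation a (1 / r) u"
  have u: "u = dilation a r u'" using r by (simp add: u'_def)
  have "norm u' = 1" using rho_normalise[of u] r by (simp add: u'_def r_def)
  then have "norm (s *\<^sub>R u') \<le> 1" using assms by simp
  then have "\<rho> (s *\<^sub>R u') \<le> 1" using rho_le_1 by blast
  have "\<rho> (s *\<^sub>R u) = \<rho> (dilation a r (s *\<^sub>R u'))" unfolding u by (simp only: dilation_scaleR)
  also have "\<dots> = r * \<rho> (s *\<^sub>R u')" by (rule rho_dilation[OF r])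
  also have "\<dots> \<le> r * 1" using r \<open>\<rho> (s *\<^sub>R u') \<le> 1\<close> by (intro mult_left_mono) auto
  finally show ?thesis by (simp add: r_def)
qed simp

text \<open>Peetre's inequality.  On the ball of radius \<open>\<delta> t\<close> around \<open>x y\<^sup>-\<^sup>1\<close> the function \<open>F = f * \<phi>\<^sub>t\<close> differs
  from its value at the centre by at most an error \<open>e\<close>, which is \<open>\<delta>\<close> times the Peetre weight of \<open>y\<close> times Peetre
  maximal functions of the \<open>f * (X\<^sub>k \<phi>)\<^sub>t\<close>.  If the value \<open>c\<close> at the centre exceeds \<open>e\<close>, the mean of \<open>\<bar>F\<bar> powr (\<gamma> / N)\<close> over the ball is at
  least \<open>(c - e) powr (\<gamma> / N)\<close>, and a ball around \<open>x\<close> whose volume is larger by a constant times the Peetre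
  weight to the power \<open>\<gamma> / N\<close> contains the given one.\<close>

theorem peetre_inequality:
  assumes f: "f \<in> schwartz" and \<phi>: "\<phi> \<in> schwartz" and X: "\<And>k. left_deriv mul k \<phi> \<in> schwartz" and t: "0 < t"
    and N: "0 < N" and \<delta>: "0 < \<delta>" "\<delta> \<le> 1"
  shows "peetre mul \<rho> N (1 / t) (conv mul f (rescale a \<phi> t)) x \<le>
    ennreal ((3 * c\<^sub>0 * c\<^sub>0 / \<delta>) powr N) * epowr (balls.maxfn (\<lambda>y. ennreal (norm (conv mul f (rescale a \<phi> t) y) powr (hom_dim a / N))) x) (N / hom_dim a)
    + ennreal ((2 * c\<^sub>0) powr N * \<delta>) * (\<Sum>k\<in>UNIV. peetre mul \<rho> N (1 / t) (conv mul f (rescale a (left_deriv mul k \<phi>) t)) x)"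
proof -
  define F where "F = conv mul f (rescale a \<phi> t)"
  define G where "G k = conv mul f (rescale a (left_deriv mul k \<phi>) t)" for k
  let ?g = "hom_dim a"
  define r where "r = ?g / N"
  have r: "0 < r" using N hom_dim_ge_1 by (simp add: r_def)
  have [measurable]: "f \<in> borel_measurable borel" "\<phi> \<in> borel_measurable borel"
    using f \<phi> by (auto intro: schwartz_measurable)
  have [measurable]: "F \<in> borel_measurable borel" unfolding F_def by measurable
  define h where "h y = ennreal (norm (F y) powr r)" for y
  have [measurable]: "h \<in> borel_measurable borel" unfolding h_def by measurable
  define H where "H = balls.maxfn h x"
  define P where "P k = peetre mul \<rho> N (1 / t) (G k) x" for k
  define A where "A = (3 * c\<^sub>0 * c\<^sub>0 / \<delta>) powr N"
  define B where "B = (2 * c\<^sub>0) powr N"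
  have c0: "0 < c\<^sub>0" using c\<^sub>0(1) by simp
  have B: "0 < B" using c0 by (simp add: B_def)
  have main: "ennreal (norm (F (mul x (- y))) / (1 + 1 / t * \<rho> y) powr N) \<le>
      ennreal A * epowr H (N / ?g) + ennreal (B * \<delta>) * (\<Sum>k\<in>UNIV. P k)" for y
  proof (cases "\<exists>k. P k = top")
    case True
    then obtain k where "P k = top" ..
    with member_le_sum[of k UNIV P] have "(\<Sum>k\<in>UNIV. P k) = top" by (simp add: top_unique)
    then have "ennreal (B * \<delta>) * (\<Sum>k\<in>UNIV. P k) = ennreal (B * \<delta>) * top" by (simp only:)
    also have "\<dots> = top" using B \<delta> by (simp add: ennreal_mult_top)
    finally have "ennreal A * epowr H (N / ?g) + ennreal (B * \<delta>) * (\<Sum>k\<in>UNIV. P k) = top"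
      by (simp only: ennreal_add_eq_top simp_thms)
    then show ?thesis by (simp only: top_greatest)
  next
    case False
    define p where "p k = enn2real (P k)" for k
    have p: "P k = ennreal (p k)" "0 \<le> p k" for k
      using False by (auto simp: p_def less_top)
    define Y where "Y = (1 + \<rho> y / t) powr N"
    have Y1: "1 \<le> 1 + \<rho> y / t" using t by simp
    have Y0: "0 < 1 + \<rho> y / t" using Y1 by linarith
    have Y: "0 < Y" using Y0 unfolding Y_def by auto
    define e where "e = B * \<delta> * Y * (\<Sum>k\<in>UNIV. p k)"
    have e: "0 \<le> e" unfolding e_def using B \<delta> Y p(2) by (intro mult_nonneg_nonneg sum_nonneg) auto
    define c where "c = norm (F (mul x (- y)))"
    have small: "c - e \<le> norm (F (mul (mul x (- y)) u))" if u: "\<rho> u < \<delta> * t" for u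
    proof -
      have bd: "norm (G k (mul (mul x (- y)) (s *\<^sub>R u))) \<le> p k * (B * Y)" if s: "0 \<le> s" "s \<le> 1" for k s
      proof -
        define v where "v = s *\<^sub>R u"
        have v: "\<rho> v / t \<le> 1"
        proof -
          have "\<rho> v \<le> \<rho> u" unfolding v_def by (rule rho_scaleR_le[OF s])
          also have "\<dots> \<le> 1 * t" using u \<delta> t by (meson less_imp_le mult_right_mono order_trans)
          finally show ?thesis using t by (simp add: pos_divide_le_eq)
        qed
        have "mul (mul x (- y)) v = mul x (- mul (- v) y)" by (simp add: uminus_mul mul_assoc)
        then have "ennreal (norm (G k (mul (mul x (- y)) v))) \<le> P k * ennreal ((1 + 1 / t * \<rho> (mul (- v) y)) powr N)"
          using norm_le_peetre[of "1 / t" "G k" x "mul (- v) y" N] t by (simp add: P_def)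
        also have "\<dots> \<le> P k * ennreal (B * Y)"
        proof (intro mult_left_mono ennreal_leI)
          have "1 + 1 / t * \<rho> (mul (- v) y) \<le> c\<^sub>0 * ((1 + 1 / t * \<rho> (- v)) * (1 + 1 / t * \<rho> y))"
            using t by (intro one_plus_rho_mul) auto
          also have "\<dots> \<le> c\<^sub>0 * (2 * (1 + \<rho> y / t))"
          proof (intro mult_left_mono mult_mono)
            show "1 + 1 / t * \<rho> (- v) \<le> 2" using v by (simp add: rho_inverse)
          qed (use c0 Y0 in auto)
          also have "\<dots> = (2 * c\<^sub>0) * (1 + \<rho> y / t)" by simp
          finally have "(1 + 1 / t * \<rho> (mul (- v) y)) powr N \<le> ((2 * c\<^sub>0) * (1 + \<rho> y / t)) powr N"
            using N t by (intro powr_mono2) auto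
          also have "\<dots> = B * Y" using c0 Y0 by (simp add: B_def Y_def powr_mult)
          finally show "(1 + 1 / t * \<rho> (mul (- v) y)) powr N \<le> B * Y" .
        qed simp
        also have "\<dots> = ennreal (p k * (B * Y))" using p B Y by (simp flip: ennreal_mult)
        finally show ?thesis using p(2)[of k] B Y by (simp add: v_def)
      qed
      have uk: "\<bar>dilation a (1 / t) u $ k\<bar> \<le> \<delta>" for k
      proof -
        have "\<rho> (dilation a (1 / t) u) = \<rho> u / t" using t by (simp add: rho_dilation)
        also have "\<dots> \<le> \<delta>" using u t by (simp add: pos_divide_le_eq)
        finally have le: "\<rho> (dilation a (1 / t) u) \<le> \<delta>" .
        have "\<bar>dilation a (1 / t) u $ k\<bar> \<le> norm (dilation a (1 / t) u)" by (rule component_le_norm_cart)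
        also have "\<dots> \<le> \<rho> (dilation a (1 / t) u)" using le \<delta> by (intro norm_le_rho) auto
        finally show ?thesis using le by linarith
      qed
      have "norm (F (mul (mul x (- y)) u) - F (mul x (- y))) \<le> (\<Sum>k\<in>UNIV. \<bar>dilation a (1 / t) u $ k\<bar> * (p k * (B * Y)))"
        unfolding F_def using bd unfolding G_def by (intro norm_conv_increment_le f \<phi> X t) auto
      also have "\<dots> \<le> (\<Sum>k\<in>UNIV. \<delta> * (p k * (B * Y)))"
        using p(2) B Y by (intro sum_mono mult_right_mono uk) auto
      also have "\<dots> = e" by (simp add: e_def sum_distrib_left sum_distrib_right mult_ac)
      finally have "norm (F (mul (mul x (- y)) u) - F (mul x (- y))) \<le> e" .
      then show ?thesis
        using norm_triangle_ineq2[of "F (mul x (- y))" "F (mul (mul x (- y)) u)"]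
        by (simp add: c_def norm_minus_commute)
    qed
    have goal: "ennreal c \<le> ennreal Y * (ennreal A * epowr H (N / ?g)) + ennreal e"
    proof (cases "c \<le> e")
      case True
      then have "ennreal c \<le> ennreal e" by (rule ennreal_leI)
      then show ?thesis by (simp add: add_increasing)
    next
      case False
      then have ce: "0 < c - e" by simp
      define R where "R = c\<^sub>0 * (\<rho> y + \<delta> * t)"
      have dt: "0 < \<delta> * t" using \<delta> t by simp
      have R: "0 < R" using c0 dt by (simp add: R_def add_nonneg_pos)
      have "ennreal ((c - e) powr r) * ennreal ((\<delta> * t) powr ?g * unit_volume) =
          (\<integral>\<^sup>+u. ennreal ((c - e) powr r) * indicator {u. \<rho> u < \<delta> * t} u \<partial>lborel)"
        by (subst nn_integral_cmult_indicator) (auto simp: emeasure_rho_ball[OF dt])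
      also have "\<dots> \<le> (\<integral>\<^sup>+u. h (mul (mul x (- y)) u) * indicator {z. \<rho> (mul (- mul x (- y)) z) < \<delta> * t} (mul (mul x (- y)) u) \<partial>lborel)"
      proof (rule nn_integral_mono)
        fix u
        have "ennreal ((c - e) powr r) \<le> h (mul (mul x (- y)) u)" if "\<rho> u < \<delta> * t"
          unfolding h_def using small[OF that] ce r by (intro ennreal_leI powr_mono2) auto
        then show "ennreal ((c - e) powr r) * indicator {u. \<rho> u < \<delta> * t} u \<le>
            h (mul (mul x (- y)) u) * indicator {z. \<rho> (mul (- mul x (- y)) z) < \<delta> * t} (mul (mul x (- y)) u)"
          by (auto simp: indicator_def)
      qed
      also have "\<dots> = (\<integral>\<^sup>+z. h z * indicator {z. \<rho> (mul (- mul x (- y)) z) < \<delta> * t} z \<partial>lborel)"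
        by (rule nn_integral_mul_left[where f = "\<lambda>z. h z * indicator {z. \<rho> (mul (- mul x (- y)) z) < \<delta> * t} z"]) measurable
      also have "\<dots> \<le> (\<integral>\<^sup>+z\<in>gball mul \<rho> x R. h z \<partial>lborel)"
      proof (intro nn_integral_mono mult_left_mono)
        fix z
        have "\<rho> (mul (- z) x) < R" if "\<rho> (mul (- mul x (- y)) z) < \<delta> * t"
        proof -
          have "\<rho> (mul (- z) x) = \<rho> (mul (- x) z)" by (rule rho_minus_swap)
          also have "mul (- x) z = mul (- y) (mul (- mul x (- y)) z)" by (simp add: uminus_mul mul_assoc)
          also have "\<rho> \<dots> \<le> c\<^sub>0 * (\<rho> y + \<rho> (mul (- mul x (- y)) z))"
            using c\<^sub>0(2)[of "- y"] by (simp add: rho_inverse)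
          also have "\<dots> < R" unfolding R_def using that c0 by (intro mult_strict_left_mono) auto
          finally show ?thesis .
        qed
        then show "indicator {z. \<rho> (mul (- mul x (- y)) z) < \<delta> * t} z \<le> (indicator (gball mul \<rho> x R) z :: ennreal)"
          by (auto simp: indicator_def gball_def)
      qed simp
      also have "\<dots> \<le> ennreal ((3 * c\<^sub>0) powr ?g) * H * ennreal (R powr ?g * unit_volume)"
        unfolding H_def by (rule integral_gball_le_maxfn[OF R])
      finally have le: "ennreal ((c - e) powr r) * ennreal ((\<delta> * t) powr ?g * unit_volume) \<le>
          ennreal ((3 * c\<^sub>0) powr ?g) * H * ennreal (R powr ?g * unit_volume)" .
      define V where "V = (\<delta> * t) powr ?g * unit_volume"
      have V: "0 < V" unfolding V_def using \<delta> t unit_volume_pos by (intro mult_pos_pos) auto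
      have RY: "R powr ?g * unit_volume \<le> (c\<^sub>0 / \<delta> * (1 + \<rho> y / t)) powr ?g * V"
      proof -
        have "\<rho> y + \<delta> * t \<le> t * (1 + \<rho> y / t)" using \<delta> t by (simp add: distrib_left)
        then have "R \<le> c\<^sub>0 * (t * (1 + \<rho> y / t))"
          unfolding R_def using c0 by (intro mult_left_mono) auto
        also have "\<dots> = (c\<^sub>0 / \<delta> * (1 + \<rho> y / t)) * (\<delta> * t)" using \<delta> by simp
        finally have "R powr ?g \<le> ((c\<^sub>0 / \<delta> * (1 + \<rho> y / t)) * (\<delta> * t)) powr ?g"
          using R hom_dim_ge_1 by (intro powr_mono2) auto
        also have "\<dots> = (c\<^sub>0 / \<delta> * (1 + \<rho> y / t)) powr ?g * (\<delta> * t) powr ?g"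
          using c0 \<delta> Y0 dt by (intro powr_mult)
        finally have "R powr ?g * unit_volume \<le> (c\<^sub>0 / \<delta> * (1 + \<rho> y / t)) powr ?g * (\<delta> * t) powr ?g * unit_volume"
          using unit_volume_pos by (intro mult_right_mono) auto
        then show ?thesis by (simp add: V_def mult.assoc)
      qed
      define Z where "Z = (3 * c\<^sub>0 * c\<^sub>0 / \<delta> * (1 + \<rho> y / t)) powr ?g"
      have ZZ: "(3 * c\<^sub>0) powr ?g * (c\<^sub>0 / \<delta> * (1 + \<rho> y / t)) powr ?g \<le> Z"
        unfolding Z_def using c0 \<delta> Y0 by (subst powr_mult[symmetric]) (auto simp: mult_ac)
      have "ennreal ((c - e) powr r) * ennreal V \<le> ennreal ((3 * c\<^sub>0) powr ?g) * H * ennreal ((c\<^sub>0 / \<delta> * (1 + \<rho> y / t)) powr ?g * V)"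
        by (rule order_trans[OF le[folded V_def] mult_left_mono[OF ennreal_leI[OF RY]]]) simp
      also have "\<dots> = ennreal ((3 * c\<^sub>0) powr ?g * (c\<^sub>0 / \<delta> * (1 + \<rho> y / t)) powr ?g) * H * ennreal V"
        using V by (simp add: ennreal_mult mult_ac)
      also have "\<dots> \<le> ennreal Z * H * ennreal V"
        by (intro mult_right_mono ennreal_leI ZZ) auto
      finally have "ennreal V * ennreal ((c - e) powr r) \<le> ennreal V * (ennreal Z * H)"
        by (simp only: mult_ac)
      then have "ennreal ((c - e) powr r) \<le> ennreal Z * H"
        using V by (subst (asm) ennreal_mult_le_mult_iff) auto
      then have "epowr (ennreal (c - e)) r \<le> ennreal Z * H"
        using ce by (simp add: epowr_ennreal_pos)
      then have "ennreal (c - e) \<le> epowr (ennreal Z * H) (1 / r)"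
        using r by (subst (asm) epowr_le_swap)
      also have "\<dots> = ennreal (Z powr (1 / r)) * epowr H (N / ?g)"
      proof -
        have "1 / r = N / ?g" "0 < N / ?g" using N hom_dim_ge_1 by (simp_all add: r_def)
        then show ?thesis by (simp add: epowr_mult epowr_ennreal Z_def)
      qed
      also have "Z powr (1 / r) = A * Y"
        using c0 \<delta> Y0 N hom_dim_ge_1 unfolding Z_def A_def Y_def r_def
        by (subst powr_mult[symmetric]) (auto simp: powr_powr)
      finally have "ennreal (c - e) \<le> ennreal Y * (ennreal A * epowr H (N / ?g))"
        using Y by (simp add: A_def ennreal_mult mult_ac)
      then have "ennreal (c - e) + ennreal e \<le> ennreal Y * (ennreal A * epowr H (N / ?g)) + ennreal e"
        by (rule add_right_mono)
      then show ?thesis using ce e by (simp flip: ennreal_plus)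
    qed
    have "ennreal (1 / Y) * ennreal c \<le> ennreal (1 / Y) * (ennreal Y * (ennreal A * epowr H (N / ?g)) + ennreal e)"
      by (intro mult_left_mono goal) simp
    also have "\<dots> = (ennreal (1 / Y) * ennreal Y) * (ennreal A * epowr H (N / ?g)) + ennreal (1 / Y) * ennreal e"
      by (simp add: distrib_left mult.assoc)
    also have "ennreal (1 / Y) * ennreal Y = 1" using Y by (simp flip: ennreal_mult)
    also have "ennreal (1 / Y) * ennreal e = ennreal (B * \<delta>) * (\<Sum>k\<in>UNIV. P k)"
    proof -
      have "ennreal (1 / Y) * ennreal e = ennreal (B * \<delta> * (\<Sum>k\<in>UNIV. p k))"
        using Y e by (simp add: e_def mult.assoc flip: ennreal_mult)
      also have "\<dots> = ennreal (B * \<delta>) * (\<Sum>k\<in>UNIV. P k)"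
        using B \<delta> p by (simp add: ennreal_mult sum_nonneg sum_ennreal)
      finally show ?thesis .
    qed
    finally have "ennreal (1 / Y) * ennreal c \<le> ennreal A * epowr H (N / ?g) + ennreal (B * \<delta>) * (\<Sum>k\<in>UNIV. P k)"
      by simp
    moreover have "ennreal (1 / Y) * ennreal c = ennreal (norm (F (mul x (- y))) / (1 + 1 / t * \<rho> y) powr N)"
      using Y by (simp add: c_def Y_def flip: ennreal_mult)
    ultimately show ?thesis by simp
  qed
  show ?thesis
    unfolding peetre_def[of mul \<rho> N "1 / t" "conv mul f (rescale a \<phi> t)" x]
  proof (rule SUP_least)
    fix y
    show "ennreal (norm (conv mul f (rescale a \<phi> t) (mul x (- y))) / (1 + 1 / t * \<rho> y) powr N) \<le>
      ennreal ((3 * c\<^sub>0 * c\<^sub>0 / \<delta>) powr N) * epowr (balls.maxfn (\<lambda>y. ennreal (norm (conv mul f (rescale a \<phi> t) y) powr (hom_dim a / N))) x) (N / hom_dim a)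
      + ennreal ((2 * c\<^sub>0) powr N * \<delta>) * (\<Sum>k\<in>UNIV. peetre mul \<rho> N (1 / t) (conv mul f (rescale a (left_deriv mul k \<phi>) t)) x)"
      using main[of y] by (simp add: F_def H_def h_def[abs_def] r_def A_def B_def P_def G_def)
  qed
qed

end

section \<open>The weighted inequality\<close>

definition dt_over_t :: "real measure" where
  "dt_over_t = density lborel (\<lambda>t. ennreal (indicator {0<..} t * (1 / t)))"

lemma sets_dt_over_t [simp, measurable_cong]: "sets dt_over_t = sets borel"
  and space_dt_over_t [simp]: "space dt_over_t = UNIV"
  by (simp_all add: dt_over_t_def)

lemma sigma_finite_dt_over_t: "sigma_finite_measure dt_over_t"
  unfolding dt_over_t_def
  by (subst sigma_finite_measure.sigma_finite_iff_density_finite[OF sigma_finite_lborel]) auto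

lemma nn_integral_dt_over_t:
  assumes "h \<in> borel_measurable borel"
  shows "(\<integral>\<^sup>+t. h t \<partial>dt_over_t) = (\<integral>\<^sup>+t\<in>{0<..}. h t * ennreal (1 / t) \<partial>lborel)"
proof -
  have "(\<integral>\<^sup>+t. h t \<partial>dt_over_t) = (\<integral>\<^sup>+t. ennreal (indicator {0<..} t * (1 / t)) * h t \<partial>lborel)"
    unfolding dt_over_t_def using assms by (intro nn_integral_density) auto
  also have "\<dots> = (\<integral>\<^sup>+t\<in>{0<..}. h t * ennreal (1 / t) \<partial>lborel)"
    by (intro nn_integral_cong) (auto simp: indicator_def mult.commute)
  finally show ?thesis .
qed

lemma AE_dt_over_t: "AE t in dt_over_t. 0 < t"
  unfolding dt_over_t_def by (subst AE_density) (auto simp: indicator_def)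

lemma nn_integral_dt_over_t_mono:
  "(\<And>t. 0 < t \<Longrightarrow> h t \<le> g t) \<Longrightarrow> (\<integral>\<^sup>+t. h t \<partial>dt_over_t) \<le> (\<integral>\<^sup>+t. g t \<partial>dt_over_t)"
  by (intro nn_integral_mono_AE eventually_mono[OF AE_dt_over_t])

lemma nn_integral_dt_over_t_scale:
  assumes c: "0 < c" and [measurable]: "h \<in> borel_measurable borel"
  shows "(\<integral>\<^sup>+t. h (c * t) \<partial>dt_over_t) = (\<integral>\<^sup>+t. h t \<partial>dt_over_t)"
proof -
  have "(\<integral>\<^sup>+t. h t \<partial>dt_over_t) = (\<integral>\<^sup>+t\<in>{0<..}. h t * ennreal (1 / t) \<partial>lborel)"
    by (rule nn_integral_dt_over_t) measurable
  also have "\<dots> = ennreal c * (\<integral>\<^sup>+t. h (c * t) * ennreal (1 / (c * t)) * indicator {0<..} (c * t) \<partial>lborel)"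
    using c nn_integral_real_affine[of "\<lambda>t. h t * ennreal (1 / t) * indicator {0<..} t" c 0] by simp
  also have "\<dots> = (\<integral>\<^sup>+t. ennreal c * (h (c * t) * ennreal (1 / (c * t)) * indicator {0<..} (c * t)) \<partial>lborel)"
    by (rule nn_integral_cmult[symmetric]) measurable
  also have "\<dots> = (\<integral>\<^sup>+t\<in>{0<..}. h (c * t) * ennreal (1 / t) \<partial>lborel)"
  proof (rule nn_integral_cong)
    fix t :: real
    have "ennreal c * ennreal (1 / (c * t)) = ennreal (1 / t)" if "0 < t"
      using c that by (simp flip: ennreal_mult)
    moreover have "0 < c * t \<longleftrightarrow> 0 < t" using c by (simp add: zero_less_mult_iff)
    ultimately show "ennreal c * (h (c * t) * ennreal (1 / (c * t)) * indicator {0<..} (c * t)) =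
        h (c * t) * ennreal (1 / t) * indicator {0<..} t"
      by (cases "0 < t") (auto simp: mult.left_commute[of "ennreal c"])
  qed
  also have "\<dots> = (\<integral>\<^sup>+t. h (c * t) \<partial>dt_over_t)"
    by (rule nn_integral_dt_over_t[symmetric]) measurable
  finally show ?thesis by simp
qed

lemma nn_integral_dt_over_t_min_finite:
  assumes q: "0 < q"
  shows "(\<integral>\<^sup>+t. ennreal (min (t powr (1/2)) (t powr (- 1/2)) powr q) \<partial>dt_over_t) < top"
proof -
  have I1: "((\<lambda>t. t powr (q / 2 - 1)) has_integral (1 powr (q / 2 - 1 + 1) / (q / 2 - 1 + 1))) {0..1::real}"
    using q by (intro has_integral_powr_from_0) auto
  have I2: "((\<lambda>t. t powr (- q / 2 - 1)) has_integral (- (1 powr (- q / 2 - 1 + 1)) / (- q / 2 - 1 + 1))) {1::real..}"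
    using q by (intro has_integral_powr_to_inf) auto
  have "(\<integral>\<^sup>+t. ennreal (min (t powr (1/2)) (t powr (- 1/2)) powr q) \<partial>dt_over_t) =
      (\<integral>\<^sup>+t\<in>{0<..}. ennreal (min (t powr (1/2)) (t powr (- 1/2)) powr q) * ennreal (1 / t) \<partial>lborel)"
    by (rule nn_integral_dt_over_t) measurable
  also have "\<dots> \<le> (\<integral>\<^sup>+t. ennreal (t powr (q / 2 - 1)) * indicator {0..1} t + ennreal (t powr (- q / 2 - 1)) * indicator {1..} t \<partial>lborel)"
  proof (rule nn_integral_mono)
    fix t :: real
    show "ennreal (min (t powr (1/2)) (t powr (- 1/2)) powr q) * ennreal (1 / t) * indicator {0<..} t \<le>
        ennreal (t powr (q / 2 - 1)) * indicator {0..1} t + ennreal (t powr (- q / 2 - 1)) * indicator {1..} t"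
    proof (cases "0 < t")
      case True
      have a: "min (t powr (1/2)) (t powr (- 1/2)) powr q * (1 / t) \<le> t powr (e * q - 1)"
        if "min (t powr (1/2)) (t powr (- 1/2)) \<le> t powr e" for e
      proof -
        have "min (t powr (1/2)) (t powr (- 1/2)) powr q \<le> (t powr e) powr q"
          using q that by (intro powr_mono2) auto
        then have "min (t powr (1/2)) (t powr (- 1/2)) powr q * (1 / t) \<le> (t powr e) powr q * (1 / t)"
          using True by (intro mult_right_mono) auto
        also have "\<dots> = t powr (e * q - 1)" using True by (simp add: powr_powr powr_diff)
        finally show ?thesis .
      qed
      have "min (t powr (1/2)) (t powr (- 1/2)) powr q * (1 / t) \<le> t powr (q / 2 - 1)"
           "min (t powr (1/2)) (t powr (- 1/2)) powr q * (1 / t) \<le> t powr (- q / 2 - 1)"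
        using a[of "1/2"] a[of "- 1/2"] by simp_all
      then have "ennreal (min (t powr (1/2)) (t powr (- 1/2)) powr q * (1 / t)) \<le> ennreal (t powr (q / 2 - 1))"
        "ennreal (min (t powr (1/2)) (t powr (- 1/2)) powr q * (1 / t)) \<le> ennreal (t powr (- q / 2 - 1))"
        by (auto intro: ennreal_leI)
      then show ?thesis
        using True by (cases "t \<le> 1") (auto simp: indicator_def add_increasing2 simp flip: ennreal_mult)
    qed simp
  qed
  also have "\<dots> = (\<integral>\<^sup>+t. ennreal (t powr (q / 2 - 1)) * indicator {0..1} t \<partial>lborel) + (\<integral>\<^sup>+t. ennreal (t powr (- q / 2 - 1)) * indicator {1..} t \<partial>lborel)"
    by (rule nn_integral_add) measurable
  also have "\<dots> < top"
    using nn_integral_has_integral_lebesgue'[OF _ I1] nn_integral_has_integral_lebesgue'[OF _ I2] by simp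
  finally show ?thesis .
qed

lemma Lq_dt_t_eq:
  assumes q: "0 < q" and [measurable]: "h' \<in> borel_measurable borel" and eq: "\<And>t. 0 < t \<Longrightarrow> h t = h' t"
  shows "Lq_dt_t q h = epowr (\<integral>\<^sup>+t. epowr (h' t) q \<partial>dt_over_t) (1 / q)"
proof -
  have "(\<integral>\<^sup>+t\<in>{0<..}. epowr (h t) q * ennreal (1 / t) \<partial>lborel) = (\<integral>\<^sup>+t\<in>{0<..}. epowr (h' t) q * ennreal (1 / t) \<partial>lborel)"
    by (intro nn_integral_cong) (auto simp: indicator_def eq)
  then show ?thesis
    by (simp add: Lq_dt_t_def nn_integral_completion nn_integral_dt_over_t)
qed

lemma ennreal_absorb:
  assumes "X < top" "X \<le> y + ennreal c * X" "c \<le> 1/2" "0 \<le> c"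
  shows "X \<le> 2 * (y :: ennreal)"
proof (cases y)
  case (real z)
  obtain x where x: "X = ennreal x" "0 \<le> x" using assms(1) by (cases X) auto
  have "ennreal x \<le> ennreal (z + c * x)"
    using assms(2,4) real x by (simp flip: ennreal_mult ennreal_plus)
  then have "x \<le> z + c * x" using real x assms(4) by (subst (asm) ennreal_le_iff) auto
  moreover have "c * x \<le> 1/2 * x" using assms(3) x by (intro mult_right_mono) auto
  ultimately have "x \<le> 2 * z" by linarith
  then have "ennreal x \<le> ennreal (2 * z)" by (rule ennreal_leI)
  then show ?thesis using x real by (simp add: ennreal_mult)
qed (simp add: ennreal_mult_top)

lemma measurable_dilation_joint:
  fixes g :: "'a \<Rightarrow> real^'n::finite"
  assumes [measurable]: "h \<in> borel_measurable M" "g \<in> borel_measurable M"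
  shows "(\<lambda>p. dilation a (h p) (g p)) \<in> borel_measurable M"
proof (subst borel_measurable_euclidean_space, intro ballI)
  fix e :: "real^'n" assume "e \<in> Basis"
  then obtain i where e: "e = axis i 1" by (auto simp: Basis_vec_real)
  have [measurable]: "(\<lambda>p. g p $ i) \<in> borel_measurable M"
    using borel_measurable_inner[OF assms(2), of "\<lambda>_. axis i 1"] by (simp add: inner_axis)
  have "(\<lambda>p. h p powr a i * g p $ i) \<in> borel_measurable M" by measurable
  then show "(\<lambda>p. dilation a (h p) (g p) \<bullet> e) \<in> borel_measurable M"
    by (simp add: e inner_axis dilation_def)
qed

context norm_function
begin

lemma measurable_conv_rescale_joint:
  assumes [measurable]: "f \<in> borel_measurable borel" "\<phi> \<in> borel_measurable borel"
    and [measurable]: "h \<in> borel_measurable M" "g \<in> borel_measurable M"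
  shows "(\<lambda>p. conv mul f (rescale a \<phi> (h p)) (g p)) \<in> borel_measurable M"
proof -
  have "(\<lambda>(p, y). \<phi> (dilation a (1 / h p) y)) \<in> borel_measurable (M \<Otimes>\<^sub>M lborel)"
    unfolding case_prod_beta
    by (rule measurable_compose[OF measurable_dilation_joint]) measurable
  then have [measurable]: "(\<lambda>(p, y). rescale a \<phi> (h p) y) \<in> borel_measurable (M \<Otimes>\<^sub>M lborel)"
    unfolding rescale_def by (simp add: case_prod_beta)
  have "(\<lambda>p. \<integral>y. f (mul (g p) (- y)) * rescale a \<phi> (h p) y \<partial>lborel) \<in> borel_measurable M"
    by measurable
  then show ?thesis by (simp add: conv_lborel)
qed

text \<open>By continuity the Peetre maximal function is a countable supremum, hence measurable in \<open>t\<close>.\<close>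

definition countable_peetre ::
  "real \<Rightarrow> (real^('n::{finite,linorder}) \<Rightarrow> complex) \<Rightarrow> (real^('n::{finite,linorder}) \<Rightarrow> complex) \<Rightarrow>
    real^('n::{finite,linorder}) \<Rightarrow> real \<Rightarrow> ennreal" where
  "countable_peetre N f \<phi> x t = (SUP y\<in>dense_points.
     ennreal (norm (conv mul f (rescale a \<phi> t) (mul x (- y))) / (1 + 1 / t * \<rho> y) powr N))"

lemma measurable_countable_peetre [measurable]:
  assumes [measurable]: "f \<in> borel_measurable borel" "\<phi> \<in> borel_measurable borel"
  shows "countable_peetre N f \<phi> x \<in> borel_measurable borel"
proof -
  have [measurable]: "(\<lambda>t. conv mul f (rescale a \<phi> t) (mul x (- y))) \<in> borel_measurable borel" for y
    by (rule measurable_conv_rescale_joint) measurable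
  show ?thesis
    unfolding countable_peetre_def[abs_def] by (intro borel_measurable_SUP dense_points) measurable
qed

lemma peetre_eq_countable:
  assumes f: "f \<in> schwartz" and \<phi>: "\<phi> \<in> schwartz" and t: "0 < t"
  shows "peetre mul \<rho> N (1 / t) (conv mul f (rescale a \<phi> t)) x = countable_peetre N f \<phi> x t"
proof -
  define F where "F = conv mul f (rescale a \<phi> t)"
  define G where "G y = norm (F (mul x (- y))) / (1 + 1 / t * \<rho> y) powr N" for y
  obtain B where B: "\<And>x. norm (f x) \<le> B" using rapid_bounded[OF schwartz_rapid[OF f]] by blast
  have F: "continuous_on UNIV F"
    unfolding F_def using f \<phi> t B
    by (intro continuous_conv[OF _ B] schwartz_continuous integrable_rescale rapid_integrable schwartz_rapid)
  have pos: "0 < 1 + 1 / t * \<rho> y" for y using t by (simp add: add_pos_nonneg)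
  have "1 + 1 / t * \<rho> y \<noteq> 0" for y using pos[of y] by linarith
  then have "continuous_on UNIV G"
    unfolding G_def
    by (intro continuous_on_divide continuous_on_norm continuous_on_compose2[OF F] continuous_on_powr
        continuous_intros rho_continuous) (auto simp: powr_eq_0_iff)
  then have cont: "continuous_on UNIV (\<lambda>y. ennreal (G y))"
    by (rule continuous_on_ennreal)
  have "ennreal (G y) \<le> (SUP y\<in>dense_points. ennreal (G y))" for y
  proof (rule dense_le)
    fix c assume c: "c < ennreal (G y)"
    have "open {y. c < ennreal (G y)}"
      by (intro open_Collect_less continuous_on_const cont)
    then obtain d where "d \<in> dense_points" "c < ennreal (G d)"
      using dense_points(2)[of "{y. c < ennreal (G y)}" y] c by auto
    then show "c \<le> (SUP y\<in>dense_points. ennreal (G y))"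
      by (meson SUP_upper less_imp_le order_trans)
  qed
  then have "(SUP y. ennreal (G y)) = (SUP y\<in>dense_points. ennreal (G y))"
    by (intro antisym SUP_least SUP_subset_mono) auto
  then show ?thesis
    by (simp add: peetre_def countable_peetre_def G_def F_def)
qed

text \<open>The square function of Peetre maximal functions, without the final power \<open>1 / q\<close>.\<close>

definition peetre_square ::
  "real \<Rightarrow> real \<Rightarrow> (real^('n::{finite,linorder}) \<Rightarrow> complex) \<Rightarrow> (real^('n::{finite,linorder}) \<Rightarrow> complex) \<Rightarrow>
    real^('n::{finite,linorder}) \<Rightarrow> ennreal" where
  "peetre_square N q f \<phi> x = (\<integral>\<^sup>+t. epowr (countable_peetre N f \<phi> x t) q \<partial>dt_over_t)"

text \<open>The decay of \<open>f * \<phi>\<^sub>t\<close> for \<open>t \<rightarrow> 0\<close> and for \<open>t \<rightarrow> \<infinity>\<close> is uniform in the point of evaluation.\<close>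

lemma peetre_square_finite:
  assumes f: "f \<in> schwartz" and \<phi>: "\<phi> \<in> schwartz" and mean: "(\<integral>x. \<phi> x \<partial>lborel) = 0"
    and q: "0 < q" and N: "0 < N"
  shows "peetre_square N q f \<phi> x < top"
proof -
  obtain C where C: "0 \<le> C" "\<And>t x. 0 < t \<Longrightarrow> norm (conv mul f (rescale a \<phi> t) x) \<le> C * min (t powr (1/2)) (t powr (- 1/2))"
    using conv_rescale_bound[OF f schwartz_rapid[OF \<phi>] mean] by blast
  have "peetre_square N q f \<phi> x \<le> (\<integral>\<^sup>+t. ennreal (C powr q) * ennreal (min (t powr (1/2)) (t powr (- 1/2)) powr q) \<partial>dt_over_t)"
    unfolding peetre_square_def
  proof (rule nn_integral_dt_over_t_mono)
    fix t :: real assume t: "0 < t"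
    have "countable_peetre N f \<phi> x t \<le> ennreal (C * min (t powr (1/2)) (t powr (- 1/2)))"
      unfolding countable_peetre_def
    proof (intro SUP_least ennreal_leI)
      fix y
      have "1 \<le> (1 + 1 / t * \<rho> y) powr N" using t N by (intro ge_one_powr_ge_zero) auto
      then have "norm (conv mul f (rescale a \<phi> t) (mul x (- y))) / (1 + 1 / t * \<rho> y) powr N \<le>
          norm (conv mul f (rescale a \<phi> t) (mul x (- y))) / 1"
        by (intro divide_left_mono) auto
      also have "\<dots> \<le> C * min (t powr (1/2)) (t powr (- 1/2))" using C(2)[OF t] by simp
      finally show "norm (conv mul f (rescale a \<phi> t) (mul x (- y))) / (1 + 1 / t * \<rho> y) powr N \<le> C * min (t powr (1/2)) (t powr (- 1/2))" .
    qed
    then have "epowr (countable_peetre N f \<phi> x t) q \<le> epowr (ennreal (C * min (t powr (1/2)) (t powr (- 1/2)))) q"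
      using q by (rule epowr_mono)
    also have "\<dots> = ennreal (C powr q) * ennreal (min (t powr (1/2)) (t powr (- 1/2)) powr q)"
      using C(1) q by (simp add: epowr_mult epowr_ennreal ennreal_mult)
    finally show "epowr (countable_peetre N f \<phi> x t) q \<le> ennreal (C powr q) * ennreal (min (t powr (1/2)) (t powr (- 1/2)) powr q)" .
  qed
  also have "\<dots> = ennreal (C powr q) * (\<integral>\<^sup>+t. ennreal (min (t powr (1/2)) (t powr (- 1/2)) powr q) \<partial>dt_over_t)"
    by (rule nn_integral_cmult) measurable
  also have "\<dots> < top" using nn_integral_dt_over_t_min_finite[OF q] by (simp add: ennreal_mult_less_top)
  finally show ?thesis .
qed

end

context calderon_system
begin

text \<open>The measure \<open>dt / t\<close> is invariant under the dilations by \<open>b\<^sup>j\<close>, so that the domination by the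
  scales \<open>b\<^sup>j t\<close> passes to the square functions.\<close>

lemma peetre_square_domination:
  assumes \<psi>: "\<psi> \<in> schwartz" and mean: "(\<integral>x. \<psi> x \<partial>lborel) = 0" and N: "0 < N" and \<epsilon>: "0 < \<epsilon>"
    and cl: "\<And>l. l \<in> {1..M} \<Longrightarrow> (\<eta> l, \<psi>) \<in> C1_class a mul \<rho> (N + \<epsilon>) N" and q: "0 < q"
  shows "\<exists>C>0. \<forall>f\<in>schwartz. \<forall>x. peetre_square N q f \<psi> x \<le> ennreal C * (\<Sum>l\<in>{1..M}. peetre_square N q f (\<phi> l) x)"
proof -
  obtain C r where C: "0 < C" and r: "0 < r" "r < 1" and dom: "\<And>f t x. f \<in> schwartz \<Longrightarrow> 0 < t \<Longrightarrow>
    peetre mul \<rho> N (1 / t) (conv mul f (rescale a \<psi> t)) x \<le> ennreal C *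
      (SUP j. ennreal (r ^ nat \<bar>j\<bar>) * (\<Sum>l\<in>{1..M}.
        peetre mul \<rho> N (1 / (b powi j * t)) (conv mul f (rescale a (\<phi> l) (b powi j * t))) x))"
    using peetre_domination[OF \<psi> mean N \<epsilon> cl] by blast
  define R where "R = r powr q"
  have R: "0 < R" "R < 1" using r q by (auto simp: R_def powr01_less_one)
  define K where "K = C powr q * (2 / (1 - R)) * (real M powr q) + 1"
  have K: "0 < K" "C powr q * (2 / (1 - R)) * (real M powr q) \<le> K" using R C by (auto simp: K_def add_nonneg_pos)
  have main: "peetre_square N q f \<psi> x \<le> ennreal K * (\<Sum>l\<in>{1..M}. peetre_square N q f (\<phi> l) x)"
    if f: "f \<in> schwartz" for f x
  proof -
    have [measurable]: "f \<in> borel_measurable borel" using f by (rule schwartz_measurable)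
    define S where "S t = (\<Sum>l\<in>{1..M}. countable_peetre N f (\<phi> l) x t)" for t
    have cp_meas: "countable_peetre N f (\<phi> l) x \<in> borel_measurable borel" if "l \<in> {1..M}" for l
      using \<phi>_measurable[OF that] by measurable
    have S_meas [measurable]: "S \<in> borel_measurable borel"
      unfolding S_def by (intro borel_measurable_sum cp_meas)
    define X where "X j t = epowr (ennreal (r ^ nat \<bar>j\<bar>) * S (b powi j * t)) q" for j t
    have X_meas [measurable]: "X j \<in> borel_measurable borel" for j unfolding X_def by measurable
    have X_int: "(\<integral>\<^sup>+t. X j t \<partial>dt_over_t) = ennreal (R ^ nat \<bar>j\<bar>) * (\<integral>\<^sup>+t. epowr (S t) q \<partial>dt_over_t)" for j
    proof -
      have e: "(r ^ n) powr q = R ^ n" for n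
        using r by (simp add: R_def powr_realpow[symmetric] powr_powr mult.commute)
      have "X j t = ennreal (R ^ nat \<bar>j\<bar>) * epowr (S (b powi j * t)) q" for t
        unfolding X_def using q r by (simp add: epowr_mult epowr_ennreal e)
      then have "(\<integral>\<^sup>+t. X j t \<partial>dt_over_t) = ennreal (R ^ nat \<bar>j\<bar>) * (\<integral>\<^sup>+t. epowr (S (b powi j * t)) q \<partial>dt_over_t)"
        by (simp add: nn_integral_cmult)
      also have "(\<integral>\<^sup>+t. epowr (S (b powi j * t)) q \<partial>dt_over_t) = (\<integral>\<^sup>+t. epowr (S t) q \<partial>dt_over_t)"
        using scale_pos(1)[of j] by (intro nn_integral_dt_over_t_scale[where h = "\<lambda>t. epowr (S t) q"]) measurable
      finally show ?thesis .
    qed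
    have "peetre_square N q f \<psi> x \<le> (\<integral>\<^sup>+t. ennreal (C powr q) * (\<Sum>n. X (int n) t + X (- int n) t) \<partial>dt_over_t)"
      unfolding peetre_square_def
    proof (rule nn_integral_dt_over_t_mono)
      fix t :: real assume t: "0 < t"
      have "countable_peetre N f \<psi> x t \<le> ennreal C * (SUP j. ennreal (r ^ nat \<bar>j\<bar>) * S (b powi j * t))"
      proof -
        have "(\<Sum>l\<in>{1..M}. peetre mul \<rho> N (1 / (b powi j * t)) (conv mul f (rescale a (\<phi> l) (b powi j * t))) x) = S (b powi j * t)" for j
          unfolding S_def by (intro sum.cong refl peetre_eq_countable f \<phi>_schwartz scale_pos t)
        then show ?thesis using dom[OF f t, of x] unfolding peetre_eq_countable[OF f \<psi> t] by simp
      qed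
      then have "epowr (countable_peetre N f \<psi> x t) q \<le> epowr (ennreal C * (SUP j. ennreal (r ^ nat \<bar>j\<bar>) * S (b powi j * t))) q"
        using q by (rule epowr_mono)
      also have "\<dots> = ennreal (C powr q) * (SUP j. X j t)"
        using q C by (simp add: epowr_mult epowr_ennreal epowr_SUP X_def)
      also have "\<dots> \<le> ennreal (C powr q) * (\<Sum>n. X (int n) t + X (- int n) t)"
      proof (intro mult_left_mono SUP_least)
        fix j :: int
        have "X j t \<le> X (int (nat \<bar>j\<bar>)) t + X (- int (nat \<bar>j\<bar>)) t"
          by (cases "0 \<le> j") (auto simp: add_increasing add_increasing2)
        also have "\<dots> \<le> (\<Sum>n. X (int n) t + X (- int n) t)"
          by (rule suminf_upper_ennreal[of "\<lambda>n. X (int n) t + X (- int n) t"])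
        finally show "X j t \<le> (\<Sum>n. X (int n) t + X (- int n) t)" .
      qed simp
      finally show "epowr (countable_peetre N f \<psi> x t) q \<le> ennreal (C powr q) * (\<Sum>n. X (int n) t + X (- int n) t)" .
    qed
    also have "\<dots> = ennreal (C powr q) * (\<integral>\<^sup>+t. (\<Sum>n. X (int n) t + X (- int n) t) \<partial>dt_over_t)"
      by (rule nn_integral_cmult) measurable
    also have "(\<integral>\<^sup>+t. (\<Sum>n. X (int n) t + X (- int n) t) \<partial>dt_over_t) = (\<Sum>n. (\<integral>\<^sup>+t. X (int n) t + X (- int n) t \<partial>dt_over_t))"
      by (rule nn_integral_suminf) measurable
    also have "\<dots> = (\<Sum>n. ennreal (2 * R ^ n) * (\<integral>\<^sup>+t. epowr (S t) q \<partial>dt_over_t))"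
    proof (intro suminf_cong)
      fix n
      have "(\<integral>\<^sup>+t. X (int n) t + X (- int n) t \<partial>dt_over_t) = (ennreal (R ^ n) + ennreal (R ^ n)) * (\<integral>\<^sup>+t. epowr (S t) q \<partial>dt_over_t)"
        by (subst nn_integral_add) (auto simp: X_int distrib_right)
      also have "ennreal (R ^ n) + ennreal (R ^ n) = ennreal (2 * R ^ n)" using R by (simp flip: ennreal_plus)
      finally show "(\<integral>\<^sup>+t. X (int n) t + X (- int n) t \<partial>dt_over_t) = ennreal (2 * R ^ n) * (\<integral>\<^sup>+t. epowr (S t) q \<partial>dt_over_t)" .
    qed
    also have "\<dots> = (\<Sum>n. ennreal (2 * R ^ n)) * (\<integral>\<^sup>+t. epowr (S t) q \<partial>dt_over_t)"
      by simp
    also have "(\<Sum>n. ennreal (2 * R ^ n)) = ennreal (\<Sum>n. 2 * R ^ n)"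
      using R by (intro suminf_ennreal2 summable_mult summable_geometric) auto
    also have "(\<Sum>n. 2 * R ^ n) = 2 / (1 - R)"
      using R suminf_mult[of "\<lambda>n. R ^ n" 2] by (simp add: suminf_geometric summable_geometric)
    also have "(\<integral>\<^sup>+t. epowr (S t) q \<partial>dt_over_t) \<le> ennreal (real M powr q) * (\<Sum>l\<in>{1..M}. peetre_square N q f (\<phi> l) x)"
    proof -
      have "(\<integral>\<^sup>+t. epowr (S t) q \<partial>dt_over_t) \<le> (\<integral>\<^sup>+t. ennreal (real M powr q) * (\<Sum>l\<in>{1..M}. epowr (countable_peetre N f (\<phi> l) x t) q) \<partial>dt_over_t)"
        unfolding S_def using q epowr_sum_le[of q "{1..M}"] by (intro nn_integral_mono) simp
      also have "\<dots> = ennreal (real M powr q) * (\<integral>\<^sup>+t. (\<Sum>l\<in>{1..M}. epowr (countable_peetre N f (\<phi> l) x t) q) \<partial>dt_over_t)"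
        by (intro nn_integral_cmult borel_measurable_sum borel_measurable_epowr)
          (use cp_meas in \<open>simp add: measurable_cong_sets[OF sets_dt_over_t refl]\<close>)
      also have "(\<integral>\<^sup>+t. (\<Sum>l\<in>{1..M}. epowr (countable_peetre N f (\<phi> l) x t) q) \<partial>dt_over_t) = (\<Sum>l\<in>{1..M}. peetre_square N q f (\<phi> l) x)"
        unfolding peetre_square_def
        by (intro nn_integral_sum borel_measurable_epowr)
          (use cp_meas in \<open>simp add: measurable_cong_sets[OF sets_dt_over_t refl]\<close>)
      finally show ?thesis .
    qed
    finally have "peetre_square N q f \<psi> x \<le> ennreal (C powr q) * (ennreal (2 / (1 - R)) * (ennreal (real M powr q) * (\<Sum>l\<in>{1..M}. peetre_square N q f (\<phi> l) x)))"
      by (simp add: mult_left_mono)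
    also have "\<dots> = ennreal (C powr q * (2 / (1 - R)) * (real M powr q)) * (\<Sum>l\<in>{1..M}. peetre_square N q f (\<phi> l) x)"
    proof -
      have "ennreal (C powr q * (2 / (1 - R)) * (real M powr q)) = ennreal (C powr q) * (ennreal (2 / (1 - R)) * ennreal (real M powr q))"
        using R by (subst ennreal_mult, simp, simp, subst ennreal_mult) (auto simp: mult.assoc)
      then show ?thesis by (simp only: mult.assoc)
    qed
    also have "\<dots> \<le> ennreal K * (\<Sum>l\<in>{1..M}. peetre_square N q f (\<phi> l) x)"
      using K by (intro mult_right_mono ennreal_leI) auto
    finally show ?thesis .
  qed
  with K show ?thesis by blast
qed

text \<open>The square function of \<open>M (\<bar>f * g\<^sub>t\<bar> powr (\<gamma> / N)) powr (N / \<gamma>)\<close>, again without the final power.\<close>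

definition maxfn_square :: "real \<Rightarrow> real \<Rightarrow> (real^('n::{finite,linorder}) \<Rightarrow> complex) \<Rightarrow> (real^('n::{finite,linorder}) \<Rightarrow> complex) \<Rightarrow>
    real^('n::{finite,linorder}) \<Rightarrow> ennreal" where
  "maxfn_square N q f g x = (\<integral>\<^sup>+t. epowr (balls.maxfn (\<lambda>y. ennreal (norm (conv mul f (rescale a g t) y) powr (hom_dim a / N))) x)
     (N / hom_dim a * q) \<partial>dt_over_t)"

lemma measurable_power_joint:
  assumes "f \<in> borel_measurable borel" "g \<in> borel_measurable borel"
  shows "(\<lambda>(t, y). ennreal (norm (conv mul f (rescale a g t) y) powr c)) \<in> borel_measurable (dt_over_t \<Otimes>\<^sub>M lborel)"
proof -
  have [measurable]: "(\<lambda>p. conv mul f (rescale a g (fst p)) (snd p)) \<in> borel_measurable (dt_over_t \<Otimes>\<^sub>M lborel)"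
    by (rule measurable_conv_rescale_joint[OF assms]) measurable
  show ?thesis unfolding case_prod_beta by measurable
qed

text \<open>The derivatives \<open>f * (X\<^sub>k \<phi>)\<^sub>t\<close> in Peetre's inequality are dominated by the functions \<open>f * \<phi>\<^sub>t\<close>
  themselves, with a factor that is small with \<open>\<delta>\<close>; as all quantities are finite, they are absorbed.\<close>

lemma peetre_square_le_maxfn:
  assumes N: "0 < N" and q: "0 < q" and \<epsilon>: "0 < \<epsilon>"
    and X: "\<And>k l m. l \<in> {1..M} \<Longrightarrow> m \<in> {1..M} \<Longrightarrow> (\<eta> m, left_deriv mul k (\<phi> l)) \<in> C1_class a mul \<rho> (N + \<epsilon>) N"
  shows "\<exists>C>0. \<forall>f\<in>schwartz. \<forall>x. (\<Sum>l\<in>{1..M}. peetre_square N q f (\<phi> l) x) \<le> ennreal C * (\<Sum>l\<in>{1..M}. maxfn_square N q f (\<phi> l) x)"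
proof -
  have X_schwartz: "left_deriv mul k (\<phi> l) \<in> schwartz" if "l \<in> {1..M}" for k l
    using X[OF that that] by (auto simp: C1_class_def)
  have "\<forall>kl\<in>UNIV \<times> {1..M}. \<exists>C>0. \<forall>f\<in>schwartz. \<forall>x. peetre_square N q f (left_deriv mul (fst kl) (\<phi> (snd kl))) x \<le>
      ennreal C * (\<Sum>l\<in>{1..M}. peetre_square N q f (\<phi> l) x)"
  proof
    fix kl :: "'n \<times> nat" assume "kl \<in> UNIV \<times> {1..M}"
    then have l: "snd kl \<in> {1..M}" by (cases kl) auto
    show "\<exists>C>0. \<forall>f\<in>schwartz. \<forall>x. peetre_square N q f (left_deriv mul (fst kl) (\<phi> (snd kl))) x \<le>
        ennreal C * (\<Sum>l\<in>{1..M}. peetre_square N q f (\<phi> l) x)"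
      by (rule peetre_square_domination[OF X_schwartz[OF l] left_deriv_mean_zero[OF \<phi>_schwartz[OF l] X_schwartz[OF l]] N \<epsilon> X[OF l] q])
  qed
  from bchoice[OF this] obtain D where D0: "\<forall>kl\<in>UNIV \<times> {1..M}. 0 < D kl \<and> (\<forall>f\<in>schwartz. \<forall>x.
      peetre_square N q f (left_deriv mul (fst kl) (\<phi> (snd kl))) x \<le> ennreal (D kl) * (\<Sum>l\<in>{1..M}. peetre_square N q f (\<phi> l) x))" ..
  have D: "l \<in> {1..M} \<Longrightarrow> 0 \<le> D (k, l)"
    "l \<in> {1..M} \<Longrightarrow> f \<in> schwartz \<Longrightarrow> peetre_square N q f (left_deriv mul k (\<phi> l)) x \<le>
      ennreal (D (k, l)) * (\<Sum>l\<in>{1..M}. peetre_square N q f (\<phi> l) x)" for k l f x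
    using bspec[OF D0, of "(k, l)"] by (simp_all add: less_imp_le)
  define B where "B = 2 powr q * ((2 * c\<^sub>0) powr N) powr q * real CARD('n) powr q"
  have B: "0 \<le> B" by (simp add: B_def)
  define E where "E = B * (\<Sum>l\<in>{1..M}. \<Sum>k\<in>UNIV. D (k, l))"
  have E: "0 \<le> E" unfolding E_def using B D(1) by (intro mult_nonneg_nonneg sum_nonneg) auto
  \<comment> \<open>makes the coefficient \<open>\<delta>\<^sup>q E\<close> of the absorbed quantity at most \<open>1 / 2\<close>\<close>
  define \<delta> where "\<delta> = (1 / (2 * (E + 1))) powr (1 / q)"
  have \<delta>: "0 < \<delta>" "\<delta> \<le> 1" "\<delta> powr q * E \<le> 1/2"
  proof -
    have e: "0 < 1 / (2 * (E + 1))" "1 / (2 * (E + 1)) \<le> 1" using E by auto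
    show "0 < \<delta>" unfolding \<delta>_def using e E by auto
    show "\<delta> \<le> 1" unfolding \<delta>_def using e q by (intro powr_le1) auto
    have "\<delta> powr q = 1 / (2 * (E + 1))" using e q by (simp add: \<delta>_def powr_powr)
    also have "\<dots> * E \<le> 1/2" using E by (simp add: field_simps)
    finally show "\<delta> powr q * E \<le> 1/2" .
  qed
  define A where "A = 2 powr q * ((3 * c\<^sub>0 * c\<^sub>0 / \<delta>) powr N) powr q"
  have "(3 * c\<^sub>0 * c\<^sub>0 / \<delta>) powr N \<noteq> 0" using c\<^sub>0(1) \<delta>(1) by auto
  then have A: "0 < A" unfolding A_def by simp
  have main: "(\<Sum>l\<in>{1..M}. peetre_square N q f (\<phi> l) x) \<le> ennreal (2 * A) * (\<Sum>l\<in>{1..M}. maxfn_square N q f (\<phi> l) x)"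
    if f: "f \<in> schwartz" for f x
  proof -
    have [measurable]: "f \<in> borel_measurable borel" using f by (rule schwartz_measurable)
    define Z where "Z = (\<Sum>l\<in>{1..M}. peetre_square N q f (\<phi> l) x)"
    have Zfin: "Z < top"
      unfolding Z_def using peetre_square_finite[OF f \<phi>_schwartz \<phi>_mean q N] by auto
    have single: "peetre_square N q f (\<phi> l) x \<le> ennreal A * maxfn_square N q f (\<phi> l) x + ennreal (\<delta> powr q * B * (\<Sum>k\<in>UNIV. D (k, l))) * Z"
      if l: "l \<in> {1..M}" for l
    proof -
      note [measurable] = \<phi>_measurable[OF l]
      define m where "m t = balls.maxfn (\<lambda>y. ennreal (norm (conv mul f (rescale a (\<phi> l) t) y) powr (hom_dim a / N))) x" for t
      have [measurable]: "m \<in> borel_measurable borel"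
      proof -
        have "(\<lambda>(t, x). balls.maxfn (\<lambda>y. ennreal (norm (conv mul f (rescale a (\<phi> l) t) y) powr (hom_dim a / N))) x) \<in> borel_measurable (dt_over_t \<Otimes>\<^sub>M lborel)"
          by (rule balls.measurable_maxfn_param[OF measurable_power_joint]) measurable
        from measurable_compose[OF measurable_Pair2'[of x lborel dt_over_t] this]
        show ?thesis by (simp add: m_def[abs_def] measurable_cong_sets[OF sets_dt_over_t refl])
      qed
      define d where "d k = countable_peetre N f (left_deriv mul k (\<phi> l)) x" for k
      have [measurable]: "d k \<in> borel_measurable borel" for k
        unfolding d_def using schwartz_measurable[OF X_schwartz[OF l]] by measurable
      have "peetre_square N q f (\<phi> l) x \<le> (\<integral>\<^sup>+t. ennreal A * epowr (m t) (N / hom_dim a * q) + ennreal (\<delta> powr q * B) * (\<Sum>k\<in>UNIV. epowr (d k t) q) \<partial>dt_over_t)"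
        unfolding peetre_square_def
      proof (rule nn_integral_dt_over_t_mono)
        fix t :: real assume t: "0 < t"
        have "countable_peetre N f (\<phi> l) x t \<le> ennreal ((3 * c\<^sub>0 * c\<^sub>0 / \<delta>) powr N) * epowr (m t) (N / hom_dim a) + ennreal ((2 * c\<^sub>0) powr N * \<delta>) * (\<Sum>k\<in>UNIV. d k t)"
          using peetre_inequality[OF f \<phi>_schwartz[OF l] X_schwartz[OF l] t N \<delta>(1,2), of x]
          by (simp add: m_def d_def peetre_eq_countable[OF f \<phi>_schwartz[OF l] t] peetre_eq_countable[OF f X_schwartz[OF l] t])
        then have "epowr (countable_peetre N f (\<phi> l) x t) q \<le>
            epowr (ennreal ((3 * c\<^sub>0 * c\<^sub>0 / \<delta>) powr N) * epowr (m t) (N / hom_dim a) + ennreal ((2 * c\<^sub>0) powr N * \<delta>) * (\<Sum>k\<in>UNIV. d k t)) q"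
          using q by (rule epowr_mono)
        also have "\<dots> \<le> ennreal (2 powr q) * (epowr (ennreal ((3 * c\<^sub>0 * c\<^sub>0 / \<delta>) powr N) * epowr (m t) (N / hom_dim a)) q +
            epowr (ennreal ((2 * c\<^sub>0) powr N * \<delta>) * (\<Sum>k\<in>UNIV. d k t)) q)"
          using q by (rule epowr_add_le)
        also have "epowr (ennreal ((3 * c\<^sub>0 * c\<^sub>0 / \<delta>) powr N) * epowr (m t) (N / hom_dim a)) q =
            ennreal (((3 * c\<^sub>0 * c\<^sub>0 / \<delta>) powr N) powr q) * epowr (m t) (N / hom_dim a * q)"
          using q N hom_dim_ge_1 by (simp add: epowr_mult epowr_epowr epowr_ennreal)
        also have "epowr (ennreal ((2 * c\<^sub>0) powr N * \<delta>) * (\<Sum>k\<in>UNIV. d k t)) q \<le>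
            ennreal (((2 * c\<^sub>0) powr N) powr q * \<delta> powr q) * (ennreal (real CARD('n) powr q) * (\<Sum>k\<in>UNIV. epowr (d k t) q))"
        proof -
          have "epowr (ennreal ((2 * c\<^sub>0) powr N * \<delta>)) q = ennreal (((2 * c\<^sub>0) powr N) powr q * \<delta> powr q)"
            using q \<delta> by (subst epowr_ennreal) (auto simp: powr_mult)
          then show ?thesis
            using q by (simp only: epowr_mult) (intro mult_left_mono epowr_sum_le, auto)
        qed
        finally have "epowr (countable_peetre N f (\<phi> l) x t) q \<le> ennreal (2 powr q) * (ennreal (((3 * c\<^sub>0 * c\<^sub>0 / \<delta>) powr N) powr q) * epowr (m t) (N / hom_dim a * q) +
            ennreal (((2 * c\<^sub>0) powr N) powr q * \<delta> powr q) * (ennreal (real CARD('n) powr q) * (\<Sum>k\<in>UNIV. epowr (d k t) q)))"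
          by (simp add: mult_left_mono add_left_mono)
        also have "\<dots> = ennreal A * epowr (m t) (N / hom_dim a * q) + ennreal (\<delta> powr q * B) * (\<Sum>k\<in>UNIV. epowr (d k t) q)"
        proof -
          have "ennreal (2 powr q) * ennreal (((3 * c\<^sub>0 * c\<^sub>0 / \<delta>) powr N) powr q) = ennreal A"
            by (simp add: A_def ennreal_mult)
          moreover have "ennreal (2 powr q) * (ennreal (((2 * c\<^sub>0) powr N) powr q * \<delta> powr q) * ennreal (real CARD('n) powr q)) = ennreal (\<delta> powr q * B)"
            by (simp add: B_def mult_ac flip: ennreal_mult)
          ultimately show ?thesis by (simp only: distrib_left mult.assoc[symmetric])
        qed
        finally show "epowr (countable_peetre N f (\<phi> l) x t) q \<le> ennreal A * epowr (m t) (N / hom_dim a * q) + ennreal (\<delta> powr q * B) * (\<Sum>k\<in>UNIV. epowr (d k t) q)" .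
      qed
      also have "\<dots> = ennreal A * (\<integral>\<^sup>+t. epowr (m t) (N / hom_dim a * q) \<partial>dt_over_t) +
          ennreal (\<delta> powr q * B) * (\<Sum>k\<in>UNIV. \<integral>\<^sup>+t. epowr (d k t) q \<partial>dt_over_t)"
        by (simp add: nn_integral_add nn_integral_cmult nn_integral_sum)
      also have "\<dots> = ennreal A * maxfn_square N q f (\<phi> l) x + ennreal (\<delta> powr q * B) * (\<Sum>k\<in>UNIV. peetre_square N q f (left_deriv mul k (\<phi> l)) x)"
        by (simp only: maxfn_square_def peetre_square_def m_def d_def)
      also have "\<dots> \<le> ennreal A * maxfn_square N q f (\<phi> l) x + ennreal (\<delta> powr q * B) * (\<Sum>k\<in>UNIV. ennreal (D (k, l)) * Z)"
        unfolding Z_def by (intro add_left_mono mult_left_mono sum_mono D(2) l f) auto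
      also have "(\<Sum>k\<in>UNIV. ennreal (D (k, l)) * Z) = ennreal (\<Sum>k\<in>UNIV. D (k, l)) * Z"
        using D(1)[OF l] by (simp add: sum_distrib_right[symmetric] sum_ennreal)
      also have "ennreal (\<delta> powr q * B) * (ennreal (\<Sum>k\<in>UNIV. D (k, l)) * Z) = ennreal (\<delta> powr q * B * (\<Sum>k\<in>UNIV. D (k, l))) * Z"
        using B D(1)[OF l] by (subst ennreal_mult) (auto intro!: sum_nonneg simp: mult.assoc)
      finally show ?thesis .
    qed
    have "Z \<le> (\<Sum>l\<in>{1..M}. ennreal A * maxfn_square N q f (\<phi> l) x + ennreal (\<delta> powr q * B * (\<Sum>k\<in>UNIV. D (k, l))) * Z)"
      unfolding Z_def by (intro sum_mono) (use single in \<open>simp add: Z_def\<close>)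
    also have "\<dots> = ennreal A * (\<Sum>l\<in>{1..M}. maxfn_square N q f (\<phi> l) x) + ennreal (\<delta> powr q * E) * Z"
    proof -
      have "(\<Sum>l\<in>{1..M}. ennreal (\<delta> powr q * B * (\<Sum>k\<in>UNIV. D (k, l)))) = ennreal (\<Sum>l\<in>{1..M}. \<delta> powr q * B * (\<Sum>k\<in>UNIV. D (k, l)))"
        using B D(1) by (intro sum_ennreal mult_nonneg_nonneg sum_nonneg) auto
      also have "(\<Sum>l\<in>{1..M}. \<delta> powr q * B * (\<Sum>k\<in>UNIV. D (k, l))) = \<delta> powr q * E"
        by (simp add: E_def sum_distrib_left mult.assoc)
      finally show ?thesis by (simp only: sum.distrib sum_distrib_left[symmetric] sum_distrib_right[symmetric])
    qed
    finally have "Z \<le> 2 * (ennreal A * (\<Sum>l\<in>{1..M}. maxfn_square N q f (\<phi> l) x))"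
      using \<delta> E by (intro ennreal_absorb[OF Zfin, where c = "\<delta> powr q * E"]) auto
    then show ?thesis using A by (simp add: Z_def ennreal_mult mult.assoc)
  qed
  show ?thesis using A main by (intro exI[of _ "2 * A"]) auto
qed

text \<open>The exponents of the vector-valued maximal inequality are \<open>s = p N / \<gamma>\<close> and \<open>u = q N / \<gamma>\<close>; the
  hypotheses on \<open>p\<close> and \<open>q\<close> say that both exceed \<open>1\<close>.\<close>

theorem weighted_square_function_bound:
  assumes N: "0 < N" and p: "hom_dim a / N < p" and q: "hom_dim a / N < q"
    and w: "w \<in> muckenhoupt mul \<rho> (p * N / hom_dim a)"
    and \<epsilon>: "0 < \<epsilon>" and X: "\<And>k l m. l \<in> {1..M} \<Longrightarrow> m \<in> {1..M} \<Longrightarrow> (\<eta> m, left_deriv mul k (\<phi> l)) \<in> C1_class a mul \<rho> (N + \<epsilon>) N"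
    and \<psi>: "\<psi> \<in> schwartz" and mean: "(\<integral>x. \<psi> x \<partial>lborel) = 0"
    and \<epsilon>': "0 < \<epsilon>'" and cl: "\<And>l. l \<in> {1..M} \<Longrightarrow> (\<eta> l, \<psi>) \<in> C1_class a mul \<rho> (N + \<epsilon>') N"
  shows "\<exists>C>0. \<forall>f\<in>schwartz.
    Lp_norm p w (\<lambda>x. Lq_dt_t q (\<lambda>t. peetre mul \<rho> N (1 / t) (conv mul f (rescale a \<psi> t)) x))
    \<le> ennreal C * (\<Sum>l\<in>{1..M}.
        Lp_norm p w (\<lambda>x. Lq_dt_t q (\<lambda>t. ennreal (norm (conv mul f (rescale a (\<phi> l) t) x)))))"
proof -
  let ?g = "hom_dim a"
  have g: "0 < ?g" using hom_dim_ge_1 by linarith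
  have gN: "0 < ?g / N" using g N by simp
  then have p0: "0 < p" and q0: "0 < q" using p q by linarith+
  define s u where "s = p * N / ?g" and "u = N / ?g * q"
  have s: "1 < s" using p N g by (simp add: s_def pos_divide_less_eq pos_less_divide_eq)
  have u: "1 < u" using q N g by (simp add: u_def pos_divide_less_eq pos_less_divide_eq mult.commute)
  have su: "s / u = p / q" using N g q0 by (simp add: s_def u_def)
  obtain C1 where C1: "0 < C1" "\<And>f x. f \<in> schwartz \<Longrightarrow> peetre_square N q f \<psi> x \<le> ennreal C1 * (\<Sum>l\<in>{1..M}. peetre_square N q f (\<phi> l) x)"
    using peetre_square_domination[OF \<psi> mean N \<epsilon>' cl q0] by blast
  obtain C2 where C2: "0 < C2" "\<And>f x. f \<in> schwartz \<Longrightarrow> (\<Sum>l\<in>{1..M}. peetre_square N q f (\<phi> l) x) \<le> ennreal C2 * (\<Sum>l\<in>{1..M}. maxfn_square N q f (\<phi> l) x)"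
    using peetre_square_le_maxfn[OF N q0 \<epsilon> X] by blast
  obtain C3 where C3: "0 < C3" "\<And>g. case_prod g \<in> borel_measurable (dt_over_t \<Otimes>\<^sub>M lborel) \<Longrightarrow>
    (\<integral>\<^sup>+x. epowr (\<integral>\<^sup>+t. epowr (balls.maxfn (g t) x) u \<partial>dt_over_t) (s / u) * ennreal (w x) \<partial>lebesgue)
    \<le> ennreal C3 * (\<integral>\<^sup>+x. epowr (\<integral>\<^sup>+t. epowr (g t x) u \<partial>dt_over_t) (s / u) * ennreal (w x) \<partial>lebesgue)"
    using maxfn_vector_valued_muckenhoupt[OF w[folded s_def] s u sigma_finite_dt_over_t] by blast
  have w_meas [measurable]: "w \<in> borel_measurable lebesgue" using w by (simp add: muckenhoupt_def weight_def)
  define c where "c = (C1 * C2) powr (p / q) * real M powr (p / q) * C3"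
  define C where "C = c powr (1 / p) * real M powr (1 / p) + 1"
  have c: "0 \<le> c" using C3 by (simp add: c_def)
  have C: "0 < C" "c powr (1 / p) * real M powr (1 / p) \<le> C" by (auto simp: C_def add_nonneg_pos)
  have main: "Lp_norm p w (\<lambda>x. Lq_dt_t q (\<lambda>t. peetre mul \<rho> N (1 / t) (conv mul f (rescale a \<psi> t)) x))
    \<le> ennreal C * (\<Sum>l\<in>{1..M}. Lp_norm p w (\<lambda>x. Lq_dt_t q (\<lambda>t. ennreal (norm (conv mul f (rescale a (\<phi> l) t) x)))))"
    if f: "f \<in> schwartz" for f
  proof -
    have [measurable]: "f \<in> borel_measurable borel" "\<psi> \<in> borel_measurable borel"
      using f \<psi> by (auto intro: schwartz_measurable)
    define W where "W l x = maxfn_square N q f (\<phi> l) x" for l x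
    define V where "V l x = (\<integral>\<^sup>+t. epowr (ennreal (norm (conv mul f (rescale a (\<phi> l) t) x))) q \<partial>dt_over_t)" for l x
    have V_int: "(\<integral>\<^sup>+x. epowr (W l x) (p / q) * ennreal (w x) \<partial>lebesgue) \<le> ennreal C3 * (\<integral>\<^sup>+x. epowr (V l x) (p / q) * ennreal (w x) \<partial>lebesgue)"
      if l: "l \<in> {1..M}" for l
    proof -
      have e: "epowr (ennreal (n powr (?g / N))) u = epowr (ennreal n) q" if "0 \<le> n" for n
        using that u q0 N g by (simp add: epowr_ennreal powr_powr u_def)
      show ?thesis
        using C3(2)[OF measurable_power_joint[of f "\<phi> l" "?g / N"]] \<phi>_measurable[OF l]
        unfolding su W_def V_def maxfn_square_def u_def[symmetric] by (simp add: e)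
    qed
    have W_meas: "W l \<in> borel_measurable lebesgue" if l: "l \<in> {1..M}" for l
    proof -
      note [measurable] = \<phi>_measurable[OF l]
      interpret T: sigma_finite_measure dt_over_t by (rule sigma_finite_dt_over_t)
      have "(\<lambda>(t, x). balls.maxfn (\<lambda>y. ennreal (norm (conv mul f (rescale a (\<phi> l) t) y) powr (?g / N))) x) \<in> borel_measurable (dt_over_t \<Otimes>\<^sub>M lborel)"
        by (rule balls.measurable_maxfn_param[OF measurable_power_joint]) measurable
      from measurable_compose[OF measurable_pair_swap' this]
      have [measurable]: "(\<lambda>(x, t). balls.maxfn (\<lambda>y. ennreal (norm (conv mul f (rescale a (\<phi> l) t) y) powr (?g / N))) x) \<in> borel_measurable (lborel \<Otimes>\<^sub>M dt_over_t)"
        by (simp add: case_prod_beta)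
      have "W l \<in> borel_measurable lborel"
        unfolding W_def[abs_def] maxfn_square_def by measurable
      then show ?thesis by (rule measurable_completion)
    qed
    have LHS: "Lq_dt_t q (\<lambda>t. peetre mul \<rho> N (1 / t) (conv mul f (rescale a \<psi> t)) x) = epowr (peetre_square N q f \<psi> x) (1 / q)" for x
      unfolding peetre_square_def by (rule Lq_dt_t_eq[OF q0 _ peetre_eq_countable[OF f \<psi>]]) measurable
    have RHS: "Lq_dt_t q (\<lambda>t. ennreal (norm (conv mul f (rescale a (\<phi> l) t) x))) = epowr (V l x) (1 / q)"
      if l: "l \<in> {1..M}" for l x
    proof -
      note [measurable] = \<phi>_measurable[OF l]
      have [measurable]: "(\<lambda>t. conv mul f (rescale a (\<phi> l) t) x) \<in> borel_measurable borel"
        by (rule measurable_conv_rescale_joint) measurable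
      show ?thesis unfolding V_def by (rule Lq_dt_t_eq[OF q0]) auto
    qed
    have pq: "epowr (epowr y (1 / q)) p = epowr y (p / q)" for y using p0 q0 by (simp add: epowr_epowr)
    have pq0: "0 < p / q" using p0 q0 by simp
    have "(\<integral>\<^sup>+x. epowr (peetre_square N q f \<psi> x) (p / q) * ennreal (w x) \<partial>lebesgue) \<le>
        (\<integral>\<^sup>+x. ennreal ((C1 * C2) powr (p / q) * real M powr (p / q)) * (\<Sum>l\<in>{1..M}. epowr (W l x) (p / q) * ennreal (w x)) \<partial>lebesgue)"
    proof (rule nn_integral_mono)
      fix x
      have "peetre_square N q f \<psi> x \<le> ennreal C1 * (ennreal C2 * (\<Sum>l\<in>{1..M}. W l x))"
        unfolding W_def by (rule order_trans[OF C1(2)[OF f] mult_left_mono[OF C2(2)[OF f]]]) simp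
      also have "\<dots> = ennreal (C1 * C2) * (\<Sum>l\<in>{1..M}. W l x)"
        using C1 C2 by (simp add: ennreal_mult mult.assoc)
      finally have "epowr (peetre_square N q f \<psi> x) (p / q) \<le> epowr (ennreal (C1 * C2) * (\<Sum>l\<in>{1..M}. W l x)) (p / q)"
        using pq0 by (rule epowr_mono)
      also have "\<dots> = ennreal ((C1 * C2) powr (p / q)) * epowr (\<Sum>l\<in>{1..M}. W l x) (p / q)"
      proof -
        have "epowr (ennreal (C1 * C2)) (p / q) = ennreal ((C1 * C2) powr (p / q))"
          using pq0 C1 C2 by (intro epowr_ennreal) auto
        then show ?thesis by (simp only: epowr_mult[OF pq0])
      qed
      also have "\<dots> \<le> ennreal ((C1 * C2) powr (p / q)) * (ennreal (real M powr (p / q)) * (\<Sum>l\<in>{1..M}. epowr (W l x) (p / q)))"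
        using epowr_sum_le[OF pq0, of "{1..M}" "\<lambda>l. W l x"] by (intro mult_left_mono) auto
      also have "\<dots> = ennreal ((C1 * C2) powr (p / q) * real M powr (p / q)) * (\<Sum>l\<in>{1..M}. epowr (W l x) (p / q))"
        by (simp add: ennreal_mult mult.assoc)
      finally have "epowr (peetre_square N q f \<psi> x) (p / q) * ennreal (w x) \<le>
          ennreal ((C1 * C2) powr (p / q) * real M powr (p / q)) * (\<Sum>l\<in>{1..M}. epowr (W l x) (p / q)) * ennreal (w x)"
        by (rule mult_right_mono) simp
      then show "epowr (peetre_square N q f \<psi> x) (p / q) * ennreal (w x) \<le>
          ennreal ((C1 * C2) powr (p / q) * real M powr (p / q)) * (\<Sum>l\<in>{1..M}. epowr (W l x) (p / q) * ennreal (w x))"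
        by (simp add: mult.assoc sum_distrib_right)
    qed
    also have "\<dots> = ennreal ((C1 * C2) powr (p / q) * real M powr (p / q)) * (\<Sum>l\<in>{1..M}. (\<integral>\<^sup>+x. epowr (W l x) (p / q) * ennreal (w x) \<partial>lebesgue))"
    proof -
      have m: "(\<lambda>x. epowr (W l x) (p / q) * ennreal (w x)) \<in> borel_measurable lebesgue" if "l \<in> {1..M}" for l
        using W_meas[OF that] by measurable
      show ?thesis
        by (subst nn_integral_cmult) (auto intro!: borel_measurable_sum m nn_integral_sum arg_cong2[where f = "(*)"])
    qed
    also have "\<dots> \<le> ennreal ((C1 * C2) powr (p / q) * real M powr (p / q)) * (\<Sum>l\<in>{1..M}. ennreal C3 * (\<integral>\<^sup>+x. epowr (V l x) (p / q) * ennreal (w x) \<partial>lebesgue))"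
      by (intro mult_left_mono sum_mono V_int) auto
    also have "\<dots> = ennreal c * (\<Sum>l\<in>{1..M}. (\<integral>\<^sup>+x. epowr (V l x) (p / q) * ennreal (w x) \<partial>lebesgue))"
    proof -
      have "ennreal c = ennreal ((C1 * C2) powr (p / q) * real M powr (p / q)) * ennreal C3"
        unfolding c_def using C3 by (intro ennreal_mult) auto
      then show ?thesis by (simp only: sum_distrib_left[symmetric] mult.assoc)
    qed
    finally have "epowr (\<integral>\<^sup>+x. epowr (peetre_square N q f \<psi> x) (p / q) * ennreal (w x) \<partial>lebesgue) (1 / p) \<le>
        epowr (ennreal c * (\<Sum>l\<in>{1..M}. (\<integral>\<^sup>+x. epowr (V l x) (p / q) * ennreal (w x) \<partial>lebesgue))) (1 / p)"
      using p0 by (intro epowr_mono) auto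
    also have "\<dots> = ennreal (c powr (1 / p)) * epowr (\<Sum>l\<in>{1..M}. (\<integral>\<^sup>+x. epowr (V l x) (p / q) * ennreal (w x) \<partial>lebesgue)) (1 / p)"
      using p0 c by (simp add: epowr_mult epowr_ennreal)
    also have "\<dots> \<le> ennreal (c powr (1 / p)) * (ennreal (real M powr (1 / p)) * (\<Sum>l\<in>{1..M}. epowr (\<integral>\<^sup>+x. epowr (V l x) (p / q) * ennreal (w x) \<partial>lebesgue) (1 / p)))"
      using p0 epowr_sum_le[of "1 / p" "{1..M}"] by (intro mult_left_mono) auto
    also have "\<dots> = ennreal (c powr (1 / p) * real M powr (1 / p)) * (\<Sum>l\<in>{1..M}. epowr (\<integral>\<^sup>+x. epowr (V l x) (p / q) * ennreal (w x) \<partial>lebesgue) (1 / p))"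
      by (simp add: ennreal_mult mult.assoc)
    also have "\<dots> \<le> ennreal C * (\<Sum>l\<in>{1..M}. epowr (\<integral>\<^sup>+x. epowr (V l x) (p / q) * ennreal (w x) \<partial>lebesgue) (1 / p))"
      using C by (intro mult_right_mono ennreal_leI) auto
    also have "(\<Sum>l\<in>{1..M}. epowr (\<integral>\<^sup>+x. epowr (V l x) (p / q) * ennreal (w x) \<partial>lebesgue) (1 / p)) =
        (\<Sum>l\<in>{1..M}. Lp_norm p w (\<lambda>x. Lq_dt_t q (\<lambda>t. ennreal (norm (conv mul f (rescale a (\<phi> l) t) x)))))"
      by (intro sum.cong refl) (simp only: Lp_norm_def RHS pq)
    finally show ?thesis by (simp only: Lp_norm_def LHS pq)
  qed
  then show ?thesis using C by blast
qed

end

theorem theorem6p2: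
  fixes a :: "'n::{finite,linorder} \<Rightarrow> real"
    and mul :: "real^('n::{finite,linorder}) \<Rightarrow> real^('n::{finite,linorder}) \<Rightarrow> real^('n::{finite,linorder})"
    and \<rho> :: "real^('n::{finite,linorder}) \<Rightarrow> real"
    and M :: nat
    and \<phi> \<eta> :: "nat \<Rightarrow> real^('n::{finite,linorder}) \<Rightarrow> complex"
    and b N p q :: real
    and w :: "real^('n::{finite,linorder}) \<Rightarrow> real"
    and \<psi> :: "real^('n::{finite,linorder}) \<Rightarrow> complex"
  assumes "homogeneous_group a mul"
    and "norm_function a mul \<rho>"
    and "\<And>l. l \<in> {1..M} \<Longrightarrow> \<phi> l \<in> schwartz"
    and "\<And>l. l \<in> {1..M} \<Longrightarrow> (\<integral>x. \<phi> l x \<partial>lebesgue) = 0"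
    and "\<And>l. l \<in> {1..M} \<Longrightarrow> \<eta> l \<in> schwartz"
    and "0 < b" and "b < 1"
    and "tempered_lim
      (\<lambda>(k::nat, m::nat). distr_of (\<lambda>x. \<Sum>j\<in>{- int k..int m}. \<Sum>l\<in>{1..M}.
          conv mul (rescale a (\<phi> l) (b powi j)) (rescale a (\<eta> l) (b powi j)) x))
      dirac (sequentially \<times>\<^sub>F sequentially)"
    and "N > 0"
    and "hom_dim a / N < p" and "hom_dim a / N < q"
    and "w \<in> muckenhoupt mul \<rho> (p * N / hom_dim a)"
    and "\<exists>\<epsilon>>0. \<forall>k. \<forall>l\<in>{1..M}. \<forall>m\<in>{1..M}.
      (\<eta> m, left_deriv mul k (\<phi> l)) \<in> C1_class a mul \<rho> (N + \<epsilon>) N"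
    and "\<psi> \<in> schwartz"
    and "(\<integral>x. \<psi> x \<partial>lebesgue) = 0"
    and "\<exists>\<epsilon>>0. \<forall>l\<in>{1..M}. (\<eta> l, \<psi>) \<in> C1_class a mul \<rho> (N + \<epsilon>) N"
  shows "\<exists>C>0. \<forall>f\<in>schwartz.
    Lp_norm p w (\<lambda>x. Lq_dt_t q (\<lambda>t. peetre mul \<rho> N (1 / t) (conv mul f (rescale a \<psi> t)) x))
    \<le> ennreal C * (\<Sum>l\<in>{1..M}.
        Lp_norm p w (\<lambda>x. Lq_dt_t q (\<lambda>t. ennreal (norm (conv mul f (rescale a (\<phi> l) t) x)))))"
proof -
  interpret norm_function a mul \<rho> by fact
  have to_lborel: "(\<integral>x. g x \<partial>lebesgue) = (\<integral>x. g x \<partial>lborel)" if "g \<in> schwartz" for g :: "real^('n::{finite,linorder}) \<Rightarrow> complex"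
    by (rule integral_completion) (use schwartz_measurable[OF that] in simp)
  have mean: "(\<integral>x. \<phi> l x \<partial>lborel) = 0" if "l \<in> {1..M}" for l
    using assms(4)[OF that] to_lborel[OF assms(3)[OF that]] by simp
  interpret calderon_system a mul \<rho> M \<phi> \<eta> b
    by unfold_locales (fact assms(3) mean assms(5) assms(6) assms(7) assms(8))+
  obtain \<epsilon> where \<epsilon>: "0 < \<epsilon>" "\<And>k l m. l \<in> {1..M} \<Longrightarrow> m \<in> {1..M} \<Longrightarrow> (\<eta> m, left_deriv mul k (\<phi> l)) \<in> C1_class a mul \<rho> (N + \<epsilon>) N"
    using assms(13) by blast
  obtain \<epsilon>' where \<epsilon>': "0 < \<epsilon>'" "\<And>l. l \<in> {1..M} \<Longrightarrow> (\<eta> l, \<psi>) \<in> C1_class a mul \<rho> (N + \<epsilon>') N"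
    using assms(16) by blast
  have "(\<integral>x. \<psi> x \<partial>lborel) = 0" using assms(15) to_lborel[OF assms(14)] by simp
  from weighted_square_function_bound[OF assms(9-12) \<epsilon> assms(14) this \<epsilon>']
  show ?thesis .
qed

end
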